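(* Let $a,b,c\geq 3$ be integers and let $\Gamma_\Delta\subset \mathrm{SO}(2,1)\subset\mathrm{SL}(3,\mathbb{R})$ be the hyperbolic reflection group generated by a triangle $\Delta\subset\mathbb{H}^2\subset\mathbb{RP}^2$ with angles $\frac{\pi}{a}$, $\frac{\pi}{b}$ and $\frac{\pi}{c}$. The moduli space $\mathcal{X}_\Delta$ of representations $\rho:\Gamma_\Delta\to\mathrm{SL}(3,\mathbb{R})$ that are deformations of the inclusion is then homeomorphic to $\mathbb{R}$; fix a homeomorphism $\mathcal{X}_\Delta\cong\mathbb{R}$. For each $t\in\mathbb{R}$ pick a representation $\rho_t:\Gamma_\Delta\to\mathrm{SL}(3,\mathbb{R})$ whose class in $\mathcal{X}_\Delta\cong\mathbb{R}$ is $t$, and let $\Omega_t\in\mathfrak{C}$ be the properly convex domain $\Omega_{\rho_t}$ preserved by $\rho_t(\Gamma_\Delta)$. Let $\Omega\in\mathfrak{C}$. Then, for each of the two ends $t\to+\infty$ and $t\to-\infty$, there exists a family $(a_t)_{t\in\mathbb{R}}\subset\mathrm{SL}(3,\mathbb{R})$ such that $a_t(\Omega_t)$ converges to $\Omega$ in $\mathfrak{C}$ as $t$ tends to that end if and only if $\Omega$ is a regular $k$-gon with $k\in\{3,a,b,c\}$.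
   Context: A properly convex domain in $\mathbb{RP}^2$ is an open set contained in some affine chart as a bounded convex domain. The space $\mathfrak{C}$ of all such domains carries the topology given by Hausdorff distance (for a fixed Riemannian metric on $\mathbb{RP}^2$). A regular $k$-gon is a convex domain in $\mathbb{RP}^2$ projectively equivalent to (the interior of) a regular $k$-gon in the Euclidean plane $\mathbb{E}^2\subset\mathbb{RP}^2$. A (projective) reflection is an element of $\mathrm{SL}(3,\mathbb{R})$ conjugate to $\mathrm{diag}(1,-1,-1)$; it fixes pointwise a projective line $L\subset\mathbb{RP}^2$ and a point outside $L$, and is called a reflection across $L$. The hyperbolic plane $\mathbb{H}^2$ is embedded in $\mathbb{RP}^2$ as the interior of an ellipse (Klein model), with isometry group $\mathrm{SO}(2,1)<\mathrm{SL}(3,\mathbb{R})$. For a closed geodesic triangle $\Delta\subset\mathbb{H}^2$ with angles $\pi/a,\pi/b,\pi/c$ (so $\frac1a+\frac1b+\frac1c<1$), $\Gamma_\Delta$ is the subgroup of $\mathrm{SO}(2,1)$ generated by the hyperbolic reflections $\sigma_1,\sigma_2,\sigma_3$ across the three sides of $\Delta$. Let $\widetilde{\mathcal{X}}_\Delta$ be the connected component of $\mathrm{Hom}(\Gamma_\Delta,\mathrm{SL}(3,\mathbb{R}))$ containing the inclusion $\Gamma_\Delta\hookrightarrow\mathrm{SO}(2,1)\subset\mathrm{SL}(3,\mathbb{R})$, and let $\mathcal{X}_\Delta:=\widetilde{\mathcal{X}}_\Delta/\mathrm{SL}(3,\mathbb{R})$ be the topological quotient by conjugation. It is known that when $a,b,c\ge3$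 the space $\mathcal{X}_\Delta$ is homeomorphic to $\mathbb{R}$. Each $\rho\in\widetilde{\mathcal{X}}_\Delta$ has a closed fundamental triangle $\Delta_\rho\subset\mathbb{RP}^2$, depending continuously on $\rho$ and equal to $\Delta$ when $\rho$ is the inclusion, such that $\rho(\sigma_1),\rho(\sigma_2),\rho(\sigma_3)$ are reflections across the sides of $\Delta_\rho$; by a theorem of Tits the triangles $\rho(\gamma)\Delta_\rho$ ($\gamma\in\Gamma_\Delta$) have disjoint interiors and their union $\Omega_\rho:=\bigcup_{\gamma\in\Gamma_\Delta}\rho(\gamma)\Delta_\rho$ is a properly convex domain, preserved by $\rho(\Gamma_\Delta)$. *)

theory Defs
  imports "HOL-Analysis.Analysis" "HOL-Algebra.Generated_Groups"
begin

section \<open>The real projective plane\<close>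

typedef rp2 = "{L :: (real^3) set. subspace L \<and> dim L = 1}"
  morphisms line_of Rp2
proof
  show "span {axis 1 1 :: real^3} \<in> {L. subspace L \<and> dim L = 1}"
    by simp
qed

definition proj :: "real^3 \<Rightarrow> rp2" where
  "proj v = Rp2 (span {v})"

lemma line_of_proj: "v \<noteq> 0 \<Longrightarrow> line_of (proj v) = span {v}"
  unfolding proj_def by (subst Rp2_inverse) auto

lemma unit_in_span_unit:
  fixes u v :: "real^3"
  assumes "norm u = 1" "norm v = 1"
  shows "v \<in> span {u} \<longleftrightarrow> v = u \<or> v = - u"
proof
  assume "v \<in> span {u}"
  then obtain k where k: "v = k *\<^sub>R u" by (auto simp: span_singleton)
  with assms have "\<bar>k\<bar> = 1" by simp
  then show "v = u \<or> v = - u" using k by (auto simp: abs_if split: if_splits)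
qed (auto intro: span_base span_neg)

lemma rp2_unit_rep:
  obtains u where "norm u = 1" "p = proj u"
proof -
  have d: "dim (line_of p) = 1" and s: "subspace (line_of p)"
    using line_of[of p] by auto
  have "\<not> line_of p \<subseteq> {0}"
    using d by (metis dim_eq_0 zero_neq_one)
  then obtain w where w: "w \<in> line_of p" "w \<noteq> 0" by auto
  define u where "u = w /\<^sub>R norm w"
  have u: "u \<in> line_of p" "norm u = 1"
    using w s by (auto simp: u_def subspace_scale)
  then have "u \<noteq> 0" by auto
  then have "span {u} = line_of p"
    using u s d by (intro subspace_dim_equal) (auto simp: span_minimal)
  then have "p = proj u"
    by (simp add: proj_def line_of_inverse)
  then show ?thesis using that u by blast
qed

text \<open>The distance of the round Riemannian metric, i.e. of the quotient of the unit sphere by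
  the antipodal map: the smallest spherical distance between unit representatives.\<close>

instantiation rp2 :: metric_space
begin

definition dist_rp2 :: "rp2 \<Rightarrow> rp2 \<Rightarrow> real" where
  "dist_rp2 p q = Inf {arccos (u \<bullet> v) |u v.
     u \<in> line_of p \<and> v \<in> line_of q \<and> norm u = 1 \<and> norm v = 1}"

definition uniformity_rp2 :: "(rp2 \<times> rp2) filter" where
  "uniformity_rp2 = (INF e\<in>{0<..}. principal {(x, y). dist x y < e})"

definition open_rp2 :: "rp2 set \<Rightarrow> bool" where
  "open_rp2 U \<longleftrightarrow> (\<forall>x\<in>U. \<forall>\<^sub>F (x', y) in uniformity. x' = x \<longrightarrow> y \<in> U)"

lemma dist_proj_unit:
  assumes "norm u = 1" "norm v = 1"
  shows "dist (proj u) (proj v) = arccos \<bar>u \<bullet> v\<bar>"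
proof -
  have "u \<noteq> 0" "v \<noteq> 0" using assms by auto
  then have "{arccos (x \<bullet> y) |x y. x \<in> line_of (proj u) \<and> y \<in> line_of (proj v) \<and>
      norm x = 1 \<and> norm y = 1} = {arccos (u \<bullet> v), arccos (- (u \<bullet> v))}"
    (is "?S = ?T")
  proof (intro equalityI subsetI)
    fix t assume "t \<in> ?S"
    then obtain x y where "t = arccos (x \<bullet> y)" "x = u \<or> x = -u" "y = v \<or> y = -v"
      using assms \<open>u \<noteq> 0\<close> \<open>v \<noteq> 0\<close> by (auto simp: line_of_proj unit_in_span_unit)
    then show "t \<in> ?T" by auto
  next
    fix t assume "t \<in> ?T"
    moreover have "u \<in> span {u}" "v \<in> span {v}" "- v \<in> span {v}"
      by (auto intro: span_base span_neg)
    ultimately show "t \<in> ?S"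
      using assms \<open>u \<noteq> 0\<close> \<open>v \<noteq> 0\<close>
      by (force simp: line_of_proj intro: exI[of _ u] exI[of _ v] exI[of _ "- v"])
  qed
  moreover have "\<bar>u \<bullet> v\<bar> \<le> 1"
    using Cauchy_Schwarz_ineq2[of u v] assms by simp
  ultimately show ?thesis
    unfolding dist_rp2_def
    by (auto simp: cInf_eq_Min abs_if min_def arccos_le_mono)
qed

lemma arccos_unit_triangle:
  fixes u v w :: "real^3"
  assumes "norm u = 1" "norm v = 1" "norm w = 1"
  shows "arccos (u \<bullet> w) \<le> arccos (u \<bullet> v) + arccos (v \<bullet> w)"
proof -
  let ?p = "u \<bullet> v" and ?q = "v \<bullet> w"
  have b: "\<bar>?p\<bar> \<le> 1" "\<bar>?q\<bar> \<le> 1" "\<bar>u \<bullet> w\<bar> \<le> 1"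
    using Cauchy_Schwarz_ineq2[of u v] Cauchy_Schwarz_ineq2[of v w]
      Cauchy_Schwarz_ineq2[of u w] assms by auto
  define u' w' where "u' = u - ?p *\<^sub>R v" and "w' = w - ?q *\<^sub>R v"
  have uv: "u \<bullet> u = 1" "v \<bullet> v = 1" "w \<bullet> w = 1"
    using assms by (auto simp: dot_square_norm)
  have "(norm u')\<^sup>2 = 1 - ?p\<^sup>2" "(norm w')\<^sup>2 = 1 - ?q\<^sup>2"
    using uv unfolding power2_norm_eq_inner u'_def w'_def
    by (simp_all add: inner_diff_left inner_diff_right inner_commute power2_eq_square)
  then have n: "norm u' = sqrt (1 - ?p\<^sup>2)" "norm w' = sqrt (1 - ?q\<^sup>2)"
    by (metis norm_ge_zero real_sqrt_unique)+
  have "u' \<bullet> w' = u \<bullet> w - ?p * ?q"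
    using uv unfolding u'_def w'_def
    by (simp add: inner_diff_left inner_diff_right inner_commute)
  moreover have "\<bar>u' \<bullet> w'\<bar> \<le> norm u' * norm w'"
    by (rule Cauchy_Schwarz_ineq2)
  ultimately have "?p * ?q - sqrt (1 - ?p\<^sup>2) * sqrt (1 - ?q\<^sup>2) \<le> u \<bullet> w"
    unfolding n by linarith
  then have c: "cos (arccos ?p + arccos ?q) \<le> u \<bullet> w"
    using b by (simp add: cos_add cos_arccos_abs sin_arccos_abs)
  show ?thesis
  proof (cases "arccos ?p + arccos ?q \<le> pi")
    case True
    moreover have "0 \<le> arccos ?p + arccos ?q"
      using b by (intro add_nonneg_nonneg arccos_lbound) auto
    ultimately have "arccos ?p + arccos ?q = arccos (cos (arccos ?p + arccos ?q))"
      by (simp add: arccos_cos)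
    also have "\<dots> \<ge> arccos (u \<bullet> w)"
      using b c by (intro arccos_le_arccos) auto
    finally show ?thesis .
  next
    case False
    then show ?thesis using arccos_ubound[of "u \<bullet> w"] b by (auto simp: abs_le_iff)
  qed
qed

instance
proof
  fix p q r :: rp2
  obtain u v w where u: "norm u = 1" "p = proj u" and v: "norm v = 1" "q = proj v"
    and w: "norm w = 1" "r = proj w"
    by (metis rp2_unit_rep)
  have b: "\<bar>u \<bullet> v\<bar> \<le> 1" using Cauchy_Schwarz_ineq2[of u v] u v by simp
  have "dist p q = 0 \<longleftrightarrow> \<bar>u \<bullet> v\<bar> = 1"
    using u v b arccos_1 arccos_eq_iff[of "\<bar>u \<bullet> v\<bar>" 1] by (simp add: dist_proj_unit)
  also have "\<dots> \<longleftrightarrow> p = q"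
  proof
    assume "\<bar>u \<bullet> v\<bar> = 1"
    then have "v = u \<or> v = - u"
      using u v norm_cauchy_schwarz_abs_eq[of u v] by auto
    then have "v \<in> span {u}" "u \<in> span {v}"
      using u v by (auto simp: unit_in_span_unit)
    then have "span {v} = span {u}"
      by (simp add: span_eq)
    then show "p = q" using u v by (simp add: proj_def)
  next
    assume "p = q"
    then have "span {u} = span {v}" using u v
      by (metis line_of_proj norm_zero zero_neq_one)
    then have "v = u \<or> v = - u"
      using u v unit_in_span_unit span_base[of v "{v}"] by auto
    then show "\<bar>u \<bullet> v\<bar> = 1" using u by (auto simp: dot_square_norm)
  qed
  finally show "dist p q = 0 \<longleftrightarrow> p = q" .
  define u' v' where "u' = (if u \<bullet> w \<ge> 0 then u else - u)"
    and "v' = (if w \<bullet> v \<ge> 0 then v else - v)"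
  have n: "norm u' = 1" "norm v' = 1" using u v by (auto simp: u'_def v'_def)
  have "\<bar>u' \<bullet> v'\<bar> \<le> 1" using Cauchy_Schwarz_ineq2[of u' v'] n by simp
  then have "arccos \<bar>u' \<bullet> v'\<bar> \<le> arccos (u' \<bullet> v')" by (intro arccos_le_arccos) auto
  also have "\<dots> \<le> arccos (u' \<bullet> w) + arccos (w \<bullet> v')"
    using n w by (intro arccos_unit_triangle) auto
  also have "\<dots> = arccos \<bar>u \<bullet> w\<bar> + arccos \<bar>v \<bullet> w\<bar>"
    by (simp add: u'_def v'_def inner_commute)
  also have "\<bar>u' \<bullet> v'\<bar> = \<bar>u \<bullet> v\<bar>" by (simp add: u'_def v'_def)
  finally show "dist p q \<le> dist p r + dist q r"
    using u v w by (simp add: dist_proj_unit)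
qed (rule uniformity_rp2_def open_rp2_def)+

end

text \<open>Projective linear span of a set of points.\<close>

definition pspan :: "rp2 set \<Rightarrow> rp2 set" where
  "pspan S = {p. line_of p \<subseteq> span (\<Union>q\<in>S. line_of q)}"

definition proj_line :: "rp2 set \<Rightarrow> bool" where
  "proj_line L \<longleftrightarrow> (\<exists>p q. p \<noteq> q \<and> L = pspan {p, q})"

definition SL3 :: "(real^3^3) monoid" where
  "SL3 = \<lparr>carrier = {A. det A = 1}, mult = (**), one = mat 1\<rparr>"

lemma group_SL3: "group SL3"
proof (rule groupI)
  fix A assume "A \<in> carrier SL3"
  then have "det A = 1" by (simp add: SL3_def)
  moreover from this obtain B where B: "B ** A = mat 1"
    using invertible_det_nz[of A] by (auto simp: invertible_def)
  moreover have "det B * det A = 1"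
    using arg_cong[OF B, of det] by (simp add: det_mul)
  ultimately have "B ** A = mat 1" "det B = 1" by auto
  then show "\<exists>B\<in>carrier SL3. B \<otimes>\<^bsub>SL3\<^esub> A = \<one>\<^bsub>SL3\<^esub>"
    by (auto simp: SL3_def)
qed (auto simp: SL3_def det_mul matrix_mul_assoc)

text \<open>Projective transformation induced by an invertible matrix.\<close>

definition pact :: "real^3^3 \<Rightarrow> rp2 \<Rightarrow> rp2" where
  "pact A p = Rp2 ((*v) A ` line_of p)"

lemma pact_proj:
  assumes "v \<noteq> 0"
  shows "pact A (proj v) = proj (A *v v)"
proof -
  have "(*v) A ` span {v} = span {A *v v}"
    using linear_span_image[OF matrix_vector_mul_linear, of A "{v}"] by simp
  then show ?thesis
    using line_of_proj[OF assms] by (simp add: pact_def proj_def)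
qed

section \<open>Convex domains\<close>

text \<open>The Euclidean plane as the standard affine chart of the projective plane.\<close>

definition affine_lift :: "real^2 \<Rightarrow> real^3" where
  "affine_lift x = vector [x $ 1, x $ 2, 1]"

definition affine_pt :: "real^2 \<Rightarrow> rp2" where
  "affine_pt x = proj (affine_lift x)"

text \<open>An arbitrary affine chart is the image of the standard one under some \<^term>\<open>g \<in> carrier SL3\<close>.\<close>

definition convex_domains :: "rp2 set set" where
  "convex_domains = {\<Omega>. open \<Omega> \<and> \<Omega> \<noteq> {} \<and>
     (\<exists>g\<in>carrier SL3. \<exists>K. convex K \<and> bounded K \<and> \<Omega> = pact g ` affine_pt ` K)}"

definition hausdist :: "'a::metric_space set \<Rightarrow> 'a set \<Rightarrow> real" where
  "hausdist A B = (if A = {} \<or> B = {} then 0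
     else max (SUP x\<in>A. infdist x B) (SUP y\<in>B. infdist y A))"

lemma dist_rp2_le: "dist p q \<le> pi" for p q :: rp2
proof -
  obtain u v where "norm u = 1" "p = proj u" "norm v = 1" "q = proj v"
    by (metis rp2_unit_rep)
  moreover from this have "\<bar>u \<bullet> v\<bar> \<le> 1" using Cauchy_Schwarz_ineq2[of u v] by simp
  ultimately show ?thesis using arccos_ubound[of "\<bar>u \<bullet> v\<bar>"] by (simp add: dist_proj_unit)
qed

lemma infdist_rp2_bdd:
  fixes A B :: "rp2 set"
  assumes "B \<noteq> {}"
  shows "bdd_above ((\<lambda>x. infdist x B) ` A)"
proof (rule bdd_aboveI2)
  obtain y where "y \<in> B" using assms by blast
  then show "infdist x B \<le> pi" for x
    using infdist_le[of y B x] dist_rp2_le[of x y] by linarith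
qed

lemma hausdist_ge1:
  fixes A B :: "rp2 set"
  assumes "B \<noteq> {}" "x \<in> A"
  shows "infdist x B \<le> hausdist A B"
proof -
  have "infdist x B \<le> (SUP x\<in>A. infdist x B)"
    using assms infdist_rp2_bdd by (intro cSUP_upper)
  then show ?thesis using assms by (auto simp: hausdist_def)
qed

lemma hausdist_commute: "hausdist A B = hausdist B A"
  by (auto simp: hausdist_def max.commute)

lemma hausdist_ge2:
  fixes A B :: "rp2 set"
  assumes "A \<noteq> {}" "x \<in> B"
  shows "infdist x A \<le> hausdist A B"
  using hausdist_ge1[of A x B] assms by (simp add: hausdist_commute)

lemma infdist_hausdist:
  fixes A B C :: "rp2 set"
  assumes "A \<noteq> {}" "B \<noteq> {}" "C \<noteq> {}" "x \<in> A"
  shows "infdist x C \<le> hausdist A B + hausdist B C"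
proof -
  have "infdist x C - hausdist B C \<le> dist x y" if "y \<in> B" for y
    using infdist_triangle[of x C y] hausdist_ge1[of C y B] that assms by linarith
  then have "infdist x C - hausdist B C \<le> infdist x B"
    using assms by (auto simp: infdist_notempty intro!: cINF_greatest)
  also have "\<dots> \<le> hausdist A B" using assms by (intro hausdist_ge1) auto
  finally show ?thesis by simp
qed

lemma hausdist_triangle:
  fixes A B C :: "rp2 set"
  assumes "A \<noteq> {}" "B \<noteq> {}" "C \<noteq> {}"
  shows "hausdist A C \<le> hausdist A B + hausdist B C"
proof -
  have "infdist x C \<le> hausdist A B + hausdist B C" if "x \<in> A" for x
    using assms that by (rule infdist_hausdist)
  moreover have "infdist x A \<le> hausdist A B + hausdist B C" if "x \<in> C" for x
    using infdist_hausdist[of C B A x] assms that by (simp add: hausdist_commute)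
  ultimately show ?thesis
    unfolding hausdist_def[of A C] using assms by (auto intro!: cSUP_least)
qed

lemma hausdist_nonneg:
  fixes A B :: "rp2 set"
  assumes "A \<noteq> {}" "B \<noteq> {}"
  shows "0 \<le> hausdist A B"
proof -
  obtain x where "x \<in> A" using assms by blast
  then show ?thesis
    using hausdist_ge1[OF assms(2)] infdist_nonneg by (metis order_trans)
qed

lemma hausdist_eq_0D:
  fixes A B :: "rp2 set"
  assumes "A \<noteq> {}" "B \<noteq> {}" "hausdist A B = 0"
  shows "A \<subseteq> closure B"
proof
  fix x assume "x \<in> A"
  then have "infdist x B = 0"
    using hausdist_ge1[of B x A] assms infdist_nonneg[of x B] by simp
  then show "x \<in> closure B" using assms by (simp add: in_closure_iff_infdist_zero)
qed

lemma proj_scaleR: "c \<noteq> 0 \<Longrightarrow> proj (c *\<^sub>R v) = proj v"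
proof -
  assume "c \<noteq> 0"
  then have "v \<in> span {c *\<^sub>R v}"
    using span_scale[OF span_base[of "c *\<^sub>R v" "{c *\<^sub>R v}"], of "inverse c"] by simp
  moreover have "c *\<^sub>R v \<in> span {v}" by (simp add: span_scale span_base)
  ultimately have "span {c *\<^sub>R v} = span {v}" by (simp add: span_eq)
  then show ?thesis by (simp add: proj_def)
qed

lemma dist_proj:
  assumes "u \<noteq> 0" "v \<noteq> 0"
  shows "dist (proj u) (proj v) = arccos (\<bar>u \<bullet> v\<bar> / (norm u * norm v))"
proof -
  have "dist (proj u) (proj v) = dist (proj (inverse (norm u) *\<^sub>R u)) (proj (inverse (norm v) *\<^sub>R v))"
    using assms by (simp add: proj_scaleR)
  also have "\<dots> = arccos \<bar>(inverse (norm u) *\<^sub>R u) \<bullet> (inverse (norm v) *\<^sub>R v)\<bar>"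
    using assms by (intro dist_proj_unit) auto
  finally show ?thesis
    by (simp add: abs_mult divide_inverse mult_ac)
qed

lemma continuous_on_proj: "continuous_on (- {0}) proj"
  unfolding continuous_on_def
proof
  fix u :: "real^3" assume "u \<in> - {0}"
  then have u: "u \<noteq> 0" by simp
  have "((\<lambda>v. \<bar>v \<bullet> u\<bar> / (norm v * norm u)) \<longlongrightarrow> \<bar>u \<bullet> u\<bar> / (norm u * norm u)) (at u within - {0})"
    using u by (intro tendsto_intros) auto
  moreover have "\<bar>u \<bullet> u\<bar> / (norm u * norm u) = 1"
    using u by (simp add: dot_square_norm power2_eq_square)
  moreover have "\<forall>\<^sub>F v in at u within - {0}. \<bar>v \<bullet> u\<bar> / (norm v * norm u) \<in> {-1..1}"
  proof -
    have "\<bar>v \<bullet> u\<bar> / (norm v * norm u) \<le> 1" for v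
      using Cauchy_Schwarz_ineq2[of v u] u by (cases "v = 0") (auto simp: divide_le_eq)
    moreover have "- 1 \<le> \<bar>v \<bullet> u\<bar> / (norm v * norm u)" for v
      by (rule order_trans[of _ 0]) auto
    ultimately show ?thesis by simp
  qed
  ultimately have "((\<lambda>v. arccos (\<bar>v \<bullet> u\<bar> / (norm v * norm u))) \<longlongrightarrow> arccos 1) (at u within - {0})"
    by (intro continuous_on_tendsto_compose[OF continuous_on_arccos']) auto
  moreover have "\<forall>\<^sub>F v in at u within - {0}.
      arccos (\<bar>v \<bullet> u\<bar> / (norm v * norm u)) = dist (proj v) (proj u)"
    using u by (simp add: eventually_at_filter dist_proj)
  ultimately have "((\<lambda>v. dist (proj v) (proj u)) \<longlongrightarrow> arccos 1) (at u within - {0})"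
    by (rule Lim_transform_eventually)
  then show "(proj \<longlongrightarrow> proj u) (at u within - {0})"
    by (subst tendsto_dist_iff) simp
qed

lemma affine_lift_nth [simp]:
  "affine_lift x $ 1 = x $ 1" "affine_lift x $ 2 = x $ 2" "affine_lift x $ 3 = 1"
  by (simp_all add: affine_lift_def)

lemma affine_lift_nonzero [simp]: "affine_lift x \<noteq> 0"
  by (metis affine_lift_nth(3) zero_index zero_neq_one)

lemma SL3_inj: "g \<in> carrier SL3 \<Longrightarrow> inj ((*v) g)"
  by (simp add: SL3_def invertible_det_nz inj_matrix_vector_mult)

lemma SL3_nonzero: "g \<in> carrier SL3 \<Longrightarrow> v \<noteq> 0 \<Longrightarrow> g *v v \<noteq> 0"
  by (metis SL3_inj injD matrix_vector_mult_0_right)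

lemma convex_chart:
  assumes g: "g \<in> carrier SL3"
  defines "f \<equiv> \<lambda>x. pact g (affine_pt x)"
  shows "continuous_on UNIV f" "inj f"
proof -
  have f: "f = (\<lambda>x. proj (g *v affine_lift x))"
    by (simp add: f_def affine_pt_def pact_proj)
  have "continuous_on UNIV (\<lambda>x. affine_lift x $ i)" for i
  proof -
    have "continuous_on UNIV (\<lambda>x. affine_lift x $ 1)" "continuous_on UNIV (\<lambda>x. affine_lift x $ 2)"
      "continuous_on UNIV (\<lambda>x. affine_lift x $ 3)"
      by (simp_all add: continuous_on_component)
    then show ?thesis using exhaust_3[of i] by metis
  qed
  then have "continuous_on UNIV affine_lift"
    by (subst continuous_on_componentwise) (auto simp: Basis_vec_def inner_axis)
  then have c: "continuous_on UNIV (\<lambda>x. g *v affine_lift x)"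
    by (intro continuous_on_compose2[OF matrix_vector_mult_linear_continuous_on]) auto
  show "continuous_on UNIV f"
    unfolding f using g SL3_nonzero
    by (intro continuous_on_compose2[OF continuous_on_proj c]) auto
  show "inj f"
  proof (rule injI)
    fix x y assume "f x = f y"
    then have "span {g *v affine_lift x} = span {g *v affine_lift y}"
      unfolding f using g by (simp add: SL3_nonzero flip: line_of_proj)
    then have "g *v affine_lift x \<in> span {g *v affine_lift y}"
      by (metis span_base singletonI)
    then obtain k where "g *v affine_lift x = g *v (k *\<^sub>R affine_lift y)"
      by (auto simp: span_singleton matrix_vector_mult_scaleR)
    then have e: "affine_lift x = k *\<^sub>R affine_lift y"
      using SL3_inj[OF g] by (simp add: inj_eq)
    have "k = 1"
      using arg_cong[OF e, of "\<lambda>v. v $ 3"] by simp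
    then have "x $ 1 = y $ 1" "x $ 2 = y $ 2"
      using arg_cong[OF e, of "\<lambda>v. v $ 1"] arg_cong[OF e, of "\<lambda>v. v $ 2"] by auto
    then show "x = y" by (simp add: vec_eq_iff forall_2)
  qed
qed

lemma convex_domain_interior_closure:
  assumes "\<Omega> \<in> convex_domains"
  shows "interior (closure \<Omega>) = \<Omega>"
proof
  obtain g K where g: "g \<in> carrier SL3" and K: "convex K" "bounded K"
    and \<Omega>: "open \<Omega>" "\<Omega> = pact g ` affine_pt ` K"
    using assms by (auto simp: convex_domains_def)
  define f where "f = (\<lambda>x. pact g (affine_pt x))"
  have f: "continuous_on UNIV f" "inj f"
    unfolding f_def by (rule convex_chart[OF g])+
  have \<Omega>f: "\<Omega> = f ` K" by (simp add: \<Omega> f_def image_image)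
  have "open (f -` \<Omega>)"
    using f \<Omega> by (simp add: continuous_on_open_vimage)
  then have "open K" using f by (simp add: \<Omega>f inj_vimage_image_eq)
  show "\<Omega> \<subseteq> interior (closure \<Omega>)"
    by (simp add: \<Omega>(1) closure_subset interior_maximal)
  show "interior (closure \<Omega>) \<subseteq> \<Omega>"
  proof
    fix p assume p: "p \<in> interior (closure \<Omega>)"
    have "compact (f ` closure K)"
      using K f by (intro compact_continuous_image) (auto intro: continuous_on_subset)
    then have "closure \<Omega> \<subseteq> f ` closure K"
      unfolding \<Omega>f by (intro closure_minimal image_mono closure_subset compact_imp_closed)
    then have s: "interior (closure \<Omega>) \<subseteq> f ` closure K"
      using interior_subset by blast
    then obtain x where x: "p = f x" using p by auto
    have "f -` interior (closure \<Omega>) \<subseteq> closure K"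
      using s inj_image_mem_iff[OF f(2)] by blast
    moreover have "open (f -` interior (closure \<Omega>))"
      using f by (simp add: continuous_on_open_vimage)
    ultimately have "x \<in> interior (closure K)"
      using p x by (auto simp: interior_def)
    then have "x \<in> K"
      using convex_interior_closure[OF K(1)] interior_open[OF \<open>open K\<close>] by simp
    then show "p \<in> \<Omega>" by (simp add: x \<Omega>f)
  qed
qed

lemma Metric_space_convex_domains: "Metric_space convex_domains hausdist"
proof
  fix A B :: "rp2 set"
  assume AB: "A \<in> convex_domains" "B \<in> convex_domains"
  then have ne: "A \<noteq> {}" "B \<noteq> {}" by (auto simp: convex_domains_def)
  show "hausdist A B = 0 \<longleftrightarrow> A = B"
  proof
    assume "hausdist A B = 0"
    then have "A \<subseteq> closure B" "B \<subseteq> closure A"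
      using hausdist_eq_0D[of A B] hausdist_eq_0D[of B A] ne by (auto simp: hausdist_commute)
    then have "closure A = closure B"
      by (simp add: closure_minimal subset_antisym)
    then show "A = B" using AB convex_domain_interior_closure by metis
  qed (use ne in \<open>auto simp: hausdist_def\<close>)
  fix C :: "rp2 set"
  assume "C \<in> convex_domains"
  then have "C \<noteq> {}" by (auto simp: convex_domains_def)
  then show "hausdist A C \<le> hausdist A B + hausdist B C"
    using ne by (intro hausdist_triangle)
next
  fix A B :: "rp2 set"
  show "hausdist A B = hausdist B A" by (rule hausdist_commute)
  show "0 \<le> hausdist A B"
    using hausdist_nonneg[of A B] by (cases "A = {} \<or> B = {}") (auto simp: hausdist_def)
qed

definition domain_topology :: "rp2 set topology" where
  "domain_topology = Metric_space.mtopology convex_domains hausdist"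

definition euclidean_regular_gon :: "nat \<Rightarrow> (real^2) set \<Rightarrow> bool" where
  "euclidean_regular_gon k P \<longleftrightarrow> (\<exists>m r \<theta>. r > 0 \<and>
     P = convex hull ((\<lambda>j. m + r *\<^sub>R vector [cos (\<theta> + 2 * pi * real j / real k),
                                         sin (\<theta> + 2 * pi * real j / real k)]) ` {..<k}))"

definition regular_gon :: "nat \<Rightarrow> rp2 set \<Rightarrow> bool" where
  "regular_gon k \<Omega> \<longleftrightarrow> (\<exists>g\<in>carrier SL3. \<exists>P.
     euclidean_regular_gon k P \<and> \<Omega> = pact g ` affine_pt ` interior P)"

section \<open>Reflections and the hyperbolic plane\<close>

definition reflection_across :: "real^3^3 \<Rightarrow> rp2 set \<Rightarrow> bool" where
  "reflection_across A L \<longleftrightarrow> proj_line L \<and> (\<forall>p\<in>L. pact A p = p) \<and>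
     (\<exists>h\<in>carrier SL3. A = h ** (\<chi> i j. if i = j then if i = 1 then 1 else - 1 else 0) ** matrix_inv h)"

text \<open>The Klein model is the open unit disc of the standard affine chart, i.e. the set of lines on
  which the form below is negative.\<close>

definition mink :: "real^3 \<Rightarrow> real^3 \<Rightarrow> real" where
  "mink u v = u $ 1 * v $ 1 + u $ 2 * v $ 2 - u $ 3 * v $ 3"

definition SO21 :: "(real^3^3) set" where
  "SO21 = {A. det A = 1 \<and> (\<forall>u v. mink (A *v u) (A *v v) = mink u v)}"

text \<open>Hyperbolic angles, measured on the hyperboloid \<^term>\<open>mink u u = -1\<close>: the tangent vector at
  \<open>u\<close> of the geodesic towards \<open>v\<close> is a positive multiple of \<open>v + mink u v *\<^sub>R u\<close>.\<close>

definition hyperboloid_lift :: "real^2 \<Rightarrow> real^3" where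
  "hyperboloid_lift x = affine_lift x /\<^sub>R sqrt (1 - (norm x)\<^sup>2)"

definition hyp_direction :: "real^2 \<Rightarrow> real^2 \<Rightarrow> real^3" where
  "hyp_direction x y = (let u = hyperboloid_lift x; v = hyperboloid_lift y in v + mink u v *\<^sub>R u)"

definition hyp_angle :: "real^2 \<Rightarrow> real^2 \<Rightarrow> real^2 \<Rightarrow> real" where
  "hyp_angle x y z = (let a = hyp_direction x y; b = hyp_direction x z in
     arccos (mink a b / sqrt (mink a a * mink b b)))"

text \<open>A triangle is given by its three vertices \<open>x 1\<close>, \<open>x 2\<close>, \<open>x 3\<close>; side \<open>i\<close> is opposite to
  vertex \<open>i\<close>. Geodesics of the Klein model are straight segments.\<close>

definition hyp_triangle :: "(3 \<Rightarrow> real^2) \<Rightarrow> bool" where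
  "hyp_triangle x \<longleftrightarrow> (\<forall>i. norm (x i) < 1) \<and> \<not> collinear (range x)"

definition closed_triangle :: "(3 \<Rightarrow> real^2) \<Rightarrow> rp2 set" where
  "closed_triangle x = affine_pt ` (convex hull (range x))"

definition side_line :: "(3 \<Rightarrow> real^2) \<Rightarrow> 3 \<Rightarrow> rp2 set" where
  "side_line x i = pspan (affine_pt ` x ` (- {i}))"

definition side_reflection :: "(3 \<Rightarrow> real^2) \<Rightarrow> 3 \<Rightarrow> real^3^3" where
  "side_reflection x i = (THE A. A \<in> SO21 \<and> reflection_across A (side_line x i))"

definition triangle_group :: "(3 \<Rightarrow> real^2) \<Rightarrow> (real^3^3) monoid" where
  "triangle_group x = subgroup_generated SL3 (range (side_reflection x))"

section \<open>Representation and moduli spaces\<close>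

text \<open>Homomorphisms are made extensional, so that \<^term>\<open>rep_space G\<close> is the space of all
  homomorphisms with the topology of pointwise convergence.\<close>

definition rep_space :: "(real^3^3) monoid \<Rightarrow> (real^3^3 \<Rightarrow> real^3^3) topology" where
  "rep_space G = subtopology (product_topology (\<lambda>_. euclidean) (carrier G)) (hom G SL3)"

definition deformations :: "(3 \<Rightarrow> real^2) \<Rightarrow> (real^3^3 \<Rightarrow> real^3^3) topology" where
  "deformations x = (let G = triangle_group x in
     subtopology (rep_space G)
       (connected_component_of_set (rep_space G) (\<lambda>\<gamma>\<in>carrier G. \<gamma>)))"

definition conj_class :: "(real^3^3) monoid \<Rightarrow> (real^3^3 \<Rightarrow> real^3^3) \<Rightarrow> (real^3^3 \<Rightarrow> real^3^3) set" where
  "conj_class G \<rho> = {\<lambda>\<gamma>\<in>carrier G. g ** \<rho> \<gamma> ** matrix_inv g | g. g \<in> carrier SL3}"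

definition quotient_topology :: "'a topology \<Rightarrow> ('a \<Rightarrow> 'b) \<Rightarrow> 'b topology" where
  "quotient_topology X f =
     topology (\<lambda>U. U \<subseteq> f ` topspace X \<and> openin X {x \<in> topspace X. f x \<in> U})"

lemma openin_quotient_topology:
  "openin (quotient_topology X f) U \<longleftrightarrow>
     U \<subseteq> f ` topspace X \<and> openin X {x \<in> topspace X. f x \<in> U}"
proof -
  have "istopology (\<lambda>U. U \<subseteq> f ` topspace X \<and> openin X {x \<in> topspace X. f x \<in> U})"
    unfolding istopology_def
  proof (intro conjI allI impI; (elim conjE)?)
    fix S T assume "openin X {x \<in> topspace X. f x \<in> S}" "openin X {x \<in> topspace X. f x \<in> T}"
    then have "openin X ({x \<in> topspace X. f x \<in> S} \<inter> {x \<in> topspace X. f x \<in> T})"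
      by blast
    then show "openin X {x \<in> topspace X. f x \<in> S \<inter> T}"
      by (rule back_subst[of "openin X"]) auto
  next
    fix \<K> assume "\<forall>K\<in>\<K>. K \<subseteq> f ` topspace X \<and> openin X {x \<in> topspace X. f x \<in> K}"
    then have "openin X (\<Union>K\<in>\<K>. {x \<in> topspace X. f x \<in> K})"
      by blast
    then show "openin X {x \<in> topspace X. f x \<in> \<Union>\<K>}"
      by (rule back_subst[of "openin X"]) auto
  qed auto
  then show ?thesis
    by (simp add: quotient_topology_def topology_inverse')
qed

lemma quotient_map_quotient_topology: "quotient_map X (quotient_topology X f) f"
proof -
  have "{x \<in> topspace X. f x \<in> f ` topspace X} = topspace X"
    by blast
  then have "openin (quotient_topology X f) (f ` topspace X)"
    by (simp add: openin_quotient_topology)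
  moreover have "topspace (quotient_topology X f) \<subseteq> f ` topspace X"
    by (auto simp: topspace_def openin_quotient_topology)
  ultimately have "topspace (quotient_topology X f) = f ` topspace X"
    by (simp add: openin_subset subset_antisym)
  then show ?thesis
    by (simp add: quotient_map_def openin_quotient_topology)
qed

definition moduli_space :: "(3 \<Rightarrow> real^2) \<Rightarrow> (real^3^3 \<Rightarrow> real^3^3) set topology" where
  "moduli_space x = quotient_topology (deformations x) (conj_class (triangle_group x))"

section \<open>Fundamental triangles\<close>

text \<open>Closed triangles of the projective plane are the projective images of the coordinate
  triangle; its sides lie on the lines \<open>coord_line i\<close>.\<close>

definition coord_triangle :: "rp2 set" where
  "coord_triangle = {proj s | s. s \<noteq> 0 \<and> (\<forall>i. 0 \<le> s $ i)}"

definition coord_line :: "3 \<Rightarrow> rp2 set" where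
  "coord_line i = {proj s | s. s \<noteq> 0 \<and> s $ i = 0}"

definition fundamental_triangles ::
  "(3 \<Rightarrow> real^2) \<Rightarrow> ((real^3^3 \<Rightarrow> real^3^3) \<Rightarrow> rp2 set) \<Rightarrow> bool" where
  "fundamental_triangles x D \<longleftrightarrow>
     (\<forall>\<rho>\<in>topspace (deformations x).
        (\<exists>g\<in>carrier SL3. D \<rho> = pact g ` coord_triangle \<and>
           (\<forall>i. reflection_across (\<rho> (side_reflection x i)) (pact g ` coord_line i))) \<and>
        ((\<lambda>\<rho>'. hausdist (D \<rho>') (D \<rho>)) \<longlongrightarrow> 0) (atin (deformations x) \<rho>)) \<and>
     D (\<lambda>\<gamma>\<in>carrier (triangle_group x). \<gamma>) = closed_triangle x"

text \<open>The triangles bounded by the reflection lines of \<open>\<rho>\<close> form a discrete set, so over the connected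
  space of deformations a continuous choice is determined by its value at the inclusion.\<close>

definition fundamental_triangle ::
  "(3 \<Rightarrow> real^2) \<Rightarrow> (real^3^3 \<Rightarrow> real^3^3) \<Rightarrow> rp2 set" where
  "fundamental_triangle x \<rho> = (THE T. \<exists>D. fundamental_triangles x D \<and> T = D \<rho>)"

definition invariant_domain ::
  "(3 \<Rightarrow> real^2) \<Rightarrow> (real^3^3 \<Rightarrow> real^3^3) \<Rightarrow> rp2 set" where
  "invariant_domain x \<rho> =
     (\<Union>\<gamma>\<in>carrier (triangle_group x). pact (\<rho> \<gamma>) ` fundamental_triangle x \<rho>)"

end

(* A representation is determined up to conjugacy by the Cartan matrix of its three reflections up to
   diagonal conjugation, that is by the orders a, b, c and one cyclic product c(rho) > 0, which traces
   detect; this identifies the moduli space with the real line through ln c(rho). In suitable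
   coordinates the fundamental triangle is the nonnegative orthant, and the invariant domain is the
   projectivised Tits cone of a Cartan matrix with prescribed cyclic product.
   As the product tends to infinity, diagonal conjugations (which may depend on a sequence of base
   points) make the Cartan matrices converge after deletion of the walls whose parameters blow up.
   At most two walls survive, so the limit of the Tits cones is bounded by finitely many planes: a
   triangle, or the union of the images of a triangle under a finite dihedral group, which is a
   regular polygon with a, b or c vertices. A compactness argument for projective maps shows that any
   other limit of images of the domains is projectively equivalent to one of these. The limit in which
   the product tends to zero is reduced to this one by reversing the cyclic order of the walls. *)
theory Submission
  imports Defs
begin

section \<open>Reflection groups acting on half-spaces\<close>

text \<open>The obstacle is that the matrices a_t are arbitrary and may diverge, so an abstract
  limit cannot be compared with the model limits directly. What helps is that the group acts
  cocompactly: a point of the limit domain is approximated by points of the domains, each of which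
  is moved into the fundamental triangle by the group and then, by a diagonal matrix chosen for that
  very point, into a bounded position away from every wall whose parameter escapes. Matching these
  base points forces the comparison maps, which could degenerate a priori, to accumulate at an
  invertible map. Convexity and openness of the domains, and the equality of relations for all
  parameters, are drawn from one statement on reduced words: a letter prefixed to a word lengthens
  it only if the word keeps the chamber on the positive side of that wall. An element of SL(3,R)
  conjugate to diag(1,-1,-1) is minus a linear reflection. The sign is invisible projectively, but
  it must be tracked in relations, and -1 must be kept out of the group of the linear
  reflections.\<close>

fun alt :: "'i \<Rightarrow> 'i \<Rightarrow> nat \<Rightarrow> 'i list" where
  "alt i j 0 = []"
| "alt i j (Suc k) = i # alt j i k"

lemma length_alt [simp]: "length (alt i j k) = k"
  by (induction k arbitrary: i j) auto

lemma alt_append: "\<exists>i' j'. {i', j'} = {i, j} \<and> alt i j (m + n) = alt i j m @ alt i' j' n"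
proof (induction m arbitrary: i j)
  case (Suc m)
  from Suc[of j i] show ?case by (auto simp: insert_commute)
qed auto

text \<open>\<open>s i\<close> is the reflection across the wall of the half-space \<open>H i\<close>; the assumption \<open>rotation_pos\<close>
  is what remains of Coxeter's dihedral groups.\<close>

locale coxeter =
  fixes s :: "'i \<Rightarrow> 'x \<Rightarrow> 'x" and H :: "'i \<Rightarrow> 'x set" and m :: "'i \<Rightarrow> 'i \<Rightarrow> nat"
  assumes invol: "s i (s i x) = x"
    and braid: "i \<noteq> j \<Longrightarrow> foldr s (alt i j (m i j)) x = foldr s (alt j i (m i j)) x"
    and m_sym: "m i j = m j i"
    and m_pos: "i \<noteq> j \<Longrightarrow> 0 < m i j"
    and rotation_pos: "i \<noteq> j \<Longrightarrow> k < m i j \<Longrightarrow> x \<in> H i \<Longrightarrow> x \<in> H j \<Longrightarrow> foldr s (alt j i k) x \<in> H i"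
    and parity: "foldr s u = foldr s v \<Longrightarrow> even (length u) = even (length v)"
begin

section \<open>Reduced words and the sides of walls\<close>

definition reduced :: "'i list \<Rightarrow> bool" where
  "reduced w \<longleftrightarrow> (\<forall>v. foldr s v = foldr s w \<longrightarrow> length w \<le> length v)"

lemma reduced_exists:
  obtains v where "reduced v" "foldr s v = foldr s w" "length v \<le> length w"
proof -
  define v where "v = arg_min length (\<lambda>v. foldr s v = foldr s w)"
  have "foldr s v = foldr s w"
    unfolding v_def by (rule arg_min_natI[of _ w]) simp
  moreover have "length v \<le> length u" if "foldr s u = foldr s w" for u
    unfolding v_def by (rule arg_min_nat_le) (use that in simp)
  ultimately show ?thesis using that[of v] by (auto simp: reduced_def)
qed

lemma reduced_appendD:
  assumes "reduced (u @ v)" shows "reduced u" "reduced v"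
proof -
  show "reduced u"
    unfolding reduced_def
  proof (intro allI impI)
    fix u' assume "foldr s u' = foldr s u"
    then have "foldr s (u' @ v) = foldr s (u @ v)" by (simp add: fun_eq_iff)
    then have "length (u @ v) \<le> length (u' @ v)" using assms unfolding reduced_def by blast
    then show "length u \<le> length u'" by simp
  qed
  show "reduced v"
    unfolding reduced_def
  proof (intro allI impI)
    fix v' assume "foldr s v' = foldr s v"
    then have "foldr s (u @ v') = foldr s (u @ v)" by (simp add: fun_eq_iff)
    then have "length (u @ v) \<le> length (u @ v')" using assms unfolding reduced_def by blast
    then show "length v \<le> length v'" by simp
  qed
qed

lemma not_reduced_double: "\<not> reduced (i # i # v)"
proof
  assume "reduced (i # i # v)"
  moreover have "foldr s v = foldr s (i # i # v)" by (simp add: fun_eq_iff invol)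
  ultimately have "length (i # i # v) \<le> length v" unfolding reduced_def by blast
  then show False by simp
qed

text \<open>Parity rules out an equivalent word of length \<open>length w\<close>, so if
  \<open>i # w\<close> is not reduced, the drop goes below the length of w itself.\<close>

lemma reduced_Cons_shorter:
  assumes "reduced w" "\<not> reduced (i # w)"
  obtains v where "reduced v" "foldr s v = foldr s (i # w)" "length v < length w"
proof -
  from assms(2) obtain u where u: "foldr s u = foldr s (i # w)" "length u < length (i # w)"
    unfolding reduced_def by (auto simp: not_le)
  have "length u \<noteq> length w" using parity[OF u(1)] by auto
  with u(2) have "length u < length w" by simp
  moreover obtain v where "reduced v" "foldr s v = foldr s u" "length v \<le> length u"
    using reduced_exists by blast
  ultimately show ?thesis using that u(1) by simp
qed

text \<open>Equal neighbouring letters cancel, so a reduced word in two letters can only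
  alternate.\<close>

lemma reduced_dihedral:
  assumes "reduced (i # u)" "set u \<subseteq> {i, j}" "i \<noteq> j"
  shows "u = alt j i (length u)"
  using assms
proof (induction u arbitrary: i j)
  case (Cons l u)
  have "l \<noteq> i" using Cons.prems(1) not_reduced_double[of i u] by auto
  then have l: "l = j" using Cons.prems(2) by auto
  have "reduced (j # u)" using reduced_appendD(2)[of "[i]" "j # u"] Cons.prems(1) l by simp
  then have "u = alt i j (length u)"
    using Cons.prems(2,3) by (intro Cons.IH) auto
  then show ?case using l by simp
qed simp

text \<open>Once the alternating tail has \<open>m i j\<close> letters, the braid relation rewrites
  its beginning so that it starts with i, next to the i in front, and the two cancel.\<close>

lemma reduced_dihedral_length:
  assumes "reduced (i # alt j i k)" "i \<noteq> j"
  shows "k < m i j"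
proof (rule ccontr)
  assume "\<not> k < m i j"
  then obtain n where k: "k = m i j + n" by (metis le_Suc_ex not_less)
  obtain i' j' where a: "alt j i k = alt j i (m i j) @ alt i' j' n"
    using alt_append[of j i "m i j" n] k by auto
  have "foldr s (i # alt i j (m i j)) = foldr s (i # alt j i (m i j))"
    using braid[OF assms(2)] by (simp add: fun_eq_iff)
  moreover have "reduced (i # alt j i (m i j))"
    using reduced_appendD(1)[of "i # alt j i (m i j)"] assms(1) a by simp
  ultimately have "reduced (i # alt i j (m i j))"
    unfolding reduced_def by simp
  moreover obtain m' where "m i j = Suc m'" using m_pos[OF assms(2)] gr0_implies_Suc by blast
  ultimately show False using not_reduced_double by simp
qed

text \<open>Let j be the first letter of w. Factor w as u v with u a word in i and j and v as short
  as possible, so that v is a shortest element of its coset under the dihedral group of i and j.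
  Then neither letter can be absorbed by v, the induction hypothesis puts v x on the positive side
  of both walls, and u alternates with fewer than \<open>m i j\<close> letters, which is the
  situation of \<open>rotation_pos\<close>.\<close>

theorem reduced_Cons_pos:
  assumes "reduced (i # w)" "\<And>i. x \<in> H i"
  shows "foldr s w x \<in> H i"
  using assms(1)
proof (induction "length w" arbitrary: i w rule: less_induct)
  case less
  show ?case
  proof (cases w)
    case Nil then show ?thesis using assms(2) by simp
  next
    case (Cons j w')
    have w: "reduced w" using reduced_appendD(2)[of "[i]" w] less.prems by simp
    have ij: "i \<noteq> j" using less.prems not_reduced_double[of i w'] Cons by auto
    define P where "P u v \<longleftrightarrow> set u \<subseteq> {i, j} \<and> foldr s (u @ v) = foldr s w \<and>
      length u + length v = length w" for u v
    have "P [j] w'" using Cons by (simp add: P_def)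
    then have ex: "\<exists>u. P u w'" by blast
    define v where "v = arg_min length (\<lambda>v. \<exists>u. P u v)"
    have v: "\<exists>u. P u v"
      unfolding v_def by (rule arg_min_natI[of _ w']) (rule ex)
    have vmin: "length v \<le> length v'" if "P u v'" for u v'
      unfolding v_def by (rule arg_min_nat_le) (use that in blast)
    from v obtain u where u: "P u v" by blast
    have uv: "reduced (i # u @ v)"
    proof -
      have "foldr s (i # u @ v) = foldr s (i # w)" using u by (simp add: P_def fun_eq_iff)
      moreover have "length (i # u @ v) = length (i # w)" using u by (simp add: P_def)
      ultimately show ?thesis using less.prems unfolding reduced_def by metis
    qed
    have red_v: "reduced v" using reduced_appendD(2)[of "i # u" v] uv by simp
    \<comment> \<open>Otherwise l could be handed over to u, leaving a factorisation with the
      shorter tail v'; its total length is still right because w is reduced.\<close>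
    have red: "reduced (l # v)" if l: "l \<in> {i, j}" for l
    proof (rule ccontr)
      assume "\<not> reduced (l # v)"
      with red_v obtain v' where v': "foldr s v' = foldr s (l # v)" "length v' < length v"
        by (rule reduced_Cons_shorter)
      have "foldr s ((u @ [l]) @ v') = foldr s w"
        using u v'(1) by (simp add: P_def fun_eq_iff invol)
      moreover from this have "length w \<le> length ((u @ [l]) @ v')"
        using w unfolding reduced_def by blast
      ultimately have "P (u @ [l]) v'" using u v' l by (auto simp: P_def)
      then show False using vmin v'(2) by fastforce
    qed
    have "length v \<le> length w'" by (rule vmin) fact
    then have lv: "length v < length w" using Cons by simp
    have "foldr s v x \<in> H i" "foldr s v x \<in> H j"
      using less.hyps[OF lv red] by auto
    moreover have "reduced (i # u)" using reduced_appendD(1)[of "i # u" v] uv by simp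
    then have "u = alt j i (length u)"
      using u ij by (intro reduced_dihedral) (auto simp: P_def)
    moreover from this have "length u < m i j"
      using reduced_dihedral_length ij \<open>reduced (i # u)\<close> by metis
    ultimately have "foldr s u (foldr s v x) \<in> H i"
      using rotation_pos ij by metis
    then show ?thesis using u by (simp add: P_def fun_eq_iff)
  qed
qed

text \<open>The descent behind convexity: reflecting in a wall that separates the point from the
  chamber shortens the word.\<close>

lemma reduced_neg_shorter:
  assumes "reduced w" "\<And>i. x \<in> H i" "foldr s w x \<notin> H i"
  obtains v where "reduced v" "foldr s v = foldr s (i # w)" "length v < length w"
  using reduced_Cons_shorter[OF assms(1)] reduced_Cons_pos assms(2,3) by metis

end

lemma alt_Suc_double: "alt i j (Suc (n + n)) = alt i j (n + n) @ [i]"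
  by (induction n) auto

lemma alt_double: "alt i j (n + n) = alt i j n @ rev (alt j i n)"
proof (induction n arbitrary: i j)
  case (Suc n)
  have "alt i j (Suc n + Suc n) = i # alt j i (Suc (n + n))" by simp
  also have "\<dots> = i # alt j i n @ rev (alt i j n) @ [j]"
    unfolding alt_Suc_double Suc by simp
  finally show ?case by simp
qed simp

context coxeter
begin

lemma foldr_rev [simp]: "foldr s w (foldr s (rev w) x) = x"
  by (induction w arbitrary: x) (auto simp: invol)

lemma foldr_rev' [simp]: "foldr s (rev w) (foldr s w x) = x"
  using foldr_rev[of "rev w"] by simp

text \<open>By the braid relation the first half of the word is the map whose inverse is the second
  half.\<close>

lemma rotation_order: "i \<noteq> j \<Longrightarrow> foldr s (alt i j (m i j + m i j)) x = x"
  unfolding alt_double foldr_append o_apply by (subst braid) auto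

end

lemma cyc3: "(1::3) + 1 = 2" "(2::3) + 1 = 3" "(3::3) + 1 = 1"
    "(1::3) + 2 = 3" "(2::3) + 2 = 1" "(3::3) + 2 = 2" "(4::3) = 1" "(5::3) = 2"
  by simp_all

text \<open>Numerals of type \<open>3\<close> are read modulo 3, where the three indices add up to
  zero; hence minus the sum of two of them is the third.\<close>

lemma third_index:
  fixes i j k :: 3
  assumes "i \<noteq> j" "k = - (i + j)"
  shows "k \<noteq> i" "k \<noteq> j" "UNIV = {i, j, k}"
proof -
  have "k \<noteq> i \<and> k \<noteq> j \<and> (l = i \<or> l = j \<or> l = k)" for l
    using exhaust_3[of i] exhaust_3[of j] exhaust_3[of l] assms by (elim disjE) simp_all
  then show "k \<noteq> i" "k \<noteq> j" "UNIV = {i, j, k}" by blast+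
qed

section \<open>Cartan matrices and the Tits cone\<close>

text \<open>The coordinates are the wall functionals themselves, so the walls are the coordinate
  planes and the geometry sits in the columns of S: when \<open>S $ i $ i = 2\<close>, column i is
  the vector that is negated.\<close>

definition refl :: "real^3^3 \<Rightarrow> 3 \<Rightarrow> real^3 \<Rightarrow> real^3" where
  "refl S i x = x - (x $ i) *\<^sub>R column i S"

definition orthant :: "(real^3) set" where
  "orthant = {x. \<forall>i. 0 \<le> x $ i}"

definition tits :: "real^3^3 \<Rightarrow> (real^3) set" where
  "tits S = {foldr (refl S) w x | w x. x \<in> orthant}"

text \<open>The pair \<open>i \<noteq> j\<close> of walls is labelled by the opposite vertex \<open>- (i + j)\<close>.\<close>

definition cartan :: "(3 \<Rightarrow> nat) \<Rightarrow> real^3^3 \<Rightarrow> bool" where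
  "cartan m S \<longleftrightarrow> (\<forall>k. 3 \<le> m k) \<and> (\<forall>i. S $ i $ i = 2) \<and> det S < 0 \<and>
     (\<forall>i j. i \<noteq> j \<longrightarrow> S $ i $ j < 0 \<and> S $ i $ j * S $ j $ i = 4 * (cos (pi / m (- (i + j))))\<^sup>2)"

lemma refl_component: "refl S i x $ k = x $ k - x $ i * S $ k $ i"
  by (simp add: refl_def column_def)

lemma refl_add: "refl S i (x + y) = refl S i x + refl S i y"
  by (simp add: refl_def algebra_simps)

lemma refl_scaleR: "refl S i (c *\<^sub>R x) = c *\<^sub>R refl S i x"
  by (simp add: refl_def algebra_simps)

lemma linear_refl_word: "linear (foldr (refl S) w)"
proof (induction w)
  case Nil then show ?case by (simp add: id_def linear_ident)
next
  case (Cons i w)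
  have "linear (refl S i)" by (intro linearI) (auto simp: refl_add refl_scaleR)
  then show ?case using linear_compose[OF Cons] by (simp add: o_def)
qed

lemma orthant_in_tits: "x \<in> orthant \<Longrightarrow> x \<in> tits S"
  unfolding tits_def by (metis (mono_tags, lifting) foldr.simps(1) id_apply mem_Collect_eq)

lemma word_tits: "x \<in> tits S \<Longrightarrow> foldr (refl S) w x \<in> tits S"
proof -
  assume "x \<in> tits S"
  then obtain v y where "x = foldr (refl S) v y" "y \<in> orthant" by (auto simp: tits_def)
  then have "foldr (refl S) w x = foldr (refl S) (w @ v) y" by simp
  then show ?thesis using \<open>y \<in> orthant\<close> unfolding tits_def by blast
qed

lemma tits_scaleR: "x \<in> tits S \<Longrightarrow> 0 \<le> c \<Longrightarrow> c *\<^sub>R x \<in> tits S"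
proof -
  assume "x \<in> tits S" "0 \<le> c"
  then obtain w y where "x = foldr (refl S) w y" "y \<in> orthant" by (auto simp: tits_def)
  moreover from this \<open>0 \<le> c\<close> have "c *\<^sub>R y \<in> orthant" by (simp add: orthant_def)
  moreover have "c *\<^sub>R foldr (refl S) w y = foldr (refl S) w (c *\<^sub>R y)"
    using linear_refl_word by (simp add: linear_cmul)
  ultimately show ?thesis unfolding tits_def by auto
qed

definition refl_matrix :: "real^3^3 \<Rightarrow> 3 \<Rightarrow> real^3^3" where
  "refl_matrix S i = (\<chi> r c. (if r = c then 1 else 0) - (if c = i then S $ r $ i else 0))"

lemma refl_matrix_mult: "refl_matrix S i *v x = refl S i x"
  using exhaust_3[of i]
  by (auto simp: vec_eq_iff forall_3 matrix_vector_mult_def sum_3 refl_component refl_matrix_def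
      algebra_simps)

definition word_matrix :: "real^3^3 \<Rightarrow> 3 list \<Rightarrow> real^3^3" where
  "word_matrix S w = foldr (\<lambda>i A. refl_matrix S i ** A) w (mat 1)"

lemma word_matrix_mult: "word_matrix S w *v x = foldr (refl S) w x"
  by (induction w) (auto simp: word_matrix_def refl_matrix_mult simp flip: matrix_vector_mul_assoc)

lemma det_refl_matrix: "S $ i $ i = 2 \<Longrightarrow> det (refl_matrix S i) = - 1"
  using exhaust_3[of i] by (auto simp: det_3 refl_matrix_def)

lemma det_word_matrix: "(\<And>i. S $ i $ i = 2) \<Longrightarrow> det (word_matrix S w) = (- 1) ^ length w"
  by (induction w) (auto simp: word_matrix_def det_mul det_refl_matrix)

text \<open>The determinant of a word is -1 to the power of its length.\<close>

lemma refl_parity: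
  assumes "\<And>i. S $ i $ i = 2" "foldr (refl S) u = foldr (refl S) v"
  shows "even (length u) = even (length v)"
proof -
  have "word_matrix S u = word_matrix S v"
    using assms(2) by (auto simp: matrix_eq word_matrix_mult)
  then have "(- 1 :: real) ^ length u = (- 1) ^ length v"
    using assms(1) by (metis det_word_matrix)
  then show ?thesis by (metis minus_one_power_iff one_neq_neg_one)
qed

context
  fixes m :: "3 \<Rightarrow> nat" and S :: "real^3^3"
  assumes S: "cartan m S"
begin

lemma cartan_diag: "S $ i $ i = 2"
  using S by (simp add: cartan_def)

lemma cartan_neg: "i \<noteq> j \<Longrightarrow> S $ i $ j < 0"
  using S by (simp add: cartan_def)

lemma cartan_angle:
  "0 < pi / m k" "pi / m k \<le> pi / 3" "0 < cos (pi / m k)" "0 < sin (pi / m k)"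
proof -
  have "3 \<le> m k" using S by (simp add: cartan_def)
  then show *: "0 < pi / m k" "pi / m k \<le> pi / 3" by (auto simp: field_simps)
  have "pi / 3 < pi / 2" "pi / 3 < pi" by auto
  then have "pi / m k < pi / 2" "pi / m k < pi" using *(2) by (meson le_less_trans)+
  with *(1) show "0 < cos (pi / m k)" "0 < sin (pi / m k)"
    by (metis cos_gt_zero, metis sin_gt_zero)
qed

lemma cartan_prod: "i \<noteq> j \<Longrightarrow> S $ i $ j * S $ j $ i = 4 * (cos (pi / m (- (i + j))))\<^sup>2"
  using S by (simp add: cartan_def)

lemma cartan_prod_less:
  assumes "i \<noteq> j" shows "S $ i $ j * S $ j $ i < 4"
proof -
  have "0 < (sin (pi / m (- (i + j))))\<^sup>2"
    using cartan_angle(4)[of "- (i + j)"] by (intro zero_less_power)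
  then show ?thesis
    using cartan_prod[OF assms] sin_cos_squared_add[of "pi / m (- (i + j))"] by linarith
qed

text \<open>The numbers u_k = sin(k \<theta>) / sin \<theta> satisfy u_(k+2) = 2 cos \<theta>
  u_(k+1) - u_k, and the two coordinates of alternating words obey the same recursion. S need not be
  symmetric; the normalised entries f and g absorb this, since f g = 1.\<close>

lemma dihedral_component:
  fixes i j :: 3 and k :: nat
  assumes "i \<noteq> j"
  defines "\<theta> \<equiv> pi / m (- (i + j))"
  defines "u \<equiv> \<lambda>k. sin (real k * \<theta>) / sin \<theta>"
    and "r \<equiv> 2 * cos \<theta>"
  shows "foldr (refl S) (alt j i k) x $ i =
      (if even k then u (Suc k) * x $ i - S $ i $ j / r * u k * x $ j
       else u k * x $ i - S $ i $ j / r * u (Suc k) * x $ j)" (is "?P k")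
    "foldr (refl S) (alt i j k) x $ j =
      (if even k then u (Suc k) * x $ j - S $ j $ i / r * u k * x $ i
       else u k * x $ j - S $ j $ i / r * u (Suc k) * x $ i)" (is "?Q k")
proof -
  have th: "\<theta> > 0" "cos \<theta> > 0" "sin \<theta> > 0" using cartan_angle by (auto simp: \<theta>_def)
  then have r: "r > 0" by (simp add: r_def)
  have ab: "S $ i $ j * S $ j $ i = r * r"
    using cartan_prod[OF assms(1)] by (simp add: r_def \<theta>_def power2_eq_square)
  have ua: "u 0 = 0" "u (Suc 0) = 1" using th by (auto simp: u_def)
  have uS: "u (Suc (Suc k)) = r * u (Suc k) - u k" for k
  proof -
    have "sin (real (Suc (Suc k)) * \<theta>) + sin (real k * \<theta>) = r * sin (real (Suc k) * \<theta>)"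
      unfolding r_def using sin_times_cos[of "real (Suc k) * \<theta>" \<theta>]
      by (simp add: algebra_simps)
    then show ?thesis using th by (simp add: u_def field_simps)
  qed
  define f where "f = S $ i $ j / r"
  define g where "g = S $ j $ i / r"
  have fg: "f * g = 1" "S $ i $ j = r * f" "S $ j $ i = r * g"
    using ab r by (auto simp: f_def g_def)
  have step: "foldr (refl S) (alt j i (Suc (Suc k))) x $ i =
      - foldr (refl S) (alt j i k) x $ i - r * f * foldr (refl S) (alt i j (Suc k)) x $ j"
    "foldr (refl S) (alt i j (Suc (Suc k))) x $ j =
      - foldr (refl S) (alt i j k) x $ j - r * g * foldr (refl S) (alt j i (Suc k)) x $ i" for k
    using cartan_diag fg by (simp_all add: refl_component)
  have gf: "f * (g * y) = y" "g * (f * y) = y" for y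
    using fg by (simp_all add: mult.assoc[symmetric] mult.commute[of g f])
  let ?P' = "\<lambda>k. foldr (refl S) (alt j i k) x $ i = (if even k then u (Suc k) * x $ i - f * u k * x $ j
       else u k * x $ i - f * u (Suc k) * x $ j)"
  let ?Q' = "\<lambda>k. foldr (refl S) (alt i j k) x $ j = (if even k then u (Suc k) * x $ j - g * u k * x $ i
       else u k * x $ j - g * u (Suc k) * x $ i)"
  have "?P' k \<and> ?Q' k"
  proof (induction k rule: induct_nat_012)
    case 0 then show ?case by (simp add: ua)
  next
    case 1 then show ?case using fg uS[of 0] by (simp add: ua refl_component)
  next
    case (ge2 k)
    then have P: "?P' k" "?P' (Suc k)" and Q: "?Q' k" "?Q' (Suc k)" by auto
    have "?P' (Suc (Suc k))"
      unfolding step P(1) Q(2) by (simp add: uS algebra_simps gf)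
    moreover have "?Q' (Suc (Suc k))"
      unfolding step Q(1) P(2) by (simp add: uS algebra_simps gf)
    ultimately show ?case ..
  qed
  then show "?P k" "?Q k" by (auto simp: f_def g_def)
qed

text \<open>For k < m the angles k \<theta> and (k + 1) \<theta> stay in [0, \<pi>], so every sine
  in the formula is non-negative, and so is the coefficient f because the entries of S off the
  diagonal are negative.\<close>

lemma dihedral_pos:
  assumes "i \<noteq> j" "k < m (- (i + j))" "0 \<le> x $ i" "0 \<le> x $ j"
  shows "0 \<le> foldr (refl S) (alt j i k) x $ i"
proof -
  define \<theta> where "\<theta> = pi / m (- (i + j))"
  have th: "\<theta> > 0" "cos \<theta> > 0" "sin \<theta> > 0" using cartan_angle by (auto simp: \<theta>_def)
  have u: "0 \<le> sin (real l * \<theta>) / sin \<theta>" if "l \<le> m (- (i + j))" for l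
  proof -
    have "real l * \<theta> \<le> m (- (i + j)) * \<theta>" using that th by (intro mult_right_mono) auto
    also have "\<dots> = pi" using assms(2) by (simp add: \<theta>_def)
    finally show ?thesis using th by (intro divide_nonneg_pos sin_ge_zero) auto
  qed
  define f where "f = - S $ i $ j / (2 * cos \<theta>)"
  have f: "0 \<le> f" using cartan_neg[OF assms(1)] th by (simp add: f_def divide_le_0_iff)
  have "foldr (refl S) (alt j i k) x $ i =
      (if even k then sin (real (Suc k) * \<theta>) / sin \<theta> * x $ i + f * (sin (real k * \<theta>) / sin \<theta>) * x $ j
       else sin (real k * \<theta>) / sin \<theta> * x $ i + f * (sin (real (Suc k) * \<theta>) / sin \<theta>) * x $ j)"
    unfolding dihedral_component(1)[OF assms(1)] \<theta>_def[symmetric] f_def by simp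
  moreover have "k \<le> m (- (i + j))" "Suc k \<le> m (- (i + j))" using assms(2) by auto
  ultimately show ?thesis
    using u[of k] u[of "Suc k"] f assms(3,4) by (auto intro!: add_nonneg_nonneg mult_nonneg_nonneg
        simp del: of_nat_Suc times_divide_eq_left times_divide_eq_right)
qed

text \<open>This functional is invariant under both reflections and recovers coordinate k once the
  coordinates i and j are known. The coefficients a and b come from Cramer's rule for the two by two
  block, whose determinant D is positive because the product of the two entries is below 4.\<close>

lemma dihedral_functional:
  assumes "i \<noteq> j" "k = - (i + j)"
  obtains \<psi> where "\<psi> $ k = 1" "\<psi> \<bullet> column i S = 0" "\<psi> \<bullet> column j S = 0"
proof -
  define D where "D = 4 - S $ i $ j * S $ j $ i"
  have D: "D > 0" using cartan_prod_less[OF assms(1)] by (simp add: D_def)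
  define a where "a = (S $ k $ j * S $ j $ i - 2 * S $ k $ i) / D"
  define b where "b = (S $ k $ i * S $ i $ j - 2 * S $ k $ j) / D"
  have ab: "2 * a + b * S $ j $ i + S $ k $ i = 0" "a * S $ i $ j + 2 * b + S $ k $ j = 0"
    using D unfolding a_def b_def
    by (simp_all add: field_simps) (simp_all add: D_def algebra_simps)
  define \<psi> :: "real^3" where "\<psi> = (\<chi> l. if l = i then a else if l = j then b else 1)"
  have k: "k \<noteq> i" "k \<noteq> j" and U: "UNIV = {i, j, k}"
    using third_index[OF assms(1), of k] assms(2) by auto
  have sum: "(\<Sum>l\<in>UNIV. f l) = f i + f j + f k" for f :: "3 \<Rightarrow> real"
    using k assms(1) by (subst U) (simp add: add.assoc)
  have "\<psi> $ k = 1" "\<psi> \<bullet> column i S = 0" "\<psi> \<bullet> column j S = 0"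
    using k assms(1) ab
    by (auto simp: \<psi>_def inner_vec_def sum column_def cartan_diag algebra_simps)
  then show ?thesis using that by blast
qed

lemma inner_refl: "\<psi> \<bullet> refl S i x = \<psi> \<bullet> x - x $ i * (\<psi> \<bullet> column i S)"
  by (simp add: refl_def inner_diff_right)

lemma alt_invariant:
  assumes "\<psi> \<bullet> column i S = 0" "\<psi> \<bullet> column j S = 0"
  shows "\<psi> \<bullet> foldr (refl S) (alt i j n) x = \<psi> \<bullet> x"
proof -
  have "\<psi> \<bullet> foldr (refl S) (alt i j n) x = \<psi> \<bullet> x \<and> \<psi> \<bullet> foldr (refl S) (alt j i n) x = \<psi> \<bullet> x"
    by (induction n) (auto simp: inner_refl assms)
  then show ?thesis ..
qed

text \<open>After m steps the sine formulas reach the angle \<pi>, where both words give the same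
  coordinates i and j; the invariant functional \<psi> then settles the third coordinate.\<close>

lemma dihedral_braid:
  assumes "i \<noteq> j"
  shows "foldr (refl S) (alt i j (m (- (i + j)))) x = foldr (refl S) (alt j i (m (- (i + j)))) x"
    (is "?u = ?v")
proof -
  define \<theta> where "\<theta> = pi / m (- (i + j))"
  have m3: "3 \<le> m (- (i + j))" using S by (simp add: cartan_def)
  have th: "\<theta> > 0" "cos \<theta> > 0" "sin \<theta> > 0" using cartan_angle by (auto simp: \<theta>_def)
  obtain n where n: "m (- (i + j)) = Suc n" using m3 by (cases "m (- (i + j))") auto
  have mth: "real (Suc n) * \<theta> = pi" using m3 n by (simp add: \<theta>_def)
  have nth: "real n * \<theta> = pi - \<theta>" "real (Suc (Suc n)) * \<theta> = pi + \<theta>"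
    using mth by (simp_all add: algebra_simps)
  have s: "sin (real n * \<theta>) = sin \<theta>" "sin (real (Suc n) * \<theta>) = 0"
    "sin (real (Suc (Suc n)) * \<theta>) = - sin \<theta>"
    unfolding nth mth by simp_all
  have half: "foldr (refl S) (alt i j (Suc n)) x $ i = foldr (refl S) (alt j i (Suc n)) x $ i"
    if "i \<noteq> j" "pi / m (- (i + j)) = \<theta>" for i j
  proof -
    have "foldr (refl S) (alt i j (Suc n)) x $ i = - foldr (refl S) (alt j i n) x $ i"
      by (simp add: refl_component cartan_diag)
    then show ?thesis
      unfolding dihedral_component(1)[OF that(1)] that(2) s using th by simp
  qed
  define k where "k = - (i + j)"
  obtain \<psi> where \<psi>: "\<psi> $ k = 1" "\<psi> \<bullet> column i S = 0" "\<psi> \<bullet> column j S = 0"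
    using dihedral_functional[OF assms k_def] by blast
  have k: "k \<noteq> i" "k \<noteq> j" and U: "UNIV = {i, j, k}"
    using third_index[OF assms(1), of k] k_def by auto
  have sum: "(\<Sum>l\<in>UNIV. f l) = f i + f j + f k" for f :: "3 \<Rightarrow> real"
    using k assms(1) by (subst U) (simp add: add.assoc)
  have i: "?u $ i = ?v $ i"
    unfolding n using half[of i j] assms by (simp add: \<theta>_def)
  have j: "?u $ j = ?v $ j"
    unfolding n using half[of j i] assms by (simp add: \<theta>_def add.commute)
  have "\<psi> \<bullet> ?u = \<psi> \<bullet> ?v"
    using alt_invariant[OF \<psi>(2,3)] alt_invariant[OF \<psi>(3,2)] by simp
  then have k': "?u $ k = ?v $ k"
    using i j \<psi>(1) by (simp add: inner_vec_def sum)
  have "?u $ l = ?v $ l" for l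
  proof -
    have "l = i \<or> l = j \<or> l = k" using U by auto
    then show ?thesis using i j k' by (elim disjE) (simp_all only:)
  qed
  then show ?thesis by (simp add: vec_eq_iff)
qed

end

text \<open>Two representations are run in parallel, which shows that they satisfy the same relations.\<close>

definition refl_pair :: "real^3^3 \<Rightarrow> real^3^3 \<Rightarrow> 3 \<Rightarrow> (real^3) \<times> (real^3) \<Rightarrow> (real^3) \<times> (real^3)" where
  "refl_pair S T i = map_prod (refl S i) (refl T i)"

lemma foldr_refl_pair: "foldr (refl_pair S T) w (x, y) = (foldr (refl S) w x, foldr (refl T) w y)"
  by (induction w) (auto simp: refl_pair_def)

lemma refl_invol: "S $ i $ i = 2 \<Longrightarrow> refl S i (refl S i x) = x"
  by (simp add: vec_eq_iff refl_component)

lemma coxeter_refl_pair: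
  assumes S: "cartan m S" and T: "cartan m T"
  shows "coxeter (refl_pair S T) (\<lambda>i. {x. 0 \<le> fst x $ i \<and> 0 \<le> snd x $ i}) (\<lambda>i j. m (- (i + j)))"
proof
  fix i j :: 3 and k and x :: "(real^3) \<times> (real^3)"
  obtain y z where x: "x = (y, z)" by (cases x)
  show "refl_pair S T i (refl_pair S T i x) = x"
    using cartan_diag[OF S] cartan_diag[OF T] by (simp add: x refl_pair_def refl_invol)
  show "m (- (i + j)) = m (- (j + i))" by (simp add: add.commute)
  show "i \<noteq> j \<Longrightarrow> 0 < m (- (i + j))"
    using S unfolding cartan_def by (metis less_le_trans zero_less_numeral)
  show "foldr (refl_pair S T) (alt i j (m (- (i + j)))) x =
      foldr (refl_pair S T) (alt j i (m (- (i + j)))) x" if "i \<noteq> j"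
    unfolding x foldr_refl_pair
    using dihedral_braid[OF S that, of y] dihedral_braid[OF T that, of z] by simp
  show "foldr (refl_pair S T) (alt j i k) x \<in> {x. 0 \<le> fst x $ i \<and> 0 \<le> snd x $ i}"
    if "i \<noteq> j" "k < m (- (i + j))" "x \<in> {x. 0 \<le> fst x $ i \<and> 0 \<le> snd x $ i}"
      "x \<in> {x. 0 \<le> fst x $ j \<and> 0 \<le> snd x $ j}"
    using that dihedral_pos[OF S that(1,2)] dihedral_pos[OF T that(1,2)]
    by (simp add: x foldr_refl_pair)
next
  fix u v assume *: "foldr (refl_pair S T) u = foldr (refl_pair S T) v"
  have "foldr (refl S) u x = foldr (refl S) v x" for x
    using fun_cong[OF *, of "(x, x)"] by (simp add: foldr_refl_pair)
  then show "even (length u) = even (length v)"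
    by (intro refl_parity[of S]) (auto simp: cartan_diag[OF S])
qed

section \<open>Convexity, properness and openness of the Tits cone\<close>

lemma orthant_scaleR: "x \<in> orthant \<Longrightarrow> 0 \<le> c \<Longrightarrow> c *\<^sub>R x \<in> orthant"
  by (simp add: orthant_def)

text \<open>\<tau> is the time at which the segment from x to x + z leaves the orthant, the least of
  the ratios at which a decreasing coordinate reaches zero.\<close>

lemma orthant_exit:
  assumes "x \<in> orthant" "x + z \<notin> orthant"
  obtains \<tau> i where "0 \<le> \<tau>" "\<tau> < 1" "x + \<tau> *\<^sub>R z \<in> orthant" "(x + \<tau> *\<^sub>R z) $ i = 0" "z $ i < 0"
proof -
  have x: "0 \<le> x $ i" for i using assms(1) by (simp add: orthant_def)
  define I where "I = {i. z $ i < 0}"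
  obtain l where l: "x $ l + z $ l < 0"
    using assms(2) by (auto simp: orthant_def not_le)
  then have "l \<in> I" using x[of l] by (simp add: I_def)
  then have I: "finite I" "I \<noteq> {}" by auto
  define h where "h i = x $ i / - (z $ i)" for i
  define \<tau> where "\<tau> = Min (h ` I)"
  have "\<tau> \<in> h ` I" unfolding \<tau>_def using I by (intro Min_in) auto
  then obtain i where i: "i \<in> I" "\<tau> = h i" by auto
  have le: "\<tau> \<le> h j" if "j \<in> I" for j unfolding \<tau>_def using I that by simp
  have 1: "0 \<le> \<tau>" using i x[of i] by (simp add: h_def I_def divide_nonneg_neg)
  have "h l < 1" using l \<open>l \<in> I\<close> by (simp add: h_def I_def field_simps)
  then have 2: "\<tau> < 1" using le[OF \<open>l \<in> I\<close>] by simp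
  have "0 \<le> (x + \<tau> *\<^sub>R z) $ j" for j
  proof (cases "j \<in> I")
    case True
    then show ?thesis using le[OF True] by (simp add: h_def I_def field_simps)
  next
    case False
    then show ?thesis using x[of j] 1 by (simp add: I_def)
  qed
  then have 3: "x + \<tau> *\<^sub>R z \<in> orthant" by (simp add: orthant_def)
  have "(x + \<tau> *\<^sub>R z) $ i = 0" "z $ i < 0" using i by (auto simp: h_def I_def)
  with 1 2 3 show ?thesis using that by blast
qed

context
  fixes m :: "3 \<Rightarrow> nat" and S :: "real^3^3"
  assumes S: "cartan m S"
begin

interpretation coxeter "refl_pair S S" "\<lambda>i. {x. 0 \<le> fst x $ i \<and> 0 \<le> snd x $ i}" "\<lambda>i j. m (- (i + j))"
  by (rule coxeter_refl_pair[OF S S])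

lemma tits_reducedE:
  assumes "z \<in> tits S"
  obtains w y where "reduced w" "y \<in> orthant" "z = foldr (refl S) w y"
proof -
  obtain w y where z: "z = foldr (refl S) w y" "y \<in> orthant" using assms by (auto simp: tits_def)
  obtain v where v: "reduced v" "foldr (refl_pair S S) v = foldr (refl_pair S S) w"
    using reduced_exists by blast
  have "foldr (refl S) v y = z"
    using fun_cong[OF v(2), of "(y, y)"] z by (simp add: foldr_refl_pair)
  then show ?thesis using that v z by metis
qed

text \<open>Follow the segment from x to x + z until it leaves the chamber at a point p of wall i.
  The vector z lies on the negative side of that wall, so reflecting it shortens its word. As p is
  fixed by the reflection, the sum of p and (1 - \<tau>) z becomes, after reflection, an instance of
  the induction hypothesis.\<close>

lemma orthant_add_tits:
  assumes "reduced w" "x \<in> orthant" "y \<in> orthant"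
  shows "x + foldr (refl S) w y \<in> tits S"
  using assms
proof (induction "length w" arbitrary: w x y rule: less_induct)
  case less
  define z where "z = foldr (refl S) w y"
  show ?case
  proof (cases "x + z \<in> orthant")
    case True then show ?thesis by (simp add: z_def orthant_in_tits)
  next
    case False
    obtain \<tau> i where \<tau>: "0 \<le> \<tau>" "\<tau> < 1" "x + \<tau> *\<^sub>R z \<in> orthant" "(x + \<tau> *\<^sub>R z) $ i = 0" "z $ i < 0"
      using orthant_exit[OF less.prems(2) False] by blast
    have "(y, y) \<in> {x. 0 \<le> fst x $ j \<and> 0 \<le> snd x $ j}" for j
      using less.prems(3) by (simp add: orthant_def)
    moreover have "foldr (refl_pair S S) w (y, y) \<notin> {x. 0 \<le> fst x $ i \<and> 0 \<le> snd x $ i}"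
      using \<tau>(5) by (simp add: foldr_refl_pair z_def)
    ultimately obtain v where v: "reduced v"
        "foldr (refl_pair S S) v = foldr (refl_pair S S) (i # w)" "length v < length w"
      using reduced_neg_shorter[OF less.prems(1)] by blast
    have vz: "foldr (refl S) v y = refl S i z"
      using fun_cong[OF v(2), of "(y, y)"] by (simp add: foldr_refl_pair z_def refl_pair_def)
    let ?p = "x + \<tau> *\<^sub>R z"
    have "?p + foldr (refl S) v ((1 - \<tau>) *\<^sub>R y) \<in> tits S"
      using less.prems \<tau> v by (intro less.hyps orthant_scaleR) auto
    also have "?p + foldr (refl S) v ((1 - \<tau>) *\<^sub>R y) = refl S i (?p + (1 - \<tau>) *\<^sub>R z)"
    proof -
      have "refl S i ?p = ?p" using \<tau>(4) by (simp only: refl_def) simp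
      then show ?thesis
        by (simp only: refl_add[of S i ?p] refl_scaleR linear_cmul[OF linear_refl_word] vz)
    qed
    also have "?p + (1 - \<tau>) *\<^sub>R z = x + z" by (simp add: algebra_simps)
    finally have "refl S i (refl S i (x + z)) \<in> tits S"
      using word_tits[of _ S "[i]"] by simp
    then show ?thesis by (simp add: refl_invol cartan_diag[OF S] z_def)
  qed
qed

lemma tits_add:
  assumes "x \<in> tits S" "y \<in> tits S"
  shows "x + y \<in> tits S"
proof -
  obtain w x' where x: "x = foldr (refl S) w x'" "x' \<in> orthant" using assms by (auto simp: tits_def)
  have inv: "foldr (refl S) (rev w) x = x'" "foldr (refl S) w (foldr (refl S) (rev w) z) = z" for z
    using foldr_rev'[of w "(x', x')"] foldr_rev[of w "(z, z)"] x(1) by (auto simp: foldr_refl_pair)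
  have "foldr (refl S) (rev w) y \<in> tits S" using assms word_tits by blast
  then obtain v y' where "reduced v" "y' \<in> orthant" "foldr (refl S) (rev w) y = foldr (refl S) v y'"
    using tits_reducedE by metis
  then have "foldr (refl S) (rev w) (x + y) \<in> tits S"
    using orthant_add_tits x(2) inv(1) linear_add[OF linear_refl_word] by metis
  then show ?thesis using word_tits inv(2) by metis
qed

lemma convex_tits: "convex (tits S)"
  by (simp add: convex_alt tits_add tits_scaleR)

text \<open>By \<open>reduced_Cons_pos\<close> each letter of a reduced word meets a vector on the
  positive side of its wall, so it subtracts a non-negative multiple of a column on which \<phi> is
  not positive.\<close>

lemma tits_functional_mono:
  assumes "\<And>i. \<phi> \<bullet> column i S \<le> 0" "reduced w" "y \<in> orthant"
  shows "\<phi> \<bullet> y \<le> \<phi> \<bullet> foldr (refl S) w y"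
  using assms(2)
proof (induction w)
  case (Cons i w)
  have w: "reduced w" using reduced_appendD(2)[of "[i]" w] Cons.prems by simp
  have "foldr (refl_pair S S) w (y, y) \<in> {x. 0 \<le> fst x $ i \<and> 0 \<le> snd x $ i}"
    using Cons.prems assms(3) by (intro reduced_Cons_pos) (auto simp: orthant_def)
  then have "0 \<le> foldr (refl S) w y $ i" by (simp add: foldr_refl_pair)
  then have "foldr (refl S) w y $ i * (\<phi> \<bullet> column i S) \<le> 0"
    using assms(1) by (simp add: mult_nonneg_nonpos)
  then show ?case using Cons.IH[OF w] by (simp add: inner_refl[OF S])
qed simp

lemma orthant_functional_pos:
  assumes "\<And>i. 0 < \<phi> $ i" "y \<in> orthant" "y \<noteq> 0"
  shows "0 < \<phi> \<bullet> (y :: real^3)"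
proof -
  obtain i where "y $ i \<noteq> 0" using assms(3) by (auto simp: vec_eq_iff)
  then have "0 < \<phi> $ i * y $ i" using assms by (simp add: orthant_def less_le)
  moreover have "0 \<le> \<phi> $ j * y $ j" for j using assms by (simp add: orthant_def less_imp_le)
  ultimately show ?thesis unfolding inner_vec_def by (intro sum_pos2[of _ i]) auto
qed

lemma tits_functional_pos:
  assumes "\<And>i. \<phi> \<bullet> column i S \<le> 0" "\<And>i. 0 < \<phi> $ i" "z \<in> tits S" "z \<noteq> 0"
  shows "0 < \<phi> \<bullet> z"
proof -
  obtain w y where w: "reduced w" "y \<in> orthant" "z = foldr (refl S) w y"
    using tits_reducedE assms(3) by blast
  have "y \<noteq> 0" using w(3) assms(4) linear_0[OF linear_refl_word] by auto
  then show ?thesis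
    using tits_functional_mono[OF assms(1) w(1,2)] orthant_functional_pos[OF assms(2) w(2)] w(3)
    by simp
qed

text \<open>Row \<open>k\<close> of the adjugate matrix.\<close>

lemma adjugate_row:
  defines "\<phi> \<equiv> \<lambda>k. cross3 (column (k + 1) S) (column (k + 2) S)"
  shows "\<phi> k $ k = 4 - S $ (k + 1) $ (k + 2) * S $ (k + 2) $ (k + 1)"
    "\<phi> k $ (k + 1) = S $ (k + 2) $ (k + 1) * S $ k $ (k + 2) - 2 * S $ k $ (k + 1)"
    "\<phi> k $ (k + 2) = S $ k $ (k + 1) * S $ (k + 1) $ (k + 2) - 2 * S $ k $ (k + 2)"
    "\<phi> k \<bullet> column i S = (if i = k then det S else 0)"
    "0 < \<phi> k $ i"
proof -
  have *: "\<phi> k $ k = 4 - S $ (k + 1) $ (k + 2) * S $ (k + 2) $ (k + 1) \<and>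
    \<phi> k $ (k + 1) = S $ (k + 2) $ (k + 1) * S $ k $ (k + 2) - 2 * S $ k $ (k + 1) \<and>
    \<phi> k $ (k + 2) = S $ k $ (k + 1) * S $ (k + 1) $ (k + 2) - 2 * S $ k $ (k + 2)" for k
    using exhaust_3[of k] cartan_diag[OF S]
    by (elim disjE; simp only: cyc3) (simp_all add: \<phi>_def cyc3 cross3_simps column_def)
  then show 1: "\<phi> k $ k = 4 - S $ (k + 1) $ (k + 2) * S $ (k + 2) $ (k + 1)"
    "\<phi> k $ (k + 1) = S $ (k + 2) $ (k + 1) * S $ k $ (k + 2) - 2 * S $ k $ (k + 1)"
    "\<phi> k $ (k + 2) = S $ k $ (k + 1) * S $ (k + 1) $ (k + 2) - 2 * S $ k $ (k + 2)"
    by auto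
  show "\<phi> k \<bullet> column i S = (if i = k then det S else 0)"
    using exhaust_3[of k] exhaust_3[of i]
    by (auto simp: \<phi>_def cross3_simps column_def inner_vec_def sum_3 det_3 algebra_simps cyc3)
  have ne: "k + 1 \<noteq> k" "k + 2 \<noteq> k" "k + 1 \<noteq> k + 2" for k :: 3
    using exhaust_3[of k] by auto
  have "0 < \<phi> k $ k"
    using 1(1) cartan_prod_less[OF S, of "k + 1" "k + 2"] by simp
  moreover have "0 < S $ a $ b * S $ c $ d - 2 * S $ e $ f" if "a \<noteq> b" "c \<noteq> d" "e \<noteq> f" for a b c d e f
    using mult_neg_neg[OF cartan_neg[OF S that(1)] cartan_neg[OF S that(2)]] cartan_neg[OF S that(3)] by linarith
  then have "0 < \<phi> k $ (k + 1)" "0 < \<phi> k $ (k + 2)"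
    unfolding 1(2,3) using ne(1,2)[of k] ne(3)[of k] by metis+
  moreover have "i = k \<or> i = k + 1 \<or> i = k + 2"
    using exhaust_3[of k] exhaust_3[of i] by auto
  ultimately show "0 < \<phi> k $ i" by auto
qed

text \<open>Row k of the adjugate vanishes on the columns other than k, takes the value
  \<open>det S\<close> < 0 on column k, and has positive entries. The sign of the determinant, that
  is hyperbolicity, is what makes the Tits cone proper.\<close>

lemma adjugate_tits:
  assumes "z \<in> tits S" "z \<noteq> 0"
  shows "0 < cross3 (column (k + 1) S) (column (k + 2) S) \<bullet> z"
  using assms S by (intro tits_functional_pos) (auto simp: adjugate_row cartan_def)

text \<open>A vertex of the chamber has a finite stabiliser. Summing the images of an interior point
  y over the rotations about it gives an interior point Y fixed by the rotation, and the only fixed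
  direction is the vertex itself.\<close>

lemma axis_interior_tits: "axis k 1 \<in> interior (tits S)"
proof -
  define i where "i = k + 1"
  define j where "j = k + 2"
  have ij: "i \<noteq> j" "- (i + j) = k"
    using exhaust_3[of k] by (elim disjE; simp add: i_def j_def)+
  then have U: "UNIV = {i, j, k}" and k: "k \<noteq> i" "k \<noteq> j"
    using third_index[of i j k] by auto
  define R where "R n = foldr (refl S) (alt i j (n + n))" for n
  have R: "R (m k) y = y" for y
    using rotation_order[OF ij(1), of "(y, y)"] ij(2) by (simp add: R_def foldr_refl_pair)
  define y :: "real^3" where "y = (\<chi> _. 1)"
  have "y \<in> interior orthant"
  proof (rule interiorI)
    show "open {x :: real^3. \<forall>i. 0 < x $ i}"
      by (simp add: Collect_all_eq open_INT open_halfspace_component_gt_cart)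
  qed (auto simp: y_def orthant_def less_imp_le)
  then have y: "y \<in> interior (tits S)"
    using interior_mono[of orthant "tits S"] orthant_in_tits by blast
  define Y where "Y = (\<Sum>n<m k. R n y)"
  have "3 \<le> m k" using S by (simp add: cartan_def)
  have Rt: "R n y \<in> tits S" for n
    unfolding R_def by (intro word_tits orthant_in_tits) (simp add: y_def orthant_def)
  have sums: "(\<Sum>n\<in>A. R n y) \<in> tits S" if "finite A" for A
    using that by (induction A rule: finite_induct)
      (auto intro: tits_add Rt orthant_in_tits simp: orthant_def)
  have Ysplit: "Y = y + (\<Sum>n\<in>{..<m k} - {0}. R n y)"
    unfolding Y_def using \<open>3 \<le> m k\<close> by (subst sum.remove[of _ 0]) (auto simp: R_def)
  have Yint: "Y \<in> interior (tits S)"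
  proof -
    let ?s = "\<Sum>n\<in>{..<m k} - {0}. R n y"
    have "(\<lambda>x. ?s + x) ` interior (tits S) \<subseteq> interior (tits S)"
      by (intro interior_maximal open_translation open_interior)
        (use sums tits_add interior_subset in blast)
    then show ?thesis
      using y Ysplit by (auto simp: add.commute)
  qed
  have "refl S i (refl S j Y) = (\<Sum>n<m k. R (Suc n) y)"
  proof -
    have "linear (\<lambda>y. refl S i (refl S j y))"
      using linear_refl_word[of S "[i, j]"] by (simp add: o_def)
    from linear_sum[OF this, of "\<lambda>n. R n y"] show ?thesis by (simp add: Y_def R_def)
  qed
  also have "\<dots> = Y"
    using sum.lessThan_Suc_shift[of "\<lambda>n. R n y" "m k"] R[of y]
    by (simp add: Y_def R_def)
  finally have "refl S i (refl S j Y) = Y" .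
  then have "refl S j Y = refl S i Y"
    using refl_invol[of S i "refl S j Y"] cartan_diag[OF S] by simp
  then have c: "Y $ j * S $ l $ j = Y $ i * S $ l $ i" for l
    by (simp add: vec_eq_iff refl_component)
  have "Y $ j * 2 = Y $ i * S $ j $ i" "Y $ i * 2 = Y $ j * S $ i $ j"
    using c[of j] c[of i] cartan_diag[OF S] by auto
  \<comment> \<open>Being fixed by the rotation amounts to a homogeneous two by two system whose
    determinant is not zero.\<close>
  then have "(4 - S $ i $ j * S $ j $ i) * Y $ i = 0" "(4 - S $ i $ j * S $ j $ i) * Y $ j = 0"
    by algebra+
  then have Y0: "Y $ i = 0" "Y $ j = 0"
    using cartan_prod_less[OF S ij(1)] by auto
  have Yaxis: "Y = (Y $ k) *\<^sub>R axis k 1"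
    unfolding vec_eq_iff using U Y0 k by (auto simp: axis_def)
  \<comment> \<open>The summands cannot cancel, since an adjugate functional is positive on each of
    them.\<close>
  have "Y \<noteq> 0"
  proof
    assume "Y = 0"
    let ?t = "cross3 (column (k + 1) S) (column (k + 2) S)"
    have "0 < ?t \<bullet> R n y" for n
    proof (rule adjugate_tits[OF Rt])
      show "R n y \<noteq> 0"
      proof
        assume "R n y = 0"
        then have "foldr (refl_pair S S) (alt i j (n + n)) (y, y) = (0, 0)"
          by (simp add: R_def foldr_refl_pair)
        then have "(y, y) = foldr (refl_pair S S) (rev (alt i j (n + n))) (0, 0)"
          by (metis foldr_rev')
        then show False
          using linear_0[OF linear_refl_word] by (simp add: foldr_refl_pair y_def vec_eq_iff)
      qed
    qed
    then have "0 < (\<Sum>n<m k. ?t \<bullet> R n y)"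
      using \<open>3 \<le> m k\<close> by (intro sum_pos) (auto simp: lessThan_empty_iff)
    then have "0 < ?t \<bullet> Y" by (simp add: Y_def inner_sum_right)
    then show False using \<open>Y = 0\<close> by simp
  qed
  moreover have "Y \<in> tits S" using Yint interior_subset by blast
  ultimately have "0 < cross3 (column (k + 1) S) (column (k + 2) S) \<bullet> Y" by (rule adjugate_tits[rotated])
  then have "0 < (Y $ k) * cross3 (column (k + 1) S) (column (k + 2) S) $ k"
    by (subst (asm) Yaxis) (simp add: inner_axis)
  then have Yk: "0 < Y $ k"
    using adjugate_row(5)[of k k] by (simp add: zero_less_mult_iff)
  have "(*\<^sub>R) (inverse (Y $ k)) ` interior (tits S) \<subseteq> interior (tits S)"
    using Yk tits_scaleR interior_subset[of "tits S"]
    by (intro interior_maximal open_scaling open_interior) auto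
  moreover have "axis k 1 = inverse (Y $ k) *\<^sub>R Y"
    by (subst Yaxis) (use Yk in simp)
  ultimately show ?thesis using Yint by blast
qed

text \<open>After moving into the orthant, some coordinate k is positive; the point is then a
  positive multiple of the interior vertex k plus an element of the cone.\<close>

lemma tits_nonzero_interior:
  assumes "z \<in> tits S" "z \<noteq> 0"
  shows "z \<in> interior (tits S)"
proof -
  have scale: "c *\<^sub>R x \<in> interior (tits S)" if "x \<in> interior (tits S)" "0 < c" for c x
  proof -
    have "(*\<^sub>R) c ` interior (tits S) \<subseteq> interior (tits S)"
      using that tits_scaleR interior_subset[of "tits S"]
      by (intro interior_maximal open_scaling open_interior) auto
    then show ?thesis using that by blast
  qed
  have add: "x + y \<in> interior (tits S)" if "x \<in> interior (tits S)" "y \<in> tits S" for x y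
  proof -
    have "(\<lambda>x. y + x) ` interior (tits S) \<subseteq> interior (tits S)"
      by (intro interior_maximal open_translation open_interior)
        (use that tits_add interior_subset in blast)
    then show ?thesis using that by (auto simp: add.commute)
  qed
  obtain w y where z: "z = foldr (refl S) w y" "y \<in> orthant" using assms by (auto simp: tits_def)
  have y0: "y \<noteq> 0" using z(1) assms(2) linear_0[OF linear_refl_word] by auto
  then obtain k where k: "y $ k \<noteq> 0" by (auto simp: vec_eq_iff)
  have "y - (y $ k) *\<^sub>R axis k 1 \<in> orthant"
    using z(2) by (auto simp: orthant_def axis_def)
  then have "(y $ k) *\<^sub>R axis k 1 + (y - (y $ k) *\<^sub>R axis k 1) \<in> interior (tits S)"
    using k z(2) by (intro add scale axis_interior_tits orthant_in_tits) (auto simp: orthant_def less_le)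
  then have y: "y \<in> interior (tits S)" by simp
  have inv: "foldr (refl S) w (foldr (refl S) (rev w) x) = x"
      "foldr (refl S) (rev w) (foldr (refl S) w x) = x" for x
    using foldr_rev[of w "(x, x)"] foldr_rev'[of w "(x, x)"] by (auto simp: foldr_refl_pair)
  have "foldr (refl S) w ` interior (tits S) = foldr (refl S) (rev w) -` interior (tits S)"
    using inv by (auto simp: image_iff) (metis inv(1))
  moreover have "continuous_on UNIV (foldr (refl S) (rev w))"
    by (intro linear_continuous_on linear_conv_bounded_linear[THEN iffD1] linear_refl_word)
  ultimately have "open (foldr (refl S) w ` interior (tits S))"
    by (simp add: open_vimage)
  then have "foldr (refl S) w ` interior (tits S) \<subseteq> interior (tits S)"
    by (intro interior_maximal) (use word_tits interior_subset in blast)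
  then show ?thesis using z y by blast
qed

lemma open_tits: "open (tits S - {0})"
proof -
  have "tits S - {0} = interior (tits S) - {0}"
    using tits_nonzero_interior interior_subset by blast
  then show ?thesis by (simp add: open_delete)
qed

end

text \<open>Shorten a relation of S to a reduced word v in the pair group. If v began with a letter
  i, the rest of v would keep the all-ones vector on the positive side of wall i, and the reflection
  would then make coordinate i non-positive, although v fixes that vector. So v is empty and the
  relation holds for T as well. Minus the identity is excluded because the Tits cone contains no
  line.\<close>

theorem coxeter_same_relations:
  assumes S: "cartan m S" and T: "cartan m T"
  shows "foldr (refl S) w = id \<Longrightarrow> foldr (refl T) w = id"
    "foldr (refl S) w \<noteq> uminus"
proof -
  interpret coxeter "refl_pair S T" "\<lambda>i. {x. 0 \<le> fst x $ i \<and> 0 \<le> snd x $ i}" "\<lambda>i j. m (- (i + j))"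
    by (rule coxeter_refl_pair[OF S T])
  show "foldr (refl T) w = id" if w: "foldr (refl S) w = id"
  proof -
    obtain v where v: "reduced v" "foldr (refl_pair S T) v = foldr (refl_pair S T) w"
      using reduced_exists by blast
    have vS: "foldr (refl S) v x = x" for x
      using fun_cong[OF v(2), of "(x, x)"] w by (simp add: foldr_refl_pair)
    have "v = []"
    proof (cases v)
      case (Cons i u)
      define y :: "real^3" where "y = (\<chi> _. 1)"
      have "foldr (refl_pair S T) u (y, y) \<in> {x. 0 \<le> fst x $ i \<and> 0 \<le> snd x $ i}"
        using v(1) Cons by (intro reduced_Cons_pos) (auto simp: y_def)
      then have "0 \<le> foldr (refl S) u y $ i" by (simp add: foldr_refl_pair)
      moreover have "refl S i (foldr (refl S) u y) $ i = 1"
        using vS[of y] Cons by (simp add: y_def)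
      ultimately show ?thesis using cartan_diag[OF S] by (simp add: refl_component)
    qed simp
    then show ?thesis
      using v(2) by (auto simp: fun_eq_iff foldr_refl_pair)
  qed
  show "foldr (refl S) w \<noteq> uminus"
  proof
    assume w: "foldr (refl S) w = uminus"
    define y :: "real^3" where "y = (\<chi> _. 1)"
    have y: "y \<in> orthant" "y \<noteq> 0" by (auto simp: y_def orthant_def vec_eq_iff)
    then have "- y \<in> tits S" "- y \<noteq> 0"
      using word_tits[OF orthant_in_tits, of y S w] w by auto
    then have "0 < cross3 (column (1 + 1) S) (column (1 + 2) S) \<bullet> (- y)"
      by (rule adjugate_tits[OF S])
    moreover have "0 < cross3 (column (1 + 1) S) (column (1 + 2) S) \<bullet> y"
      by (rule adjugate_tits[OF S orthant_in_tits]) (use y in auto)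
    ultimately show False by simp
  qed
qed

section \<open>Projective cones and Hausdorff convergence\<close>

lemma matrix_inv_inverse:
  assumes "invertible A"
  shows "A ** matrix_inv A = mat 1" "matrix_inv A ** A = mat 1"
  using assms unfolding matrix_inv_def invertible_def by (metis (mono_tags, lifting) someI_ex)+

lemma matrix_inv_mult [simp]:
  assumes "invertible A"
  shows "A *v (matrix_inv A *v x) = x" "matrix_inv A *v (A *v x) = x"
  using assms by (simp_all add: matrix_vector_mul_assoc matrix_inv_inverse)

section \<open>Lifting points and limits of the projective plane to vectors\<close>

lemma proj_eq_iff:
  assumes "x \<noteq> 0" "y \<noteq> 0"
  shows "proj x = proj y \<longleftrightarrow> (\<exists>c. c \<noteq> 0 \<and> x = c *\<^sub>R y)"
proof
  assume "proj x = proj y"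
  then have "span {x} = span {y}" using assms by (metis line_of_proj)
  then have "x \<in> span {y}" using span_base by blast
  then obtain c where "x = c *\<^sub>R y" by (auto simp: span_singleton)
  with assms show "\<exists>c. c \<noteq> 0 \<and> x = c *\<^sub>R y" by auto
qed (auto simp: proj_scaleR)

text \<open>Of the two unit representatives the one on the same side as u is taken; the chord 2
  sin(\<theta> / 2) is then at most the arc \<theta>.\<close>

lemma unit_lift:
  fixes u :: "real^3"
  assumes "norm u = 1"
  obtains v where "norm v = 1" "p = proj v" "norm (u - v) \<le> dist (proj u) p"
proof -
  obtain v0 where v0: "norm v0 = 1" "p = proj v0" using rp2_unit_rep by blast
  define v where "v = (if 0 \<le> u \<bullet> v0 then v0 else - v0)"
  have "proj (- v0) = proj v0" using proj_scaleR[of "- 1" v0] by simp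
  then have "p = proj v" unfolding v_def using v0(2) by metis
  moreover have "norm v = 1" "0 \<le> u \<bullet> v" by (simp_all add: v_def v0(1))
  ultimately have v: "norm v = 1" "p = proj v" "0 \<le> u \<bullet> v" by blast+
  define \<theta> where "\<theta> = dist (proj u) p"
  have th: "\<theta> = arccos (u \<bullet> v)" using dist_proj_unit[OF assms v(1)] v by (simp add: \<theta>_def)
  have "\<bar>u \<bullet> v\<bar> \<le> 1" using Cauchy_Schwarz_ineq2[of u v] assms v by simp
  then have c: "cos \<theta> = u \<bullet> v" by (simp add: th cos_arccos_abs)
  have t0: "0 \<le> \<theta>" by (simp add: \<theta>_def)
  have "(norm (u - v))\<^sup>2 = 2 - 2 * cos \<theta>"
  proof -
    have "u \<bullet> u = 1" "v \<bullet> v = 1" using assms v(1) by (auto simp: dot_square_norm)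
    then show ?thesis
      by (simp add: c power2_norm_eq_inner inner_diff_left inner_diff_right inner_commute[of v u])
  qed
  also have "\<dots> = (2 * sin (\<theta> / 2))\<^sup>2"
    using cos_double_sin[of "\<theta> / 2"] by (simp add: power_mult_distrib)
  finally have "norm (u - v) = \<bar>2 * sin (\<theta> / 2)\<bar>"
    using power2_eq_iff_nonneg[of "norm (u - v)" "\<bar>2 * sin (\<theta> / 2)\<bar>"] by simp
  also have "\<dots> \<le> \<theta>" using abs_sin_x_le_abs_x[of "\<theta> / 2"] t0 by simp
  finally show ?thesis using that v by (simp add: \<theta>_def)
qed

lemma lift_near:
  fixes u :: "real^3"
  assumes "u \<noteq> 0"
  obtains v where "v \<noteq> 0" "p = proj v" "norm (u - v) \<le> norm u * dist (proj u) p"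
proof -
  have n: "norm (u /\<^sub>R norm u) = 1" using assms by simp
  obtain v where v: "norm v = 1" "p = proj v" "norm (u /\<^sub>R norm u - v) \<le> dist (proj (u /\<^sub>R norm u)) p"
    using unit_lift[OF n] by blast
  have "u - norm u *\<^sub>R v = norm u *\<^sub>R (u /\<^sub>R norm u - v)" using assms by (simp add: scaleR_diff_right)
  then have "norm (u - norm u *\<^sub>R v) = norm u * norm (u /\<^sub>R norm u - v)" by simp
  moreover have "proj (u /\<^sub>R norm u) = proj u" using assms by (simp add: proj_scaleR)
  moreover have "norm u * norm (u /\<^sub>R norm u - v) \<le> norm u * dist (proj (u /\<^sub>R norm u)) p"
    using v(3) by (intro mult_left_mono) auto
  ultimately have "norm (u - norm u *\<^sub>R v) \<le> norm u * dist (proj u) p" by simp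
  moreover have "norm u *\<^sub>R v \<noteq> 0" using assms v(1) by auto
  moreover have "p = proj (norm u *\<^sub>R v)" using assms v(2) by (simp add: proj_scaleR)
  ultimately show ?thesis using that by blast
qed

text \<open>Limits in the projective plane are handled through convergent representatives, so that
  closedness of cones in space can be used.\<close>

lemma lift_convergent:
  assumes "p \<longlonglongrightarrow> proj u" "u \<noteq> 0"
  obtains v where "v \<longlonglongrightarrow> u" "\<And>n. v n \<noteq> 0" "\<And>n. p n = proj (v n)"
proof -
  have "\<exists>v. v \<noteq> 0 \<and> p n = proj v \<and> norm (u - v) \<le> norm u * dist (proj u) (p n)" for n
    using lift_near[OF assms(2), of "p n"] by metis
  then obtain v where v: "\<And>n. v n \<noteq> 0" "\<And>n. p n = proj (v n)"
    "\<And>n. norm (u - v n) \<le> norm u * dist (proj u) (p n)" by metis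
  have "(\<lambda>n. norm u * dist (proj u) (p n)) \<longlonglongrightarrow> norm u * dist (proj u) (proj u)"
    by (intro tendsto_intros assms)
  then have "(\<lambda>n. norm u * dist (proj u) (p n)) \<longlonglongrightarrow> 0" by simp
  then have "(\<lambda>n. u - v n) \<longlonglongrightarrow> 0"
    by (rule Lim_null_comparison[rotated]) (use v(3) in simp)
  from tendsto_diff[OF tendsto_const[of u] this] have "v \<longlonglongrightarrow> u" by simp
  then show ?thesis using that v by blast
qed

lemma proj_convergent:
  assumes "v \<longlonglongrightarrow> u" "u \<noteq> 0"
  shows "(\<lambda>n. proj (v n)) \<longlonglongrightarrow> proj u"
proof -
  have "isCont proj u"
    using continuous_on_eq_continuous_at[of "- {0}" proj] continuous_on_proj assms(2) by auto
  then show ?thesis using assms(1) isCont_tendsto_compose by blast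
qed

lemma compact_rp2: "compact (UNIV :: rp2 set)"
proof -
  have "compact (proj ` sphere 0 1)"
    by (intro compact_continuous_image continuous_on_subset[OF continuous_on_proj]) auto
  moreover have "proj ` sphere 0 1 = UNIV"
    using rp2_unit_rep by (auto simp: image_iff) (metis dist_0_norm mem_sphere)
  ultimately show ?thesis by simp
qed

lemma rp2_subsequence:
  fixes z :: "nat \<Rightarrow> rp2"
  obtains l r where "strict_mono r" "(z \<circ> r) \<longlonglongrightarrow> l"
  using compact_rp2[unfolded compact_def, rule_format, of z] by auto

definition pcone :: "(real^3) set \<Rightarrow> rp2 set" where
  "pcone K = proj ` (K - {0})"

lemma open_pcone:
  assumes "open (K - {0})"
  shows "open (pcone K)"
  unfolding open_dist
proof
  fix p assume "p \<in> pcone K"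
  then obtain u where u: "u \<in> K - {0}" "p = proj u" by (auto simp: pcone_def)
  then obtain e where e: "e > 0" "ball u e \<subseteq> K - {0}" using assms open_contains_ball by blast
  have "q \<in> pcone K" if "dist q p < e / norm u" for q
  proof -
    obtain v where v: "v \<noteq> 0" "q = proj v" "norm (u - v) \<le> norm u * dist (proj u) q"
      using lift_near[of u q] u by auto
    have "norm u * dist (proj u) q < e"
      using that u by (simp add: dist_commute field_simps)
    then have "v \<in> ball u e" using v(3) by (simp add: dist_norm)
    then show ?thesis using e v by (auto simp: pcone_def)
  qed
  then show "\<exists>e>0. \<forall>q. dist q p < e \<longrightarrow> q \<in> pcone K"
    using e u by (intro exI[of _ "e / norm u"]) auto
qed

lemma pact_pcone:
  assumes "invertible g"
  shows "pact g ` pcone K = pcone ((*v) g ` K)"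
proof -
  have "inj ((*v) g)" using assms by (simp add: inj_matrix_vector_mult)
  then have "g *v x \<noteq> 0" if "x \<noteq> 0" for x using that by (metis injD matrix_vector_mult_0_right)
  then have *: "(*v) g ` K - {0} = (*v) g ` (K - {0})" by auto
  show ?thesis
    unfolding pcone_def * image_image by (intro image_cong) (auto simp: pact_proj)
qed

section \<open>Hausdorff convergence tested on sequences of points\<close>

lemma frequently_subsequence:
  assumes "\<not> eventually P sequentially"
  obtains r where "strict_mono (r :: nat \<Rightarrow> nat)" "\<And>n. \<not> P (r n)"
proof -
  have "infinite {n. \<not> P n}"
    using assms unfolding eventually_sequentially infinite_nat_iff_unbounded_le by auto
  then obtain r where "strict_mono (r :: nat \<Rightarrow> nat)" "\<And>n. r n \<in> {n. \<not> P n}"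
    using infinite_enumerate by blast
  then show ?thesis using that by simp
qed

text \<open>In a compact space a failure of either half persists along a subsequence of points at
  distance greater than e / 2, and a limit of such points contradicts \<open>upper\<close> or
  \<open>lower\<close>. The closure of B appears in \<open>upper\<close> because the Hausdorff
  distance does not distinguish a set from its closure.\<close>

lemma hausdist_tendsto_0I:
  fixes A :: "nat \<Rightarrow> rp2 set"
  assumes ne: "\<And>n. A n \<noteq> {}" "B \<noteq> {}"
    and lower: "\<And>y. y \<in> B \<Longrightarrow> \<exists>z. (\<forall>n. z n \<in> A n) \<and> z \<longlonglongrightarrow> y"
    and upper: "\<And>r z l. strict_mono (r :: nat \<Rightarrow> nat) \<Longrightarrow> (\<And>n. z n \<in> A (r n)) \<Longrightarrow> z \<longlonglongrightarrow> l \<Longrightarrow> l \<in> closure B"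
  shows "(\<lambda>n. hausdist (A n) B) \<longlonglongrightarrow> 0"
proof (rule tendstoI)
  fix e :: real assume e: "e > 0"
  have 1: "eventually (\<lambda>n. \<forall>x\<in>A n. infdist x B \<le> e / 2) sequentially"
  proof (rule ccontr)
    assume "\<not> ?thesis"
    then obtain r where r: "strict_mono (r :: nat \<Rightarrow> nat)" "\<And>n. \<not> (\<forall>x\<in>A (r n). infdist x B \<le> e / 2)"
      using frequently_subsequence[of "\<lambda>n. \<forall>x\<in>A n. infdist x B \<le> e / 2"] by blast
    then obtain z where z: "\<And>n. z n \<in> A (r n)" "\<And>n. infdist (z n) B > e / 2"
      by (metis not_le)
    obtain l s where s: "strict_mono s" "(z \<circ> s) \<longlonglongrightarrow> l" using rp2_subsequence by blast
    have "l \<in> closure B"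
      using upper[of "r \<circ> s" "z \<circ> s" l] r s z by (simp add: strict_mono_o)
    then have l0: "infdist l B = 0" using ne in_closure_iff_infdist_zero by blast
    have "(\<lambda>n. infdist ((z \<circ> s) n) B) \<longlonglongrightarrow> infdist l B"
      by (intro tendsto_infdist s)
    moreover have "e / 2 \<le> infdist ((z \<circ> s) n) B" for n
      using z(2)[of "s n"] by simp
    ultimately have "e / 2 \<le> infdist l B" using LIMSEQ_le_const by blast
    then show False using e l0 by simp
  qed
  have 2: "eventually (\<lambda>n. \<forall>y\<in>B. infdist y (A n) \<le> e / 2) sequentially"
  proof (rule ccontr)
    assume "\<not> ?thesis"
    then obtain r where r: "strict_mono (r :: nat \<Rightarrow> nat)" "\<And>n. \<not> (\<forall>y\<in>B. infdist y (A (r n)) \<le> e / 2)"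
      using frequently_subsequence[of "\<lambda>n. \<forall>y\<in>B. infdist y (A n) \<le> e / 2"] by blast
    then obtain y where y: "\<And>n. y n \<in> B" "\<And>n. infdist (y n) (A (r n)) > e / 2"
      by (metis not_le)
    obtain l s where s: "strict_mono s" "(y \<circ> s) \<longlonglongrightarrow> l" using rp2_subsequence by blast
    have "l \<in> closure B" using s(2) y(1) closure_sequential by (metis comp_apply)
    \<comment> \<open>Three distances below e / 6, from y to l, from l to b and from b to z, will
      add up to less than e / 2.\<close>
    then obtain b where b: "b \<in> B" "dist b l < e / 6"
      using e closure_approachable[of l B] by (metis divide_pos_pos zero_less_numeral)
    obtain z where z: "\<And>n. z n \<in> A n" "z \<longlonglongrightarrow> b" using lower[OF b(1)] by blast
    have zb: "(z \<circ> (r \<circ> s)) \<longlonglongrightarrow> b"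
      using z(2) r(1) s(1) LIMSEQ_subseq_LIMSEQ strict_mono_o by blast
    have "eventually (\<lambda>n. dist ((z \<circ> (r \<circ> s)) n) b < e / 6) sequentially"
      using tendstoD[OF zb, of "e / 6"] e by (simp del: o_apply)
    moreover have "eventually (\<lambda>n. dist ((y \<circ> s) n) l < e / 6) sequentially"
      using tendstoD[OF s(2), of "e / 6"] e by (simp del: o_apply)
    ultimately have "eventually (\<lambda>n. False) sequentially"
    proof eventually_elim
      case (elim n)
      have "infdist (y (s n)) (A (r (s n))) \<le> dist (y (s n)) (z (r (s n)))"
        using z(1) by (intro infdist_le)
      also have "\<dots> \<le> dist (y (s n)) l + dist b l + dist (z (r (s n))) b"
        using dist_triangle[of "y (s n)" "z (r (s n))" l] dist_triangle[of l "z (r (s n))" b]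
        by (simp add: dist_commute)
      also have "\<dots> < e / 6 + e / 6 + e / 6" using elim b by (auto intro!: add_strict_mono)
      finally show False using y(2)[of "s n"] by simp
    qed
    then show False by simp
  qed
  from 1 2 show "eventually (\<lambda>n. dist (hausdist (A n) B) 0 < e) sequentially"
  proof eventually_elim
    case (elim n)
    have "(SUP x\<in>A n. infdist x B) \<le> e / 2" "(SUP y\<in>B. infdist y (A n)) \<le> e / 2"
      by (rule cSUP_least[OF ne(1)], use elim in blast) (rule cSUP_least[OF ne(2)], use elim in blast)
    then have "hausdist (A n) B \<le> e / 2" using ne by (simp add: hausdist_def)
    then show ?case using hausdist_nonneg[OF ne(1,2), of n] e by simp
  qed
qed

lemma hausdist_lower_limit:
  fixes A :: "nat \<Rightarrow> rp2 set"
  assumes "(\<lambda>n. hausdist (A n) B) \<longlonglongrightarrow> 0" "\<And>n. A n \<noteq> {}" "y \<in> B"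
  obtains z where "\<And>n. z n \<in> A n" "z \<longlonglongrightarrow> y"
proof -
  \<comment> \<open>The infimum need not be attained, hence the slack 1 / (n + 1).\<close>
  have "\<exists>z\<in>A n. dist y z < hausdist (A n) B + inverse (real (Suc n))" for n
  proof -
    have "infdist y (A n) \<le> hausdist (A n) B" using assms by (intro hausdist_ge2) auto
    then have "(INF z\<in>A n. dist y z) < hausdist (A n) B + inverse (real (Suc n))"
      using assms(2)[of n] by (simp add: infdist_notempty) (smt (verit) inverse_positive_iff_positive of_nat_0_le_iff)
    then show ?thesis
      using assms(2)[of n] by (subst (asm) cINF_less_iff) (auto intro!: bdd_belowI2[of _ 0])
  qed
  then obtain z where z: "\<And>n. z n \<in> A n" "\<And>n. dist y (z n) < hausdist (A n) B + inverse (real (Suc n))"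
    by metis
  have "(\<lambda>n. hausdist (A n) B + inverse (real (Suc n))) \<longlonglongrightarrow> 0 + 0"
    by (intro tendsto_add assms(1) LIMSEQ_inverse_real_of_nat)
  then have "(\<lambda>n. hausdist (A n) B + inverse (real (Suc n))) \<longlonglongrightarrow> 0" by simp
  then have "(\<lambda>n. dist (z n) y) \<longlonglongrightarrow> 0"
    by (rule Lim_null_comparison[rotated])
      (use z(2) in \<open>auto intro!: always_eventually less_imp_le simp: dist_commute\<close>)
  then show ?thesis using that z(1) tendsto_dist_iff by blast
qed

lemma hausdist_upper_limit:
  fixes A :: "nat \<Rightarrow> rp2 set"
  assumes "(\<lambda>n. hausdist (A n) B) \<longlonglongrightarrow> 0" "B \<noteq> {}" "strict_mono r"
    "\<And>n. z n \<in> A (r n)" "z \<longlonglongrightarrow> l"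
  shows "l \<in> closure B"
proof -
  have "(\<lambda>n. infdist (z n) B) \<longlonglongrightarrow> infdist l B" by (intro tendsto_infdist assms)
  moreover have "(\<lambda>n. infdist (z n) B) \<longlonglongrightarrow> 0"
  proof (rule Lim_null_comparison)
    show "((\<lambda>n. hausdist (A n) B) \<circ> r) \<longlonglongrightarrow> 0"
      using assms(1,3) LIMSEQ_subseq_LIMSEQ by blast
    show "\<forall>\<^sub>F n in sequentially. norm (infdist (z n) B) \<le> ((\<lambda>n. hausdist (A n) B) \<circ> r) n"
      using assms(2,4) by (auto intro!: always_eventually hausdist_ge1 simp: infdist_nonneg)
  qed
  ultimately have "infdist l B = 0" using LIMSEQ_unique by blast
  then show ?thesis using assms(2) in_closure_iff_infdist_zero by blast
qed

section \<open>Properly convex domains as projectivised cones\<close>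

lemma affine_lift_combine:
  "u + v = 1 \<Longrightarrow> affine_lift (u *\<^sub>R x + v *\<^sub>R y) = u *\<^sub>R affine_lift x + v *\<^sub>R affine_lift y"
  by (simp add: vec_eq_iff forall_3 affine_lift_nth)

lemma affine_lift_of_nth:
  assumes "y $ 3 \<noteq> 0"
  shows "y = (y $ 3) *\<^sub>R affine_lift (vector [y $ 1 / y $ 3, y $ 2 / y $ 3])"
  using assms by (simp add: vec_eq_iff forall_3 affine_lift_nth)

text \<open>Slices of K at constant \<phi> are bounded because \<phi> dominates the norm. A rotation
  carrying the third axis to the direction of \<phi> has determinant 1 and turns such a slice into a
  bounded convex set of the standard chart.\<close>

lemma pcone_convex_domain:
  fixes K :: "(real^3) set"
  assumes K: "convex K" "open (K - {0})" "K - {0} \<noteq> {}"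
    and cone: "\<And>c x. x \<in> K \<Longrightarrow> 0 < c \<Longrightarrow> c *\<^sub>R x \<in> K"
    and \<phi>: "0 < e" "\<And>x. x \<in> K \<Longrightarrow> e * norm x \<le> \<phi> \<bullet> x"
  shows "pcone K \<in> convex_domains"
proof -
  obtain z where z: "z \<in> K" "z \<noteq> 0" using K(3) by auto
  have "0 < e * norm z" using \<phi>(1) z by simp
  then have "\<phi> \<noteq> 0" using \<phi>(2)[OF z(1)] by auto
  obtain f where f: "orthogonal_transformation f" "det (matrix f) = 1"
      "f (axis 3 1) = \<phi> /\<^sub>R norm \<phi>"
    using rotation_exists[of "axis 3 1 :: real^3" "\<phi> /\<^sub>R norm \<phi>"] \<open>\<phi> \<noteq> 0\<close> by auto
  define g where "g = matrix f"
  have gf: "g *v x = f x" for x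
    using f(1) by (simp add: g_def matrix_works orthogonal_transformation_linear)
  have g: "g \<in> carrier SL3" using f by (simp add: g_def SL3_def)
  have \<phi>g: "\<phi> \<bullet> (g *v y) = norm \<phi> * y $ 3" for y
  proof -
    have "\<phi> = norm \<phi> *\<^sub>R f (axis 3 1)" using f(3) \<open>\<phi> \<noteq> 0\<close> by simp
    then have "\<phi> \<bullet> (g *v y) = norm \<phi> * (f (axis 3 1) \<bullet> f y)" by (metis gf inner_scaleR_left)
    also have "f (axis 3 1) \<bullet> f y = y $ 3"
      using f(1) by (simp add: orthogonal_transformation_def inner_axis_axis inner_axis')
    finally show ?thesis .
  qed
  define L where "L = {x. g *v affine_lift x \<in> K}"
  have "convex L"
    unfolding convex_def
  proof (intro ballI allI impI)
    fix x y and u v :: real assume *: "x \<in> L" "y \<in> L" "0 \<le> u" "0 \<le> v" "u + v = 1"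
    then have "u *\<^sub>R (g *v affine_lift x) + v *\<^sub>R (g *v affine_lift y) \<in> K"
      using K(1) by (auto simp: L_def convex_def)
    then show "u *\<^sub>R x + v *\<^sub>R y \<in> L"
      using * by (simp add: L_def affine_lift_combine matrix_vector_right_distrib matrix_vector_mult_scaleR)
  qed
  moreover have "bounded L"
  proof (rule boundedI)
    fix x assume "x \<in> L"
    then have "e * norm (g *v affine_lift x) \<le> norm \<phi>"
      using \<phi>(2)[of "g *v affine_lift x"] by (simp add: L_def \<phi>g affine_lift_nth)
    then have "norm (affine_lift x) \<le> norm \<phi> / e"
      using f(1) \<phi>(1) by (simp add: gf orthogonal_transformation_norm field_simps)
    moreover have "norm x \<le> norm (affine_lift x)"
      by (simp add: norm_vec_def L2_set_def sum_2 sum_3 affine_lift_nth)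
    ultimately show "norm x \<le> norm \<phi> / e" by simp
  qed
  moreover have "pcone K = pact g ` affine_pt ` L"
  proof
    show "pact g ` affine_pt ` L \<subseteq> pcone K"
      using g by (auto simp: L_def pcone_def affine_pt_def pact_proj SL3_nonzero)
    show "pcone K \<subseteq> pact g ` affine_pt ` L"
    proof
      fix p assume "p \<in> pcone K"
      then obtain w where w: "w \<in> K" "w \<noteq> 0" "p = proj w" by (auto simp: pcone_def)
      obtain y where y: "w = g *v y"
        using f(1) orthogonal_transformation_surj by (metis gf surjD)
      have "0 < e * norm w" using \<phi>(1) w by simp
      then have "0 < norm \<phi> * y $ 3" using \<phi>(2)[OF w(1)] \<phi>g[of y] y by simp
      then have y3: "y $ 3 > 0" by (simp add: zero_less_mult_iff)
      define x :: "real^2" where "x = vector [y $ 1 / y $ 3, y $ 2 / y $ 3]"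
      have yx: "y = (y $ 3) *\<^sub>R affine_lift x"
        unfolding x_def using y3 by (intro affine_lift_of_nth) auto
      then have wx: "w = (y $ 3) *\<^sub>R (g *v affine_lift x)"
        unfolding y by (metis matrix_vector_mult_scaleR)
      then have "inverse (y $ 3) *\<^sub>R w = g *v affine_lift x" using y3 by simp
      then have "x \<in> L" using cone[OF w(1), of "inverse (y $ 3)"] y3 by (simp add: L_def)
      moreover have "p = pact g (affine_pt x)"
        unfolding w(3) wx using y3 by (simp add: affine_pt_def pact_proj proj_scaleR)
      ultimately show "p \<in> pact g ` affine_pt ` L" by blast
    qed
  qed
  moreover have "open (pcone K)" using K(2) by (rule open_pcone)
  moreover have "pcone K \<noteq> {}" using K(3) by (simp add: pcone_def)
  ultimately show ?thesis using g by (auto simp: convex_domains_def)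
qed

text \<open>K is the one-sided cone over the set L in the chart. The functional \<phi> reads off the
  third coordinate there, and boundedness of L bounds the norm by a multiple of \<phi>.\<close>

lemma convex_domain_pcone:
  assumes "\<Omega> \<in> convex_domains"
  obtains K \<phi> e where "convex K" "open K" "K \<noteq> {}" "0 \<notin> K" "\<And>c x. x \<in> K \<Longrightarrow> 0 < c \<Longrightarrow> c *\<^sub>R x \<in> K"
    "0 < e" "\<And>x. x \<in> K \<Longrightarrow> e * norm x \<le> \<phi> \<bullet> x" "\<Omega> = pcone K"
proof -
  obtain g L where g: "g \<in> carrier SL3" and L: "convex L" "bounded L"
    and \<Omega>: "open \<Omega>" "\<Omega> \<noteq> {}" "\<Omega> = pact g ` affine_pt ` L"
    using assms by (auto simp: convex_domains_def)
  have inv: "invertible g" using g by (simp add: SL3_def invertible_det_nz)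
  define \<phi> where "\<phi> = row 3 (matrix_inv g)"
  have \<phi>g: "\<phi> \<bullet> (g *v y) = y $ 3" for y
  proof -
    have "\<phi> \<bullet> (g *v y) = (matrix_inv g *v (g *v y)) $ 3"
      by (simp add: \<phi>_def row_def matrix_vector_mult_def inner_vec_def)
    also have "\<dots> = y $ 3" using inv by simp
    finally show ?thesis .
  qed
  define K where "K = {t *\<^sub>R (g *v affine_lift x) | t x. 0 < t \<and> x \<in> L}"
  obtain B where B: "B > 0" "\<And>x. x \<in> L \<Longrightarrow> norm (g *v affine_lift x) \<le> B"
  proof -
    obtain b where b: "\<And>x. x \<in> L \<Longrightarrow> norm x \<le> b" using L(2) bounded_iff by blast
    have "norm (affine_lift x) \<le> norm x + 1" for x
    proof -
      let ?w = "\<chi> i::3. if i = 1 then x $ 1 else if i = 2 then x $ 2 else 0"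
      have "affine_lift x = affine_lift 0 + (\<chi> i. if i = 1 then x $ 1 else if i = 2 then x $ 2 else 0)"
        by (simp add: vec_eq_iff forall_3 affine_lift_nth)
      moreover have "norm (affine_lift 0) = 1"
        by (simp add: norm_vec_def L2_set_def sum_3 affine_lift_nth)
      moreover have "norm (\<chi> i::3. if i = 1 then x $ 1 else if i = 2 then x $ 2 else 0) = norm x"
        by (simp add: norm_vec_def L2_set_def sum_2 sum_3)
      ultimately show ?thesis using norm_triangle_ineq[of "affine_lift 0" ?w] by simp
    qed
    moreover obtain c where c: "c > 0" "\<And>x. norm (g *v x) \<le> norm x * c"
      using bounded_linear.pos_bounded[OF matrix_vector_mul_bounded_linear[of g]] by blast
    ultimately have "norm (g *v affine_lift x) \<le> (\<bar>b\<bar> + 1) * c" if "x \<in> L" for x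
      using b[OF that] by (smt (verit) mult_right_mono)
    then show ?thesis using that[of "(\<bar>b\<bar> + 1) * c"] c by auto
  qed
  have \<phi>K: "\<phi> \<bullet> (t *\<^sub>R (g *v affine_lift x)) = t" for t x by (simp add: \<phi>g affine_lift_nth)
  have \<Omega>K: "\<Omega> = pcone K"
  proof
    show "\<Omega> \<subseteq> pcone K"
    proof
      fix p assume "p \<in> \<Omega>"
      then obtain x where x: "x \<in> L" "p = pact g (affine_pt x)" using \<Omega> by auto
      then have "1 *\<^sub>R (g *v affine_lift x) \<in> K" unfolding K_def by (metis (mono_tags, lifting) mem_Collect_eq zero_less_one)
      then show "p \<in> pcone K"
        using x g by (auto simp: pcone_def affine_pt_def pact_proj SL3_nonzero intro!: image_eqI)
    qed
    show "pcone K \<subseteq> \<Omega>"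
    proof
      fix p assume "p \<in> pcone K"
      then obtain t x where "0 < t" "x \<in> L" "p = proj (t *\<^sub>R (g *v affine_lift x))"
        by (auto simp: pcone_def K_def)
      then have "p = pact g (affine_pt x)" by (simp add: affine_pt_def proj_scaleR pact_proj)
      then show "p \<in> \<Omega>" using \<Omega>(3) \<open>x \<in> L\<close> by blast
    qed
  qed
  have "0 \<notin> K" using g by (auto simp: K_def SL3_nonzero)
  have cone: "c *\<^sub>R x \<in> K" if "x \<in> K" "0 < c" for c x
    using that unfolding K_def by (smt (verit) mem_Collect_eq mult_pos_pos scaleR_scaleR)
  have "convex K"
  proof -
    have add: "a + b \<in> K" if ab: "a \<in> K" "b \<in> K" for a b
    proof -
      obtain s x t y where *: "a = s *\<^sub>R (g *v affine_lift x)" "0 < s" "x \<in> L"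
        "b = t *\<^sub>R (g *v affine_lift y)" "0 < t" "y \<in> L"
        using ab unfolding K_def by blast
      define w where "w = (s / (s + t)) *\<^sub>R x + (t / (s + t)) *\<^sub>R y"
      have st: "s / (s + t) + t / (s + t) = 1"
        using * by (simp add: add_divide_distrib[symmetric])
      then have w: "w \<in> L" unfolding w_def using L(1) * by (intro convexD) auto
      have "(s + t) *\<^sub>R affine_lift w = s *\<^sub>R affine_lift x + t *\<^sub>R affine_lift y"
        unfolding w_def affine_lift_combine[OF st] using * by (simp add: scaleR_add_right)
      then have "a + b = (s + t) *\<^sub>R (g *v affine_lift w)"
        unfolding * by (metis matrix_vector_mult_scaleR matrix_vector_right_distrib)
      then show ?thesis using w * unfolding K_def by (metis (mono_tags, lifting) add_pos_pos mem_Collect_eq)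
    qed
    show ?thesis
      unfolding convex_alt
    proof (intro ballI allI impI)
      fix x y and u :: real assume *: "x \<in> K" "y \<in> K" "0 \<le> u \<and> u \<le> 1"
      consider "u = 0" | "u = 1" | "0 < u" "u < 1" using * by fastforce
      then show "(1 - u) *\<^sub>R x + u *\<^sub>R y \<in> K"
        using * by cases (simp_all add: add cone)
    qed
  qed
  \<comment> \<open>Openness of the domain is given in the projective plane; K is recovered as the
    part of the preimage on which \<phi> is positive.\<close>
  have Keq: "K = {z. 0 < \<phi> \<bullet> z} \<inter> (- {0} \<inter> proj -` \<Omega>)"
  proof (intro equalityI subsetI)
    fix z assume z: "z \<in> K"
    then obtain t x where "z = t *\<^sub>R (g *v affine_lift x)" "0 < t" using K_def by blast
    then have "0 < \<phi> \<bullet> z" using \<phi>K by metis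
    then show "z \<in> {z. 0 < \<phi> \<bullet> z} \<inter> (- {0} \<inter> proj -` \<Omega>)"
      using z \<open>0 \<notin> K\<close> \<Omega>K by (auto simp: pcone_def)
  next
    fix z assume z: "z \<in> {z. 0 < \<phi> \<bullet> z} \<inter> (- {0} \<inter> proj -` \<Omega>)"
    then obtain w where w: "w \<in> K" "w \<noteq> 0" "proj z = proj w" using \<Omega>K by (auto simp: pcone_def)
    then obtain c where c: "c \<noteq> 0" "z = c *\<^sub>R w" using z proj_eq_iff by auto
    obtain t x where "w = t *\<^sub>R (g *v affine_lift x)" "0 < t" using w(1) K_def by blast
    then have "0 < \<phi> \<bullet> w" using \<phi>K by metis
    then have "0 < c" using z c by (simp add: zero_less_mult_iff)
    then show "z \<in> K" using cone[OF w(1)] c by simp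
  qed
  have "open (- {0} \<inter> proj -` \<Omega>)"
    using continuous_on_open_vimage[of "- {0 :: real^3}" proj] continuous_on_proj \<Omega>(1)
    by (simp add: open_Compl Int_commute)
  then have "open K" unfolding Keq by (rule open_Int[OF open_halfspace_gt])
  moreover have "K \<noteq> {}" using \<Omega>(2) \<Omega>K by (auto simp: pcone_def)
  moreover have "inverse B * norm x \<le> \<phi> \<bullet> x" if x: "x \<in> K" for x
  proof -
    obtain t y where y: "x = t *\<^sub>R (g *v affine_lift y)" "0 < t" "y \<in> L" using x K_def by blast
    have "norm x \<le> t * B" using B(2)[OF y(3)] y by simp
    moreover have "\<phi> \<bullet> x = t" unfolding y(1) by (rule \<phi>K)
    ultimately show ?thesis using B(1) by (simp add: field_simps)
  qed
  moreover have "0 < inverse B" using B(1) by simp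
  ultimately show ?thesis using that \<open>convex K\<close> \<open>0 \<notin> K\<close> cone \<Omega>K by blast
qed

section \<open>Triangle Cartan matrices and their degenerations\<close>

definition weight :: "(3 \<Rightarrow> nat) \<Rightarrow> 3 \<Rightarrow> real" where
  "weight m k = 4 * (cos (pi / m k))\<^sup>2"

text \<open>The parameter \<open>p c\<close> is minus the entry in row \<open>c + 2\<close> and column \<open>c\<close>; up to diagonal conjugation the
  matrix depends only on \<open>p 1 * p 2 * p 3\<close>.\<close>

definition tri :: "(3 \<Rightarrow> nat) \<Rightarrow> (3 \<Rightarrow> real) \<Rightarrow> real^3^3" where
  "tri m p = (\<chi> r c. if r = c then 2 else if r = c + 2 then - p c else - weight m (c + 2) / p (c + 1))"

text \<open>The expression is half the determinant of the symmetric Cartan matrix with off-diagonal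
  entries -2 cos(\<pi> / m k); its negativity says that the angles are those of a hyperbolic
  triangle.\<close>

definition hyperbolic_orders :: "(3 \<Rightarrow> nat) \<Rightarrow> bool" where
  "hyperbolic_orders m \<longleftrightarrow> (\<forall>k. 3 \<le> m k) \<and>
     4 - (weight m 1 + weight m 2 + weight m 3) - 8 * (cos (pi / m 1) * cos (pi / m 2) * cos (pi / m 3)) < 0"

lemma ne3 [simp]:
  fixes k :: 3
  shows "k + 1 \<noteq> k" "k + 2 \<noteq> k" "k + 1 \<noteq> k + 2" "k \<noteq> k + 1" "k \<noteq> k + 2" "k + 2 \<noteq> k + 1"
    "k + 1 + 1 = k + 2" "k + 1 + 2 = k" "k + 2 + 1 = k" "k + 2 + 2 = k + 1"
  using exhaust_3[of k] by (elim disjE; simp)+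

lemma cyclic_cases: "i = k \<or> i = k + 1 \<or> i = k + (2::3)"
  using exhaust_3[of i] exhaust_3[of k] by (elim disjE; simp)

lemma forall_cyclic: "(\<forall>i. P i) \<longleftrightarrow> P k \<and> P (k + 1) \<and> P (k + (2::3))"
  using cyclic_cases by metis

lemma tri_nth:
  "tri m p $ k $ k = 2" "tri m p $ (k + 2) $ k = - p k"
  "tri m p $ (k + 1) $ k = - weight m (k + 2) / p (k + 1)"
  "tri m p $ k $ (k + 1) = - p (k + 1)"
  "tri m p $ k $ (k + 2) = - weight m (k + 1) / p k"
  "tri m p $ (k + 1) $ (k + 2) = - p (k + 2)"
  "tri m p $ (k + 2) $ (k + 1) = - weight m k / p (k + 2)"
  by (simp_all add: tri_def)

lemma weight_bounds:
  assumes "\<And>k. 3 \<le> m k" shows "0 < cos (pi / m k)" "1 \<le> weight m k" "weight m k < 4"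
proof -
  have m: "3 \<le> m k" by (rule assms)
  then have *: "0 < pi / m k" "pi / m k \<le> pi / 3" by (auto simp: field_simps)
  have "pi / 3 < pi" by auto
  then have "pi / m k < pi" using *(2) by linarith
  have "cos (pi / 3) \<le> cos (pi / m k)" using * by (intro cos_monotone_0_pi_le) auto
  then have c: "1 / 2 \<le> cos (pi / m k)" by (simp add: cos_60)
  then show "0 < cos (pi / m k)" by linarith
  from c have "(1 / 2)\<^sup>2 \<le> (cos (pi / m k))\<^sup>2" by (intro power_mono) auto
  then show "1 \<le> weight m k" by (simp add: weight_def power2_eq_square)
  have "0 < sin (pi / m k)" using * \<open>pi / m k < pi\<close> by (intro sin_gt_zero)
  then have "0 < (sin (pi / m k))\<^sup>2" by simp
  then show "weight m k < 4" using sin_cos_squared_add[of "pi / m k"] unfolding weight_def by linarith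
qed

text \<open>With P the product of the parameters and C that of the cosines, the determinant is 8 - 2
  (w_1 + w_2 + w_3) - (P + 64 C^2 / P). By the arithmetic-geometric mean inequality the last bracket
  is at least 16 C, with equality in the symmetric case P = 8 C, so \<open>hyperbolic_orders\<close>
  takes care of all parameters at once.\<close>

lemma cartan_tri:
  assumes m: "hyperbolic_orders m" and p: "\<And>i. 0 < p i"
  shows "cartan m (tri m p)"
proof -
  have m3: "3 \<le> m k" for k using m by (simp add: hyperbolic_orders_def)
  note wb = weight_bounds[of m, OF m3]
  have "tri m p $ i $ j < 0 \<and> tri m p $ i $ j * tri m p $ j $ i = weight m (- (i + j))" if "i \<noteq> j" for i j
  proof -
    have w: "0 < weight m k" for k using wb(2)[of k] by simp
    have p0: "p k \<noteq> 0" for k using p[of k] by simp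
    have "j = i + 1 \<or> j = i + 2" using cyclic_cases[of j i] that by auto
    moreover have "- (i + (i + 1)) = i + 2" "- (i + (i + 2)) = i + 1"
      using exhaust_3[of i] by (elim disjE; simp)+
    ultimately show ?thesis
    proof (elim disjE)
      assume j: "j = i + 1" and k: "- (i + (i + 1)) = i + 2"
      show ?thesis
        unfolding j k using p[of "i + 1"] w[of "i + 2"] p0 by (simp add: tri_nth)
    next
      assume j: "j = i + 2" and k: "- (i + (i + 2)) = i + 1"
      show ?thesis
        unfolding j k using p[of i] w[of "i + 1"] p0 by (simp add: tri_nth)
    qed
  qed
  moreover have "det (tri m p) < 0"
  proof -
    define P where "P = p 1 * p 2 * p 3"
    define C where "C = cos (pi / m 1) * cos (pi / m 2) * cos (pi / m 3)"
    have P: "0 < P" using p by (simp add: P_def)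
    have p0: "p k \<noteq> 0" for k using p[of k] by simp
    have "det (tri m p) = 8 - 2 * (weight m 1 + weight m 2 + weight m 3) - P
        - weight m 1 * weight m 2 * weight m 3 / P"
      using p0 by (simp add: det_3 tri_def cyc3 P_def field_simps)
    also have "weight m 1 * weight m 2 * weight m 3 = 64 * C\<^sup>2"
      by (simp add: weight_def C_def power_mult_distrib)
    finally have D: "det (tri m p) = 8 - 2 * (weight m 1 + weight m 2 + weight m 3) - P - 64 * C\<^sup>2 / P" .
    have i1: "16 * C \<le> P + 64 * C\<^sup>2 / P"
    proof -
      have "0 \<le> (P - 8 * C)\<^sup>2 / P" using P by simp
      also have "\<dots> = P + 64 * C\<^sup>2 / P - 16 * C"
        using P by (simp add: power2_eq_square field_simps)
      finally show ?thesis by simp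
    qed
    have i2: "4 - (weight m 1 + weight m 2 + weight m 3) - 8 * C < 0"
      using m by (simp add: hyperbolic_orders_def C_def)
    have key: "8 - 2 * a - P - Q < 0" if "16 * C \<le> P + Q" "4 - a - 8 * C < 0" for a Q
      using that by linarith
    show ?thesis unfolding D by (rule key[OF i1 i2])
  qed
  ultimately show ?thesis
    unfolding cartan_def weight_def[symmetric] by (simp add: m3 tri_nth(1))
qed

text \<open>The relabelling \<pi> of the walls will be the identity for diagonal changes of
  coordinates and the negation of indices for the reversal that exchanges the two ends.\<close>

lemma tits_transport:
  assumes g: "\<And>i x. g (refl S i x) = refl T (\<pi> i) (g x)" and "surj \<pi>" "g ` orthant = orthant"
  shows "g ` tits S = tits T"
proof -
  have *: "g (foldr (refl S) w x) = foldr (refl T) (map \<pi> w) (g x)" for w x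
    by (induction w) (auto simp: g)
  show ?thesis
  proof
    show "g ` tits S \<subseteq> tits T"
    proof
      fix z assume "z \<in> g ` tits S"
      then obtain w x where z: "z = g (foldr (refl S) w x)" "x \<in> orthant" by (auto simp: tits_def)
      have "g x \<in> orthant" using z(2) assms(3) by blast
      then show "z \<in> tits T" unfolding z(1) * tits_def by blast
    qed
    show "tits T \<subseteq> g ` tits S"
    proof
      fix z assume "z \<in> tits T"
      then obtain v y where z: "z = foldr (refl T) v y" "y \<in> orthant" by (auto simp: tits_def)
      obtain x where x: "x \<in> orthant" "y = g x" using z(2) assms(3) by blast
      have "map \<pi> (map (inv_into UNIV \<pi>) v) = v" using assms(2) by (simp add: map_idI surj_f_inv_f)
      then have "z = g (foldr (refl S) (map (inv_into UNIV \<pi>) v) x)" using z(1) x(2) * by metis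
      then show "z \<in> g ` tits S" using x(1) by (auto simp: tits_def)
    qed
  qed
qed

section \<open>Diagonal rescaling of the coordinates\<close>

definition diag :: "(3 \<Rightarrow> real) \<Rightarrow> real^3^3" where
  "diag d = (\<chi> i j. if i = j then d i else 0)"

lemma diag_mult_nth: "(diag d *v x) $ i = d i * x $ i"
proof -
  have "(\<Sum>j\<in>UNIV. diag d $ i $ j * x $ j) = (\<Sum>j\<in>UNIV. if j = i then d i * x $ i else 0)"
    by (intro sum.cong) (auto simp: diag_def)
  then show ?thesis by (simp add: matrix_vector_mult_def)
qed

lemma diag_mult_inverse: "(\<And>i. d i \<noteq> 0) \<Longrightarrow> diag d *v (diag (\<lambda>i. inverse (d i)) *v x) = x"
  by (simp add: vec_eq_iff diag_mult_nth)

lemma invertible_diag: "(\<And>i. d i \<noteq> 0) \<Longrightarrow> invertible (diag d)"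
  by (simp add: invertible_det_nz det_3 diag_def)

lemma diag_tits:
  assumes d: "\<And>i. 0 < d i" and p: "\<And>i. p i \<noteq> 0"
  shows "(*v) (diag d) ` tits (tri m p) = tits (tri m (\<lambda>i. p i * d (i + 2) / d i))"
proof (rule tits_transport[where \<pi> = id])
  have d0: "d i \<noteq> 0" for i using d[of i] by simp
  show "diag d *v refl (tri m p) i x = refl (tri m (\<lambda>i. p i * d (i + 2) / d i)) (id i) (diag d *v x)" for i x
    unfolding vec_eq_iff forall_cyclic[of _ i]
    using d0 p by (simp add: refl_component diag_mult_nth tri_nth, simp add: field_simps)
  show "(*v) (diag d) ` orthant = orthant"
  proof
    show "(*v) (diag d) ` orthant \<subseteq> orthant"
      using d by (auto simp: orthant_def diag_mult_nth less_imp_le)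
    show "orthant \<subseteq> (*v) (diag d) ` orthant"
    proof
      fix x assume x: "x \<in> orthant"
      have "x = diag d *v (diag (\<lambda>i. inverse (d i)) *v x)" using d0 by (simp add: diag_mult_inverse)
      moreover have "diag (\<lambda>i. inverse (d i)) *v x \<in> orthant"
        using x d by (simp add: orthant_def diag_mult_nth less_imp_le)
      ultimately show "x \<in> (*v) (diag d) ` orthant" by blast
    qed
  qed
qed simp

text \<open>In the new coordinates the base point \<open>y\<close> stays bounded, and it can approach a wall only where the
  parameter remains bounded.\<close>

lemma base_point_rescaling:
  assumes p: "\<And>i. 0 < p i" "1 \<le> p 1 * p 2 * p 3" and y: "y \<in> orthant" "y \<noteq> 0"
  obtains d where "\<And>i. 0 < d i" "\<And>i. 1 \<le> p i * d (i + 2) / d i"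
    "\<And>i. (diag d *v y) $ i \<le> 1" "\<And>i. (diag d *v y) $ i < 1 \<Longrightarrow> p i * d (i + 2) / d i = 1"
proof -
  have y0: "0 \<le> y $ i" for i using y by (simp add: orthant_def)
  have prod: "1 \<le> p i * p (i + 1) * p (i + 2)" for i
    using exhaust_3[of i] p(2) by (elim disjE) (simp_all add: cyc3 mult_ac)
  \<comment> \<open>The least e with y_i \<le> e_i and e_(i+2) \<le> p_i e_i: the second condition
    is propagated twice along the cycle of indices, and a third time gives nothing new because the
    product of the parameters is at least 1.\<close>
  define e where "e i = max (y $ i) (max (y $ (i + 2) / p i) (y $ (i + 1) / (p i * p (i + 2))))" for i
  have e: "0 < e i" for i
  proof -
    obtain k where "y $ k \<noteq> 0" using y(2) by (auto simp: vec_eq_iff)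
    then have "0 < y $ k" using y0[of k] by simp
    moreover have "k = i \<or> k = i + 1 \<or> k = i + 2" by (rule cyclic_cases)
    ultimately show ?thesis
      using p(1) by (auto simp: e_def less_max_iff_disj)
  qed
  have pe: "p i * e i = max (p i * y $ i) (max (y $ (i + 2)) (y $ (i + 1) / p (i + 2)))" for i
    using p(1)[of i] by (simp add: e_def max_mult_distrib_left)
  have e2: "e (i + 2) = max (y $ (i + 2)) (max (y $ (i + 1) / p (i + 2)) (y $ i / (p (i + 2) * p (i + 1))))" for i
    by (simp add: e_def)
  have yi: "y $ i / (p (i + 2) * p (i + 1)) \<le> p i * y $ i" for i
  proof -
    have "y $ i * 1 \<le> y $ i * (p i * p (i + 1) * p (i + 2))"
      using prod y0 by (intro mult_left_mono)
    then show ?thesis using p(1) by (simp add: field_simps)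
  qed
  have ge: "e (i + 2) \<le> p i * e i" for i
    unfolding pe e2 using yi[of i] by (auto simp: le_max_iff_disj)
  show ?thesis
  proof (rule that[of "\<lambda>i. inverse (e i)"])
    fix i
    show "0 < inverse (e i)" using e by simp
    show "1 \<le> p i * inverse (e (i + 2)) / inverse (e i)"
      using ge[of i] e[of i] e[of "i + 2"] by (simp add: field_simps)
    show "(diag (\<lambda>i. inverse (e i)) *v y) $ i \<le> 1"
      using e[of i] by (simp add: diag_mult_nth field_simps) (simp add: e_def)
    assume "(diag (\<lambda>i. inverse (e i)) *v y) $ i < 1"
    then have "y $ i < e i" using e[of i] by (simp add: diag_mult_nth field_simps)
    then have "e i = max (y $ (i + 2) / p i) (y $ (i + 1) / (p i * p (i + 2)))"
      unfolding e_def by (auto simp: max_def split: if_splits)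
    then have "p i * e i = max (y $ (i + 2)) (y $ (i + 1) / p (i + 2))"
      using p(1)[of i] by (simp add: max_mult_distrib_left)
    then have "p i * e i \<le> e (i + 2)" unfolding e2 by auto
    then show "p i * inverse (e (i + 2)) / inverse (e i) = 1"
      using ge[of i] e[of i] e[of "i + 2"] p(1)[of i] by (simp add: field_simps)
  qed
qed

section \<open>Limits of Tits cones\<close>

definition cone_limit :: "(nat \<Rightarrow> (real^3) set) \<Rightarrow> (real^3) set \<Rightarrow> bool" where
  "cone_limit U L \<longleftrightarrow> (\<forall>z\<in>L. \<exists>y. (\<forall>n. y n \<in> U n) \<and> y \<longlonglongrightarrow> z) \<and>
     (\<forall>r y z. strict_mono (r :: nat \<Rightarrow> nat) \<longrightarrow> (\<forall>n. y n \<in> U (r n)) \<longrightarrow> y \<longlonglongrightarrow> z \<longrightarrow> z \<in> L)"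

lemma inner_cyclic: "x \<bullet> y = x $ k * y $ k + x $ (k + 1) * y $ (k + 1) + x $ (k + 2) * y $ (k + 2)"
  for x y :: "real^3"
proof -
  have U: "(UNIV :: 3 set) = {k, k + 1, k + 2}" using cyclic_cases by auto
  show ?thesis unfolding inner_vec_def U by (simp add: add.assoc)
qed

text \<open>The adjugate functional of index i + 1 is non-negative on the Tits cones. Divided by the
  parameters of i and i + 2, it tends to coordinate i as soon as the parameter of i escapes.\<close>

lemma tits_limit_coordinate:
  assumes m: "hyperbolic_orders m" and p: "\<And>n i. 1 \<le> p n i"
    and l: "\<And>i. (\<lambda>n. inverse (p n i)) \<longlonglongrightarrow> l i" "l i = 0"
    and y: "strict_mono r" "\<And>n. y n \<in> tits (tri m (p (r n)))" "y \<longlonglongrightarrow> z"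
  shows "0 \<le> z $ i"
proof -
  define k where "k = i + 1"
  have i: "i = k + 2" by (simp add: k_def)
  define t where "t n j = inverse (p (r n) j)" for n j
  have tl: "(\<lambda>n. t n j) \<longlonglongrightarrow> l j" for j
    using LIMSEQ_subseq_LIMSEQ[OF l(1) y(1)] by (simp add: t_def o_def)
  have y': "(\<lambda>n. y n $ j) \<longlonglongrightarrow> z $ j" for j using y(3) by (rule tendsto_vec_nth)
  let ?f = "\<lambda>t y. (4 - weight m k) * t (k + 1) * t (k + 2) * y $ k +
     (weight m k * weight m (k + 1) * t (k + 1) * t (k + 2) * t (k + 2) * t k + 2 * t (k + 2)) * y $ (k + 1) +
     (1 + 2 * weight m (k + 1) * t k * t (k + 1) * t (k + 2)) * y $ (k + 2)"
  have "0 \<le> ?f (t n) (y n)" for n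
  proof -
    let ?p = "p (r n)"
    let ?S = "tri m ?p"
    have p0: "0 < ?p j" "?p j \<noteq> 0" for j using p[of "r n" j] by linarith+
    have c: "cartan m ?S" using m p0 by (intro cartan_tri)
    have "0 \<le> cross3 (column (k + 1) ?S) (column (k + 2) ?S) \<bullet> y n"
      using adjugate_tits[where k = k, OF c y(2)[of n]] by (cases "y n = 0") auto
    also have "\<dots> = (4 - weight m k) * y n $ k +
       (weight m k * weight m (k + 1) / (?p (k + 2) * ?p k) + 2 * ?p (k + 1)) * y n $ (k + 1) +
       (?p (k + 1) * ?p (k + 2) + 2 * weight m (k + 1) / ?p k) * y n $ (k + 2)"
      unfolding inner_cyclic[of _ _ k] adjugate_row(1-3)[OF c] using p0 by (simp add: tri_nth)
    finally have "0 \<le> (\<dots>) * (t n (k + 1) * t n (k + 2))"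
      using p0 by (intro mult_nonneg_nonneg) (auto simp: t_def less_imp_le)
    also have "\<dots> = ?f (t n) (y n)" using p0 by (simp add: t_def field_simps)
    finally show ?thesis .
  qed
  moreover have "(\<lambda>n. ?f (t n) (y n)) \<longlonglongrightarrow> ?f l z"
    by (intro tendsto_intros tl y')
  ultimately have "0 \<le> ?f l z" by (intro LIMSEQ_le_const) auto
  then show ?thesis using l(2) by (simp add: i)
qed

text \<open>The entrywise limit of \<open>tri m (p n)\<close>, with l the limit of the inverse
  parameters. Column c is a genuine limit when \<open>l c\<close> is not zero; for an escaping
  parameter the inverse of 0 is a default value, and only reflections in surviving walls are taken
  to the limit.\<close>

definition limit_tri :: "(3 \<Rightarrow> nat) \<Rightarrow> (3 \<Rightarrow> real) \<Rightarrow> real^3^3" where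
  "limit_tri m l = (\<chi> r c. if r = c then 2 else if r = c + 2 then - inverse (l c) else - weight m (c + 2) * l (c + 1))"

text \<open>The limit of Tits cones is cut out by the walls \<open>i\<close> with \<open>l i = 0\<close> and their images under the
  reflections that survive in the limit.\<close>

definition limit_words :: "(3 \<Rightarrow> real) \<Rightarrow> 3 list set" where
  "limit_words l = {w. \<forall>j\<in>set w. l j \<noteq> 0}"

definition limit_cone :: "(3 \<Rightarrow> nat) \<Rightarrow> (3 \<Rightarrow> real) \<Rightarrow> (real^3) set" where
  "limit_cone m l = {z. \<forall>w\<in>limit_words l. \<forall>i. l i = 0 \<longrightarrow> 0 \<le> foldr (refl (limit_tri m l)) w z $ i}"

lemma limit_tri_nth:
  "limit_tri m l $ k $ k = 2" "limit_tri m l $ (k + 2) $ k = - inverse (l k)"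
  "limit_tri m l $ (k + 1) $ k = - weight m (k + 2) * l (k + 1)"
  "limit_tri m l $ k $ (k + 1) = - inverse (l (k + 1))"
  "limit_tri m l $ k $ (k + 2) = - weight m (k + 1) * l k"
  "limit_tri m l $ (k + 1) $ (k + 2) = - inverse (l (k + 2))"
  "limit_tri m l $ (k + 2) $ (k + 1) = - weight m k * l (k + 2)"
  by (simp_all add: limit_tri_def)

lemma limit_refl_invol: "refl (limit_tri m l) i (refl (limit_tri m l) i x) = x"
  by (simp add: refl_invol limit_tri_nth)

lemma limit_word_rev:
  "foldr (refl (limit_tri m l)) w (foldr (refl (limit_tri m l)) (rev w) x) = x"
  by (induction w arbitrary: x) (auto simp: limit_refl_invol)

context
  fixes m :: "3 \<Rightarrow> nat" and p :: "nat \<Rightarrow> 3 \<Rightarrow> real" and l :: "3 \<Rightarrow> real"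
  assumes m: "hyperbolic_orders m" and p: "\<And>n i. 1 \<le> p n i"
    and l: "\<And>i. (\<lambda>n. inverse (p n i)) \<longlonglongrightarrow> l i"
begin

lemma limit_nonneg: "0 \<le> l i"
proof -
  have "0 \<le> inverse (p n i)" for n using p[of n i] by simp
  then show ?thesis using LIMSEQ_le_const[OF l] by blast
qed

lemma refl_tri_limit:
  assumes "strict_mono r" "l j \<noteq> 0" "x \<longlonglongrightarrow> z"
  shows "(\<lambda>n. refl (tri m (p (r n))) j (x n)) \<longlonglongrightarrow> refl (limit_tri m l) j z"
proof -
  have lr: "(\<lambda>n. inverse (p (r n) i)) \<longlonglongrightarrow> l i" for i
    using LIMSEQ_subseq_LIMSEQ[OF l assms(1)] by (simp add: o_def)
  have "(\<lambda>n. inverse (inverse (p (r n) j))) \<longlonglongrightarrow> inverse (l j)"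
    by (intro tendsto_inverse lr assms)
  then have pj: "(\<lambda>n. p (r n) j) \<longlonglongrightarrow> inverse (l j)" by simp
  have x: "(\<lambda>n. x n $ i) \<longlonglongrightarrow> z $ i" for i using assms(3) by (rule tendsto_vec_nth)
  have "(\<lambda>n. refl (tri m (p (r n))) j (x n) $ i) \<longlonglongrightarrow> refl (limit_tri m l) j z $ i" for i
  proof -
    have "\<forall>i. (\<lambda>n. refl (tri m (p (r n))) j (x n) $ i) \<longlonglongrightarrow> refl (limit_tri m l) j z $ i"
      unfolding forall_cyclic[of _ j] refl_component tri_nth limit_tri_nth divide_inverse
      by (intro conjI tendsto_intros x lr pj)
    then show ?thesis by blast
  qed
  then show ?thesis by (intro vec_tendstoI)
qed

lemma word_tri_limit:
  assumes "strict_mono r" "w \<in> limit_words l" "x \<longlonglongrightarrow> z"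
  shows "(\<lambda>n. foldr (refl (tri m (p (r n)))) w (x n)) \<longlonglongrightarrow> foldr (refl (limit_tri m l)) w z"
  using assms(2)
proof (induction w)
  case (Cons j w)
  then show ?case
    using refl_tri_limit[OF assms(1), of j] by (simp add: limit_words_def)
qed (use assms(3) in simp)

lemma limit_cone_upper:
  assumes "strict_mono r" "\<And>n. y n \<in> tits (tri m (p (r n)))" "y \<longlonglongrightarrow> z"
  shows "z \<in> limit_cone m l"
  unfolding limit_cone_def
proof (intro CollectI ballI allI impI)
  fix w i assume w: "w \<in> limit_words l" and i: "l i = 0"
  show "0 \<le> foldr (refl (limit_tri m l)) w z $ i"
    using tits_limit_coordinate[where y = "\<lambda>n. foldr (refl (tri m (p (r n)))) w (y n)",
        OF m p l i assms(1) word_tits[OF assms(2)] word_tri_limit[OF assms(1) w assms(3)]] .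
qed

lemma limit_word_orthant:
  assumes "y \<in> orthant" "w \<in> limit_words l"
  shows "foldr (refl (limit_tri m l)) w y \<in> limit_cone m l"
proof (rule limit_cone_upper[of id])
  show "(\<lambda>n. foldr (refl (tri m (p (id n)))) w y) \<longlonglongrightarrow> foldr (refl (limit_tri m l)) w y"
    using assms by (intro word_tri_limit) (auto simp: strict_mono_def)
  show "foldr (refl (tri m (p (id n)))) w y \<in> tits (tri m (p (id n)))" for n
    by (intro word_tits orthant_in_tits assms)
qed (simp add: strict_mono_id)

text \<open>Descent brings a limit point into the orthant by a word in the surviving reflections.
  Undoing this word in the approximating groups, whose reflections converge, produces points of the
  Tits cones that tend to the given one.\<close>

lemma cone_limit_tits:
  assumes descent: "\<And>z. z \<in> limit_cone m l \<Longrightarrow> \<exists>w\<in>limit_words l. foldr (refl (limit_tri m l)) w z \<in> orthant"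
  shows "cone_limit (\<lambda>n. tits (tri m (p n))) (limit_cone m l)"
  unfolding cone_limit_def
proof (intro conjI ballI allI impI)
  fix z assume "z \<in> limit_cone m l"
  then obtain w where w: "w \<in> limit_words l" "foldr (refl (limit_tri m l)) w z \<in> orthant"
    using descent by blast
  define y where "y = foldr (refl (limit_tri m l)) w z"
  have rw: "rev w \<in> limit_words l" using w by (simp add: limit_words_def)
  have "(\<lambda>n. foldr (refl (tri m (p (id n)))) (rev w) y) \<longlonglongrightarrow> foldr (refl (limit_tri m l)) (rev w) y"
    using rw by (intro word_tri_limit) (auto simp: strict_mono_def)
  moreover have "foldr (refl (limit_tri m l)) (rev w) y = z"
    using limit_word_rev[of m l "rev w" z] by (simp add: y_def)
  moreover have "foldr (refl (tri m (p (id n)))) (rev w) y \<in> tits (tri m (p n))" for n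
    using w by (simp add: y_def word_tits orthant_in_tits)
  ultimately show "\<exists>y. (\<forall>n. y n \<in> tits (tri m (p n))) \<and> y \<longlonglongrightarrow> z"
    by (intro exI[of _ "\<lambda>n. foldr (refl (tri m (p (id n)))) (rev w) y"]) auto
qed (use limit_cone_upper in blast)

lemma limit_cone_add: "x \<in> limit_cone m l \<Longrightarrow> y \<in> limit_cone m l \<Longrightarrow> x + y \<in> limit_cone m l"
  by (simp add: limit_cone_def linear_add[OF linear_refl_word])

lemma limit_cone_scaleR: "x \<in> limit_cone m l \<Longrightarrow> 0 \<le> c \<Longrightarrow> c *\<^sub>R x \<in> limit_cone m l"
  by (simp add: limit_cone_def linear_cmul[OF linear_refl_word])

lemma limit_cone_none:
  assumes "\<And>i. l i = 0"
  shows "limit_cone m l = orthant" "z \<in> limit_cone m l \<Longrightarrow> \<exists>w\<in>limit_words l. foldr (refl (limit_tri m l)) w z \<in> orthant"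
    "(\<And>i. 0 < b $ i) \<Longrightarrow> b \<in> interior (limit_cone m l)"
proof -
  have w: "w \<in> limit_words l \<longleftrightarrow> w = []" for w by (cases w) (auto simp: limit_words_def assms)
  show *: "limit_cone m l = orthant"
    by (auto simp: limit_cone_def w orthant_def assms)
  show "z \<in> limit_cone m l \<Longrightarrow> \<exists>w\<in>limit_words l. foldr (refl (limit_tri m l)) w z \<in> orthant"
    by (auto simp: * w)
  show "b \<in> interior (limit_cone m l)" if "\<And>i. 0 < b $ i"
  proof (rule interiorI)
    show "open {x :: real^3. \<forall>i. 0 < x $ i}"
      by (simp add: Collect_all_eq open_INT open_halfspace_component_gt_cart)
  qed (auto simp: * orthant_def that less_imp_le)
qed

text \<open>One wall \<open>k\<close> survives: the two triangles adjacent along it fit together to a larger triangle.\<close>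

lemma limit_cone_one:
  assumes "l k \<noteq> 0" "l (k + 1) = 0" "l (k + 2) = 0"
  defines "F \<equiv> \<lambda>x::real^3. (\<chi> i. if i = k then x $ k - x $ (k + 2) else if i = k + 1 then x $ (k + 1)
     else inverse (l k) * x $ (k + 2))"
  shows "limit_cone m l = F ` orthant" "linear F" "inj F"
    "z \<in> limit_cone m l \<Longrightarrow> \<exists>w\<in>limit_words l. foldr (refl (limit_tri m l)) w z \<in> orthant"
    "0 \<le> b $ k \<Longrightarrow> 0 < b $ (k + 1) \<Longrightarrow> 0 < b $ (k + 2) \<Longrightarrow> b \<in> interior (limit_cone m l)"
proof -
  let ?B = "refl (limit_tri m l)"
  have lk: "0 < l k" using limit_nonneg[of k] assms(1) by simp
  have words: "foldr ?B w z = z \<or> foldr ?B w z = ?B k z" if "w \<in> limit_words l" for w z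
    using that
  proof (induction w)
    case (Cons j w)
    have "j = k" using Cons.prems cyclic_cases[of j k] assms(2,3) by (auto simp: limit_words_def)
    then show ?case using Cons by (auto simp: limit_words_def limit_refl_invol)
  qed simp
  have Bk: "?B k z $ k = - z $ k" "?B k z $ (k + 1) = z $ (k + 1)"
     "?B k z $ (k + 2) = z $ (k + 2) + z $ k * inverse (l k)" for z
    by (simp_all add: refl_component limit_tri_nth assms(2))
  have kw: "[k] \<in> limit_words l" "[] \<in> limit_words l" using assms(1) by (auto simp: limit_words_def)
  have iff: "z \<in> limit_cone m l \<longleftrightarrow> 0 \<le> z $ (k + 1) \<and> 0 \<le> z $ (k + 2) \<and> 0 \<le> z $ (k + 2) + z $ k * inverse (l k)" (is "?l z \<longleftrightarrow> ?r z") for z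
  proof
    assume "?l z"
    then have "\<forall>i. l i = 0 \<longrightarrow> 0 \<le> foldr ?B [] z $ i" "\<forall>i. l i = 0 \<longrightarrow> 0 \<le> foldr ?B [k] z $ i"
      using kw unfolding limit_cone_def by blast+
    then show "?r z" using assms(2,3) Bk[of z] by (metis foldr_Cons foldr_Nil id_apply o_apply)
  next
    assume r: "?r z"
    show "?l z"
      unfolding limit_cone_def
    proof (intro CollectI ballI allI impI)
      fix w i assume "w \<in> limit_words l" "l i = 0"
      then show "0 \<le> foldr ?B w z $ i"
        using words[of w z] r Bk[of z] cyclic_cases[of i k] assms(1) by auto
    qed
  qed
  show lin: "linear F"
    by (rule linearI) (auto simp: F_def vec_eq_iff algebra_simps)
  \<comment> \<open>The edges of the larger triangle are e_k, e_(k+1) and the mirror image of e_k;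
    the vertex e_(k+2), which lies on the mirror, becomes an interior point of a side.\<close>
  have F: "F x $ k = x $ k - x $ (k + 2)" "F x $ (k + 1) = x $ (k + 1)" "F x $ (k + 2) = inverse (l k) * x $ (k + 2)" for x
    by (simp_all add: F_def)
  show "inj F"
    unfolding linear_injective_0[OF lin]
  proof (intro allI impI)
    fix x assume "F x = 0"
    then have "F x $ k = 0" "F x $ (k + 1) = 0" "F x $ (k + 2) = 0" by auto
    then show "x = 0" unfolding F vec_eq_iff forall_cyclic[of _ k] using lk by auto
  qed
  show "limit_cone m l = F ` orthant"
  proof (intro equalityI subsetI)
    fix z assume "z \<in> limit_cone m l"
    then have r: "0 \<le> z $ (k + 1) \<and> 0 \<le> z $ (k + 2) \<and> 0 \<le> z $ (k + 2) + z $ k * inverse (l k)"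
      using iff by blast
    define x :: "real^3" where "x = (\<chi> i. if i = k then z $ k + l k * z $ (k + 2) else if i = k + 1 then z $ (k + 1) else l k * z $ (k + 2))"
    have x: "x $ k = z $ k + l k * z $ (k + 2)" "x $ (k + 1) = z $ (k + 1)" "x $ (k + 2) = l k * z $ (k + 2)"
      by (simp_all add: x_def)
    have "0 \<le> l k * (z $ (k + 2) + z $ k * inverse (l k))" using r lk by simp
    also have "\<dots> = x $ k" using lk by (simp add: x field_simps)
    finally have "x \<in> orthant"
      using r lk unfolding orthant_def mem_Collect_eq forall_cyclic[of _ k] by (simp add: x)
    moreover have "z = F x" unfolding vec_eq_iff forall_cyclic[of _ k] F x using lk by simp
    ultimately show "z \<in> F ` orthant" by blast
  next
    fix z assume "z \<in> F ` orthant"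
    then obtain x where x: "z = F x" "\<And>i. 0 \<le> x $ i" by (auto simp: orthant_def)
    show "z \<in> limit_cone m l"
      unfolding iff x(1) F using x(2)[of k] x(2)[of "k + 1"] x(2)[of "k + 2"] lk
      by (simp add: algebra_simps)
  qed
  show "\<exists>w\<in>limit_words l. foldr ?B w z \<in> orthant" if z: "z \<in> limit_cone m l"
  proof (cases "0 \<le> z $ k")
    case True
    then have "foldr ?B [] z \<in> orthant"
      using z unfolding iff orthant_def mem_Collect_eq forall_cyclic[of _ k] by simp
    then show ?thesis using kw by blast
  next
    case False
    then have "foldr ?B [k] z \<in> orthant"
      using z unfolding iff orthant_def mem_Collect_eq forall_cyclic[of _ k] by (simp add: Bk)
    then show ?thesis using kw by blast
  qed
  show "b \<in> interior (limit_cone m l)" if b: "0 \<le> b $ k" "0 < b $ (k + 1)" "0 < b $ (k + 2)"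
  proof (rule interiorI)
    show "open {z :: real^3. 0 < z $ (k + 1) \<and> 0 < z $ (k + 2) \<and> 0 < z $ (k + 2) + z $ k * inverse (l k)}"
      by (intro open_Collect_conj open_Collect_less continuous_intros)
    show "b \<in> {z. 0 < z $ (k + 1) \<and> 0 < z $ (k + 2) \<and> 0 < z $ (k + 2) + z $ k * inverse (l k)}"
      using b lk by (simp add: add_pos_nonneg)
  qed (auto simp: iff)
qed

end

section \<open>The cone over a standard regular polygon\<close>

definition gon_vertex :: "nat \<Rightarrow> int \<Rightarrow> real^3" where
  "gon_vertex k n = vector [cos (2 * pi * n / k), sin (2 * pi * n / k), 1]"

text \<open>Vertices are indexed by all integers and repeat modulo k, so that the symmetries of the
  polygon act on the index by addition and negation without any reduction.\<close>

definition gon_cone :: "nat \<Rightarrow> (real^3) set" where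
  "gon_cone k = {\<Sum>n\<in>N. c n *\<^sub>R gon_vertex k n | N c. finite N \<and> (\<forall>n\<in>N. 0 \<le> c n)}"

lemma gon_vertex_nth:
  "gon_vertex k n $ 1 = cos (2 * pi * n / k)" "gon_vertex k n $ 2 = sin (2 * pi * n / k)" "gon_vertex k n $ 3 = 1"
  by (simp_all add: gon_vertex_def)

lemma gon_vertex_mod:
  assumes "0 < k" shows "gon_vertex k n = gon_vertex k (n mod int k)"
proof -
  have "real_of_int n = real k * real_of_int (n div int k) + real_of_int (n mod int k)"
    by (metis mult_div_mod_eq of_int_add of_int_mult of_int_of_nat_eq)
  then have *: "2 * pi * real_of_int n / real k =
      2 * pi * real_of_int (n mod int k) / real k + 2 * pi * real_of_int (n div int k)"
    using assms by (simp add: field_simps)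
  have "cos (2 * pi * real_of_int n / real k) = cos (2 * pi * real_of_int (n mod int k) / real k)"
    "sin (2 * pi * real_of_int n / real k) = sin (2 * pi * real_of_int (n mod int k) / real k)"
    unfolding * cos_add sin_add cos_int_2pin sin_int_2pin by simp_all
  then show ?thesis by (simp only: gon_vertex_def)
qed

lemma finite_range_gon_vertex: "0 < k \<Longrightarrow> finite (range (gon_vertex k))"
proof -
  assume k: "0 < k"
  have "gon_vertex k n \<in> gon_vertex k ` {0..<int k}" for n
    using gon_vertex_mod[OF k, of n] k by (intro image_eqI[of _ _ "n mod int k"]) auto
  then have "range (gon_vertex k) \<subseteq> gon_vertex k ` {0..<int k}" by blast
  then show ?thesis by (rule finite_subset) simp
qed

lemma gon_cone_vertex: "gon_vertex k n \<in> gon_cone k"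
  unfolding gon_cone_def by (intro CollectI exI[of _ "{n}"] exI[of _ "\<lambda>_. 1"]) auto

lemma gon_cone_scaleR:
  assumes "x \<in> gon_cone k" "0 \<le> c" shows "c *\<^sub>R x \<in> gon_cone k"
proof -
  obtain N d where x: "x = (\<Sum>n\<in>N. d n *\<^sub>R gon_vertex k n)" "finite N" "\<forall>n\<in>N. 0 \<le> d n"
    using assms(1) by (auto simp: gon_cone_def)
  then have "c *\<^sub>R x = (\<Sum>n\<in>N. (c * d n) *\<^sub>R gon_vertex k n)" by (simp add: scaleR_sum_right)
  moreover have "\<forall>n\<in>N. 0 \<le> c * d n" using x(3) assms(2) by simp
  ultimately show ?thesis unfolding gon_cone_def using x(2)
    by (intro CollectI exI[of _ N] exI[of _ "\<lambda>n. c * d n"]) auto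
qed

lemma gon_cone_add:
  assumes "x \<in> gon_cone k" "y \<in> gon_cone k" shows "x + y \<in> gon_cone k"
proof -
  obtain N d where x: "x = (\<Sum>n\<in>N. d n *\<^sub>R gon_vertex k n)" "finite N" "\<forall>n\<in>N. 0 \<le> d n"
    using assms(1) by (auto simp: gon_cone_def)
  obtain M e where y: "y = (\<Sum>n\<in>M. e n *\<^sub>R gon_vertex k n)" "finite M" "\<forall>n\<in>M. 0 \<le> e n"
    using assms(2) by (auto simp: gon_cone_def)
  define f where "f n = (if n \<in> N then d n else 0) + (if n \<in> M then e n else 0)" for n
  have "x = (\<Sum>n\<in>N \<union> M. (if n \<in> N then d n else 0) *\<^sub>R gon_vertex k n)"
    unfolding x(1) using x(2) y(2) by (intro sum.mono_neutral_cong_left) auto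
  moreover have "y = (\<Sum>n\<in>N \<union> M. (if n \<in> M then e n else 0) *\<^sub>R gon_vertex k n)"
    unfolding y(1) using x(2) y(2) by (intro sum.mono_neutral_cong_left) auto
  ultimately have "x + y = (\<Sum>n\<in>N \<union> M. f n *\<^sub>R gon_vertex k n)"
    by (simp add: f_def scaleR_add_left sum.distrib)
  moreover have "\<forall>n\<in>N \<union> M. 0 \<le> f n" using x(3) y(3) by (auto simp: f_def)
  ultimately show ?thesis unfolding gon_cone_def using x(2) y(2)
    by (intro CollectI exI[of _ "N \<union> M"] exI[of _ f]) auto
qed

lemma gon_cone_linear_subset:
  assumes "linear f" "\<And>n. f (gon_vertex k n) \<in> C" "0 \<in> C"
    "\<And>x y. x \<in> C \<Longrightarrow> y \<in> C \<Longrightarrow> x + y \<in> C" "\<And>c x. x \<in> C \<Longrightarrow> 0 \<le> c \<Longrightarrow> c *\<^sub>R x \<in> C"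
  shows "f ` gon_cone k \<subseteq> C"
proof
  fix z assume "z \<in> f ` gon_cone k"
  then obtain N c where z: "z = f (\<Sum>n\<in>N. c n *\<^sub>R gon_vertex k n)" "finite N" "\<forall>n\<in>N. 0 \<le> c n"
    by (auto simp: gon_cone_def)
  have "(\<Sum>n\<in>N. c n *\<^sub>R f (gon_vertex k n)) \<in> C"
    using z(2,3) by (induction N rule: finite_induct) (auto intro!: assms)
  then show "z \<in> C" using assms(1) z(1) by (simp add: linear_sum linear_cmul)
qed

text \<open>The k-th roots of unity add up to zero.\<close>

lemma gon_cone_center:
  assumes "3 \<le> k"
  shows "axis 3 1 \<in> gon_cone k"
proof -
  define \<phi> where "\<phi> = 2 * pi / k"
  define s where "s = (\<Sum>n<k. cis \<phi> ^ n)"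
  have "cis \<phi> ^ k = cis (real k * \<phi>)" by (simp only: Complex.DeMoivre)
  also have "real k * \<phi> = 2 * pi" using assms by (simp add: \<phi>_def)
  finally have k: "cis \<phi> ^ k = 1" by simp
  have "0 < pi / k" "pi / k < pi" using assms by (auto simp: field_simps)
  then have "0 < sin (pi / k)" by (intro sin_gt_zero)
  then have "cos \<phi> \<noteq> 1"
    using cos_double_sin[of "pi / k"] by (simp add: \<phi>_def)
  then have "cis \<phi> \<noteq> 1" by (metis cis.sel(1) one_complex.sel(1))
  then have s: "s = 0" unfolding s_def using k by (simp add: geometric_sum)
  have cs: "cis \<phi> ^ n = cis (2 * pi * n / k)" for n
    by (simp add: Complex.DeMoivre \<phi>_def mult_ac)
  have "(\<Sum>n<k. cos (2 * pi * n / k)) = Re s" "(\<Sum>n<k. sin (2 * pi * n / k)) = Im s"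
    unfolding s_def cs by simp_all
  then have z: "(\<Sum>n<k. cos (2 * pi * n / k)) = 0" "(\<Sum>n<k. sin (2 * pi * n / k)) = 0"
    using s by simp_all
  have "axis 3 1 = (\<Sum>n<k. inverse k *\<^sub>R gon_vertex k (int n))"
    using z assms by (simp add: vec_eq_iff forall_3 gon_vertex_nth axis_def flip: sum_distrib_left scaleR_sum_right)
  moreover have "(\<Sum>n<K. inverse k *\<^sub>R gon_vertex k (int n)) \<in> gon_cone k" for K
  proof (induction K)
    case 0
    have "0 *\<^sub>R gon_vertex k 0 \<in> gon_cone k" by (intro gon_cone_scaleR gon_cone_vertex) simp
    then show ?case by simp
  qed (auto intro!: gon_cone_add gon_cone_scaleR gon_cone_vertex)
  ultimately show ?thesis by simp
qed

lemma gon_cone_0: "0 \<in> gon_cone k"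
  using gon_cone_scaleR[OF gon_cone_vertex, of 0 k 0] by simp

text \<open>G takes barycentric coordinates with respect to the three vertices at the angles 0, 2
  \<pi> / 3 and 4 \<pi> / 3.\<close>

lemma orthant_gon_cone:
  obtains G where "linear G" "inj G" "G ` gon_cone 3 = orthant"
proof -
  define G where "G x = (vector [(x $ 3 + 2 * x $ 1) / 3, (x $ 3 - x $ 1 + sqrt 3 * x $ 2) / 3,
    (x $ 3 - x $ 1 - sqrt 3 * x $ 2) / 3] :: real^3)" for x :: "real^3"
  have lin: "linear G"
    by (rule linearI) (simp_all add: G_def vec_eq_iff forall_3 algebra_simps add_divide_distrib diff_divide_distrib)
  have "inj G"
    unfolding linear_injective_0[OF lin] by (simp add: G_def vec_eq_iff forall_3) (auto simp: algebra_simps)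
  have c: "cos (2 * pi / 3) = - 1 / 2" "sin (2 * pi / 3) = sqrt 3 / 2"
    using cos_120 sin_120 by (simp_all add: mult.commute)
  have c4: "cos (4 * pi / 3) = - 1 / 2" "sin (4 * pi / 3) = - sqrt 3 / 2"
  proof -
    have "4 * pi / 3 = 2 * pi - 2 * pi / 3" by simp
    then show "cos (4 * pi / 3) = - 1 / 2" "sin (4 * pi / 3) = - sqrt 3 / 2"
      using c cos_2pi_minus[of "2 * pi / 3"] sin_2pi_minus[of "2 * pi / 3"] by auto
  qed
  have v: "G (gon_vertex 3 0) = axis 1 1" "G (gon_vertex 3 1) = axis 2 1" "G (gon_vertex 3 2) = axis 3 1"
    by (simp_all add: G_def vec_eq_iff forall_3 gon_vertex_nth axis_def c c4)
  have per: "gon_vertex 3 n = gon_vertex 3 (n mod 3)" for n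
    using gon_vertex_mod[of 3 n] by simp
  have "G (gon_vertex 3 n) \<in> orthant" for n
  proof -
    have "n mod 3 = 0 \<or> n mod 3 = 1 \<or> n mod 3 = 2" by presburger
    then show ?thesis using v by (subst per) (auto simp: orthant_def axis_def)
  qed
  then have "G ` gon_cone 3 \<subseteq> orthant"
    using lin by (intro gon_cone_linear_subset) (auto simp: orthant_def)
  moreover have "orthant \<subseteq> G ` gon_cone 3"
  proof
    fix x assume x: "x \<in> orthant"
    define y where "y = x $ 1 *\<^sub>R gon_vertex 3 0 + x $ 2 *\<^sub>R gon_vertex 3 1 + x $ 3 *\<^sub>R gon_vertex 3 2"
    have "y \<in> gon_cone 3"
      unfolding y_def using x by (intro gon_cone_add gon_cone_scaleR gon_cone_vertex) (auto simp: orthant_def)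
    moreover have "G y = x"
      using lin v by (simp add: y_def linear_add linear_cmul vec_eq_iff forall_3 axis_def)
    ultimately show "x \<in> G ` gon_cone 3" by blast
  qed
  ultimately show ?thesis using that lin \<open>inj G\<close> by blast
qed

text \<open>With the first two coordinates read as complex numbers, \<open>turn v\<close> is z
  \<mapsto> v z, and \<open>flip v\<close> is multiplication by v after complex conjugation.\<close>

definition turn :: "real^3 \<Rightarrow> real^3 \<Rightarrow> real^3" where
  "turn v x = vector [v $ 1 * x $ 1 - v $ 2 * x $ 2, v $ 2 * x $ 1 + v $ 1 * x $ 2, x $ 3]"

definition flip :: "real^3 \<Rightarrow> real^3 \<Rightarrow> real^3" where
  "flip v x = vector [v $ 1 * x $ 1 + v $ 2 * x $ 2, v $ 2 * x $ 1 - v $ 1 * x $ 2, x $ 3]"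

lemma flip_gon_vertex: "flip (gon_vertex k a) (gon_vertex k b) = gon_vertex k (a - b)"
proof -
  have *: "2 * pi * real_of_int (a - b) / k = 2 * pi * a / k - 2 * pi * b / k"
    by (simp add: right_diff_distrib diff_divide_distrib)
  show ?thesis unfolding gon_vertex_def * cos_diff sin_diff by (simp add: flip_def vec_eq_iff forall_3)
qed

lemma flip_flip: "flip (gon_vertex k a) (flip (gon_vertex k b) x) = turn (gon_vertex k (a - b)) x"
  by (simp add: flip_gon_vertex[symmetric]) (simp add: flip_def turn_def vec_eq_iff forall_3 algebra_simps)

lemma flip_turn: "flip (gon_vertex k a) (turn (gon_vertex k b) x) = flip (gon_vertex k (a - b)) x"
  by (simp add: flip_gon_vertex[symmetric]) (simp add: flip_def turn_def vec_eq_iff forall_3 algebra_simps)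

lemma linear_flip: "linear (flip v)"
  by (rule linearI) (simp_all add: flip_def vec_eq_iff forall_3 algebra_simps)

context
  fixes m :: "3 \<Rightarrow> nat" and p :: "nat \<Rightarrow> 3 \<Rightarrow> real" and l :: "3 \<Rightarrow> real" and k :: 3
  assumes m: "hyperbolic_orders m" and p: "\<And>n i. 1 \<le> p n i"
    and l: "\<And>i. (\<lambda>n. inverse (p n i)) \<longlonglongrightarrow> l i"
    and k: "l k \<noteq> 0" "l (k + 1) \<noteq> 0" "l (k + 2) = 0"
begin

text \<open>The two surviving reflections generate a dihedral group fixing the vertex \<open>k + 2\<close>;
  \<open>limit_frame\<close> conjugates it to the symmetry group of the standard regular polygon.\<close>

definition limit_frame :: "real^3 \<Rightarrow> real^3" where
  "limit_frame x = (let c = cos (2 * pi / m (k + 2)); s = sin (2 * pi / m (k + 2));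
      P = inverse (l k); Q = inverse (l (k + 1)); b = Q / (2 * s); a = P * Q / (2 * (1 - c)) in
     \<chi> i. if i = k then 2 * b * x $ 2 else if i = k + 1 then x $ 1 - b * (2 + 2 * c) / Q * x $ 2
       else a * (x $ 3 - x $ 1) - b * P * x $ 2)"

abbreviation (input) "limit_refl \<equiv> refl (limit_tri m l)"

lemma order_ge: "3 \<le> m i"
  using m by (simp add: hyperbolic_orders_def)

lemma frame_angle:
  "0 < sin (2 * pi / m (k + 2))" "cos (2 * pi / m (k + 2)) < 1"
  "weight m (k + 2) = 2 + 2 * cos (2 * pi / m (k + 2))"
proof -
  have *: "0 < 2 * pi / m (k + 2)" "2 * pi / m (k + 2) < pi"
    using order_ge[of "k + 2"] by (auto simp: field_simps)
  then show s: "0 < sin (2 * pi / m (k + 2))" by (rule sin_gt_zero)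
  have "x \<noteq> 1" if "y\<^sup>2 + x\<^sup>2 = 1" "0 < y" for x y :: real using that by auto
  from this[OF sin_cos_squared_add s] have "cos (2 * pi / m (k + 2)) \<noteq> 1" .
  then show "cos (2 * pi / m (k + 2)) < 1"
    using cos_le_one[of "2 * pi / m (k + 2)"] by linarith
  show "weight m (k + 2) = 2 + 2 * cos (2 * pi / m (k + 2))"
    using cos_double_cos[of "pi / m (k + 2)"] by (simp add: weight_def)
qed

lemma limit_pos: "0 < l k" "0 < l (k + 1)"
proof -
  have "0 \<le> l i" for i by (rule limit_nonneg[OF m p l])
  then show "0 < l k" "0 < l (k + 1)" using k by (simp_all add: less_le)
qed

lemma linear_frame: "linear limit_frame"
  by (rule linearI) (simp_all add: limit_frame_def Let_def vec_eq_iff algebra_simps add_divide_distrib diff_divide_distrib)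

text \<open>The formulas show the centre of the polygon going to a positive multiple of the fixed
  vertex k + 2. Polygon vertex 0 goes to vertex k + 1, which lies on wall k.\<close>

lemma frame_nth:
  fixes x
  defines "c \<equiv> cos (2 * pi / m (k + 2))" and "s \<equiv> sin (2 * pi / m (k + 2))"
    and "P \<equiv> inverse (l k)" and "Q \<equiv> inverse (l (k + 1))"
  shows "limit_frame x $ k = Q / s * x $ 2"
    "limit_frame x $ (k + 1) = x $ 1 - (1 + c) / s * x $ 2"
    "limit_frame x $ (k + 2) = P * Q / (2 * (1 - c)) * (x $ 3 - x $ 1) - P * Q / (2 * s) * x $ 2"
  using limit_pos frame_angle
  by (auto simp: limit_frame_def Let_def c_def s_def P_def Q_def field_simps)

lemma inj_frame: "inj limit_frame"
  unfolding linear_injective_0[OF linear_frame]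
proof (intro allI impI)
  fix x assume x: "limit_frame x = 0"
  have x2: "x $ 2 = 0"
    using arg_cong[OF x, of "\<lambda>y. y $ k"] limit_pos frame_angle by (simp add: frame_nth)
  have x1: "x $ 1 = 0"
    using arg_cong[OF x, of "\<lambda>y. y $ (k + 1)"] x2 by (simp add: frame_nth)
  have "x $ 3 = 0"
    using arg_cong[OF x, of "\<lambda>y. y $ (k + 2)"] x1 x2 limit_pos frame_angle by (simp add: frame_nth)
  then show "x = 0" using x1 x2 by (simp add: vec_eq_iff forall_3)
qed

lemma bij_frame: "bij limit_frame"
  using inj_frame linear_injective_imp_surjective[OF linear_frame] by (simp add: bij_def)

text \<open>Wall k becomes the axis of complex conjugation and wall k + 1 the axis of conjugation
  followed by the rotation by 2 \<pi> / m (k + 2), so the two axes meet at half that angle.\<close>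

lemma frame_flip:
  "limit_refl k (limit_frame x) = limit_frame (flip (gon_vertex (m (k + 2)) 0) x)"
  "limit_refl (k + 1) (limit_frame x) = limit_frame (flip (gon_vertex (m (k + 2)) 1) x)"
proof -
  define c s P Q where "c = cos (2 * pi / m (k + 2))" and "s = sin (2 * pi / m (k + 2))"
    and "P = inverse (l k)" and "Q = inverse (l (k + 1))"
  have s: "0 < s" "c < 1" "weight m (k + 2) = 2 + 2 * c"
    using frame_angle by (simp_all add: c_def s_def)
  have sc: "s * s + c * c = 1"
    using sin_cos_squared_add[of "2 * pi / m (k + 2)"] by (simp add: c_def s_def power2_eq_square)
  have lQ: "l (k + 1) * Q = 1" using k by (simp add: Q_def)
  note nth = frame_nth[folded c_def s_def P_def Q_def]
  have f0: "flip (gon_vertex (m (k + 2)) 0) x = vector [x $ 1, - x $ 2, x $ 3]"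
    by (simp add: flip_def gon_vertex_nth)
  have f1: "flip (gon_vertex (m (k + 2)) 1) x = vector [c * x $ 1 + s * x $ 2, s * x $ 1 - c * x $ 2, x $ 3]"
    by (simp add: flip_def gon_vertex_nth c_def s_def)
  have "(1 + c) / s = s / (1 - c)" using s sc by (simp add: field_simps)
  \<comment> \<open>Naming the quotients (1 + c) / s, 1 / s and 1 / (2 (1 - c)) makes the identities
    polynomial: besides s^2 + c^2 = 1 only the defining equations of h, g and f are
    involved.\<close>
  define h where "h = (1 + c) / s"
  have h: "h * s = 1 + c" "h * (1 - c) = s"
    using s sc by (simp_all add: h_def field_simps)
  define g where "g = 1 / s"
  define f where "f = 1 / (2 * (1 - c))"
  have g: "g * s = 1" and f: "f * (1 - c) * 2 = 1" using s by (simp_all add: g_def f_def)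
  have nth': "limit_frame x $ k = Q * g * x $ 2"
    "limit_frame x $ (k + 1) = x $ 1 - h * x $ 2"
    "limit_frame x $ (k + 2) = P * Q * f * (x $ 3 - x $ 1) - P * Q * g / 2 * x $ 2" for x
    by (simp_all add: nth h_def g_def f_def)
  have hg: "h = (1 + c) * g" by (simp add: h_def g_def)
  have gf: "g * (1 + c) = 2 * f * s"
  proof -
    have "g * (1 + c) * (1 - c) * s = 2 * f * s * (1 - c) * s"
      using g f sc by algebra
    then show ?thesis using s by simp
  qed
  have lq: "limit_tri m l $ (k + 1) $ k * Q = - (2 + 2 * c)" "limit_tri m l $ (k + 2) $ k = - P"
    "limit_tri m l $ k $ (k + 1) = - Q" "limit_tri m l $ (k + 2) $ (k + 1) = 0"
  proof -
    have "(- (2 + 2 * c) * l (k + 1)) * Q = - (2 + 2 * c)" using lQ by algebra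
    then show "limit_tri m l $ (k + 1) $ k * Q = - (2 + 2 * c)" by (simp only: limit_tri_nth s)
  qed (simp_all add: limit_tri_nth P_def Q_def k)
  show "limit_refl k (limit_frame x) = limit_frame (flip (gon_vertex (m (k + 2)) 0) x)"
    unfolding vec_eq_iff forall_cyclic[of _ k] refl_component f0 nth' lq limit_tri_nth(1)
  proof (intro conjI)
    show "x $ 1 - h * x $ 2 - Q * g * x $ 2 * limit_tri m l $ (k + 1) $ k =
      (vector [x $ 1, - x $ 2, x $ 3] :: real^3) $ 1 - h * (vector [x $ 1, - x $ 2, x $ 3] :: real^3) $ 2"
      using lq(1) hg by simp algebra
  qed (simp_all add: algebra_simps)
  show "limit_refl (k + 1) (limit_frame x) = limit_frame (flip (gon_vertex (m (k + 2)) 1) x)"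
    unfolding vec_eq_iff forall_cyclic[of _ k] refl_component f1 nth' lq limit_tri_nth(1)
  proof (intro conjI)
    show "Q * g * x $ 2 - (x $ 1 - h * x $ 2) * - Q =
      Q * g * (vector [c * x $ 1 + s * x $ 2, s * x $ 1 - c * x $ 2, x $ 3] :: real^3) $ 2"
      unfolding hg using g by simp algebra
    show "x $ 1 - h * x $ 2 - (x $ 1 - h * x $ 2) * 2 =
       (vector [c * x $ 1 + s * x $ 2, s * x $ 1 - c * x $ 2, x $ 3] :: real^3) $ 1 -
       h * (vector [c * x $ 1 + s * x $ 2, s * x $ 1 - c * x $ 2, x $ 3] :: real^3) $ 2"
      using h by simp algebra
    have "P * Q * (f * (x $ 3 - x $ 1) - g / 2 * x $ 2) =
      P * Q * (f * (x $ 3 - (c * x $ 1 + s * x $ 2)) - g / 2 * (s * x $ 1 - c * x $ 2))"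
    proof (rule arg_cong[of _ _ "\<lambda>z. P * Q * z"])
      have "2 * (f * (x $ 3 - x $ 1) - g / 2 * x $ 2) =
         2 * (f * (x $ 3 - (c * x $ 1 + s * x $ 2)) - g / 2 * (s * x $ 1 - c * x $ 2))"
        using g f gf by simp algebra
      then show "f * (x $ 3 - x $ 1) - g / 2 * x $ 2 =
         f * (x $ 3 - (c * x $ 1 + s * x $ 2)) - g / 2 * (s * x $ 1 - c * x $ 2)" by simp
    qed
    then show "P * Q * f * (x $ 3 - x $ 1) - P * Q * g / 2 * x $ 2 - (x $ 1 - h * x $ 2) * 0 =
       P * Q * f * ((vector [c * x $ 1 + s * x $ 2, s * x $ 1 - c * x $ 2, x $ 3] :: real^3) $ 3 -
       (vector [c * x $ 1 + s * x $ 2, s * x $ 1 - c * x $ 2, x $ 3] :: real^3) $ 1) -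
       P * Q * g / 2 * (vector [c * x $ 1 + s * x $ 2, s * x $ 1 - c * x $ 2, x $ 3] :: real^3) $ 2"
      by (simp add: algebra_simps)
  qed
qed

lemma limit_word_letter: "w \<in> limit_words l \<Longrightarrow> j \<in> set w \<Longrightarrow> j = k \<or> j = k + 1"
  using k cyclic_cases[of j k] by (auto simp: limit_words_def)

lemma frame_word:
  assumes "w \<in> limit_words l"
  shows "(\<exists>n. \<forall>x. foldr limit_refl w (limit_frame x) = limit_frame (turn (gon_vertex (m (k + 2)) n) x)) \<or>
    (\<exists>n. \<forall>x. foldr limit_refl w (limit_frame x) = limit_frame (flip (gon_vertex (m (k + 2)) n) x))"
  using assms
proof (induction w)
  case Nil
  have "turn (gon_vertex (m (k + 2)) 0) x = x" for x
    by (simp add: turn_def gon_vertex_nth vec_eq_iff forall_3)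
  then show ?case by (intro disjI1 exI[of _ 0]) simp
next
  case (Cons j w)
  have w: "w \<in> limit_words l" using Cons.prems by (simp add: limit_words_def)
  obtain a where a: "limit_refl j (limit_frame x) = limit_frame (flip (gon_vertex (m (k + 2)) a) x)" for x
    using frame_flip limit_word_letter[OF Cons.prems, of j] by auto
  from Cons.IH[OF w] show ?case
    by (auto simp: a flip_flip flip_turn)
qed

text \<open>Every word acts as a turn or a flip by one of the finitely many polygon
  vertices.\<close>

lemma finite_limit_words: "finite ((\<lambda>w. foldr limit_refl w) ` limit_words l)"
proof -
  let ?V = "range (gon_vertex (m (k + 2)))"
  let ?T = "inv_into UNIV limit_frame"
  have fin: "finite ?V" using order_ge[of "k + 2"] by (intro finite_range_gon_vertex) simp
  have "foldr limit_refl w \<in> (\<lambda>v z. limit_frame (turn v (?T z))) ` ?V \<union> (\<lambda>v z. limit_frame (flip v (?T z))) ` ?V"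
    if "w \<in> limit_words l" for w
  proof -
    have T: "z = limit_frame (?T z)" for z using bij_frame by (simp add: bij_def surj_f_inv_f)
    from frame_word[OF that] show ?thesis
    proof (elim disjE exE)
      fix n assume "\<forall>x. foldr limit_refl w (limit_frame x) = limit_frame (turn (gon_vertex (m (k + 2)) n) x)"
      then have "foldr limit_refl w = (\<lambda>z. limit_frame (turn (gon_vertex (m (k + 2)) n) (?T z)))"
        using T by (metis ext)
      then show ?thesis by blast
    next
      fix n assume "\<forall>x. foldr limit_refl w (limit_frame x) = limit_frame (flip (gon_vertex (m (k + 2)) n) x)"
      then have "foldr limit_refl w = (\<lambda>z. limit_frame (flip (gon_vertex (m (k + 2)) n) (?T z)))"
        using T by (metis ext)
      then show ?thesis by blast
    qed
  qed
  then have "(\<lambda>w. foldr limit_refl w) ` limit_words l \<subseteq> (\<lambda>v z. limit_frame (turn v (?T z))) ` ?V \<union>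
      (\<lambda>v z. limit_frame (flip v (?T z))) ` ?V" by blast
  then show ?thesis by (rule finite_subset) (simp add: fin)
qed

lemma limit_words_Cons: "j = k \<or> j = k + 1 \<Longrightarrow> w \<in> limit_words l \<Longrightarrow> j # w \<in> limit_words l"
  using k by (auto simp: limit_words_def)

lemma limit_cone_word: "z \<in> limit_cone m l \<Longrightarrow> w \<in> limit_words l \<Longrightarrow> foldr limit_refl w z \<in> limit_cone m l"
  unfolding limit_cone_def
proof (intro CollectI ballI allI impI)
  fix v i assume z: "z \<in> {z. \<forall>w\<in>limit_words l. \<forall>i. l i = 0 \<longrightarrow> 0 \<le> foldr limit_refl w z $ i}"
    and w: "w \<in> limit_words l" and v: "v \<in> limit_words l" "l i = 0"
  have "v @ w \<in> limit_words l" using v w by (auto simp: limit_words_def)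
  then have "0 \<le> foldr limit_refl (v @ w) z $ i" using z v(2) by blast
  then show "0 \<le> foldr limit_refl v (foldr limit_refl w z) $ i" by simp
qed

text \<open>The orbit of z under the surviving dihedral group is finite, so \<psi> has a maximum on
  it. At the maximum neither reflection can increase \<psi>, which forces the coordinates of the two
  surviving walls to be non-negative.\<close>

lemma limit_cone_two_descent:
  assumes z: "z \<in> limit_cone m l"
  shows "\<exists>w\<in>limit_words l. foldr limit_refl w z \<in> orthant"
proof -
  define Q where "Q = inverse (l (k + 1))"
  define W where "W = weight m (k + 2)"
  have Q: "0 < Q" "l (k + 1) * Q = 1" using limit_pos by (simp_all add: Q_def)
  have W: "W < 4" using weight_bounds(3)[of m, OF order_ge] by (simp add: W_def)
  \<comment> \<open>The coefficients make \<psi> positive on both columns, with the values (4 - W) /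
    2 and Q (4 - W) / 4; this uses W < 4.\<close>
  define \<psi> where "\<psi> y = (W + 4) / 4 * y $ k + Q * y $ (k + 1)" for y :: "real^3"
  let ?O = "(\<lambda>f. \<psi> (f z)) ` ((\<lambda>w. foldr limit_refl w) ` limit_words l)"
  have fin: "finite ?O" using finite_limit_words by blast
  have "[] \<in> limit_words l" by (simp add: limit_words_def)
  then have "?O \<noteq> {}" by blast
  with fin have "Max ?O \<in> ?O" by (rule Max_in)
  then obtain w where w: "w \<in> limit_words l" "Max ?O = \<psi> (foldr limit_refl w z)" by blast
  define y where "y = foldr limit_refl w z"
  have max: "\<psi> (limit_refl j y) \<le> \<psi> y" if "j = k \<or> j = k + 1" for j
  proof -
    have "j # w \<in> limit_words l" using limit_words_Cons that w by blast
    then have "\<psi> (foldr limit_refl (j # w) z) \<in> ?O" by blast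
    then have "\<psi> (foldr limit_refl (j # w) z) \<le> Max ?O" using fin by (rule Max_ge[rotated])
    then show ?thesis using w(2) by (simp add: y_def)
  qed
  have "\<psi> (limit_refl k y) = \<psi> y - (4 - W) / 2 * y $ k"
  proof -
    have "Q * (y $ k * (W * l (k + 1))) = W * y $ k" using Q(2) by algebra
    then show ?thesis
      unfolding \<psi>_def refl_component limit_tri_nth W_def[symmetric] by (simp add: algebra_simps)
        (simp add: field_simps)
  qed
  then have "0 \<le> (4 - W) / 2 * y $ k" using max[of k] by simp
  then have 0: "0 \<le> y $ k" using W by (simp add: zero_le_mult_iff)
  have "\<psi> (limit_refl (k + 1) y) = \<psi> y - Q * (4 - W) / 4 * y $ (k + 1)"
    unfolding \<psi>_def refl_component limit_tri_nth Q_def[symmetric] by (simp add: field_simps)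
  then have "0 \<le> Q * (4 - W) / 4 * y $ (k + 1)" using max[of "k + 1"] by simp
  moreover have "0 < Q * (4 - W) / 4" using W Q by simp
  ultimately have 1: "0 \<le> y $ (k + 1)" using zero_le_mult_iff not_less by metis
  have "0 \<le> y $ (k + 2)" using z w(1) k(3) by (simp add: limit_cone_def y_def)
  then have "y \<in> orthant" using 0 1 unfolding orthant_def mem_Collect_eq forall_cyclic[of _ k] by blast
  then show ?thesis using w(1) by (auto simp: y_def)
qed

lemma frame_vertex_0: "limit_frame (gon_vertex (m (k + 2)) 0) = axis (k + 1) 1"
  unfolding vec_eq_iff forall_cyclic[of _ k] frame_nth by (simp add: gon_vertex_nth axis_def)

text \<open>The vertices of the polygon form the orbit of vertex k + 1, so they lie in the limit
  cone. Conversely the polygon is invariant under both reflections and contains the three vertices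
  of the chamber, hence the orthant, and descent sends every point of the limit cone into the
  orthant.\<close>

lemma limit_cone_two: "limit_cone m l = limit_frame ` gon_cone (m (k + 2))"
proof
  let ?v = "gon_vertex (m (k + 2))" and ?G = "limit_frame ` gon_cone (m (k + 2))"
  have Bk: "limit_refl k x \<in> limit_cone m l" "limit_refl (k + 1) x \<in> limit_cone m l" if "x \<in> limit_cone m l" for x
    using limit_cone_word[OF that, of "[k]"] limit_cone_word[OF that, of "[k + 1]"] k
    by (simp_all add: limit_words_def)
  \<comment> \<open>The reflections act on vertex numbers by a \<mapsto> - a and a \<mapsto> 1 - a,
    which together reach every integer from 0.\<close>
  have step: "limit_frame (?v (- a)) \<in> limit_cone m l" "limit_frame (?v (1 - a)) \<in> limit_cone m l"
    if "limit_frame (?v a) \<in> limit_cone m l" for a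
    using Bk[OF that] by (simp_all add: frame_flip flip_gon_vertex)
  have v0: "limit_frame (?v 0) \<in> limit_cone m l"
    unfolding frame_vertex_0
    using limit_word_orthant[OF m p l, of "axis (k + 1) 1" "[]"]
    by (auto simp: orthant_def axis_def limit_words_def)
  have nat: "limit_frame (?v (int n)) \<in> limit_cone m l" for n
  proof (induction n)
    case (Suc n)
    then show ?case using step(2)[OF step(1)[OF Suc.IH]] by (simp add: add.commute)
  qed (use v0 in simp)
  have "limit_frame (?v a) \<in> limit_cone m l" for a
    using nat[of "nat a"] step(1)[OF nat[of "nat (- a)"]] by (cases "0 \<le> a") auto
  moreover have "0 \<in> limit_cone m l"
    by (simp add: limit_cone_def linear_0[OF linear_refl_word])
  ultimately show "?G \<subseteq> limit_cone m l"
    using linear_frame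
    by (intro gon_cone_linear_subset) (auto intro: limit_cone_add[OF m p l] limit_cone_scaleR[OF m p l])
  have G: "x + y \<in> ?G" "c *\<^sub>R x \<in> ?G" if "x \<in> ?G" "y \<in> ?G" "0 \<le> c" for x y c
    using that gon_cone_add gon_cone_scaleR
    by (auto simp: linear_add[OF linear_frame, symmetric] linear_cmul[OF linear_frame, symmetric])
  have flipG: "flip (?v a) ` gon_cone (m (k + 2)) \<subseteq> gon_cone (m (k + 2))" for a
    by (intro gon_cone_linear_subset linear_flip)
      (auto simp: flip_gon_vertex intro: gon_cone_vertex gon_cone_add gon_cone_scaleR gon_cone_0)
  have BG: "limit_refl j z \<in> ?G" if z: "z \<in> ?G" and j: "j = k \<or> j = k + 1" for j z
  proof -
    obtain x where x: "x \<in> gon_cone (m (k + 2))" "z = limit_frame x" using z by blast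
    have "flip (?v 0) x \<in> gon_cone (m (k + 2))" "flip (?v 1) x \<in> gon_cone (m (k + 2))"
      using flipG x(1) by blast+
    then show ?thesis using j by (auto simp: x(2) frame_flip)
  qed
  have wG: "foldr limit_refl w z \<in> ?G" if "z \<in> ?G" "\<forall>j\<in>set w. j = k \<or> j = k + 1" for w z
    using that by (induction w) (auto simp del: image_iff intro!: BG)
  have a1: "axis (k + 1) 1 \<in> ?G"
    using frame_vertex_0 gon_cone_vertex by (metis imageI)
  \<comment> \<open>Vertex k is, up to scale, the midpoint between vertex k + 1 and its mirror image
    in wall k + 1.\<close>
  have a0: "axis k 1 \<in> ?G"
  proof -
    have "axis k 1 = l (k + 1) *\<^sub>R (axis (k + 1) 1 + limit_refl (k + 1) (axis (k + 1) 1))"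
      unfolding vec_eq_iff forall_cyclic[of _ k]
      using k by (simp add: refl_component limit_tri_nth axis_def)
    moreover have "axis (k + 1) 1 + limit_refl (k + 1) (axis (k + 1) 1) \<in> ?G"
      using a1 BG by (intro G(1)[where c = 0]) auto
    ultimately show ?thesis using G(2) a1 limit_pos by (metis less_imp_le)
  qed
  \<comment> \<open>Vertex k + 2 is, up to scale, the centre of the polygon.\<close>
  have a2: "axis (k + 2) 1 \<in> ?G"
  proof -
    define a where "a = limit_frame (axis 3 1) $ (k + 2)"
    have a: "a > 0" "limit_frame (axis 3 1) = a *\<^sub>R axis (k + 2) 1"
      unfolding a_def vec_eq_iff forall_cyclic[of _ k] frame_nth
      using limit_pos frame_angle by (simp_all add: axis_def)
    have "limit_frame (axis 3 1) \<in> ?G" using gon_cone_center[OF order_ge] by blast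
    then have "inverse a *\<^sub>R limit_frame (axis 3 1) \<in> ?G" using G(2) a(1) a1 by (metis inverse_nonnegative_iff_nonnegative less_imp_le)
    then show ?thesis using a by simp
  qed
  have orth: "y \<in> ?G" if y: "y \<in> orthant" for y
  proof -
    have "y = y $ k *\<^sub>R axis k 1 + y $ (k + 1) *\<^sub>R axis (k + 1) 1 + y $ (k + 2) *\<^sub>R axis (k + 2) 1"
      unfolding vec_eq_iff forall_cyclic[of _ k] by (simp add: axis_def)
    moreover have "y $ k *\<^sub>R axis k 1 + y $ (k + 1) *\<^sub>R axis (k + 1) 1 + y $ (k + 2) *\<^sub>R axis (k + 2) 1 \<in> ?G"
      using y a0 a1 a2 by (intro G(1)[where c = 0] G(2)[where y = "axis k 1"]) (auto simp: orthant_def)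
    ultimately show ?thesis by simp
  qed
  show "limit_cone m l \<subseteq> ?G"
  proof
    fix z assume "z \<in> limit_cone m l"
    then obtain w where w: "w \<in> limit_words l" "foldr limit_refl w z \<in> orthant"
      using limit_cone_two_descent by blast
    have "foldr limit_refl (rev w) (foldr limit_refl w z) \<in> ?G"
      using w limit_word_letter by (intro wG orth) auto
    then show "z \<in> ?G" using limit_word_rev[of m l "rev w" z] by simp
  qed
qed

text \<open>Finitely many half-spaces cut out the limit cone, so the strict inequalities define an
  open set. They hold at b because e_(k+2) is fixed by the group and contributes
  \<open>b $ (k + 2)\<close> to every image of b.\<close>

lemma limit_cone_two_interior:
  assumes "b \<in> orthant" "0 < b $ (k + 2)"
  shows "b \<in> interior (limit_cone m l)"
proof (rule interiorI)
  let ?F = "(\<lambda>w. foldr limit_refl w) ` limit_words l"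
  show "open (\<Inter>f\<in>?F. {z. 0 < f z $ (k + 2)})"
  proof (intro open_INT finite_limit_words ballI)
    fix f assume "f \<in> ?F"
    then have "linear f" using linear_refl_word by blast
    then show "open {z. 0 < f z $ (k + 2)}"
      by (intro open_Collect_less continuous_intros linear_continuous_on linear_conv_bounded_linear[THEN iffD1])
  qed
  show "(\<Inter>f\<in>?F. {z. 0 < f z $ (k + 2)}) \<subseteq> limit_cone m l"
  proof
    fix z assume z: "z \<in> (\<Inter>f\<in>?F. {z. 0 < f z $ (k + 2)})"
    have "i = k + 2" if "l i = 0" for i using that k cyclic_cases[of i k] by auto
    then show "z \<in> limit_cone m l"
      using z by (auto simp: limit_cone_def intro!: less_imp_le)
  qed
  show "b \<in> (\<Inter>f\<in>?F. {z. 0 < f z $ (k + 2)})"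
  proof
    fix f assume "f \<in> ?F"
    then obtain w where w: "w \<in> limit_words l" "f = foldr limit_refl w" by blast
    define y where "y = b - b $ (k + 2) *\<^sub>R axis (k + 2) 1"
    have y: "y \<in> orthant" using assms(1) by (auto simp: y_def orthant_def axis_def)
    have e: "foldr limit_refl w (axis (k + 2) 1) = axis (k + 2) 1"
      using w(1)
    proof (induction w)
      case (Cons j w)
      have "j = k \<or> j = k + 1" "w \<in> limit_words l"
        using limit_word_letter[OF Cons.prems] Cons.prems by (auto simp: limit_words_def)
      then show ?case using Cons.IH by (auto simp: refl_def axis_def)
    qed simp
    have "foldr limit_refl w y \<in> limit_cone m l" using limit_word_orthant[OF m p l y w(1)] .
    moreover have "[] \<in> limit_words l" by (simp add: limit_words_def)
    ultimately have "\<forall>i. l i = 0 \<longrightarrow> 0 \<le> foldr limit_refl [] (foldr limit_refl w y) $ i"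
      unfolding limit_cone_def by blast
    then have "0 \<le> foldr limit_refl w y $ (k + 2)" using k(3) by simp
    moreover have "foldr limit_refl w b = foldr limit_refl w y + b $ (k + 2) *\<^sub>R axis (k + 2) 1"
    proof -
      have "b = y + b $ (k + 2) *\<^sub>R axis (k + 2) 1" by (simp add: y_def)
      then show ?thesis
        using e linear_add[OF linear_refl_word] linear_cmul[OF linear_refl_word] by metis
    qed
    ultimately show "b \<in> {z. 0 < f z $ (k + 2)}" using assms(2) w(2) by (simp add: axis_def)
  qed
qed

end

lemma open_image_linear_interior:
  fixes E :: "real^3 \<Rightarrow> real^3"
  assumes "linear E" "inj E"
  shows "interior (E ` S) = E ` interior S"
  using interior_bijective_linear_image[of E] assms linear_injective_imp_surjective[of E]
  by (simp add: bij_def)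

text \<open>By cyclic symmetry one starts at an escaping wall and distinguishes which of the other
  two survive. The last conclusion is shaped for the rescaled base points, whose positivity is known
  at the escaping walls only.\<close>

lemma limit_cone_cases:
  assumes m: "hyperbolic_orders m" and p: "\<And>n i. 1 \<le> p n i"
    and l: "\<And>i. (\<lambda>n. inverse (p n i)) \<longlonglongrightarrow> l i" and "l i0 = 0"
  obtains E K where "K \<in> insert 3 (range m)" "linear E" "inj E" "limit_cone m l = E ` gon_cone K"
    "cone_limit (\<lambda>n. tits (tri m (p n))) (limit_cone m l)"
    "\<And>b. b \<in> orthant \<Longrightarrow> (\<And>i. l i = 0 \<Longrightarrow> 0 < b $ i) \<Longrightarrow> b \<in> interior (limit_cone m l)"
proof -
  obtain G where G: "linear G" "inj G" "G ` gon_cone 3 = orthant" by (rule orthant_gon_cone)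
  consider "\<And>i. l i = 0" | k where "l k \<noteq> 0" "l (k + 1) = 0" "l (k + 2) = 0"
    | k where "l k \<noteq> 0" "l (k + 1) \<noteq> 0" "l (k + 2) = 0"
  proof -
    note i = \<open>l i0 = 0\<close>
    consider "l (i0 + 1) = 0" "l (i0 + 2) = 0" | "l (i0 + 1) = 0" "l (i0 + 2) \<noteq> 0"
      | "l (i0 + 1) \<noteq> 0" "l (i0 + 2) = 0" | "l (i0 + 1) \<noteq> 0" "l (i0 + 2) \<noteq> 0" by blast
    then show thesis
    proof cases
      case 1
      then have "l i = 0" for i using i cyclic_cases[of i i0] by auto
      then show ?thesis using that(1) by blast
    next
      case 2 then show ?thesis using that(2)[of "i0 + 2"] i by simp
    next
      case 3 then show ?thesis using that(2)[of "i0 + 1"] i by simp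
    next
      case 4 then show ?thesis using that(3)[of "i0 + 1"] i by simp
    qed
  qed
  then show ?thesis
  proof cases
    case 1
    show ?thesis
    proof (rule that[of 3 G])
      show "limit_cone m l = G ` gon_cone 3" using limit_cone_none(1)[where p = p and l = l, OF m p l 1] G(3) by simp
      show "cone_limit (\<lambda>n. tits (tri m (p n))) (limit_cone m l)"
        using limit_cone_none(2)[where p = p and l = l, OF m p l 1]
        by (intro cone_limit_tits[where p = p and l = l, OF m p l]) blast
      show "b \<in> interior (limit_cone m l)" if "b \<in> orthant" "\<And>i. l i = 0 \<Longrightarrow> 0 < b $ i" for b
        using limit_cone_none(3)[where p = p and l = l, OF m p l 1] that(2) 1 by blast
    qed (use G in auto)
  next
    case (2 k)
    note one = limit_cone_one[where p = p and l = l, OF m p l 2]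
    obtain F where F: "limit_cone m l = F ` orthant" "linear F" "inj F" using one(1-3) by blast
    show ?thesis
    proof (rule that[of 3 "F \<circ> G"])
      show "linear (F \<circ> G)" "inj (F \<circ> G)"
        using F G by (auto intro: linear_compose inj_compose)
      show "limit_cone m l = (F \<circ> G) ` gon_cone 3" by (simp only: F(1) G(3)[symmetric] image_comp)
      show "cone_limit (\<lambda>n. tits (tri m (p n))) (limit_cone m l)"
        using cone_limit_tits[where p = p and l = l, OF m p l] one(4) by blast
      show "b \<in> interior (limit_cone m l)" if "b \<in> orthant" "\<And>i. l i = 0 \<Longrightarrow> 0 < b $ i" for b
        using that 2 by (intro one(5)) (auto simp: orthant_def)
    qed simp
  next
    case (3 k)
    show ?thesis
      using that[of "m (k + 2)" "limit_frame m l k"] linear_frame[where p = p and l = l, OF m p l 3] inj_frame[where p = p and l = l, OF m p l 3]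
        limit_cone_two[where p = p and l = l, OF m p l 3] cone_limit_tits[where p = p and l = l, OF m p l] limit_cone_two_descent[where p = p and l = l, OF m p l 3]
        limit_cone_two_interior[where p = p and l = l, OF m p l 3] 3(3) by blast
  qed
qed

section \<open>Compactness of the maps that compare cones\<close>

lemma cone_limit_lower:
  assumes "cone_limit U L" "z \<in> L"
  shows "\<exists>y. (\<forall>n. y n \<in> U n) \<and> y \<longlonglongrightarrow> z"
  using assms(1)[unfolded cone_limit_def, THEN conjunct1, rule_format, OF assms(2)] .

lemma cone_limit_upper:
  assumes "cone_limit U L" "strict_mono r" "\<And>n. y n \<in> U (r n)" "y \<longlonglongrightarrow> z"
  shows "z \<in> L"
  using assms(1)[unfolded cone_limit_def, THEN conjunct2, rule_format, OF assms(2-4)] .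

lemma closure_limitI: "(\<And>n. x n \<in> S) \<Longrightarrow> x \<longlonglongrightarrow> l \<Longrightarrow> l \<in> closure S"
  for l :: "'a :: metric_space"
  by (auto simp: closure_sequential)

lemma closed_limit_cone: "closed (limit_cone m l)"
proof -
  have "limit_cone m l = (\<Inter>w\<in>limit_words l. \<Inter>i\<in>{i. l i = 0}. {z. 0 \<le> foldr (refl (limit_tri m l)) w z $ i})"
    by (auto simp: limit_cone_def)
  moreover have "closed {z. 0 \<le> foldr (refl (limit_tri m l)) w z $ i}" for w i
    by (intro closed_Collect_le continuous_intros linear_continuous_on
        linear_conv_bounded_linear[THEN iffD1] linear_refl_word)
  ultimately show ?thesis by (metis (no_types, lifting) closed_INT)
qed

lemma gon_cone_bound:
  assumes "x \<in> gon_cone k" shows "\<bar>x $ 1\<bar> \<le> x $ 3" "\<bar>x $ 2\<bar> \<le> x $ 3"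
proof -
  have "id ` gon_cone k \<subseteq> {x. \<bar>x $ 1\<bar> \<le> x $ 3 \<and> \<bar>x $ 2\<bar> \<le> x $ 3}"
  proof (rule gon_cone_linear_subset)
    show "c *\<^sub>R x \<in> {x. \<bar>x $ 1\<bar> \<le> x $ 3 \<and> \<bar>x $ 2\<bar> \<le> x $ 3}"
      if "x \<in> {x. \<bar>x $ 1\<bar> \<le> x $ 3 \<and> \<bar>x $ 2\<bar> \<le> x $ 3}" "0 \<le> c" for c and x :: "real^3"
      using that by (auto simp: abs_mult intro!: mult_left_mono)
  qed (auto simp: gon_vertex_nth linear_id abs_le_iff)
  then show "\<bar>x $ 1\<bar> \<le> x $ 3" "\<bar>x $ 2\<bar> \<le> x $ 3" using assms by auto
qed

lemma gon_cone_pointed: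
  assumes "x \<in> gon_cone k" "- x \<in> gon_cone k" shows "x = 0"
  using gon_cone_bound[OF assms(1)] gon_cone_bound[OF assms(2)] by (auto simp: vec_eq_iff forall_3)

lemma gon_image_pointed:
  assumes "linear E" "inj E" "x \<in> E ` gon_cone k" "- x \<in> E ` gon_cone k" shows "x = 0"
proof -
  obtain y z where y: "x = E y" "y \<in> gon_cone k" "- x = E z" "z \<in> gon_cone k" using assms(3,4) by blast
  then have "E z = E (- y)" using assms(1) by (simp add: linear_neg)
  then have "z = - y" using assms(2) by (simp add: inj_eq)
  then have "y = 0" using y gon_cone_pointed by blast
  then show ?thesis using y(1) assms(1) by (simp add: linear_0)
qed

lemma tendsto_matrix_vector_mult:
  fixes A :: "'a \<Rightarrow> real^3^3"
  assumes "(A \<longlongrightarrow> E) F" "(x \<longlongrightarrow> z) F"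
  shows "((\<lambda>n. A n *v x n) \<longlongrightarrow> E *v z) F"
proof (rule vec_tendstoI)
  show "((\<lambda>n. (A n *v x n) $ i) \<longlongrightarrow> (E *v z) $ i) F" for i
    unfolding matrix_vector_mult_def by (simp add: assms tendsto_vec_nth tendsto_mult tendsto_sum)
qed

lemma matrix_subsequence:
  fixes A :: "nat \<Rightarrow> real^3^3"
  assumes "\<And>n. norm (A n) = 1"
  obtains r E where "strict_mono (r :: nat \<Rightarrow> nat)" "(A \<circ> r) \<longlonglongrightarrow> E" "norm E = 1"
proof -
  have "compact (sphere 0 1 :: (real^3^3) set)" by simp
  then obtain E r where "E \<in> sphere 0 1" "strict_mono (r :: nat \<Rightarrow> nat)" "(A \<circ> r) \<longlonglongrightarrow> E"
    using assms unfolding compact_def by (metis dist_0_norm mem_sphere)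
  then show ?thesis using that by simp
qed

text \<open>If E kills b, it sends b + t v and b - t v to opposite vectors of the pointed cone C, so
  it kills every v.\<close>

lemma interior_functional_kernel:
  fixes E :: "real^3^3"
  assumes "b \<in> interior L" "E *v b = 0" "\<And>x. x \<in> L \<Longrightarrow> E *v x \<in> C" "\<And>x. x \<in> C \<Longrightarrow> - x \<in> C \<Longrightarrow> x = 0"
  shows "E = 0"
proof -
  obtain e where e: "0 < e" "ball b e \<subseteq> L" using assms(1) mem_interior by blast
  have "E *v v = 0" for v
  proof (cases "v = 0")
    case False
    define t where "t = e / (2 * norm v)"
    have t: "0 < t" using e False by (simp add: t_def)
    have "b + t *\<^sub>R v \<in> L" "b - t *\<^sub>R v \<in> L"
      using e False by (auto simp: subset_iff dist_norm t_def)
    then have "E *v (b + t *\<^sub>R v) \<in> C" "E *v (b - t *\<^sub>R v) \<in> C" using assms(3) by blast+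
    then have "t *\<^sub>R (E *v v) \<in> C" "- (t *\<^sub>R (E *v v)) \<in> C"
      using assms(2) by (simp_all add: matrix_vector_right_distrib matrix_vector_mult_diff_distrib matrix_vector_mult_scaleR)
    then have "t *\<^sub>R (E *v v) = 0" by (rule assms(4))
    then show ?thesis using t by simp
  qed simp
  then show ?thesis by (simp add: matrix_eq)
qed

text \<open>Normalised to norm one, the maps \<open>M n\<close> and their inverses accumulate at nonzero \<open>E\<close> and \<open>F\<close> with
  \<open>F E\<close> scalar; the base points show that this scalar does not vanish.\<close>

lemma cone_rigidity:
  fixes M :: "nat \<Rightarrow> real^3^3"
  assumes inv: "\<And>n. invertible (M n)" and img: "\<And>n. V n = (*v) (M n) ` U n"
    and U: "cone_limit U L"
    and V_lower: "\<And>z. z \<in> K \<Longrightarrow> \<exists>y. (\<forall>n. y n \<in> V n) \<and> y \<longlonglongrightarrow> z"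
    and V_upper: "\<And>r y z. strict_mono (r :: nat \<Rightarrow> nat) \<Longrightarrow> (\<And>n. y n \<in> V (r n)) \<Longrightarrow> y \<longlonglongrightarrow> z \<Longrightarrow> z \<in> closure K"
    and U_scale: "\<And>n c x. x \<in> U n \<Longrightarrow> 0 \<le> c \<Longrightarrow> c *\<^sub>R x \<in> U n"
    and K: "open K" "y \<in> K" "\<And>x. x \<in> closure K \<Longrightarrow> - x \<in> closure K \<Longrightarrow> x = 0"
    and L: "closed L" "\<And>x. x \<in> L \<Longrightarrow> - x \<in> L \<Longrightarrow> x = 0" "\<And>c x. x \<in> L \<Longrightarrow> 0 \<le> c \<Longrightarrow> c *\<^sub>R x \<in> L"
    and b: "\<And>n. \<beta> n \<in> U n" "\<beta> \<longlonglongrightarrow> b" "b \<in> interior L" "(\<lambda>n. M n *v \<beta> n) \<longlonglongrightarrow> y" "y \<noteq> 0"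
  obtains E where "invertible E" "(*v) E ` L = closure K"
proof -
  define N where "N n = matrix_inv (M n)" for n
  have NM: "N n *v (M n *v x) = x" "M n *v (N n *v x) = x" for n x
    using inv by (simp_all add: N_def)
  have nz: "M n \<noteq> 0" "N n \<noteq> 0" for n
  proof -
    have "axis 1 1 = N n *v (M n *v axis 1 1)" by (simp add: NM)
    moreover have "axis 1 1 \<noteq> (0 :: real^3)" by simp
    ultimately show "M n \<noteq> 0" "N n \<noteq> 0" by auto
  qed
  define M' where "M' n = M n /\<^sub>R norm (M n)" for n
  define N' where "N' n = N n /\<^sub>R norm (N n)" for n
  have norm1: "norm (M' n) = 1" "norm (N' n) = 1" for n using nz by (simp_all add: M'_def N'_def)
  obtain r1 E where r1: "strict_mono (r1 :: nat \<Rightarrow> nat)" "(M' \<circ> r1) \<longlonglongrightarrow> E" "norm E = 1"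
    using matrix_subsequence[of M'] norm1 by blast
  obtain r2 F where r2: "strict_mono (r2 :: nat \<Rightarrow> nat)" "(N' \<circ> r1 \<circ> r2) \<longlonglongrightarrow> F" "norm F = 1"
    using matrix_subsequence[of "N' \<circ> r1"] norm1 by (metis comp_apply)
  define r where "r = r1 \<circ> r2"
  have r: "strict_mono r" "(M' \<circ> r) \<longlonglongrightarrow> E" "(N' \<circ> r) \<longlonglongrightarrow> F"
    using r1 r2 LIMSEQ_subseq_LIMSEQ[OF r1(2) r2(1)] by (auto simp: r_def strict_mono_o o_assoc)
  have M'x: "M' n *v x = inverse (norm (M n)) *\<^sub>R (M n *v x)" and N'x: "N' n *v x = inverse (norm (N n)) *\<^sub>R (N n *v x)" for n x
    by (simp_all add: M'_def N'_def scaleR_matrix_vector_assoc)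
  have EL: "E *v z \<in> closure K" if z: "z \<in> L" for z
  proof -
    obtain x where x: "\<And>n. x n \<in> U n" "x \<longlonglongrightarrow> z" using cone_limit_lower[OF U z] by blast
    have "(\<lambda>n. (M' \<circ> r) n *v (x \<circ> r) n) \<longlonglongrightarrow> E *v z"
      by (intro tendsto_matrix_vector_mult r LIMSEQ_subseq_LIMSEQ[OF x(2) r(1)])
    moreover have "(M' \<circ> r) n *v (x \<circ> r) n \<in> V (r n)" for n
    proof -
      have "inverse (norm (M (r n))) *\<^sub>R x (r n) \<in> U (r n)" using x(1) by (intro U_scale) auto
      then show ?thesis unfolding img by (auto simp: M'x matrix_vector_mult_scaleR[symmetric])
    qed
    ultimately show ?thesis
      using V_upper[OF r(1), where y = "\<lambda>n. (M' \<circ> r) n *v (x \<circ> r) n" and z = "E *v z"] by blast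
  qed
  have FK: "F *v z \<in> L" if z: "z \<in> K" for z
  proof -
    obtain x where x: "\<And>n. x n \<in> V n" "x \<longlonglongrightarrow> z" using V_lower[OF z] by blast
    have "(\<lambda>n. (N' \<circ> r) n *v (x \<circ> r) n) \<longlonglongrightarrow> F *v z"
      by (intro tendsto_matrix_vector_mult r LIMSEQ_subseq_LIMSEQ[OF x(2) r(1)])
    moreover have "(N' \<circ> r) n *v (x \<circ> r) n \<in> U (r n)" for n
    proof -
      obtain u where "u \<in> U (r n)" "x (r n) = M (r n) *v u" using x(1)[of "r n"] img by blast
      then show ?thesis using U_scale by (simp add: N'x NM)
    qed
    ultimately show ?thesis
      using cone_limit_upper[OF U r(1), where y = "\<lambda>n. (N' \<circ> r) n *v (x \<circ> r) n" and z = "F *v z"] by blast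
  qed
  have FKc: "F *v z \<in> L" if z: "z \<in> closure K" for z
  proof -
    obtain x where x: "\<And>n. x n \<in> K" "x \<longlonglongrightarrow> z" using z closure_sequential by blast
    have "(\<lambda>n. F *v x n) \<longlonglongrightarrow> F *v z" by (intro tendsto_matrix_vector_mult x tendsto_const)
    then show ?thesis
      using closed_sequentially[OF L(1), of "\<lambda>n. F *v x n" "F *v z"] FK[OF x(1)] by simp
  qed
  \<comment> \<open>A limit map that killed the base point on its side would vanish altogether,
    against its norm 1.\<close>
  have Eb: "E *v b \<noteq> 0"
    using interior_functional_kernel[OF b(3) _ EL K(3)] r1(3) by auto
  have Fy: "F *v y \<noteq> 0"
    using interior_functional_kernel[of y K F L] K(1,2) FK L(2) r2(3) by (auto simp: interior_open)
  have lim: "(\<lambda>n. (M' \<circ> r) n *v (\<beta> \<circ> r) n) \<longlonglongrightarrow> E *v b"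
    by (intro tendsto_matrix_vector_mult r LIMSEQ_subseq_LIMSEQ[OF b(2) r(1)])
  have limy: "(\<lambda>n. M (r n) *v \<beta> (r n)) \<longlonglongrightarrow> y"
    using LIMSEQ_subseq_LIMSEQ[OF b(4) r(1)] by (simp add: o_def)
  \<comment> \<open>The images of the base points converge to the nonzero y without normalisation,
    so the factors 1 / norm M converge too, to \<mu>, and E b = \<mu> y.\<close>
  define \<mu> where "\<mu> = norm (E *v b) / norm y"
  have "(\<lambda>n. norm ((M' \<circ> r) n *v (\<beta> \<circ> r) n) / norm (M (r n) *v \<beta> (r n))) \<longlonglongrightarrow> \<mu>"
    unfolding \<mu>_def using b(5) by (intro tendsto_divide tendsto_norm lim limy) auto
  moreover have "eventually (\<lambda>n. norm ((M' \<circ> r) n *v (\<beta> \<circ> r) n) / norm (M (r n) *v \<beta> (r n)) = inverse (norm (M (r n)))) sequentially"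
  proof -
    have "eventually (\<lambda>n. M (r n) *v \<beta> (r n) \<noteq> 0) sequentially"
      using limy b(5) tendsto_imp_eventually_ne by blast
    then show ?thesis by eventually_elim (simp add: M'x)
  qed
  ultimately have inv_lim: "(\<lambda>n. inverse (norm (M (r n)))) \<longlonglongrightarrow> \<mu>"
    by (rule Lim_transform_eventually)
  then have "(\<lambda>n. inverse (norm (M (r n))) *\<^sub>R (M (r n) *v \<beta> (r n))) \<longlonglongrightarrow> \<mu> *\<^sub>R y"
    by (intro tendsto_scaleR limy)
  then have "E *v b = \<mu> *\<^sub>R y" using lim LIMSEQ_unique by (fastforce simp: M'x)
  define s where "s n = inverse (norm (M n)) * inverse (norm (N n))" for n
  have NMs: "N' n *v (M' n *v x) = s n *\<^sub>R x" for n x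
    by (simp add: M'x N'x NM matrix_vector_mult_scaleR s_def)
  have limNM: "(\<lambda>n. s (r n) *\<^sub>R x) \<longlonglongrightarrow> F *v (E *v x)" for x
  proof -
    have "(\<lambda>n. (N' \<circ> r) n *v ((M' \<circ> r) n *v x)) \<longlonglongrightarrow> F *v (E *v x)"
      by (intro tendsto_matrix_vector_mult r tendsto_const)
    then show ?thesis by (simp add: NMs)
  qed
  define t where "t = (F *v (E *v axis 1 1)) $ 1"
  have "(\<lambda>n. s (r n)) \<longlonglongrightarrow> t"
    using tendsto_vec_nth[OF limNM[of "axis 1 1"], of 1] by (simp add: t_def)
  then have FE: "F *v (E *v x) = t *\<^sub>R x" for x
    using limNM[of x] LIMSEQ_unique tendsto_scaleR[OF _ tendsto_const] by blast
  have "0 \<le> s n" for n by (simp add: s_def)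
  then have "0 \<le> t" using \<open>(\<lambda>n. s (r n)) \<longlonglongrightarrow> t\<close> LIMSEQ_le_const by blast
  \<comment> \<open>Otherwise F would kill E b = \<mu> y, although neither \<mu> nor F y
    vanishes.\<close>
  moreover have "t \<noteq> 0"
  proof
    assume "t = 0"
    then have "\<mu> *\<^sub>R (F *v y) = 0" using FE[of b] \<open>E *v b = \<mu> *\<^sub>R y\<close> by (simp add: matrix_vector_mult_scaleR)
    then show False using Fy Eb \<open>E *v b = \<mu> *\<^sub>R y\<close> by auto
  qed
  ultimately have t: "0 < t" by simp
  have left: "(inverse t *\<^sub>R F) ** E = mat 1"
    unfolding matrix_eq using FE t
    by (simp add: matrix_vector_mul_assoc[symmetric] scaleR_matrix_vector_assoc[symmetric])
  then have right: "E ** (inverse t *\<^sub>R F) = mat 1" by (simp add: matrix_left_right_inverse)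
  then have "invertible E" using left unfolding invertible_def by blast
  moreover have "(*v) E ` L = closure K"
  proof
    show "(*v) E ` L \<subseteq> closure K" using EL by blast
    show "closure K \<subseteq> (*v) E ` L"
    proof
      fix z assume z: "z \<in> closure K"
      have "E *v ((inverse t *\<^sub>R F) *v z) = z" using right by (simp add: matrix_vector_mul_assoc)
      moreover have "(inverse t *\<^sub>R F) *v z = inverse t *\<^sub>R (F *v z)" by (simp add: scaleR_matrix_vector_assoc)
      moreover have "inverse t *\<^sub>R (F *v z) \<in> L" using FKc[OF z] L(3) t by simp
      ultimately show "z \<in> (*v) E ` L" by (metis imageI)
    qed
  qed
  ultimately show ?thesis using that by blast
qed

text \<open>Points of the projective plane forget the sign of their lifts, so convergent lifts lie
  in the cones only up to sign; passing to a subsequence of constant sign repairs this.\<close>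

lemma cone_limit_hausdist:
  assumes U: "cone_limit U L" and ne: "\<And>n. \<exists>x\<in>U n. x \<noteq> 0"
    and scale: "\<And>n c x. x \<in> U n \<Longrightarrow> 0 \<le> c \<Longrightarrow> c *\<^sub>R x \<in> U n"
    and L: "convex L" "interior L \<noteq> {}"
  shows "(\<lambda>n. hausdist (pcone (U n)) (pcone (interior L))) \<longlonglongrightarrow> 0"
proof (rule hausdist_tendsto_0I)
  show "pcone (U n) \<noteq> {}" for n using ne[of n] by (auto simp: pcone_def)
  have "interior L \<noteq> {0}"
  proof
    assume "interior L = {0}"
    then have "open {0 :: real^3}" by (metis open_interior)
    then show False using not_open_singleton by blast
  qed
  then show "pcone (interior L) \<noteq> {}" using L(2) by (auto simp: pcone_def)
  fix y assume "y \<in> pcone (interior L)"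
  then obtain z where z: "z \<in> L" "z \<noteq> 0" "y = proj z" using interior_subset by (auto simp: pcone_def)
  obtain x where x: "\<And>n. x n \<in> U n" "x \<longlonglongrightarrow> z" using cone_limit_lower[OF U z(1)] by blast
  obtain e where e: "\<And>n. e n \<in> U n" "\<And>n. e n \<noteq> 0" using ne by metis
  \<comment> \<open>x n can vanish for finitely many n; any nonzero element of the cone serves
    there.\<close>
  define x' where "x' n = (if x n = 0 then e n else x n)" for n
  have "eventually (\<lambda>n. x n = x' n) sequentially"
    using tendsto_imp_eventually_ne[OF x(2) z(2)] by eventually_elim (simp add: x'_def)
  then have "x' \<longlonglongrightarrow> z" using x(2) by (rule Lim_transform_eventually[rotated])
  then have "(\<lambda>n. proj (x' n)) \<longlonglongrightarrow> y" using z proj_convergent by blast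
  moreover have "proj (x' n) \<in> pcone (U n)" for n
    using x(1)[of n] e[of n] by (auto simp: pcone_def x'_def)
  ultimately show "\<exists>z. (\<forall>n. z n \<in> pcone (U n)) \<and> z \<longlonglongrightarrow> y" by (intro exI[of _ "\<lambda>n. proj (x' n)"]) auto
next
  have in_closure: "proj u \<in> closure (pcone (interior L))" if u: "u \<in> L" "u \<noteq> 0" for u
  proof -
    have "u \<in> closure (interior L)" using convex_closure_interior[OF L] u closure_subset by blast
    then obtain x where x: "\<And>n. x n \<in> interior L" "x \<longlonglongrightarrow> u" using closure_sequential by blast
    obtain N where N: "\<And>n. n \<ge> N \<Longrightarrow> x n \<noteq> 0"
      using tendsto_imp_eventually_ne[OF x(2) u(2)] by (auto simp: eventually_sequentially)
    have "(\<lambda>n. proj (x (n + N))) \<longlonglongrightarrow> proj u"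
      using proj_convergent[OF LIMSEQ_ignore_initial_segment[OF x(2)] u(2)] .
    moreover have "proj (x (n + N)) \<in> pcone (interior L)" for n
      using x(1) N[of "n + N"] by (auto simp: pcone_def)
    ultimately show ?thesis using closure_limitI[where x = "\<lambda>n. proj (x (n + N))"] by blast
  qed
  fix r :: "nat \<Rightarrow> nat" and z :: "nat \<Rightarrow> rp2" and q :: rp2
  assume r: "strict_mono r" and z: "\<And>n. z n \<in> pcone (U (r n))" "z \<longlonglongrightarrow> q"
  obtain u where u: "u \<noteq> 0" "q = proj u" using rp2_unit_rep[of q] by (metis norm_zero zero_neq_one)
  obtain v where v: "v \<longlonglongrightarrow> u" "\<And>n. v n \<noteq> 0" "\<And>n. z n = proj (v n)"
    using lift_convergent[of z u] z(2) u by metis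
  have "\<exists>c. c \<noteq> 0 \<and> c *\<^sub>R v n \<in> U (r n)" for n
  proof -
    obtain w where "w \<in> U (r n)" "w \<noteq> 0" "z n = proj w" using z(1)[of n] by (auto simp: pcone_def)
    then show ?thesis using proj_eq_iff[of w "v n"] v by auto
  qed
  then obtain c where c: "\<And>n. c n \<noteq> 0" "\<And>n. c n *\<^sub>R v n \<in> U (r n)" by metis
  have sv: "sgn (c n) *\<^sub>R v n \<in> U (r n)" for n
  proof -
    have eq: "sgn (c n) *\<^sub>R v n = inverse \<bar>c n\<bar> *\<^sub>R (c n *\<^sub>R v n)"
      using c(1)[of n] by (simp add: sgn_if abs_if)
    show ?thesis unfolding eq by (rule scale[OF c(2)]) simp
  qed
  obtain \<sigma> r' where \<sigma>: "\<sigma> \<noteq> 0" "strict_mono (r' :: nat \<Rightarrow> nat)" "\<And>n. sgn (c (r' n)) = \<sigma>"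
  proof (cases "eventually (\<lambda>n. sgn (c n) \<noteq> 1) sequentially")
    case True
    have "\<not> eventually (\<lambda>n. sgn (c n) \<noteq> - 1) sequentially"
    proof
      assume "eventually (\<lambda>n. sgn (c n) \<noteq> - 1) sequentially"
      with True have "eventually (\<lambda>n. False) sequentially"
        by eventually_elim (use c(1) in \<open>auto simp: sgn_if split: if_splits\<close>)
      then show False by simp
    qed
    then obtain r' where "strict_mono (r' :: nat \<Rightarrow> nat)" "\<And>n. \<not> sgn (c (r' n)) \<noteq> - 1"
      using frequently_subsequence[of "\<lambda>n. sgn (c n) \<noteq> - 1"] by blast
    then show ?thesis using that[of "- 1" r'] by simp
  next
    case False
    then obtain r' where "strict_mono (r' :: nat \<Rightarrow> nat)" "\<And>n. \<not> sgn (c (r' n)) \<noteq> 1"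
      using frequently_subsequence[of "\<lambda>n. sgn (c n) \<noteq> 1"] by blast
    then show ?thesis using that[of 1 r'] by simp
  qed
  have "\<sigma> *\<^sub>R u \<in> L"
  proof (rule cone_limit_upper[OF U])
    show "strict_mono (r \<circ> r')" using r \<sigma>(2) by (rule strict_mono_o)
    show "\<sigma> *\<^sub>R v (r' n) \<in> U ((r \<circ> r') n)" for n using sv[of "r' n"] \<sigma>(3)[of n] by simp
    show "(\<lambda>n. \<sigma> *\<^sub>R v (r' n)) \<longlonglongrightarrow> \<sigma> *\<^sub>R u"
      using LIMSEQ_subseq_LIMSEQ[OF v(1) \<sigma>(2)] by (intro tendsto_scaleR) (auto simp: o_def)
  qed
  then have "proj (\<sigma> *\<^sub>R u) \<in> closure (pcone (interior L))" using u(1) \<sigma>(1) by (intro in_closure) auto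
  then show "q \<in> closure (pcone (interior L))" using u(2) \<sigma>(1) by (simp add: proj_scaleR)
qed

definition std_param :: "real \<Rightarrow> 3 \<Rightarrow> real" where
  "std_param c i = (if i = 1 then c else 1)"

section \<open>Limits of the domains are polygons\<close>

lemma matrix_image_scaleR:
  assumes "\<And>c x. x \<in> U \<Longrightarrow> 0 \<le> c \<Longrightarrow> c *\<^sub>R x \<in> U" "x \<in> (*v) A ` U" "0 \<le> c"
  shows "c *\<^sub>R x \<in> (*v) (A :: real^3^3) ` U"
proof -
  obtain u where "u \<in> U" "x = A *v u" using assms(2) by blast
  then show ?thesis using assms(1,3) by (auto simp: matrix_vector_mult_scaleR[symmetric])
qed

text \<open>M applies the inverse rescaling, then a group word, then A. The word preserves the Tits
  cone and the rescaling only changes the parameters, so the image cone is the same, while v has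
  become the image of a normalised point of the orthant.\<close>

lemma normalised_base_point:
  fixes A :: "real^3^3"
  assumes m: "hyperbolic_orders m" and c: "1 \<le> c" and A: "invertible A"
    and v: "v \<in> (*v) A ` tits (tri m (std_param c))" "v \<noteq> 0"
  obtains M p b where "invertible M" "\<And>i. 1 \<le> p i" "p 1 * p 2 * p 3 = c"
    "(*v) A ` tits (tri m (std_param c)) = (*v) M ` tits (tri m p)" "b \<in> orthant" "\<And>i. b $ i \<le> 1"
    "\<And>i. b $ i < 1 \<Longrightarrow> p i = 1" "M *v b = v"
proof -
  define s where "s = std_param c"
  have s: "0 < s i" "s i \<noteq> 0" for i using c by (auto simp: s_def std_param_def)
  have sc: "s 1 * s 2 * s 3 = c" by (simp add: s_def std_param_def)
  define S where "S = tri m s"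
  have S: "cartan m S" unfolding S_def by (rule cartan_tri[OF m s(1)])
  obtain w q where q: "q \<in> orthant" "v = A *v foldr (refl S) w q"
    using v(1) by (auto simp: tits_def S_def s_def)
  have q0: "q \<noteq> 0" using v(2) q(2) linear_0[OF linear_refl_word] by auto
  obtain d where d: "\<And>i. 0 < d i" "\<And>i. 1 \<le> s i * d (i + 2) / d i"
    "\<And>i. (diag d *v q) $ i \<le> 1" "\<And>i. (diag d *v q) $ i < 1 \<Longrightarrow> s i * d (i + 2) / d i = 1"
    using base_point_rescaling[of s q] s q(1) q0 sc c by metis
  have d0: "d i \<noteq> 0" for i using d(1)[of i] by simp
  define p where "p = (\<lambda>i. s i * d (i + 2) / d i)"
  define D' where "D' = diag (\<lambda>i. inverse (d i))"
  define W where "W = word_matrix S w"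
  define M where "M = A ** W ** D'"
  have "det W \<noteq> 0" using det_word_matrix[of S w] cartan_diag[OF S] by (simp add: W_def)
  then have "invertible W" by (simp add: invertible_det_nz)
  moreover have "invertible D'" using d0 by (simp add: D'_def invertible_diag)
  ultimately have M: "invertible M" unfolding M_def using A by (intro invertible_mult)
  have Mx: "M *v x = A *v foldr (refl S) w (D' *v x)" for x
    by (simp add: M_def W_def word_matrix_mult flip: matrix_vector_mul_assoc)
  have D': "D' *v (diag d *v x) = x" for x
    using diag_mult_inverse[of "\<lambda>i. inverse (d i)" x] d0 by (simp add: D'_def)
  have rev: "foldr (refl S) w (foldr (refl S) (rev w) x) = x" for x
    by (induction w arbitrary: x) (auto simp: refl_invol cartan_diag[OF S])
  have wt: "foldr (refl S) w ` tits S = tits S"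
    using word_tits rev by (metis (no_types, lifting) image_subset_iff subsetI subset_antisym imageI)
  have "(*v) M ` tits (tri m p) = (*v) M ` (*v) (diag d) ` tits S"
    using diag_tits[of d s m] d(1) s(2) by (simp add: S_def p_def)
  also have "\<dots> = (*v) A ` foldr (refl S) w ` tits S"
    by (simp add: image_image Mx D')
  finally have img: "(*v) A ` tits (tri m (std_param c)) = (*v) M ` tits (tri m p)"
    unfolding wt by (simp add: S_def s_def)
  show ?thesis
  proof (rule that[of M p "diag d *v q"])
    have "d (1 + 2) = d 3" "d (2 + 2) = d 1" "d (3 + 2) = d 2" by (simp_all only: cyc3)
    then show "p 1 * p 2 * p 3 = c" using sc d0 by (simp add: p_def cyc3 field_simps)
    show "diag d *v q \<in> orthant" using q(1) d(1) by (auto simp: orthant_def diag_mult_nth less_imp_le)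
    show "M *v (diag d *v q) = v" by (simp add: Mx D' q(2))
    show "p i = 1" if "(diag d *v q) $ i < 1" for i using d(4)[OF that] by (simp only: p_def)
    show "1 \<le> p i" for i using d(2)[of i] by (simp only: p_def)
  qed (use M d(3) img in blast)+
qed

text \<open>Base points and inverse parameters lie in the unit cube, so both converge along a
  subsequence. As the product of the parameters tends to infinity, some inverse parameter tends to
  0, and \<open>cone_rigidity\<close> compares the resulting limit cone with K.\<close>

lemma limit_domain_gon_aux:
  fixes A :: "nat \<Rightarrow> real^3^3" and K :: "(real^3) set"
  assumes m: "hyperbolic_orders m" and c: "\<And>n. 1 \<le> c n" "filterlim c at_top sequentially"
    and A: "\<And>n. invertible (A n)" and V: "\<And>n. V n = (*v) (A n) ` tits (tri m (std_param (c n)))"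
    and lower: "\<And>z. z \<in> K \<Longrightarrow> \<exists>y. (\<forall>n. y n \<in> V n) \<and> y \<longlonglongrightarrow> z"
    and upper: "\<And>r y z. strict_mono (r :: nat \<Rightarrow> nat) \<Longrightarrow> (\<And>n. y n \<in> V (r n)) \<Longrightarrow> y \<longlonglongrightarrow> z \<Longrightarrow> z \<in> closure K"
    and K: "open K" "y \<in> K" "y \<noteq> 0" "\<And>x. x \<in> closure K \<Longrightarrow> - x \<in> closure K \<Longrightarrow> x = 0"
  obtains k E where "k \<in> insert 3 (range m)" "linear E" "inj E" "closure K = E ` gon_cone k"
proof -
  have cart: "cartan m (tri m p)" if "\<And>i. 1 \<le> p i" for p
    using that by (intro cartan_tri[OF m]) (metis less_le_trans zero_less_one)
  obtain v0 where v0: "\<And>n. v0 n \<in> V n" "v0 \<longlonglongrightarrow> y" using lower[OF K(2)] by blast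
  define v where "v n = (if v0 n = 0 then A n *v axis 1 1 else v0 n)" for n
  have ax: "(axis 1 1 :: real^3) \<in> tits S" for S
    by (intro orthant_in_tits) (simp add: orthant_def axis_def)
  have v: "v n \<in> V n" "v n \<noteq> 0" for n
  proof -
    show "v n \<in> V n" using v0(1) ax by (auto simp: v_def V)
    have "A n *v axis 1 1 \<noteq> 0"
    proof
      assume "A n *v axis 1 1 = 0"
      moreover have "matrix_inv (A n) *v (A n *v axis 1 1) = axis 1 1" by (rule matrix_inv_mult(2)[OF A])
      ultimately show False by simp
    qed
    then show "v n \<noteq> 0" by (simp add: v_def)
  qed
  have "eventually (\<lambda>n. v0 n = v n) sequentially"
    using tendsto_imp_eventually_ne[OF v0(2) K(3)] by eventually_elim (simp add: v_def)
  then have vy: "v \<longlonglongrightarrow> y" using v0(2) by (rule Lim_transform_eventually[rotated])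
  have "\<exists>M p b. invertible M \<and> (\<forall>i. 1 \<le> p i) \<and> p 1 * p 2 * p 3 = c n \<and>
      V n = (*v) M ` tits (tri m p) \<and> b \<in> orthant \<and> (\<forall>i. b $ i \<le> 1) \<and>
      (\<forall>i. b $ i < 1 \<longrightarrow> p i = 1) \<and> M *v b = v n" for n
    using normalised_base_point[OF m c(1) A, of "v n" n n] v[of n] unfolding V by metis
  then obtain M p b where Mp: "\<And>n. invertible (M n)" "\<And>n i. 1 \<le> p n i" "\<And>n. p n 1 * p n 2 * p n 3 = c n"
    "\<And>n. V n = (*v) (M n) ` tits (tri m (p n))" "\<And>n. b n \<in> orthant" "\<And>n i. b n $ i \<le> 1"
    "\<And>n i. b n $ i < 1 \<Longrightarrow> p n i = 1" "\<And>n. M n *v b n = v n" by metis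
  \<comment> \<open>Taking inverses compactifies the parameters, which range over [1,
    \<infinity>).\<close>
  define t :: "nat \<Rightarrow> real^3" where "t n = (\<chi> i. inverse (p n i))" for n
  have p0: "0 < p n i" for n i using Mp(2)[of n i] by linarith
  have b01: "b n \<in> cbox 0 1" for n using Mp(5,6)[of n] by (simp add: orthant_def mem_box_cart)
  have t01: "t n \<in> cbox 0 1" for n
    using Mp(2)[of n] p0[of n] by (auto simp: t_def mem_box_cart less_imp_le inverse_le_1_iff)
  have "compact (cbox 0 1 \<times> cbox 0 1 :: ((real^3) \<times> (real^3)) set)" by (intro compact_Times compact_cbox)
  moreover have "(b n, t n) \<in> cbox 0 1 \<times> cbox 0 1" for n using b01 t01 by simp
  ultimately obtain z r where r: "strict_mono (r :: nat \<Rightarrow> nat)" "((\<lambda>n. (b n, t n)) \<circ> r) \<longlonglongrightarrow> z"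
    unfolding compact_def by (metis (no_types, lifting))
  define b' where "b' = fst z"
  define l where "l i = snd z $ i" for i
  have bl: "(\<lambda>n. b (r n)) \<longlonglongrightarrow> b'" using tendsto_fst[OF r(2)] by (simp add: b'_def o_def)
  have "(\<lambda>n. t (r n)) \<longlonglongrightarrow> snd z" using tendsto_snd[OF r(2)] by (simp add: o_def)
  from tendsto_vec_nth[OF this] have tl: "(\<lambda>n. inverse (p (r n) i)) \<longlonglongrightarrow> l i" for i
    by (simp add: t_def l_def)
  have "(\<lambda>n. inverse (p (r n) 1) * inverse (p (r n) 2) * inverse (p (r n) 3)) \<longlonglongrightarrow> l 1 * l 2 * l 3"
    by (intro tendsto_mult tl)
  moreover have "(\<lambda>n. inverse (p (r n) 1) * inverse (p (r n) 2) * inverse (p (r n) 3)) = (\<lambda>n. inverse (c (r n)))"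
    by (simp add: Mp(3)[symmetric] inverse_mult_distrib mult_ac)
  moreover have "(\<lambda>n. inverse (c (r n))) \<longlonglongrightarrow> 0"
    using tendsto_inverse_0_at_top[OF filterlim_compose[OF c(2) filterlim_subseq[OF r(1)]]] by simp
  ultimately have "l 1 * l 2 * l 3 = 0" using LIMSEQ_unique by metis
  then obtain i0 where i0: "l i0 = 0" by auto
  \<comment> \<open>At an escaping wall the parameter is eventually different from 1, and then the
    rescaled base point has coordinate exactly 1.\<close>
  have bpos: "0 < b' $ i" if i: "l i = 0" for i
  proof -
    have "eventually (\<lambda>n. inverse (p (r n) i) < 1) sequentially"
      using order_tendstoD(2)[OF tl, of i 1] i by simp
    then have "eventually (\<lambda>n. 1 = b (r n) $ i) sequentially"
    proof eventually_elim
      case (elim n)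
      then have "p (r n) i \<noteq> 1" by auto
      then have "\<not> b (r n) $ i < 1" using Mp(7) by blast
      then show ?case using Mp(6)[of "r n" i] by linarith
    qed
    then have "(\<lambda>n. b (r n) $ i) \<longlonglongrightarrow> 1" using tendsto_const by (rule Lim_transform_eventually[rotated])
    then have "b' $ i = 1" using tendsto_vec_nth[OF bl] LIMSEQ_unique by blast
    then show ?thesis by simp
  qed
  have "0 \<le> b' $ i" for i
    using LIMSEQ_le_const[OF tendsto_vec_nth[OF bl], of 0 i] Mp(5) by (auto simp: orthant_def)
  then have "b' \<in> orthant" by (simp add: orthant_def)
  obtain E k where E: "k \<in> insert 3 (range m)" "linear E" "inj E" "limit_cone m l = E ` gon_cone k"
    "cone_limit (\<lambda>n. tits (tri m (p (r n)))) (limit_cone m l)"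
    "\<And>b. b \<in> orthant \<Longrightarrow> (\<And>i. l i = 0 \<Longrightarrow> 0 < b $ i) \<Longrightarrow> b \<in> interior (limit_cone m l)"
    using limit_cone_cases[OF m, of "\<lambda>n. p (r n)" l i0] Mp(2) tl i0 by metis
  have "b' \<in> interior (limit_cone m l)" using E(6) \<open>b' \<in> orthant\<close> bpos by blast
  obtain G where G: "invertible G" "(*v) G ` limit_cone m l = closure K"
  proof (rule cone_rigidity[where M = "\<lambda>n. M (r n)" and V = "\<lambda>n. V (r n)" and
        U = "\<lambda>n. tits (tri m (p (r n)))" and K = K and L = "limit_cone m l" and y = y and
        \<beta> = "\<lambda>n. b (r n)" and b = b'])
    show "\<exists>y. (\<forall>n. y n \<in> V (r n)) \<and> y \<longlonglongrightarrow> z" if "z \<in> K" for z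
    proof -
      have "\<exists>x. (\<forall>n. x n \<in> V n) \<and> x \<longlonglongrightarrow> z" using lower[OF that] .
      then obtain x where "\<forall>n. x n \<in> V n" "x \<longlonglongrightarrow> z" by blast
      then show ?thesis using LIMSEQ_subseq_LIMSEQ[OF _ r(1), of x z] by (intro exI[of _ "x \<circ> r"]) auto
    qed
    show "z \<in> closure K" if "strict_mono s" "\<And>n. x n \<in> V (r (s n))" "x \<longlonglongrightarrow> z" for s x z
      using upper[OF strict_mono_o[OF r(1) that(1)], of x z] that(2,3) by simp
    show "(\<lambda>n. M (r n) *v b (r n)) \<longlonglongrightarrow> y"
      using LIMSEQ_subseq_LIMSEQ[OF vy r(1)] by (simp add: Mp(8) o_def)
    show "x = 0" if "x \<in> limit_cone m l" "- x \<in> limit_cone m l" for x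
      using that gon_image_pointed[OF E(2,3)] unfolding E(4) by blast
    show "a *\<^sub>R x \<in> limit_cone m l" if "x \<in> limit_cone m l" "0 \<le> a" for a x
      using that by (simp add: limit_cone_def linear_cmul[OF linear_refl_word])
  qed (use Mp K E(5) bl \<open>b' \<in> interior _\<close> in \<open>auto intro: closed_limit_cone tits_scaleR orthant_in_tits\<close>)
  have "inj ((*v) G)" using G(1) by (simp add: inj_matrix_vector_mult)
  then have "inj ((*v) G \<circ> E)" using E(3) by (rule inj_compose)
  moreover have "linear ((*v) G \<circ> E)" using E(2) by (intro linear_compose matrix_vector_mul_linear)
  moreover have "closure K = ((*v) G \<circ> E) ` gon_cone k" using G(2) E(4) by (simp add: image_comp)
  ultimately show ?thesis using that E(1) by blast
qed

lemma closure_pcone_functional: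
  fixes K :: "(real^3) set"
  assumes cone: "\<And>c x. x \<in> K \<Longrightarrow> 0 < c \<Longrightarrow> c *\<^sub>R x \<in> K"
    and \<phi>: "0 < e" "\<And>x. x \<in> K \<Longrightarrow> e * norm x \<le> \<phi> \<bullet> x"
    and u: "u \<noteq> 0" "proj u \<in> closure (pcone K)"
  shows "e * norm u \<le> \<bar>\<phi> \<bullet> u\<bar>" "0 < \<phi> \<bullet> u \<Longrightarrow> u \<in> closure K"
proof -
  obtain q where q: "\<And>n. q n \<in> pcone K" "q \<longlonglongrightarrow> proj u" using u(2) closure_sequential by blast
  obtain v where v: "v \<longlonglongrightarrow> u" "\<And>n. v n \<noteq> 0" "\<And>n. q n = proj (v n)"
    using lift_convergent[OF q(2) u(1)] by blast
  have "\<exists>c k. c \<noteq> 0 \<and> k \<in> K \<and> v n = c *\<^sub>R k" for n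
  proof -
    obtain k where "k \<in> K" "k \<noteq> 0" "q n = proj k" using q(1)[of n] by (auto simp: pcone_def)
    then show ?thesis using proj_eq_iff[OF v(2)[of n]] v(3)[of n] by metis
  qed
  then obtain c k where ck: "\<And>n. c n \<noteq> 0" "\<And>n. k n \<in> K" "\<And>n. v n = c n *\<^sub>R k n" by metis
  have kpos: "0 \<le> \<phi> \<bullet> k n" for n using \<phi>(2)[OF ck(2)[of n]] \<phi>(1) by (meson mult_nonneg_nonneg norm_ge_zero order_trans less_imp_le)
  have le: "e * norm (v n) \<le> \<bar>\<phi> \<bullet> v n\<bar>" for n
  proof -
    have "\<bar>c n\<bar> * (e * norm (k n)) \<le> \<bar>c n\<bar> * (\<phi> \<bullet> k n)" using \<phi>(2)[OF ck(2)] by (intro mult_left_mono) auto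
    then show ?thesis using kpos[of n] by (simp add: ck(3)[of n] abs_mult mult.left_commute)
  qed
  have "(\<lambda>n. e * norm (v n)) \<longlonglongrightarrow> e * norm u" by (intro tendsto_intros v)
  moreover have lim: "(\<lambda>n. \<phi> \<bullet> v n) \<longlonglongrightarrow> \<phi> \<bullet> u" by (intro tendsto_intros v)
  moreover from lim have "(\<lambda>n. \<bar>\<phi> \<bullet> v n\<bar>) \<longlonglongrightarrow> \<bar>\<phi> \<bullet> u\<bar>" by (rule tendsto_rabs)
  ultimately show "e * norm u \<le> \<bar>\<phi> \<bullet> u\<bar>" using le LIMSEQ_le by blast
  assume pos: "0 < \<phi> \<bullet> u"
  obtain N where N: "\<And>n. n \<ge> N \<Longrightarrow> 0 < \<phi> \<bullet> v n"
    using order_tendstoD(1)[OF lim pos] by (auto simp: eventually_sequentially)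
  show "u \<in> closure K"
  proof (rule closure_limitI)
    show "(\<lambda>n. v (n + N)) \<longlonglongrightarrow> u" using v(1) by (rule LIMSEQ_ignore_initial_segment)
    show "v (n + N) \<in> K" for n
    proof -
      have "0 < c (n + N) * (\<phi> \<bullet> k (n + N))" using N[of "n + N"] by (simp add: ck(3))
      then have "0 < c (n + N)" using kpos[of "n + N"] by (simp add: zero_less_mult_iff)
      then show ?thesis using cone ck by metis
    qed
  qed
qed

text \<open>A cone and its negative have the same projective image, so the side on which V n lies
  has to be found from \<phi>. If \<phi> took both signs on V n, it would vanish at a nonzero point
  by convexity; limits of such points lie in the closure of the domain of K, where \<phi> is bounded
  away from zero on unit vectors.\<close>

lemma pcone_limit_sign:
  fixes V :: "nat \<Rightarrow> (real^3) set" and K :: "(real^3) set"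
  assumes add: "\<And>n x y. x \<in> V n \<Longrightarrow> y \<in> V n \<Longrightarrow> x + y \<in> V n"
    and scale: "\<And>n c x. x \<in> V n \<Longrightarrow> 0 \<le> c \<Longrightarrow> c *\<^sub>R x \<in> V n"
    and pointed: "\<And>n x. x \<in> V n \<Longrightarrow> - x \<in> V n \<Longrightarrow> x = 0"
    and cone: "\<And>c x. x \<in> K \<Longrightarrow> 0 < c \<Longrightarrow> c *\<^sub>R x \<in> K"
    and \<phi>: "0 < e" "\<And>x. x \<in> K \<Longrightarrow> e * norm x \<le> \<phi> \<bullet> x"
    and H: "(\<lambda>n. hausdist (pcone (V n)) (pcone K)) \<longlonglongrightarrow> 0" "pcone K \<noteq> {}"
  shows "eventually (\<lambda>n. (\<forall>x\<in>V n. x \<noteq> 0 \<longrightarrow> 0 < \<phi> \<bullet> x) \<or> (\<forall>x\<in>V n. x \<noteq> 0 \<longrightarrow> \<phi> \<bullet> x < 0)) sequentially"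
proof (rule ccontr)
  assume "\<not> ?thesis"
  then obtain r where r: "strict_mono (r :: nat \<Rightarrow> nat)" "\<And>n. \<not> ((\<forall>x\<in>V (r n). x \<noteq> 0 \<longrightarrow> 0 < \<phi> \<bullet> x) \<or> (\<forall>x\<in>V (r n). x \<noteq> 0 \<longrightarrow> \<phi> \<bullet> x < 0))"
    using frequently_subsequence[of "\<lambda>n. (\<forall>x\<in>V n. x \<noteq> 0 \<longrightarrow> 0 < \<phi> \<bullet> x) \<or> (\<forall>x\<in>V n. x \<noteq> 0 \<longrightarrow> \<phi> \<bullet> x < 0)"]
    by blast
  have "\<exists>z\<in>V (r n). z \<noteq> 0 \<and> \<phi> \<bullet> z = 0" for n
  proof -
    obtain x y where x: "x \<in> V (r n)" "x \<noteq> 0" "\<phi> \<bullet> x \<le> 0" and y: "y \<in> V (r n)" "y \<noteq> 0" "0 \<le> \<phi> \<bullet> y"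
      using r(2)[of n] by (meson not_less)
    show ?thesis
    proof (cases "\<phi> \<bullet> x = 0")
      case True then show ?thesis using x by blast
    next
      case False
      then have neg: "\<phi> \<bullet> x < 0" using x by simp
      \<comment> \<open>The positive combination of x and y at which \<phi> vanishes; it is nonzero
        because the cone is pointed.\<close>
      define z where "z = (\<phi> \<bullet> y) *\<^sub>R x + (- (\<phi> \<bullet> x)) *\<^sub>R y"
      have a: "(\<phi> \<bullet> y) *\<^sub>R x \<in> V (r n)" "(- (\<phi> \<bullet> x)) *\<^sub>R y \<in> V (r n)"
        using x y neg by (auto intro!: scale simp del: scaleR_minus_left)
      then have "z \<in> V (r n)" unfolding z_def by (rule add)
      moreover have "z \<noteq> 0"
      proof
        assume "z = 0"
        then have "- ((- (\<phi> \<bullet> x)) *\<^sub>R y) = (\<phi> \<bullet> y) *\<^sub>R x"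
          unfolding z_def by (metis add.inverse_unique add.commute)
        then have "(- (\<phi> \<bullet> x)) *\<^sub>R y = 0" using pointed a by metis
        then show False using neg y(2) by simp
      qed
      moreover have "\<phi> \<bullet> z = 0" by (simp add: z_def inner_diff_right)
      ultimately show ?thesis by blast
    qed
  qed
  then obtain z where z: "\<And>n. z n \<in> V (r n)" "\<And>n. z n \<noteq> 0" "\<And>n. \<phi> \<bullet> z n = 0" by metis
  obtain l s where s: "strict_mono s" "((\<lambda>n. proj (z n)) \<circ> s) \<longlonglongrightarrow> l" using rp2_subsequence by blast
  obtain u where u: "u \<noteq> 0" "l = proj u" using rp2_unit_rep[of l] by (metis norm_zero zero_neq_one)
  have "l \<in> closure (pcone K)"
  proof (rule hausdist_upper_limit[OF H strict_mono_o[OF r(1) s(1)] _ s(2)])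
    show "((\<lambda>n. proj (z n)) \<circ> s) n \<in> pcone (V ((r \<circ> s) n))" for n
      using z by (auto simp: pcone_def)
  qed
  then have le: "e * norm u \<le> \<bar>\<phi> \<bullet> u\<bar>"
    using closure_pcone_functional(1)[of K e \<phi> u] cone \<phi> u by blast
  obtain v where v: "v \<longlonglongrightarrow> u" "\<And>n. v n \<noteq> 0" "\<And>n. ((\<lambda>n. proj (z n)) \<circ> s) n = proj (v n)"
    using lift_convergent[OF s(2)[unfolded u(2)] u(1)] by blast
  have "\<phi> \<bullet> v n = 0" for n
  proof -
    obtain c where "v n = c *\<^sub>R z (s n)" using proj_eq_iff[OF v(2) z(2)] v(3)[of n] by (metis comp_apply)
    then show ?thesis using z(3) by simp
  qed
  moreover have "(\<lambda>n. \<phi> \<bullet> v n) \<longlonglongrightarrow> \<phi> \<bullet> u" by (intro tendsto_intros v)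
  ultimately have "(\<lambda>n. 0) \<longlonglongrightarrow> \<phi> \<bullet> u" by (simp only:)
  then have "\<phi> \<bullet> u = 0" using LIMSEQ_unique[OF _ tendsto_const] by metis
  then show False using le \<phi>(1) u(1) by (simp add: mult_le_0_iff)
qed

lemma tits_pointed:
  assumes "cartan m S" "x \<in> tits S" "- x \<in> tits S" shows "x = 0"
proof (rule ccontr)
  assume "x \<noteq> 0"
  then have "0 < cross3 (column (1 + 1) S) (column (1 + 2) S) \<bullet> x"
    "0 < cross3 (column (1 + 1) S) (column (1 + 2) S) \<bullet> (- x)"
    using assms by (intro adjugate_tits[OF assms(1)]; simp)+
  then show False by simp
qed

lemma pcone_scaleR: "c \<noteq> 0 \<Longrightarrow> pcone ((*\<^sub>R) c ` K) = pcone K"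
proof -
  assume c: "c \<noteq> 0"
  then have "(*\<^sub>R) c ` K - {0} = (*\<^sub>R) c ` (K - {0})" by auto
  then show ?thesis unfolding pcone_def by (simp add: image_image proj_scaleR[OF c])
qed

lemma invertible_scaleR:
  fixes A :: "real^3^3"
  assumes "invertible A" "c \<noteq> 0"
  shows "invertible (c *\<^sub>R A)"
proof -
  have "(inverse c *\<^sub>R matrix_inv A) ** (c *\<^sub>R A) = mat 1"
    using assms by (simp add: matrix_eq matrix_vector_mul_assoc[symmetric]
      scaleR_matrix_vector_assoc[symmetric] matrix_vector_mult_scaleR)
  then show ?thesis unfolding invertible_left_inverse by blast
qed

text \<open>Initial terms are dropped until the parameter is at least 1 and \<phi> has a constant
  sign on each cone. Multiplying A n by that sign puts all cones on the side of K.\<close>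

theorem limit_domain_gon:
  fixes A :: "nat \<Rightarrow> real^3^3"
  assumes m: "hyperbolic_orders m" and c: "filterlim c at_top sequentially"
    and A: "\<And>n. invertible (A n)" and \<Omega>: "\<Omega> \<in> convex_domains"
    and H: "(\<lambda>n. hausdist (pcone ((*v) (A n) ` tits (tri m (std_param (c n))))) \<Omega>) \<longlonglongrightarrow> 0"
  shows "\<exists>k\<in>insert 3 (range m). \<exists>E. linear E \<and> inj E \<and> \<Omega> = pcone (interior (E ` gon_cone k))"
proof -
  obtain K \<phi> e where K: "convex K" "open K" "K \<noteq> {}" "0 \<notin> K" "\<And>c x. x \<in> K \<Longrightarrow> 0 < c \<Longrightarrow> c *\<^sub>R x \<in> K"
    and \<phi>: "0 < e" "\<And>x. x \<in> K \<Longrightarrow> e * norm x \<le> \<phi> \<bullet> x" and \<Omega>K: "\<Omega> = pcone K"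
    using convex_domain_pcone[OF \<Omega>] by metis
  have pK: "pcone K \<noteq> {}" using K(3,4) by (auto simp: pcone_def)
  obtain N1 where N1: "\<And>n. n \<ge> N1 \<Longrightarrow> 1 \<le> c n"
    using c unfolding filterlim_at_top eventually_sequentially by blast
  define c1 where "c1 n = c (n + N1)" for n
  define V where "V n = (*v) (A (n + N1)) ` tits (tri m (std_param (c1 n)))" for n
  have c1: "1 \<le> c1 n" for n using N1 by (simp add: c1_def)
  have cart: "cartan m (tri m (std_param (c1 n)))" for n
    using c1[of n] by (intro cartan_tri[OF m]) (auto simp: std_param_def)
  have Vadd: "x + y \<in> V n" if xy: "x \<in> V n" "y \<in> V n" for n x y
  proof -
    obtain u v where "u \<in> tits (tri m (std_param (c1 n)))" "v \<in> tits (tri m (std_param (c1 n)))"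
      "x = A (n + N1) *v u" "y = A (n + N1) *v v" using xy by (auto simp: V_def)
    then show ?thesis using tits_add[OF cart[of n], of u v]
      by (auto simp: V_def simp flip: matrix_vector_right_distrib)
  qed
  have Vscale: "a *\<^sub>R x \<in> V n" if "x \<in> V n" "0 \<le> a" for n a x
    using that unfolding V_def by (intro matrix_image_scaleR tits_scaleR)
  have Vpointed: "x = 0" if xx: "x \<in> V n" "- x \<in> V n" for n x
  proof -
    obtain u v where uv: "u \<in> tits (tri m (std_param (c1 n)))" "v \<in> tits (tri m (std_param (c1 n)))"
      "x = A (n + N1) *v u" "- x = A (n + N1) *v v" using xx by (auto simp: V_def)
    have "A (n + N1) *v v = A (n + N1) *v (- u)"
      using uv(3,4) linear_neg[OF matrix_vector_mul_linear] by metis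
    then have "v = - u" by (metis matrix_inv_mult(2)[OF A])
    then have "u = 0" using tits_pointed[OF cart] uv(1,2) by metis
    then show ?thesis using uv(3) by simp
  qed
  have HV: "(\<lambda>n. hausdist (pcone (V n)) (pcone K)) \<longlonglongrightarrow> 0"
    using LIMSEQ_ignore_initial_segment[OF H, of N1] by (simp add: V_def c1_def \<Omega>K)
  obtain N2 where N2: "\<And>n. n \<ge> N2 \<Longrightarrow> (\<forall>x\<in>V n. x \<noteq> 0 \<longrightarrow> 0 < \<phi> \<bullet> x) \<or> (\<forall>x\<in>V n. x \<noteq> 0 \<longrightarrow> \<phi> \<bullet> x < 0)"
  proof -
    have "eventually (\<lambda>n. (\<forall>x\<in>V n. x \<noteq> 0 \<longrightarrow> 0 < \<phi> \<bullet> x) \<or> (\<forall>x\<in>V n. x \<noteq> 0 \<longrightarrow> \<phi> \<bullet> x < 0)) sequentially"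
      by (rule pcone_limit_sign[where K = K and e = e]) (use Vadd Vscale Vpointed K(5) \<phi> HV pK in blast)+
    then show ?thesis using that unfolding eventually_sequentially by blast
  qed
  define \<sigma> where "\<sigma> n = (if \<forall>x\<in>V (n + N2). x \<noteq> 0 \<longrightarrow> 0 < \<phi> \<bullet> x then 1 else - 1 :: real)" for n
  have \<sigma>0: "\<sigma> n \<noteq> 0" for n by (simp add: \<sigma>_def)
  define A' where "A' n = \<sigma> n *\<^sub>R A (n + N2 + N1)" for n
  define V' where "V' n = (*v) (A' n) ` tits (tri m (std_param (c1 (n + N2))))" for n
  have V'V: "V' n = (*\<^sub>R) (\<sigma> n) ` V (n + N2)" for n
    by (simp add: V'_def V_def A'_def image_image scaleR_matrix_vector_assoc)
  have pos: "0 < \<phi> \<bullet> x" if x: "x \<in> V' n" "x \<noteq> 0" for n x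
  proof -
    obtain v where v: "v \<in> V (n + N2)" "x = \<sigma> n *\<^sub>R v" using x(1) V'V by auto
    then have "v \<noteq> 0" using x(2) by auto
    then show ?thesis using v N2[of "n + N2"] unfolding v(2) \<sigma>_def by auto
  qed
  have zero: "0 \<in> V' n" for n
    using linear_0[OF matrix_vector_mul_linear] orthant_in_tits[of 0]
    by (auto simp: V'_def orthant_def image_iff intro!: bexI[of _ 0])
  have V'scale: "a *\<^sub>R x \<in> V' n" if "x \<in> V' n" "0 \<le> a" for n a x
    using that unfolding V'_def by (intro matrix_image_scaleR tits_scaleR)
  have pV': "pcone (V' n) = pcone (V (n + N2))" for n by (simp add: V'V pcone_scaleR \<sigma>0)
  have HV': "(\<lambda>n. hausdist (pcone (V' n)) (pcone K)) \<longlonglongrightarrow> 0"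
    unfolding pV' using HV by (rule LIMSEQ_ignore_initial_segment)
  have pne: "pcone (V' n) \<noteq> {}" for n
  proof -
    have "axis 1 1 \<in> tits (tri m (std_param (c1 (n + N2))))"
      by (intro orthant_in_tits) (simp add: orthant_def axis_def)
    moreover have "A (n + N2 + N1) *v axis 1 1 \<noteq> 0"
    proof
      assume "A (n + N2 + N1) *v axis 1 1 = 0"
      then have "(axis 1 1 :: real^3) = 0"
        using matrix_inv_mult(2)[OF A[of "n + N2 + N1"], of "axis 1 1"] by (metis matrix_vector_mult_0_right)
      then show False by simp
    qed
    moreover have "A' n *v axis 1 1 = \<sigma> n *\<^sub>R (A (n + N2 + N1) *v axis 1 1)"
      by (simp only: A'_def scaleR_matrix_vector_assoc)
    ultimately have "A' n *v axis 1 1 \<noteq> 0" using \<sigma>0[of n] by (simp only: scaleR_eq_0_iff) blast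
    moreover have "A' n *v axis 1 1 \<in> V' n" unfolding V'_def by (rule imageI) fact
    ultimately show ?thesis unfolding pcone_def by blast
  qed
  have signed: "a *\<^sub>R w \<in> V' n" if "w \<in> V' n" "w \<noteq> 0" "0 < \<phi> \<bullet> (a *\<^sub>R w)" for a w n
    using that pos[OF that(1,2)] by (intro V'scale) (auto simp: zero_less_mult_iff)
  obtain y where y: "y \<in> K" using K(3) by blast
  have y0: "y \<noteq> 0" using y K(4) by auto
  have \<phi>pos: "0 < \<phi> \<bullet> x" if "x \<in> K" for x
  proof -
    have "x \<noteq> 0" using that K(4) by metis
    then have "0 < e * norm x" using \<phi>(1) by simp
    then show ?thesis using \<phi>(2)[OF that] by linarith
  qed
  obtain k E where "k \<in> insert 3 (range m)" "linear E" "inj E" "closure K = E ` gon_cone k"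
  proof (rule limit_domain_gon_aux[where A = A' and c = "\<lambda>n. c1 (n + N2)" and V = V' and K = K and y = y, OF m])
    show "filterlim (\<lambda>n. c1 (n + N2)) at_top sequentially"
      unfolding c1_def using filterlim_compose[OF c filterlim_add_const_nat_at_top[of "N2 + N1"]]
      by (simp add: add.assoc)
    show "invertible (A' n)" for n
      unfolding A'_def by (rule invertible_scaleR[OF A \<sigma>0])
    show "\<exists>x. (\<forall>n. x n \<in> V' n) \<and> x \<longlonglongrightarrow> z" if z: "z \<in> K" for z
    proof -
      have z0: "z \<noteq> 0" using z K(4) by auto
      have "proj z \<in> pcone K" using z z0 by (auto simp: pcone_def)
      then obtain q where q: "\<And>n. q n \<in> pcone (V' n)" "q \<longlonglongrightarrow> proj z"
        using hausdist_lower_limit[OF HV' pne] by metis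
      obtain v where v: "v \<longlonglongrightarrow> z" "\<And>n. v n \<noteq> 0" "\<And>n. q n = proj (v n)"
        using lift_convergent[OF q(2) z0] by blast
      define x where "x n = (if 0 < \<phi> \<bullet> v n then v n else 0)" for n
      have "(\<lambda>n. \<phi> \<bullet> v n) \<longlonglongrightarrow> \<phi> \<bullet> z" by (intro tendsto_intros v)
      then have "eventually (\<lambda>n. 0 < \<phi> \<bullet> v n) sequentially" using \<phi>pos[OF z] by (rule order_tendstoD)
      then have "eventually (\<lambda>n. v n = x n) sequentially" by eventually_elim (simp add: x_def)
      then have "x \<longlonglongrightarrow> z" using v(1) by (rule Lim_transform_eventually[rotated])
      moreover have "x n \<in> V' n" for n
      proof (cases "0 < \<phi> \<bullet> v n")
        case True
        obtain w where w: "w \<in> V' n" "w \<noteq> 0" "q n = proj w" using q(1)[of n] by (auto simp: pcone_def)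
        then obtain a where "v n = a *\<^sub>R w" using proj_eq_iff[OF v(2)[of n] w(2)] v(3)[of n] by auto
        then show ?thesis using True signed w by (auto simp: x_def)
      qed (simp add: x_def zero)
      ultimately show ?thesis by blast
    qed
    show "z \<in> closure K" if s: "strict_mono s" "\<And>n. x n \<in> V' (s n)" "x \<longlonglongrightarrow> z" for s :: "nat \<Rightarrow> nat" and x z
    proof (cases "z = 0")
      case True
      have "(\<lambda>n. inverse (real (Suc n)) *\<^sub>R y) \<longlonglongrightarrow> 0 *\<^sub>R y"
        by (intro tendsto_scaleR LIMSEQ_inverse_real_of_nat tendsto_const)
      then show ?thesis
        using True K(5)[OF y] by (intro closure_limitI[where x = "\<lambda>n. inverse (real (Suc n)) *\<^sub>R y"]) auto
    next
      case False
      obtain N where N: "\<And>n. n \<ge> N \<Longrightarrow> x n \<noteq> 0"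
        using tendsto_imp_eventually_ne[OF s(3) False] by (auto simp: eventually_sequentially)
      have xN: "(\<lambda>n. x (n + N)) \<longlonglongrightarrow> z" using s(3) by (rule LIMSEQ_ignore_initial_segment)
      have sm: "strict_mono (\<lambda>n. s (n + N))" using s(1) by (simp add: strict_mono_def)
      have pz: "proj z \<in> closure (pcone K)"
      proof (rule hausdist_upper_limit[OF HV' pK sm _ proj_convergent[OF xN False]])
        show "proj (x (n + N)) \<in> pcone (V' (s (n + N)))" for n
          using s(2)[of "n + N"] N[of "n + N"] by (auto simp: pcone_def)
      qed
      have cl: "e * norm z \<le> \<bar>\<phi> \<bullet> z\<bar>" "0 < \<phi> \<bullet> z \<Longrightarrow> z \<in> closure K"
        using closure_pcone_functional[where K = K and e = e and \<phi> = \<phi> and u = z] K(5) \<phi> False pz by blast+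
      have "0 \<le> \<phi> \<bullet> x n" for n using pos[OF s(2)[of n]] by (cases "x n = 0") auto
      moreover have "(\<lambda>n. \<phi> \<bullet> x n) \<longlonglongrightarrow> \<phi> \<bullet> z" by (intro tendsto_intros s)
      ultimately have "0 \<le> \<phi> \<bullet> z" using LIMSEQ_le_const by blast
      moreover have "0 < e * norm z" using \<phi>(1) False by simp
      ultimately have "0 < \<phi> \<bullet> z" using cl(1) by linarith
      then show ?thesis by (rule cl(2))
    qed
    show "x = 0" if x: "x \<in> closure K" "- x \<in> closure K" for x
    proof -
      have "closure K \<subseteq> {x. e * norm x \<le> \<phi> \<bullet> x}"
        using \<phi>(2) by (intro closure_minimal closed_Collect_le continuous_intros) auto
      then have "e * norm x \<le> \<phi> \<bullet> x" "e * norm (- x) \<le> \<phi> \<bullet> (- x)" using x by blast+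
      then have "e * norm x \<le> 0" by simp
      then show ?thesis using \<phi>(1) by (simp add: mult_le_0_iff)
    qed
  qed (use c1 V'_def K(2) y y0 in auto)
  moreover have "K = interior (closure K)"
    using convex_interior_closure[OF K(1)] interior_open[OF K(2)] by simp
  ultimately show ?thesis unfolding \<Omega>K by metis
qed

text \<open>Diagonal conjugation multiplies the parameters by d_(i+2) / d_i and preserves their
  product. With d_1 = 1 the equations for 1 and 3 determine d, and the equation for 2 is then the
  equality of the products.\<close>

lemma diagonal_change:
  assumes "\<And>i. 0 < p i" "\<And>i. 0 < s i" "p 1 * p 2 * p 3 = s 1 * s 2 * (s 3 :: real)"
  obtains d :: "3 \<Rightarrow> real" where "\<And>i. 0 < d i" "\<And>i. p i = s i * d (i + 2) / d i"
proof -
  define d :: "3 \<Rightarrow> real" where "d i = (if i = 1 then 1 else if i = 2 then p 1 * p 3 / (s 1 * s 3) else p 1 / s 1)" for i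
  have nz: "p i \<noteq> 0" "s i \<noteq> 0" for i using assms(1,2)[of i] by auto
  have "p i = s i * d (i + 2) / d i" for i
    using exhaust_3[of i]
  proof (elim disjE)
    assume "i = 2"
    moreover have "p 2 = s 1 * s 2 * s 3 / (p 1 * p 3)" using assms(3) nz by (simp add: field_simps)
    ultimately show ?thesis using nz by (simp add: d_def cyc3 field_simps)
  qed (use nz in \<open>simp_all add: d_def cyc3 field_simps\<close>)
  moreover have "0 < d i" for i using assms(1,2) by (simp add: d_def)
  ultimately show ?thesis using that by blast
qed

section \<open>Every admissible polygon occurs as a limit\<close>

lemma convex_gon_image:
  assumes "linear E" shows "convex (E ` gon_cone k)"
proof -
  have "convex (gon_cone k)" by (simp add: convex_alt gon_cone_add gon_cone_scaleR)
  then show ?thesis using assms by (rule convex_linear_image[rotated])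
qed

text \<open>The distribution of the product c over the three parameters selects the limit: all equal
  to the cube root of c for the triangle, or all of c on one wall for the polygon of the dihedral
  group generated by the other two.\<close>

theorem gon_is_limit:
  assumes m: "hyperbolic_orders m" and k: "k \<in> insert 3 (range m)"
  obtains D :: "real \<Rightarrow> real^3^3" and E where "\<And>c. 1 \<le> c \<Longrightarrow> invertible (D c)" "linear E" "inj E"
    "\<And>c. (\<And>n. 1 \<le> c n) \<Longrightarrow> filterlim c at_top sequentially \<Longrightarrow>
       (\<lambda>n. hausdist (pcone ((*v) (D (c n)) ` tits (tri m (std_param (c n))))) (pcone (interior (E ` gon_cone k)))) \<longlonglongrightarrow> 0"
proof -
  have "\<exists>P l E. (\<forall>c i. 1 \<le> c \<longrightarrow> 1 \<le> P c i) \<and> (\<forall>c. 1 \<le> c \<longrightarrow> P c 1 * P c 2 * P c 3 = c) \<and> linear E \<and> inj E \<and>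
    (\<forall>c. (\<forall>n. 1 \<le> c n) \<longrightarrow> filterlim c at_top sequentially \<longrightarrow> limit_cone m l = E ` gon_cone k \<and>
      (\<chi> i. 1) \<in> interior (limit_cone m l) \<and>
      cone_limit (\<lambda>n. tits (tri m (P (c n)))) (limit_cone m l))"
    (is "\<exists>P l E. ?Q P l E")
  proof (cases "k = 3")
    case True
    obtain G where G: "linear G" "inj G" "G ` gon_cone 3 = orthant" by (rule orthant_gon_cone)
    have "?Q (\<lambda>c i. root 3 c) (\<lambda>_. 0) G"
    proof (intro conjI allI impI)
      fix c :: real and i :: 3 assume c: "1 \<le> c"
      then show "1 \<le> root 3 c" by simp
      have "root 3 c ^ 3 = c" using c by (simp add: real_root_pow_pos2)
      then show "root 3 c * root 3 c * root 3 c = c" by (simp add: power3_eq_cube)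
    next
      fix c :: "nat \<Rightarrow> real" assume c: "\<forall>n. 1 \<le> c n" "filterlim c at_top sequentially"
      have p: "1 \<le> root 3 (c n)" for n and i :: 3 using c(1) by simp
      have "filterlim (\<lambda>n. root 3 (c n)) at_top sequentially"
        unfolding filterlim_at_top
      proof
        fix Z :: real
        have "eventually (\<lambda>n. \<bar>Z\<bar> ^ 3 \<le> c n) sequentially" using c(2) by (simp add: filterlim_at_top)
        then show "eventually (\<lambda>n. Z \<le> root 3 (c n)) sequentially"
        proof eventually_elim
          case (elim n)
          have "\<bar>Z\<bar> = root 3 (\<bar>Z\<bar> ^ 3)" by (simp add: real_root_power_cancel)
          also have "\<dots> \<le> root 3 (c n)" using elim by simp
          finally show ?case by simp
        qed
      qed
      then have l: "(\<lambda>n. inverse (root 3 (c n))) \<longlonglongrightarrow> 0" by (rule tendsto_inverse_0_at_top)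
      note none = limit_cone_none[where p = "\<lambda>n i. root 3 (c n)" and l = "\<lambda>_. 0", OF m p l refl]
      show "limit_cone m (\<lambda>_. 0) = G ` gon_cone k" using none(1) G(3) True by simp
      show "(\<chi> i. 1) \<in> interior (limit_cone m (\<lambda>_. 0))" by (rule none(3)) simp
      show "cone_limit (\<lambda>n. tits (tri m (\<lambda>i. root 3 (c n)))) (limit_cone m (\<lambda>_. 0))"
        using none(2) by (intro cone_limit_tits[where p = "\<lambda>n i. root 3 (c n)" and l = "\<lambda>_. 0", OF m p l])
    qed (use G in auto)
    then show ?thesis
      by (intro exI[of _ "\<lambda>c i. root 3 c"] exI[of _ "\<lambda>_. 0"] exI[of _ G])
  next
    case False
    then obtain j0 where j0: "k = m j0" using k by auto
    \<comment> \<open>Walls j and j + 1 are to survive; they meet at vertex j + 2 = j0, whose order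
      is k.\<close>
    define j where "j = j0 + 1"
    have j: "k = m (j + 2)" using j0 by (simp add: j_def)
    define l :: "3 \<Rightarrow> real" where "l i = (if i = j + 2 then 0 else 1)" for i
    have lj: "l j \<noteq> 0" "l (j + 1) \<noteq> 0" "l (j + 2) = 0" by (simp_all add: l_def)
    define P where "P c i = (if i = j + 2 then c else 1)" for c :: real and i :: 3
    have fin: "linear (limit_frame m l j) \<and> inj (limit_frame m l j) \<and> limit_cone m l = limit_frame m l j ` gon_cone k \<and>
      (\<chi> i. 1) \<in> interior (limit_cone m l) \<and> cone_limit (\<lambda>n. tits (tri m (P (c n)))) (limit_cone m l)"
      if c: "\<forall>n. 1 \<le> c n" "filterlim c at_top sequentially" for c :: "nat \<Rightarrow> real"
    proof -
      have p: "1 \<le> P (c n) i" for n i using c(1) by (simp add: P_def)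
      have lim: "(\<lambda>n. inverse (P (c n) i)) \<longlonglongrightarrow> l i" for i
        using tendsto_inverse_0_at_top[OF c(2)] by (cases "i = j + 2") (auto simp: P_def l_def)
      show ?thesis
        using linear_frame[where p = "\<lambda>n. P (c n)" and l = l, OF m p lim lj]
          inj_frame[where p = "\<lambda>n. P (c n)" and l = l, OF m p lim lj]
          limit_cone_two[where p = "\<lambda>n. P (c n)" and l = l, OF m p lim lj]
          limit_cone_two_interior[where p = "\<lambda>n. P (c n)" and l = l, OF m p lim lj, of "\<chi> i. 1"]
          cone_limit_tits[where p = "\<lambda>n. P (c n)" and l = l, OF m p lim]
          limit_cone_two_descent[where p = "\<lambda>n. P (c n)" and l = l, OF m p lim lj]
        by (simp add: j orthant_def)
    qed
    \<comment> \<open>The facts about the frame come along a sequence of parameters; c n = n + 1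
      provides one from which linearity and injectivity are read off.\<close>
    have "filterlim (\<lambda>n. real (Suc n)) at_top sequentially"
      by (rule filterlim_compose[OF filterlim_real_sequentially filterlim_Suc])
    note fin0 = fin[OF _ this]
    have "j + 2 = 1 \<or> j + 2 = 2 \<or> j + 2 = 3" using exhaust_3 by blast
    then have "?Q P l (limit_frame m l j)"
      using fin fin0 by (auto simp: P_def)
    then show ?thesis
      by (intro exI[of _ P] exI[of _ l] exI[of _ "limit_frame m l j"])
  qed
  then obtain P l E where PE: "\<And>c i. 1 \<le> c \<Longrightarrow> 1 \<le> P c i" "\<And>c. 1 \<le> c \<Longrightarrow> P c 1 * P c 2 * P c 3 = c" "linear E" "inj E"
    "\<And>c. (\<And>n. 1 \<le> c n) \<Longrightarrow> filterlim c at_top sequentially \<Longrightarrow> limit_cone m l = E ` gon_cone k \<and>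
      (\<chi> i. 1) \<in> interior (limit_cone m l) \<and> cone_limit (\<lambda>n. tits (tri m (P (c n)))) (limit_cone m l)"
    by blast
  have "\<exists>d. (\<forall>i. 0 < d i) \<and> (\<forall>i. P c i = std_param c i * d (i + 2) / d i)" if c: "1 \<le> c" for c
  proof -
    have "0 < P c i" "0 < std_param c i" for i
      using PE(1)[OF c, of i] c by (auto simp: std_param_def)
    moreover have "P c 1 * P c 2 * P c 3 = std_param c 1 * std_param c 2 * std_param c 3"
      using PE(2)[OF c] by (simp add: std_param_def)
    ultimately show ?thesis using diagonal_change[of "P c" "std_param c"] by metis
  qed
  then obtain d where d: "\<And>c i. 1 \<le> c \<Longrightarrow> 0 < d c i" "\<And>c i. 1 \<le> c \<Longrightarrow> P c i = std_param c i * d c (i + 2) / d c i"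
    by metis
  show ?thesis
  proof (rule that[of "\<lambda>c. diag (d c)" E])
    show "invertible (diag (d c))" if "1 \<le> c" for c
      using d(1)[OF that] by (intro invertible_diag) (metis less_irrefl)
    fix c :: "nat \<Rightarrow> real" assume c: "\<And>n. 1 \<le> c n" "filterlim c at_top sequentially"
    have img: "(*v) (diag (d (c n))) ` tits (tri m (std_param (c n))) = tits (tri m (P (c n)))" for n
    proof -
      have "P (c n) = (\<lambda>i. std_param (c n) i * d (c n) (i + 2) / d (c n) i)" using d(2)[OF c(1)] by blast
      moreover have "std_param (c n) i \<noteq> 0" for i using c(1)[of n] by (auto simp: std_param_def)
      ultimately show ?thesis using diag_tits[of "d (c n)" "std_param (c n)" m] d(1)[OF c(1)] by simp
    qed
    note L = PE(5)[OF c]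
    have "(\<lambda>n. hausdist (pcone (tits (tri m (P (c n))))) (pcone (interior (E ` gon_cone k)))) \<longlonglongrightarrow> 0"
    proof (rule cone_limit_hausdist)
      show "cone_limit (\<lambda>n. tits (tri m (P (c n)))) (E ` gon_cone k)" using L by metis
      show "\<exists>x\<in>tits (tri m (P (c n))). x \<noteq> 0" for n
      proof (rule bexI[of _ "axis 1 1"])
        show "axis 1 1 \<in> tits (tri m (P (c n)))"
          by (intro orthant_in_tits) (simp add: orthant_def axis_def)
      qed simp
      show "interior (E ` gon_cone k) \<noteq> {}" using L by auto
    qed (auto intro: tits_scaleR convex_gon_image PE)
    then show "(\<lambda>n. hausdist (pcone ((*v) (diag (d (c n))) ` tits (tri m (std_param (c n))))) (pcone (interior (E ` gon_cone k)))) \<longlonglongrightarrow> 0"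
      by (simp only: img)
  qed (use PE in auto)
qed

section \<open>Regular polygons as projective cones\<close>

definition plane_cone :: "(real^2) set \<Rightarrow> (real^3) set" where
  "plane_cone P = {t *\<^sub>R affine_lift x | t x. 0 \<le> t \<and> x \<in> P}"

lemma continuous_affine_lift: "continuous_on UNIV affine_lift"
proof -
  have "continuous_on UNIV (\<lambda>x. affine_lift x $ i)" for i
    using exhaust_3[of i] by (elim disjE) (simp_all add: affine_lift_nth continuous_on_component)
  then show ?thesis by (subst continuous_on_componentwise) (auto simp: Basis_vec_def inner_axis)
qed

lemma affine_lift_eqD: "affine_lift x = t *\<^sub>R affine_lift y \<Longrightarrow> x = y"
  using arg_cong[of "affine_lift x" "t *\<^sub>R affine_lift y" "\<lambda>v. v $ 3"]
    arg_cong[of "affine_lift x" "t *\<^sub>R affine_lift y" "\<lambda>v. v $ 1"]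
    arg_cong[of "affine_lift x" "t *\<^sub>R affine_lift y" "\<lambda>v. v $ 2"]
  by (simp add: affine_lift_nth vec_eq_iff forall_2)

lemma pcone_plane_cone: "pcone (interior (plane_cone P)) = affine_pt ` interior P"
proof
  show "pcone (interior (plane_cone P)) \<subseteq> affine_pt ` interior P"
  proof
    fix q assume "q \<in> pcone (interior (plane_cone P))"
    then obtain z where z: "z \<in> interior (plane_cone P)" "z \<noteq> 0" "q = proj z" by (auto simp: pcone_def)
    then obtain t x where tx: "z = t *\<^sub>R affine_lift x" "0 \<le> t" "x \<in> P"
      using interior_subset by (fastforce simp: plane_cone_def)
    have t: "0 < t" using tx z(2) by (cases "t = 0") auto
    define U where "U = (\<lambda>y. t *\<^sub>R affine_lift y) -` interior (plane_cone P)"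
    have "open U"
      unfolding U_def using continuous_affine_lift
      by (intro open_vimage open_interior continuous_on_scaleR continuous_on_const)
    moreover have "U \<subseteq> P"
    proof
      fix y assume "y \<in> U"
      then have "t *\<^sub>R affine_lift y \<in> plane_cone P" using interior_subset by (auto simp: U_def)
      then obtain s w where sw: "t *\<^sub>R affine_lift y = s *\<^sub>R affine_lift w" "w \<in> P" by (auto simp: plane_cone_def)
      then have "affine_lift y = (s / t) *\<^sub>R affine_lift w"
        using t by (metis divide_inverse_commute divideR_right less_irrefl scaleR_scaleR)
      then show "y \<in> P" using affine_lift_eqD sw(2) by metis
    qed
    moreover have "x \<in> U" using z(1) tx(1) by (simp add: U_def)
    ultimately have "x \<in> interior P" using interiorI by blast
    moreover have "q = affine_pt x" using t by (simp add: z(3) tx(1) affine_pt_def proj_scaleR)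
    ultimately show "q \<in> affine_pt ` interior P" by blast
  qed
  show "affine_pt ` interior P \<subseteq> pcone (interior (plane_cone P))"
  proof
    fix q assume "q \<in> affine_pt ` interior P"
    then obtain x where x: "x \<in> interior P" "q = affine_pt x" by blast
    define h :: "real^3 \<Rightarrow> real^2" where "h z = vector [z $ 1 / z $ 3, z $ 2 / z $ 3]" for z
    have "continuous_on {z :: real^3. 0 < z $ 3} (\<lambda>z. z $ 1 / z $ 3)"
      "continuous_on {z :: real^3. 0 < z $ 3} (\<lambda>z. z $ 2 / z $ 3)"
      by (intro continuous_intros; simp)+
    then have "continuous_on {z. 0 < z $ 3} (\<lambda>z. h z $ i)" for i
      using exhaust_2[of i] by (auto simp: h_def)
    then have "continuous_on {z. 0 < z $ 3} h"
      by (subst continuous_on_componentwise) (auto simp: Basis_vec_def inner_axis)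
    moreover have o: "open {z :: real^3. 0 < z $ 3}" by (simp add: open_halfspace_component_gt_cart)
    ultimately have "open ({z. 0 < z $ 3} \<inter> h -` interior P)"
      using continuous_on_open_vimage[OF o, of h] by (auto simp: Int_commute)
    moreover have "{z. 0 < z $ 3} \<inter> h -` interior P \<subseteq> plane_cone P"
    proof
      fix z assume z: "z \<in> {z. 0 < z $ 3} \<inter> h -` interior P"
      then have "z = (z $ 3) *\<^sub>R affine_lift (h z)" unfolding h_def by (intro affine_lift_of_nth) auto
      then show "z \<in> plane_cone P"
        using z interior_subset unfolding plane_cone_def by (smt (verit) IntE mem_Collect_eq subsetD vimageE)
    qed
    moreover have "affine_lift x \<in> {z. 0 < z $ 3} \<inter> h -` interior P"
    proof -
      have "h (affine_lift x) = x" by (simp add: h_def affine_lift_nth vec_eq_iff forall_2)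
      then show ?thesis using x(1) by (simp add: affine_lift_nth)
    qed
    ultimately have "affine_lift x \<in> interior (plane_cone P)" by (intro interiorI)
    then show "q \<in> pcone (interior (plane_cone P))"
      unfolding pcone_def x(2) affine_pt_def by (intro imageI) simp
  qed
qed

text \<open>S is the similarity with translation m, ratio r and angle \<theta> in homogeneous
  coordinates; it carries the standard vertices to those of the polygon.\<close>

lemma plane_cone_polygon:
  fixes m :: "real^2" and r \<theta> :: real
  assumes k: "0 < k"
  defines "S \<equiv> \<lambda>x :: real^3. vector [m $ 1 * x $ 3 + r * (cos \<theta> * x $ 1 - sin \<theta> * x $ 2),
     m $ 2 * x $ 3 + r * (sin \<theta> * x $ 1 + cos \<theta> * x $ 2), x $ 3] :: real^3"
  shows "plane_cone (convex hull ((\<lambda>j. m + r *\<^sub>R vector [cos (\<theta> + 2 * pi * real j / real k),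
      sin (\<theta> + 2 * pi * real j / real k)]) ` {..<k})) = S ` gon_cone k"
    "linear S" "0 < r \<Longrightarrow> inj S"
proof -
  define w where "w j = m + r *\<^sub>R (vector [cos (\<theta> + 2 * pi * real j / real k),
      sin (\<theta> + 2 * pi * real j / real k)] :: real^2)" for j
  let ?H = "convex hull (w ` {..<k})"
  show lin: "linear S"
    by (rule linearI) (simp_all add: S_def vec_eq_iff forall_3 algebra_simps)
  show "inj S" if r: "0 < r"
    unfolding linear_injective_0[OF lin]
  proof (intro allI impI)
    fix x assume "S x = 0"
    then have x3: "x $ 3 = 0" and e: "r * (cos \<theta> * x $ 1 - sin \<theta> * x $ 2) = 0" "r * (sin \<theta> * x $ 1 + cos \<theta> * x $ 2) = 0"
      by (auto simp: S_def vec_eq_iff forall_3)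
    then have e: "cos \<theta> * x $ 1 - sin \<theta> * x $ 2 = 0" "sin \<theta> * x $ 1 + cos \<theta> * x $ 2 = 0" using r by auto
    have sc: "sin \<theta> * sin \<theta> + cos \<theta> * cos \<theta> = 1" using sin_cos_squared_add[of \<theta>] by (simp add: power2_eq_square)
    have "x $ 1 = 0" "x $ 2 = 0" using e sc by algebra+
    then show "x = 0" using x3 by (simp add: vec_eq_iff forall_3)
  qed
  have Sv: "S (gon_vertex k (int j)) = affine_lift (w j)" for j
    by (simp add: S_def w_def vec_eq_iff forall_3 gon_vertex_nth affine_lift_nth cos_add sin_add)
  have add: "x + y \<in> plane_cone ?H" if xy: "x \<in> plane_cone ?H" "y \<in> plane_cone ?H" for x y
  proof -
    obtain s a t b where *: "x = s *\<^sub>R affine_lift a" "y = t *\<^sub>R affine_lift b" "0 \<le> s" "0 \<le> t" "a \<in> ?H" "b \<in> ?H"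
      using xy unfolding plane_cone_def by blast
    show ?thesis
    proof (cases "s + t = 0")
      case True
      then have "s = 0" "t = 0" using * by auto
      then show ?thesis using xy * by simp
    next
      case False
      then have st: "0 < s + t" using * by simp
      have one: "s / (s + t) + t / (s + t) = 1" using st by (simp add: add_divide_distrib[symmetric])
      define c where "c = (s / (s + t)) *\<^sub>R a + (t / (s + t)) *\<^sub>R b"
      have "c \<in> ?H" unfolding c_def using * st one by (intro convexD[OF convex_convex_hull]) auto
      moreover have "x + y = (s + t) *\<^sub>R affine_lift c"
        unfolding c_def affine_lift_combine[OF one] using st by (simp add: * scaleR_add_right)
      ultimately show ?thesis using st unfolding plane_cone_def by (intro CollectI exI[of _ "s + t"] exI[of _ c]) auto
    qed
  qed
  have scale: "c *\<^sub>R x \<in> plane_cone ?H" if "x \<in> plane_cone ?H" "0 \<le> c" for c x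
    using that unfolding plane_cone_def by (smt (verit) mem_Collect_eq mult_nonneg_nonneg scaleR_scaleR)
  have "S ` gon_cone k \<subseteq> plane_cone ?H"
  proof (rule gon_cone_linear_subset[OF lin])
    fix n
    define j where "j = nat (n mod int k)"
    have j: "j < k" "int j = n mod int k" using k by (auto simp: j_def nat_less_iff)
    have "S (gon_vertex k n) = 1 *\<^sub>R affine_lift (w j)"
      using gon_vertex_mod[OF k, of n] Sv[of j] j(2) by simp
    moreover have "w j \<in> ?H" using j(1) by (intro hull_inc) auto
    ultimately show "S (gon_vertex k n) \<in> plane_cone ?H"
      unfolding plane_cone_def by (intro CollectI exI[of _ 1] exI[of _ "w j"]) auto
  next
    have "w 0 \<in> ?H" using k by (intro hull_inc) auto
    then show "0 \<in> plane_cone ?H" unfolding plane_cone_def by (intro CollectI exI[of _ 0] exI[of _ "w 0"]) auto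
  qed (use add scale in auto)
  moreover have "plane_cone ?H \<subseteq> S ` gon_cone k"
  proof
    have sub: "?H \<subseteq> {x. affine_lift x \<in> S ` gon_cone k}"
    proof (rule hull_minimal)
      show "w ` {..<k} \<subseteq> {x. affine_lift x \<in> S ` gon_cone k}"
        using gon_cone_vertex by (auto simp: Sv[symmetric])
      show "convex {x. affine_lift x \<in> S ` gon_cone k}"
        unfolding convex_def
      proof (intro ballI allI impI)
        fix x y and u v :: real
        assume *: "x \<in> {x. affine_lift x \<in> S ` gon_cone k}" "y \<in> {x. affine_lift x \<in> S ` gon_cone k}"
          "0 \<le> u" "0 \<le> v" "u + v = 1"
        then show "u *\<^sub>R x + v *\<^sub>R y \<in> {x. affine_lift x \<in> S ` gon_cone k}"
          using convexD[OF convex_gon_image[OF lin]] by (simp add: affine_lift_combine)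
      qed
    qed
    fix z assume "z \<in> plane_cone ?H"
    then obtain t x where tx: "z = t *\<^sub>R affine_lift x" "0 \<le> t" "x \<in> ?H" by (auto simp: plane_cone_def)
    then obtain u where u: "u \<in> gon_cone k" "affine_lift x = S u" using sub by blast
    then have "z = S (t *\<^sub>R u)" using tx(1) lin by (simp add: linear_cmul)
    then show "z \<in> S ` gon_cone k" using gon_cone_scaleR[OF u(1) tx(2)] by blast
  qed
  ultimately show "plane_cone (convex hull ((\<lambda>j. m + r *\<^sub>R vector [cos (\<theta> + 2 * pi * real j / real k),
      sin (\<theta> + 2 * pi * real j / real k)]) ` {..<k})) = S ` gon_cone k"
    unfolding w_def by blast
qed

lemma SL3_invertible: "g \<in> carrier SL3 \<Longrightarrow> invertible g"
  by (simp add: SL3_def invertible_det_nz)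

text \<open>A linear isomorphism acts projectively like an element of SL(3,R), because a real cube
  root normalises its determinant whatever the sign.\<close>

theorem regular_gon_pcone_iff:
  assumes k: "0 < k"
  shows "regular_gon k \<Omega> \<longleftrightarrow> (\<exists>E. linear E \<and> inj E \<and> \<Omega> = pcone (interior (E ` gon_cone k)))"
proof
  assume "regular_gon k \<Omega>"
  then obtain g P where g: "g \<in> carrier SL3" and P: "euclidean_regular_gon k P" "\<Omega> = pact g ` affine_pt ` interior P"
    by (auto simp: regular_gon_def)
  from P(1) obtain m r \<theta> where r: "0 < r" "P = convex hull ((\<lambda>j. m + r *\<^sub>R vector [cos (\<theta> + 2 * pi * real j / real k),
      sin (\<theta> + 2 * pi * real j / real k)]) ` {..<k})" unfolding euclidean_regular_gon_def by blast
  note S = plane_cone_polygon[where m = m and r = r and \<theta> = \<theta>, OF k, folded r(2)]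
  obtain S where S: "plane_cone P = S ` gon_cone k" "linear S" "inj S" using S r(1) by blast
  have g': "linear ((*v) g)" "inj ((*v) g)"
    using SL3_inj[OF g] by (auto intro: matrix_vector_mul_linear)
  have "\<Omega> = pcone ((*v) g ` interior (S ` gon_cone k))"
    unfolding P(2) pcone_plane_cone[symmetric] S(1) by (rule pact_pcone[OF SL3_invertible[OF g]])
  also have "\<dots> = pcone (interior (((*v) g \<circ> S) ` gon_cone k))"
    by (simp add: open_image_linear_interior[OF g', symmetric] image_comp)
  finally show "\<exists>E. linear E \<and> inj E \<and> \<Omega> = pcone (interior (E ` gon_cone k))"
    using S g' linear_compose[OF S(2) g'(1)] inj_compose[OF g'(2) S(3)] by blast
next
  assume "\<exists>E. linear E \<and> inj E \<and> \<Omega> = pcone (interior (E ` gon_cone k))"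
  then obtain E where E: "linear E" "inj E" "\<Omega> = pcone (interior (E ` gon_cone k))" by blast
  define A where "A = matrix E"
  have AE: "A *v x = E x" for x using E(1) by (simp add: A_def matrix_works)
  have "inj ((*v) A)" using E(2) by (simp add: AE[abs_def] inj_def)
  then have detA: "det A \<noteq> 0" 
    by (metis invertible_det_nz invertible_left_inverse matrix_left_invertible_injective)
  define c where "c = root 3 (inverse (det A))"
  have c3: "c ^ 3 = inverse (det A)" by (simp add: c_def odd_real_root_pow)
  then have c0: "c \<noteq> 0" using detA by auto
  define g where "g = c *\<^sub>R A"
  have "det g = c ^ 3 * det A" by (simp add: g_def det_3 power3_eq_cube algebra_simps)
  then have g: "g \<in> carrier SL3" using detA c3 by (simp add: SL3_def)
  define P where "P = convex hull ((\<lambda>j. (0 :: real^2) + 1 *\<^sub>R vector [cos (0 + 2 * pi * real j / real k),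
      sin (0 + 2 * pi * real j / real k)]) ` {..<k})"
  have P: "euclidean_regular_gon k P"
    unfolding euclidean_regular_gon_def P_def by (intro exI conjI) (rule zero_less_one, rule refl)
  have "plane_cone P = (\<lambda>x. x) ` gon_cone k"
    unfolding P_def plane_cone_polygon(1)[OF k] by (intro image_cong) (auto simp: vec_eq_iff forall_3)
  then have PG: "plane_cone P = gon_cone k" by simp
  have "pact g ` affine_pt ` interior P = pcone ((*v) g ` interior (gon_cone k))"
    unfolding pcone_plane_cone[symmetric] PG by (rule pact_pcone[OF SL3_invertible[OF g]])
  also have "(*v) g ` interior (gon_cone k) = (*\<^sub>R) c ` E ` interior (gon_cone k)"
    by (simp add: image_image g_def scaleR_matrix_vector_assoc[symmetric] AE)
  also have "pcone \<dots> = \<Omega>"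
    by (simp add: pcone_scaleR[OF c0] E(3) open_image_linear_interior[OF E(1,2)])
  finally show "regular_gon k \<Omega>" using g P unfolding regular_gon_def by metis
qed

text \<open>The adjugate functional k at x equals \<open>det S\<close> times coordinate k of S^(-1)
  x, and it is non-negative on the cone. The sum of the three is therefore |det S| times the sum
  norm of S^(-1) x.\<close>

lemma tits_norm_bound:
  assumes S: "cartan m S"
  obtains e \<phi> where "0 < e" "\<And>x. x \<in> tits S \<Longrightarrow> e * norm x \<le> \<phi> \<bullet> x"
proof -
  let ?\<phi> = "\<lambda>k. cross3 (column (k + 1) S) (column (k + 2) S)"
  have det: "det S < 0" using S by (simp add: cartan_def)
  then have inv: "invertible S" by (simp add: invertible_det_nz)
  define y where "y x = matrix_inv S *v x" for x
  have Sy: "S *v y x = x" for x using inv by (simp add: y_def)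
  have comp: "?\<phi> k \<bullet> x = det S * y x $ k" for k x
  proof -
    have "?\<phi> k \<bullet> x = ?\<phi> k \<bullet> (S *v y x)" by (simp only: Sy)
    also have "S *v y x = (\<Sum>i\<in>UNIV. y x $ i *\<^sub>R column i S)"
      by (simp add: matrix_mult_sum scalar_mult_eq_scaleR)
    also have "?\<phi> k \<bullet> \<dots> = (\<Sum>i\<in>UNIV. y x $ i * (?\<phi> k \<bullet> column i S))"
      by (simp add: inner_sum_right)
    also have "\<dots> = (\<Sum>i\<in>UNIV. if i = k then det S * y x $ k else 0)"
      by (intro sum.cong) (auto simp: adjugate_row(4)[OF S])
    finally show ?thesis by simp
  qed
  obtain B where B: "0 < B" "\<And>x. norm (S *v x) \<le> norm x * B"
    using bounded_linear.pos_bounded[OF matrix_vector_mul_bounded_linear[of S]] by blast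
  have "(- det S / B) * norm x \<le> (\<Sum>k\<in>UNIV. ?\<phi> k) \<bullet> x" if x: "x \<in> tits S" for x
  proof -
    have pos: "0 \<le> ?\<phi> k \<bullet> x" for k
      using adjugate_tits[where k = k, OF S x] by (cases "x = 0") auto
    have "norm x \<le> norm (y x) * B" using B(2)[of "y x"] by (simp add: Sy)
    also have "\<dots> \<le> (\<Sum>k\<in>UNIV. \<bar>y x $ k\<bar>) * B" using B(1) norm_le_l1_cart by (intro mult_right_mono) auto
    finally have "- det S * norm x \<le> - det S * ((\<Sum>k\<in>UNIV. \<bar>y x $ k\<bar>) * B)"
      using det by (intro mult_left_mono) auto
    also have "- det S * ((\<Sum>k\<in>UNIV. \<bar>y x $ k\<bar>) * B) = (\<Sum>k\<in>UNIV. \<bar>?\<phi> k \<bullet> x\<bar>) * B"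
      using det by (simp add: comp abs_mult sum_negf flip: sum_distrib_left)
    also have "\<dots> = ((\<Sum>k\<in>UNIV. ?\<phi> k) \<bullet> x) * B"
      using pos by (simp add: inner_sum_left)
    finally show ?thesis using B(1) by (simp add: field_simps)
  qed
  moreover have "0 < - det S / B" using det B(1) by (simp add: divide_neg_pos)
  ultimately show ?thesis using that by blast
qed

lemma tits_image_convex_domain:
  assumes S: "cartan m S" and A: "invertible A"
  shows "pcone ((*v) A ` tits S) \<in> convex_domains"
proof -
  obtain e \<phi> where e: "0 < e" "\<And>x. x \<in> tits S \<Longrightarrow> e * norm x \<le> \<phi> \<bullet> x" using tits_norm_bound[OF S] by blast
  obtain B where B: "0 < B" "\<And>x. norm (A *v x) \<le> norm x * B"
    using bounded_linear.pos_bounded[OF matrix_vector_mul_bounded_linear[of A]] by blast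
  have lin: "linear ((*v) A)" "inj ((*v) A)" using A by (auto intro: matrix_vector_mul_linear inj_matrix_vector_mult)
  define \<psi> where "\<psi> = \<phi> v* matrix_inv A"
  have \<psi>: "\<psi> \<bullet> (A *v x) = \<phi> \<bullet> x" for x unfolding \<psi>_def dot_lmul_matrix by (simp add: A)
  have ne: "A *v x = 0 \<longleftrightarrow> x = 0" for x using lin by (simp add: linear_injective_0 linear_0) (metis lin(1) linear_0)
  have diff: "(*v) A ` tits S - {0} = (*v) A ` (tits S - {0})" by (auto simp: ne)
  show ?thesis
  proof (rule pcone_convex_domain[where e = "e / B" and \<phi> = \<psi>])
    show "convex ((*v) A ` tits S)" using convex_tits[OF S] lin(1) by (rule convex_linear_image[rotated])
    have "interior ((*v) A ` (tits S - {0})) = (*v) A ` (tits S - {0})"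
      using open_image_linear_interior[OF lin] open_tits[OF S] by (simp add: interior_open)
    then show "open ((*v) A ` tits S - {0})" unfolding diff by (metis open_interior)
    have "axis 1 1 \<in> tits S" by (intro orthant_in_tits) (simp add: orthant_def axis_def)
    moreover have "A *v axis 1 1 \<noteq> 0" using ne[of "axis 1 1"] by simp
    ultimately show "(*v) A ` tits S - {0} \<noteq> {}" by blast
    show "c *\<^sub>R x \<in> (*v) A ` tits S" if "x \<in> (*v) A ` tits S" "0 < c" for c x
      using that by (intro matrix_image_scaleR tits_scaleR) auto
    show "e / B * norm x \<le> \<psi> \<bullet> x" if "x \<in> (*v) A ` tits S" for x
    proof -
      obtain z where z: "z \<in> tits S" "x = A *v z" using \<open>x \<in> (*v) A ` tits S\<close> by blast
      have "norm x / B \<le> norm z" using B(2)[of z] B(1) by (simp add: z(2) field_simps)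
      then have "e * (norm x / B) \<le> e * norm z" using e(1) by (intro mult_left_mono) auto
      also have "\<dots> \<le> \<psi> \<bullet> x" unfolding z(2) \<psi> by (rule e(2)[OF z(1)])
      finally show ?thesis by simp
    qed
  qed (use e(1) B(1) in auto)
qed

section \<open>Degeneration as the parameter tends to infinity\<close>

lemma SL3_rescale:
  fixes A :: "real^3^3"
  assumes "invertible A"
  obtains c where "c \<noteq> 0" "c *\<^sub>R A \<in> carrier SL3"
proof -
  have d: "det A \<noteq> 0" using assms by (simp add: invertible_det_nz)
  define c where "c = root 3 (inverse (det A))"
  have c3: "c ^ 3 = inverse (det A)" by (simp add: c_def odd_real_root_pow)
  have "det (c *\<^sub>R A) = c ^ 3 * det A" by (simp add: det_3 power3_eq_cube algebra_simps)
  then have "c *\<^sub>R A \<in> carrier SL3" using d c3 by (simp add: SL3_def)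
  moreover have "c \<noteq> 0" using c3 d by auto
  ultimately show ?thesis using that by blast
qed

lemma pcone_matrix_scaleR:
  "c \<noteq> 0 \<Longrightarrow> pcone ((*v) (c *\<^sub>R A) ` K) = pcone ((*v) A ` K)" for A :: "real^3^3"
proof -
  assume c: "c \<noteq> 0"
  have "(*v) (c *\<^sub>R A) ` K = (*\<^sub>R) c ` (*v) A ` K"
    by (simp add: image_image scaleR_matrix_vector_assoc)
  then show ?thesis by (simp only: pcone_scaleR[OF c])
qed

lemma pact_pcone_image:
  assumes "g \<in> carrier SL3"
  shows "pact g ` pcone ((*v) B ` K) = pcone ((*v) (g ** B) ` K)"
  unfolding pact_pcone[OF SL3_invertible[OF assms]]
  by (simp add: image_image matrix_vector_mul_assoc)

text \<open>Necessity follows along a single sequence running to the end F. For sufficiency the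
  model degeneration is a function of c alone: its convergence is proved for c tending to infinity,
  transported to \<Omega> by a fixed map G, and then composed with c t.\<close>

theorem degeneration_iff:
  fixes B :: "real \<Rightarrow> real^3^3" and c :: "real \<Rightarrow> real"
  assumes m: "hyperbolic_orders m" and c: "\<And>t. 0 < c t" "filterlim c at_top F" and F: "F \<in> {at_top, at_bot}"
    and B: "\<And>t. invertible (B t)" and \<Omega>: "\<Omega> \<in> convex_domains"
  shows "(\<exists>A. (\<forall>t. A t \<in> carrier SL3) \<and>
     limitin domain_topology (\<lambda>t. pact (A t) ` pcone ((*v) (B t) ` tits (tri m (std_param (c t))))) \<Omega> F) \<longleftrightarrow>
     (\<exists>k\<in>insert 3 (range m). regular_gon k \<Omega>)"
proof -
  let ?T = "\<lambda>c. tits (tri m (std_param c))"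
  have cart: "cartan m (tri m (std_param c))" if "0 < c" for c
    using that by (intro cartan_tri[OF m]) (auto simp: std_param_def)
  have kpos: "0 < k" if "k \<in> insert 3 (range m)" for k
    using that m by (auto simp: hyperbolic_orders_def) (metis less_le_trans zero_less_numeral)
  have lim_iff: "limitin domain_topology (\<lambda>t. pact (A t) ` pcone ((*v) (B t) ` ?T (c t))) \<Omega> F \<longleftrightarrow>
      ((\<lambda>t. hausdist (pcone ((*v) (A t ** B t) ` ?T (c t))) \<Omega>) \<longlongrightarrow> 0) F"
    if A: "\<And>t. A t \<in> carrier SL3" for A
  proof -
    have img: "pact (A t) ` pcone ((*v) (B t) ` ?T (c t)) = pcone ((*v) (A t ** B t) ` ?T (c t))" for t
      by (rule pact_pcone_image[OF A])
    have dom: "pcone ((*v) (A t ** B t) ` ?T (c t)) \<in> convex_domains" for t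
      using cart[OF c(1)] by (rule tits_image_convex_domain) (intro invertible_mult SL3_invertible A B)
    have "0 \<le> hausdist (pcone ((*v) (A t ** B t) ` ?T (c t))) \<Omega>" for t
      using dom[of t] \<Omega> by (intro hausdist_nonneg) (auto simp: convex_domains_def)
    then show ?thesis
      unfolding domain_topology_def Metric_space.limitin_metric[OF Metric_space_convex_domains] tendsto_iff img
      using dom \<Omega> by simp
  qed
  show ?thesis
  proof
    assume "\<exists>A. (\<forall>t. A t \<in> carrier SL3) \<and>
     limitin domain_topology (\<lambda>t. pact (A t) ` pcone ((*v) (B t) ` ?T (c t))) \<Omega> F"
    then obtain A where A: "\<And>t. A t \<in> carrier SL3"
      "((\<lambda>t. hausdist (pcone ((*v) (A t ** B t) ` ?T (c t))) \<Omega>) \<longlongrightarrow> 0) F" using lim_iff by blast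
    obtain s :: "nat \<Rightarrow> real" where s: "filterlim s F sequentially"
    proof (cases "F = at_top")
      case True then show ?thesis using that filterlim_real_sequentially by blast
    next
      case False
      then have "F = at_bot" using F by simp
      then show ?thesis
        using that[of "\<lambda>n. - real n"] filterlim_real_sequentially by (simp add: filterlim_uminus_at_bot)
    qed
    have "\<exists>k\<in>insert 3 (range m). \<exists>E. linear E \<and> inj E \<and> \<Omega> = pcone (interior (E ` gon_cone k))"
    proof (rule limit_domain_gon[OF m _ _ \<Omega>])
      show "filterlim (\<lambda>n. c (s n)) at_top sequentially" using c(2) s by (rule filterlim_compose)
      show "invertible (A (s n) ** B (s n))" for n by (intro invertible_mult SL3_invertible A B)
      show "(\<lambda>n. hausdist (pcone ((*v) (A (s n) ** B (s n)) ` ?T (c (s n)))) \<Omega>) \<longlonglongrightarrow> 0"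
        using A(2) s by (rule filterlim_compose)
    qed
    then obtain k where "k \<in> insert 3 (range m)"
      "\<exists>E. linear E \<and> inj E \<and> \<Omega> = pcone (interior (E ` gon_cone k))" by blast
    then show "\<exists>k\<in>insert 3 (range m). regular_gon k \<Omega>"
      using regular_gon_pcone_iff[OF kpos] by metis
  next
    assume "\<exists>k\<in>insert 3 (range m). regular_gon k \<Omega>"
    then obtain k where k: "k \<in> insert 3 (range m)" "regular_gon k \<Omega>" by blast
    obtain E where E: "linear E" "inj E" "\<Omega> = pcone (interior (E ` gon_cone k))"
      using k(2) regular_gon_pcone_iff[OF kpos[OF k(1)]] by blast
    obtain D :: "real \<Rightarrow> real^3^3" and E0 where D: "\<And>c. 1 \<le> c \<Longrightarrow> invertible (D c)" "linear E0" "inj E0"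
      "\<And>c. (\<And>n. 1 \<le> c n) \<Longrightarrow> filterlim c at_top sequentially \<Longrightarrow>
       (\<lambda>n. hausdist (pcone ((*v) (D (c n)) ` ?T (c n))) (pcone (interior (E0 ` gon_cone k)))) \<longlonglongrightarrow> 0"
      using gon_is_limit[OF m k(1)] by blast
    obtain E1 where E1: "linear E1" "E1 \<circ> E0 = id" using linear_injective_left_inverse[OF D(2,3)] by blast
    define G where "G = matrix (E \<circ> E1)"
    have Gx: "G *v x = E (E1 x)" for x
      using linear_compose[OF E1(1) E(1)] by (simp add: G_def matrix_works)
    have E1': "E0 (E1 x) = x" for x
    proof -
      have "surj E0" using D(2,3) linear_injective_imp_surjective by blast
      then obtain y where "x = E0 y" by blast
      then show ?thesis using E1(2) by (simp add: fun_eq_iff)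
    qed
    have Ginj: "inj ((*v) G)"
      by (rule injI) (use E(2) E1' in \<open>metis Gx injD\<close>)
    then have Ginv: "invertible G"
      by (metis invertible_left_inverse matrix_left_invertible_injective)
    have GE: "(*v) G ` E0 ` X = E ` X" for X using E1(2) by (auto simp: image_image Gx fun_eq_iff)
    \<comment> \<open>The value 0 for c < 1 is a default: \<open>D c\<close> is controlled for c
      \<ge> 1, which holds near the end.\<close>
    define f where "f c = (if 1 \<le> c then hausdist (pcone ((*v) (G ** D c) ` ?T c)) \<Omega> else 0)" for c
    have "(f \<longlongrightarrow> 0) at_top"
    proof (rule tendsto_at_topI_sequentially)
      fix X :: "nat \<Rightarrow> real" assume X: "filterlim X at_top sequentially"
      define Y where "Y n = max 1 (X n)" for n
      have ev: "eventually (\<lambda>n. X n = Y n) sequentially"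
        using X[unfolded filterlim_at_top, rule_format, of 1] by eventually_elim (simp add: Y_def)
      have Y: "filterlim Y at_top sequentially" "\<And>n. 1 \<le> Y n"
        using X by (auto simp: Y_def intro: filterlim_at_top_mono)
      have Ym: "0 < Y n" for n using Y(2)[of n] by linarith
      have "(\<lambda>n. hausdist (pcone ((*v) (G ** D (Y n)) ` ?T (Y n))) \<Omega>) \<longlonglongrightarrow> 0"
      proof (rule hausdist_tendsto_0I)
        have im: "pcone ((*v) (G ** D (Y n)) ` ?T (Y n)) = pact G ` pcone ((*v) (D (Y n)) ` ?T (Y n))" for n
          unfolding pact_pcone[OF Ginv] by (simp add: image_image matrix_vector_mul_assoc)
        have im\<Omega>: "\<Omega> = pact G ` pcone (interior (E0 ` gon_cone k))"
          unfolding E(3) pact_pcone[OF Ginv] open_image_linear_interior[OF D(2,3)] open_image_linear_interior[OF E(1,2)] GE ..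
        have dom: "pcone ((*v) (D (Y n)) ` ?T (Y n)) \<in> convex_domains" for n
          using cart[OF Ym] D(1)[OF Y(2)] by (rule tits_image_convex_domain)
        then have ne: "pcone ((*v) (D (Y n)) ` ?T (Y n)) \<noteq> {}" for n by (auto simp: convex_domains_def)
        then show "pcone ((*v) (G ** D (Y n)) ` ?T (Y n)) \<noteq> {}" for n by (simp add: im)
        show "\<Omega> \<noteq> {}" using \<Omega> by (auto simp: convex_domains_def)
        then have ne0: "pcone (interior (E0 ` gon_cone k)) \<noteq> {}" using im\<Omega> by auto
        note H = D(4)[OF Y(2,1)]
        have cont: "(\<lambda>n. pact G (q n)) \<longlonglongrightarrow> pact G l" if q: "q \<longlonglongrightarrow> l" for q l
        proof -
          obtain u where u: "u \<noteq> 0" "l = proj u" using rp2_unit_rep[of l] by (metis norm_zero zero_neq_one)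
          obtain v where v: "v \<longlonglongrightarrow> u" "\<And>n. v n \<noteq> 0" "\<And>n. q n = proj (v n)"
            using lift_convergent[of q u] q u by metis
          have "G *v u \<noteq> 0" using Ginj u(1) by (metis injD matrix_vector_mult_0_right)
          then have "(\<lambda>n. proj (G *v v n)) \<longlonglongrightarrow> proj (G *v u)"
            by (intro proj_convergent tendsto_matrix_vector_mult tendsto_const v)
          then show ?thesis using u v by (simp add: pact_proj)
        qed
        show "\<exists>z. (\<forall>n. z n \<in> pcone ((*v) (G ** D (Y n)) ` ?T (Y n))) \<and> z \<longlonglongrightarrow> y" if y: "y \<in> \<Omega>" for y
        proof -
          obtain y0 where y0: "y0 \<in> pcone (interior (E0 ` gon_cone k))" "y = pact G y0" using y im\<Omega> by blast
          obtain z where z: "\<And>n. z n \<in> pcone ((*v) (D (Y n)) ` ?T (Y n))" "z \<longlonglongrightarrow> y0"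
            using hausdist_lower_limit[OF H ne y0(1)] by blast
          then show ?thesis using cont[OF z(2)] by (intro exI[of _ "\<lambda>n. pact G (z n)"]) (auto simp: im y0(2))
        qed
        show "l \<in> closure \<Omega>" if r: "strict_mono r" "\<And>n. z n \<in> pcone ((*v) (G ** D (Y (r n))) ` ?T (Y (r n)))" "z \<longlonglongrightarrow> l"
          for r :: "nat \<Rightarrow> nat" and z l
        proof -
          have "\<exists>w. w \<in> pcone ((*v) (D (Y (r n))) ` ?T (Y (r n))) \<and> z n = pact G w" for n
            using r(2)[of n] unfolding im by blast
          then obtain w where w: "\<And>n. w n \<in> pcone ((*v) (D (Y (r n))) ` ?T (Y (r n)))" "\<And>n. z n = pact G (w n)" by metis
          obtain l' s where s: "strict_mono s" "(w \<circ> s) \<longlonglongrightarrow> l'" using rp2_subsequence by blast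
          have "l' \<in> closure (pcone (interior (E0 ` gon_cone k)))"
            using hausdist_upper_limit[OF H ne0 strict_mono_o[OF r(1) s(1)] _ s(2)] w(1) by simp
          then obtain a where a: "\<And>n. a n \<in> pcone (interior (E0 ` gon_cone k))" "a \<longlonglongrightarrow> l'" using closure_sequential by blast
          have "(\<lambda>n. pact G ((w \<circ> s) n)) \<longlonglongrightarrow> pact G l'" by (rule cont[OF s(2)])
          moreover have "(\<lambda>n. pact G ((w \<circ> s) n)) \<longlonglongrightarrow> l"
            using LIMSEQ_subseq_LIMSEQ[OF r(3) s(1)] w(2) by (simp add: o_def)
          ultimately have "l = pact G l'" using LIMSEQ_unique by blast
          then show ?thesis
            using cont[OF a(2)] a(1) im\<Omega> by (intro closure_limitI[where x = "\<lambda>n. pact G (a n)"]) auto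
        qed
      qed
      then have "(\<lambda>n. f (Y n)) \<longlonglongrightarrow> 0" using Y(2) by (simp add: f_def)
      then show "(\<lambda>n. f (X n)) \<longlonglongrightarrow> 0"
        by (rule Lim_transform_eventually) (use ev in \<open>eventually_elim, simp\<close>)
    qed
    then have fc: "((\<lambda>t. f (c t)) \<longlongrightarrow> 0) F" using c(2) by (rule filterlim_compose)
    \<comment> \<open>A t undoes the given B t, applies the model map and is rescaled to determinant
      1; for c t < 1 the identity is taken.\<close>
    have "\<exists>A. A \<in> carrier SL3 \<and> (1 \<le> c t \<longrightarrow> pcone ((*v) (A ** B t) ` ?T (c t)) = pcone ((*v) (G ** D (c t)) ` ?T (c t)))" for t
    proof (cases "1 \<le> c t")
      case True
      have "invertible (matrix_inv (B t))" using matrix_inv_inverse[OF B[of t]] unfolding invertible_def by blast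
      then have "invertible (G ** D (c t) ** matrix_inv (B t))"
        by (intro invertible_mult Ginv D(1) True)
      then obtain a where a: "a \<noteq> 0" "a *\<^sub>R (G ** D (c t) ** matrix_inv (B t)) \<in> carrier SL3" by (rule SL3_rescale)
      have "(a *\<^sub>R (G ** D (c t) ** matrix_inv (B t))) ** B t = a *\<^sub>R (G ** D (c t))"
        using B[of t] by (simp add: matrix_eq scaleR_matrix_vector_assoc[symmetric] matrix_vector_mul_assoc[symmetric])
      then show ?thesis using a by (intro exI[of _ "a *\<^sub>R (G ** D (c t) ** matrix_inv (B t))"]) (simp add: pcone_matrix_scaleR)
    next
      case False
      have "mat 1 \<in> carrier SL3" by (simp add: SL3_def)
      then show ?thesis using False by blast
    qed
    then obtain A where A: "\<And>t. A t \<in> carrier SL3"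
      "\<And>t. 1 \<le> c t \<Longrightarrow> pcone ((*v) (A t ** B t) ` ?T (c t)) = pcone ((*v) (G ** D (c t)) ` ?T (c t))" by metis
    have "eventually (\<lambda>t. 1 \<le> c t) F" using c(2) by (simp add: filterlim_at_top)
    then have "eventually (\<lambda>t. f (c t) = hausdist (pcone ((*v) (A t ** B t) ` ?T (c t))) \<Omega>) F"
      by eventually_elim (simp add: f_def A(2))
    with fc have "((\<lambda>t. hausdist (pcone ((*v) (A t ** B t) ` ?T (c t))) \<Omega>) \<longlongrightarrow> 0) F"
      by (rule Lim_transform_eventually)
    then have "limitin domain_topology (\<lambda>t. pact (A t) ` pcone ((*v) (B t) ` ?T (c t))) \<Omega> F"
      by (rule iffD2[OF lim_iff[OF A(1)]])
    then show "\<exists>A. (\<forall>t. A t \<in> carrier SL3) \<and>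
     limitin domain_topology (\<lambda>t. pact (A t) ` pcone ((*v) (B t) ` ?T (c t))) \<Omega> F"
      using A(1) by (intro exI[of _ A]) simp
  qed
qed

section \<open>Triples of projective reflections\<close>

lemma trace_3: "trace A = A $ 1 $ 1 + A $ 2 $ 2 + A $ 3 $ 3" for A :: "real^3^3"
  by (simp add: trace_def sum_3)

text \<open>Here e is the sum of the principal two by two minors. The trace of A^2 = 1 gives 2 e =
  (trace A)^2 - 3, and 1 or -1 is an eigenvalue; both cases leave only the traces 3 and -1.\<close>

lemma involution_trace:
  fixes A :: "real^3^3"
  assumes "A ** A = mat 1" "det A = 1"
  shows "trace A = 3 \<or> trace A = - 1"
proof -
  define e where "e = A $ 1 $ 1 * A $ 2 $ 2 - A $ 1 $ 2 * A $ 2 $ 1 + A $ 1 $ 1 * A $ 3 $ 3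
    - A $ 1 $ 3 * A $ 3 $ 1 + A $ 2 $ 2 * A $ 3 $ 3 - A $ 2 $ 3 * A $ 3 $ 2"
  have "trace (A ** A) = 3" unfolding assms(1) by (simp add: trace_3 mat_def)
  moreover have "trace (A ** A) = (trace A)\<^sup>2 - 2 * e"
    by (simp add: trace_3 matrix_matrix_mult_def sum_3 e_def power2_eq_square algebra_simps)
  ultimately have e: "2 * e = (trace A)\<^sup>2 - 3" by simp
  have "(mat 1 + A) ** (mat 1 - A) = mat 1 - A ** A"
    by (simp add: matrix_eq matrix_vector_mul_assoc[symmetric] matrix_vector_mult_add_rdistrib
        matrix_vector_mult_diff_rdistrib matrix_vector_mult_diff_distrib)
  then have "det (mat 1 + A) * det (mat 1 - A) = 0" using assms(1) by (simp add: det_mul[symmetric]) (simp add: det_3)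
  moreover have "det (mat 1 + A) = 1 + trace A + e + det A" "det (mat 1 - A) = 1 - trace A + e - det A"
    by (simp_all add: det_3 trace_3 mat_def e_def algebra_simps)
  ultimately have "2 + (trace A + e) = 0 \<or> e = trace A" using assms(2) by simp
  then consider "e = - 2 - trace A" | "e = trace A" by linarith
  then have "(trace A - 3) * (trace A + 1) = 0"
  proof cases
    case 1
    then have "(trace A + 1)\<^sup>2 = 0" using e by (simp add: power2_eq_square algebra_simps)
    then show ?thesis by simp
  qed (use e in \<open>simp add: power2_eq_square algebra_simps\<close>)
  then show ?thesis by auto
qed

text \<open>For the matrix B with rows (a, b, c), (d, e, f), (g, h, i) the hypotheses say that trace
  B = 2 and B^2 = 2 B. By Cayley-Hamilton adj B = B^2 - (trace B) B + z, where z, the sum of the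
  principal two by two minors, is zero; so all two by two minors vanish.\<close>

lemma idempotent_minors:
  fixes a b c d e f g h i :: real
  assumes "a + e + i = 2"
    "a * a + b * d + c * g = 2 * a" "a * b + b * e + c * h = 2 * b" "a * c + b * f + c * i = 2 * c"
    "d * a + e * d + f * g = 2 * d" "d * b + e * e + f * h = 2 * e" "d * c + e * f + f * i = 2 * f"
    "g * a + h * d + i * g = 2 * g" "g * b + h * e + i * h = 2 * h" "g * c + h * f + i * i = 2 * i"
  shows "e * i = f * h" "a * i = c * g" "a * e = b * d" "c * h = b * i" "b * f = c * e" "f * g = d * i"
    "d * c = f * a" "h * d = g * e" "g * b = h * a"
proof -
  have "2 * (a * e - b * d + a * i - c * g + e * i - f * h) =
      (a + e + i) * (a + e + i) - ((a * a + b * d + c * g) + (d * b + e * e + f * h) + (g * c + h * f + i * i))"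
    by (simp add: algebra_simps)
  also have "\<dots> = 2 * (2 - (a + e + i))" using assms by simp
  finally have z: "a * e - b * d + a * i - c * g + e * i - f * h = 0" using assms(1) by simp
  have "e * i - f * h = (a * a + b * d + c * g) - (a + e + i) * a + (a * e - b * d + a * i - c * g + e * i - f * h)"
    "a * i - c * g = (d * b + e * e + f * h) - (a + e + i) * e + (a * e - b * d + a * i - c * g + e * i - f * h)"
    "a * e - b * d = (g * c + h * f + i * i) - (a + e + i) * i + (a * e - b * d + a * i - c * g + e * i - f * h)"
    "c * h - b * i = (a * b + b * e + c * h) - (a + e + i) * b" "b * f - c * e = (a * c + b * f + c * i) - (a + e + i) * c"
    "f * g - d * i = (d * a + e * d + f * g) - (a + e + i) * d" "d * c - f * a = (d * c + e * f + f * i) - (a + e + i) * f"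
    "h * d - g * e = (g * a + h * d + i * g) - (a + e + i) * g" "g * b - h * a = (g * b + h * e + i * h) - (a + e + i) * h"
    by (simp_all add: algebra_simps)
  then show "e * i = f * h" "a * i = c * g" "a * e = b * d" "c * h = b * i" "b * f = c * e" "f * g = d * i"
    "d * c = f * a" "h * d = g * e" "g * b = h * a"
    unfolding z unfolding assms by simp_all
qed

text \<open>B = 1 + A satisfies B^2 = 2 B and has trace 2, so its two by two minors vanish and B is
  the product of a column and a row through a nonzero diagonal entry.\<close>

lemma involution_rank_one:
  fixes A :: "real^3^3"
  assumes "A ** A = mat 1" "trace A = - 1"
  obtains v f where "\<And>x. (mat 1 + A) *v x = (f \<bullet> x) *\<^sub>R v" "f \<bullet> v = 2"
proof -
  define B where "B = mat 1 + A"
  have AA: "A *v (A *v x) = x" for x by (simp add: matrix_vector_mul_assoc assms(1))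
  have Bx: "B *v x = x + A *v x" for x by (simp add: B_def matrix_vector_mult_add_rdistrib)
  have "B *v (B *v x) = 2 *\<^sub>R (B *v x)" for x
    unfolding Bx by (simp add: matrix_vector_right_distrib AA vec_eq_iff)
  then have BB: "B ** B = 2 *\<^sub>R B"
    by (simp add: matrix_eq matrix_vector_mul_assoc[symmetric] scaleR_matrix_vector_assoc[symmetric])
  have "trace B = 2" using assms(2) by (simp add: B_def trace_3 mat_def)
  then have t: "B $ 1 $ 1 + B $ 2 $ 2 + B $ 3 $ 3 = 2" by (simp add: trace_3)
  have q: "B $ i $ 1 * B $ 1 $ j + B $ i $ 2 * B $ 2 $ j + B $ i $ 3 * B $ 3 $ j = 2 * B $ i $ j" for i j
    using arg_cong[OF BB, of "\<lambda>M. M $ i $ j"] by (simp add: matrix_matrix_mult_def sum_3)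
  note minors = idempotent_minors[OF t q[of 1 1] q[of 1 2] q[of 1 3] q[of 2 1] q[of 2 2] q[of 2 3]
      q[of 3 1] q[of 3 2] q[of 3 3]]
  note m1 = minors minors[symmetric]
  note m2 = m1 m1[THEN trans[OF mult.commute]]
  note m3 = m2 m2[THEN trans, OF mult.commute]
  have minor: "B $ i $ j * B $ a $ a = B $ i $ a * B $ a $ j" for i j a
    using exhaust_3[of i] exhaust_3[of j] exhaust_3[of a]
    by (elim disjE) (simp_all only:, (rule refl mult.commute m3)+)
  obtain a where a: "B $ a $ a \<noteq> 0" using t by force
  define v where "v = column a B"
  define f where "f = row a B /\<^sub>R B $ a $ a"
  have "B $ i $ j = v $ i * f $ j" for i j
    using minor[of i j a] a by (simp add: v_def f_def column_def row_def field_simps)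
  then have Bx: "B *v x = (f \<bullet> x) *\<^sub>R v" for x
    by (simp add: vec_eq_iff matrix_vector_mult_def inner_vec_def sum_distrib_left mult_ac)
  have "f \<bullet> v = 2"
    using q[of a a] a by (simp add: f_def v_def inner_vec_def sum_3 row_def column_def field_simps)
  then show ?thesis using that Bx by (simp add: B_def)
qed

lemma trace_rank_one:
  fixes A :: "real^3^3"
  assumes "\<And>x. A *v x = (f \<bullet> x) *\<^sub>R v" shows "trace A = f \<bullet> v"
proof -
  have "A $ i $ i = f $ i * v $ i" for i
  proof -
    have "A $ i $ i = (A *v axis i 1) $ i" by (simp add: matrix_vector_mult_basis column_def)
    also have "\<dots> = f $ i * v $ i" unfolding assms by (simp add: inner_axis)
    finally show ?thesis .
  qed
  then show ?thesis by (simp add: trace_def inner_vec_def)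
qed

lemma trace_conj:
  fixes A g :: "real^3^3"
  assumes "invertible g" shows "trace (g ** A ** matrix_inv g) = trace A"
proof -
  have "trace (X ** Y) = trace (Y ** X)" for X Y :: "real^3^3"
    by (simp add: trace_3 matrix_matrix_mult_def sum_3 algebra_simps)
  from this[of "g ** A" "matrix_inv g"] show ?thesis
    using assms by (simp add: matrix_mul_assoc matrix_inv_inverse)
qed

text \<open>\<open>wall B i\<close> is the rank one matrix whose kernel is the line fixed by the reflection \<open>B i\<close>.\<close>

definition wall :: "(3 \<Rightarrow> real^3^3) \<Rightarrow> 3 \<Rightarrow> real^3^3" where
  "wall B i = mat 1 + B i"

text \<open>If wall i is the map x \<mapsto> f_i(x) v_i, this is minus the cyclic product f_1(v_2)
  f_2(v_3) f_3(v_1) of Cartan entries. Written as a trace it is visibly continuous in the generators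
  and invariant under conjugation.\<close>

definition rep_param :: "(3 \<Rightarrow> real^3^3) \<Rightarrow> real" where
  "rep_param B = - trace (wall B 1 ** wall B 2 ** wall B 3)"

definition reflection_triple :: "(3 \<Rightarrow> nat) \<Rightarrow> (3 \<Rightarrow> real^3^3) \<Rightarrow> bool" where
  "reflection_triple m B \<longleftrightarrow> (\<forall>i. B i ** B i = mat 1 \<and> det (B i) = 1 \<and> trace (B i) = - 1) \<and>
     (\<forall>i j. i \<noteq> j \<longrightarrow> trace (wall B i ** wall B j) = weight m (- (i + j))) \<and> 0 < rep_param B"

text \<open>The rows are multiples of the three wall functionals, scaled so that the parameters 2
  and 3 become 1. Writing them as products of walls avoids a choice of functionals and makes the
  frame polynomial in the generators.\<close>

definition rep_frame :: "(3 \<Rightarrow> real^3^3) \<Rightarrow> real^3 \<Rightarrow> real^3^3" where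
  "rep_frame B u = (\<chi> i. if i = 1 then u v* wall B 1 else if i = 2 then - (u v* (wall B 1 ** wall B 2))
     else u v* (wall B 1 ** wall B 2 ** wall B 3))"

lemma rep_frame_nth:
  "(rep_frame B u *v x) $ 1 = u \<bullet> (wall B 1 *v x)"
  "(rep_frame B u *v x) $ 2 = - (u \<bullet> (wall B 1 *v (wall B 2 *v x)))"
  "(rep_frame B u *v x) $ 3 = u \<bullet> (wall B 1 *v (wall B 2 *v (wall B 3 *v x)))"
proof -
  have *: "(rep_frame B u *v x) $ i = rep_frame B u $ i \<bullet> x" for i
    by (simp add: matrix_vector_mult_def inner_vec_def)
  show "(rep_frame B u *v x) $ 1 = u \<bullet> (wall B 1 *v x)"
    "(rep_frame B u *v x) $ 2 = - (u \<bullet> (wall B 1 *v (wall B 2 *v x)))"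
    "(rep_frame B u *v x) $ 3 = u \<bullet> (wall B 1 *v (wall B 2 *v (wall B 3 *v x)))"
    unfolding * unfolding rep_frame_def by (simp_all add: dot_lmul_matrix matrix_vector_mul_assoc[symmetric])
qed

lemma wall_vectors:
  assumes "\<And>i. B i ** B i = mat 1" "\<And>i. trace (B i) = - 1"
  obtains v f where "\<And>i x. wall B i *v x = (f i \<bullet> x) *\<^sub>R v i" "\<And>i. f i \<bullet> v i = 2"
    "\<And>i j. trace (wall B i ** wall B j) = (f i \<bullet> v j) * (f j \<bullet> v i)"
    "rep_param B = - ((f 1 \<bullet> v 2) * (f 2 \<bullet> v 3) * (f 3 \<bullet> v 1))"
proof -
  have "\<exists>v f. (\<forall>x. wall B i *v x = (f \<bullet> x) *\<^sub>R v) \<and> f \<bullet> v = 2" for i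
    using involution_rank_one[OF assms] unfolding wall_def by metis
  then obtain v f where vf: "\<And>i x. wall B i *v x = (f i \<bullet> x) *\<^sub>R v i" "\<And>i. f i \<bullet> v i = 2" by metis
  have two: "(wall B i ** wall B j) *v x = (f j \<bullet> x) *\<^sub>R ((f i \<bullet> v j) *\<^sub>R v i)" for i j x
    by (simp add: matrix_vector_mul_assoc[symmetric] vf)
  have three: "(wall B 1 ** wall B 2 ** wall B 3) *v x = (f 3 \<bullet> x) *\<^sub>R ((f 1 \<bullet> v 2) * (f 2 \<bullet> v 3)) *\<^sub>R v 1" for x
    by (simp add: matrix_vector_mul_assoc[symmetric] vf)
  have "trace (wall B i ** wall B j) = (f i \<bullet> v j) * (f j \<bullet> v i)" for i j
    using trace_rank_one[OF two, of i j] by simp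
  moreover have "rep_param B = - ((f 1 \<bullet> v 2) * (f 2 \<bullet> v 3) * (f 3 \<bullet> v 1))"
    unfolding rep_param_def trace_rank_one[OF three] by simp
  ultimately show ?thesis using that vf by blast
qed

text \<open>In the frame, coordinate i is \<open>lam i\<close> times the functional f_i, and
  \<open>key\<close> says that this scaling turns the numbers f_j(v_i) into the standard Cartan
  matrix. The minus sign is there because B i has determinant 1 and a linear reflection has
  determinant -1.\<close>

theorem reflection_triple_normal_form:
  assumes m: "hyperbolic_orders m" and B: "reflection_triple m B" and u: "u v* wall B 1 \<noteq> 0"
  shows "invertible (rep_frame B u)"
    "rep_frame B u *v (B i *v x) = - refl (tri m (std_param (rep_param B))) i (rep_frame B u *v x)"
proof -
  obtain v f where vf: "\<And>i x. wall B i *v x = (f i \<bullet> x) *\<^sub>R v i" "\<And>i. f i \<bullet> v i = 2"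
    "\<And>i j. i \<noteq> j \<Longrightarrow> (f i \<bullet> v j) * (f j \<bullet> v i) = weight m (- (i + j))"
    "rep_param B = - ((f 1 \<bullet> v 2) * (f 2 \<bullet> v 3) * (f 3 \<bullet> v 1))"
  proof -
    have B': "B i ** B i = mat 1" "trace (B i) = - 1"
      "i \<noteq> j \<Longrightarrow> trace (wall B i ** wall B j) = weight m (- (i + j))" for i j
      using B unfolding reflection_triple_def by blast+
    show thesis
    proof (rule wall_vectors[OF B'(1,2)])
      fix v f :: "3 \<Rightarrow> real^3"
      assume *: "\<And>i x. wall B i *v x = (f i \<bullet> x) *\<^sub>R v i" "\<And>i. f i \<bullet> v i = 2"
        "\<And>i j. trace (wall B i ** wall B j) = (f i \<bullet> v j) * (f j \<bullet> v i)"
        "rep_param B = - ((f 1 \<bullet> v 2) * (f 2 \<bullet> v 3) * (f 3 \<bullet> v 1))"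
      show thesis by (rule that[OF *(1,2) _ *(4)]) (metis *(3) B'(3))
    qed
  qed
  define c where "c = rep_param B"
  have c: "0 < c" using B by (simp add: c_def reflection_triple_def)
  define S where "S = tri m (std_param c)"
  have cart: "cartan m S" unfolding S_def using c by (intro cartan_tri[OF m]) (auto simp: std_param_def)
  let ?F = "rep_frame B u"
  define s where "s = u \<bullet> v 1"
  define lam :: "3 \<Rightarrow> real" where "lam i = (if i = 1 then s else if i = 2 then - s * (f 1 \<bullet> v 2)
    else s * (f 1 \<bullet> v 2) * (f 2 \<bullet> v 3))" for i
  have F: "(?F *v x) $ i = lam i * (f i \<bullet> x)" for i x
    using exhaust_3[of i]
    by (elim disjE) (simp_all add: rep_frame_nth vf(1) lam_def s_def mult_ac)
  have w: "(f 1 \<bullet> v 2) * (f 2 \<bullet> v 1) = weight m 3" "(f 2 \<bullet> v 3) * (f 3 \<bullet> v 2) = weight m 1"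
    "(f 1 \<bullet> v 3) * (f 3 \<bullet> v 1) = weight m 2"
  proof -
    have "- (1 + 2) = (3 :: 3)" "- (2 + 3) = (1 :: 3)" "- (1 + 3) = (2 :: 3)" by simp_all
    then show "(f 1 \<bullet> v 2) * (f 2 \<bullet> v 1) = weight m 3" "(f 2 \<bullet> v 3) * (f 3 \<bullet> v 2) = weight m 1"
      "(f 1 \<bullet> v 3) * (f 3 \<bullet> v 1) = weight m 2"
      using vf(3)[of 1 2] vf(3)[of 2 3] vf(3)[of 1 3] by (simp_all only: simp_thms) auto
  qed
  have wpos: "0 < weight m k" for k
    using weight_bounds(2)[of m k] m by (force simp: hyperbolic_orders_def)
  have nz: "f 1 \<bullet> v 2 \<noteq> 0" "f 2 \<bullet> v 3 \<noteq> 0" "f 3 \<bullet> v 1 \<noteq> 0"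
    using w wpos[of 1] wpos[of 2] wpos[of 3] by auto
  have cf: "c = - ((f 1 \<bullet> v 2) * (f 2 \<bullet> v 3) * (f 3 \<bullet> v 1))" using vf(4) by (simp add: c_def)
  have key: "lam j * (f j \<bullet> v i) = lam i * S $ j $ i" for i j
  proof -
    have 13: "s * (f 1 \<bullet> v 3) = s * (f 1 \<bullet> v 2) * (f 2 \<bullet> v 3) * (- weight m 2 / c)"
    proof -
      have "(f 1 \<bullet> v 3) * c = - (weight m 2 * ((f 1 \<bullet> v 2) * (f 2 \<bullet> v 3)))"
        unfolding cf w(3)[symmetric] by (simp add: mult_ac)
      then have "f 1 \<bullet> v 3 = - (weight m 2 * ((f 1 \<bullet> v 2) * (f 2 \<bullet> v 3))) / c"
        using c by (intro eq_divide_imp) simp_all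
      then show ?thesis by (simp add: mult_ac)
    qed
    have S: "S $ 1 $ 1 = 2" "S $ 2 $ 2 = 2" "S $ 3 $ 3 = 2" "S $ 2 $ 1 = - weight m 3" "S $ 3 $ 1 = - c"
      "S $ 1 $ 2 = - 1" "S $ 3 $ 2 = - weight m 1" "S $ 2 $ 3 = - 1" "S $ 1 $ 3 = - weight m 2 / c"
      by (simp_all add: S_def tri_def std_param_def cyc3)
    show ?thesis
      using exhaust_3[of i] exhaust_3[of j] vf(2)
      by (elim disjE) (simp_all add: lam_def S w[symmetric] 13 cf mult_ac)
  qed
  show "?F *v (B i *v x) = - refl (tri m (std_param (rep_param B))) i (?F *v x)"
  proof -
    have Bx: "B i *v x = (f i \<bullet> x) *\<^sub>R v i - x"
      using vf(1)[of i x] by (simp add: wall_def matrix_vector_mult_add_rdistrib algebra_simps)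
    have "(?F *v (B i *v x)) $ j = - refl S i (?F *v x) $ j" for j
      using key[of j i] unfolding F Bx refl_component by (simp add: inner_diff_right algebra_simps)
    then show ?thesis by (simp add: vec_eq_iff S_def c_def)
  qed
  have s0: "s \<noteq> 0"
  proof
    assume "s = 0"
    have "(u v* wall B 1) \<bullet> x = 0" for x
      using \<open>s = 0\<close> by (simp add: dot_lmul_matrix vf(1) s_def)
    from this[of "u v* wall B 1"] have "u v* wall B 1 = 0" by simp
    then show False using u by simp
  qed
  then have lam0: "lam i \<noteq> 0" for i using nz exhaust_3[of i] by (auto simp: lam_def)
  \<comment> \<open>The columns are the rescaled centres; the frame times V is the Cartan matrix,
    whose determinant is not zero.\<close>
  define V where "V = (\<chi> r i. v i $ r / lam i)"
  have "?F ** V = S"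
  proof -
    have "(?F ** V) $ j $ i = S $ j $ i" for i j
    proof -
      have "(?F ** V) $ j $ i = (?F *v (inverse (lam i) *\<^sub>R v i)) $ j"
        by (simp add: matrix_matrix_mult_def matrix_vector_mult_def V_def divide_inverse mult_ac)
      also have "\<dots> = inverse (lam i) * (lam j * (f j \<bullet> v i))" by (simp add: F)
      also have "\<dots> = S $ j $ i" unfolding key using lam0[of i] by simp
      finally show ?thesis .
    qed
    then show ?thesis by (simp add: vec_eq_iff)
  qed
  then have "det ?F * det V \<noteq> 0" using cart by (simp add: cartan_def flip: det_mul)
  then show "invertible ?F" by (simp add: invertible_det_nz)
qed

text \<open>Chebyshev polynomials in the trace: at x = 4 (cos \<theta>)^2 the k-th one takes the
  value sin(2 k \<theta>) / sin(2 \<theta>). The value k at x = 4 shows that it is not the zero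
  polynomial for k > 0.\<close>

fun dihedral_poly :: "nat \<Rightarrow> real poly" where
  "dihedral_poly 0 = 0"
| "dihedral_poly (Suc 0) = 1"
| "dihedral_poly (Suc (Suc k)) = [:- 2, 1:] * dihedral_poly (Suc k) - dihedral_poly k"

lemma poly_dihedral_4: "poly (dihedral_poly k) 4 = real k"
  by (induction k rule: dihedral_poly.induct) (auto simp: algebra_simps)

text \<open>The values 0 and 4 account for the degenerate positions, where a mixed pairing vanishes
  or the two centres are parallel.\<close>

definition dihedral_values :: "nat \<Rightarrow> real set" where
  "dihedral_values m = insert 0 (insert 4 {x. poly (dihedral_poly m) x = 0})"

lemma finite_dihedral_values: "0 < m \<Longrightarrow> finite (dihedral_values m)"
proof -
  assume "0 < m"
  then have "dihedral_poly m \<noteq> 0" using poly_dihedral_4[of m] by auto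
  then show ?thesis unfolding dihedral_values_def using poly_roots_finite by auto
qed

text \<open>The product of two reflections satisfies a quadratic equation on the span of their centres, so its
  powers there are governed by polynomials in the trace.\<close>

lemma dihedral_trace_values:
  fixes v w f g :: "real^3" and m :: nat
  defines "R \<equiv> \<lambda>y. (f \<bullet> y) *\<^sub>R v - y" and "T \<equiv> \<lambda>y. (g \<bullet> y) *\<^sub>R w - y"
  assumes vf: "f \<bullet> v = 2" "g \<bullet> w = 2" and fin: "((R \<circ> T) ^^ m) w = w" and m: "0 < m"
  shows "(f \<bullet> w) * (g \<bullet> v) \<in> dihedral_values m"
proof -
  define x where "x = (f \<bullet> w) * (g \<bullet> v)"
  define h where "h = R \<circ> T"
  define d where "d k = poly (dihedral_poly k) x" for k
  have d: "d 0 = 0" "d (Suc 0) = 1" "d (Suc (Suc k)) = (x - 2) * d (Suc k) - d k" for k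
    by (simp_all add: d_def algebra_simps)
  have hw: "h w = (f \<bullet> w) *\<^sub>R v - w"
    using vf by (simp add: h_def R_def T_def algebra_simps scaleR_2)
  have lin: "h (a *\<^sub>R y + b *\<^sub>R z) = a *\<^sub>R h y + b *\<^sub>R h z" for a b y z
    by (simp add: h_def R_def T_def algebra_simps inner_simps)
  have hhw: "h (h w) = (x - 2) *\<^sub>R h w - w"
    unfolding hw vec_eq_iff using vf by (simp add: h_def R_def T_def x_def inner_simps algebra_simps)
  have pow: "(h ^^ Suc k) w = d (Suc k) *\<^sub>R h w - d k *\<^sub>R w" for k
  proof (induction k)
    case (Suc k)
    have "(h ^^ Suc (Suc k)) w = h (d (Suc k) *\<^sub>R h w + (- d k) *\<^sub>R w)" using Suc by simp
    also have "\<dots> = d (Suc k) *\<^sub>R h (h w) + (- d k) *\<^sub>R h w" by (rule lin)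
    finally show ?case unfolding hhw d(3) by (simp add: algebra_simps)
  qed (simp add: d)
  obtain n where n: "m = Suc n" using m gr0_implies_Suc by blast
  have eq: "d m *\<^sub>R h w = (1 + d n) *\<^sub>R w" using pow[of n] fin n by (simp add: h_def algebra_simps)
  show ?thesis
  proof (cases "d m = 0 \<or> x = 0")
    case True then show ?thesis by (auto simp: dihedral_values_def d_def x_def)
  next
    case False
    define l where "l = (1 + d n) / d m"
    have "h w = l *\<^sub>R w"
    proof -
      have "inverse (d m) *\<^sub>R (d m *\<^sub>R h w) = inverse (d m) *\<^sub>R ((1 + d n) *\<^sub>R w)" unfolding eq ..
      then show ?thesis using False by (simp add: l_def divide_inverse mult.commute)
    qed
    then have vw: "(f \<bullet> w) *\<^sub>R v = (l + 1) *\<^sub>R w" unfolding hw by (simp add: algebra_simps)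
    have "(f \<bullet> w) * (f \<bullet> v) = (l + 1) * (f \<bullet> w)" using arg_cong[OF vw, of "\<lambda>y. f \<bullet> y"] by simp
    then have "l + 1 = 2" using vf False by (auto simp: x_def)
    moreover have "(f \<bullet> w) * (g \<bullet> v) = (l + 1) * (g \<bullet> w)" using arg_cong[OF vw, of "\<lambda>y. g \<bullet> y"] by simp
    ultimately show ?thesis using vf by (simp add: dihedral_values_def)
  qed
qed

section \<open>Words in three generators\<close>

definition gword :: "(3 \<Rightarrow> real^3^3) \<Rightarrow> 3 list \<Rightarrow> real^3^3" where
  "gword B w = foldr (\<lambda>i A. B i ** A) w (mat 1)"

lemma gword_simps [simp]: "gword B [] = mat 1" "gword B (i # w) = B i ** gword B w"
  by (simp_all add: gword_def)

lemma gword_append: "gword B (u @ v) = gword B u ** gword B v"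
  by (induction u) (auto simp: matrix_mul_assoc)

lemma gword_SL3: "(\<And>i. B i \<in> carrier SL3) \<Longrightarrow> gword B w \<in> carrier SL3"
  by (induction w) (auto simp: SL3_def det_mul)

lemma gword_rev:
  assumes "\<And>i. B i ** B i = mat 1"
  shows "gword B (rev w) ** gword B w = mat 1"
proof (induction w)
  case (Cons i w)
  have "gword B (rev (i # w)) ** gword B (i # w) = gword B (rev w) ** (B i ** B i) ** gword B w"
    by (simp add: gword_append matrix_mul_assoc)
  then show ?case using Cons assms by simp
qed simp

lemma SL3_simps:
  "mult SL3 A B = A ** B" "one SL3 = mat 1" "A \<in> carrier SL3 \<longleftrightarrow> det A = 1"
  by (simp_all add: SL3_def)

lemma carrier_reflection_group:
  assumes \<sigma>: "\<And>i. \<sigma> i \<in> carrier SL3" "\<And>i. \<sigma> i ** \<sigma> i = mat 1"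
  shows "carrier (subgroup_generated SL3 (range \<sigma>)) = range (gword \<sigma>)"
proof -
  interpret group SL3 by (rule group_SL3)
  have inv: "m_inv SL3 (\<sigma> i) = \<sigma> i" for i
    using \<sigma> by (intro inv_equality) (auto simp: SL3_simps)
  have "carrier SL3 \<inter> range \<sigma> = range \<sigma>" using \<sigma>(1) by auto
  then have "carrier (subgroup_generated SL3 (range \<sigma>)) = generate SL3 (range \<sigma>)"
    by (simp add: carrier_subgroup_generated)
  also have "\<dots> = range (gword \<sigma>)"
  proof
    show "generate SL3 (range \<sigma>) \<subseteq> range (gword \<sigma>)"
    proof
      fix A assume "A \<in> generate SL3 (range \<sigma>)"
      then show "A \<in> range (gword \<sigma>)"
      proof (induction rule: generate.induct)
        case one
        then show ?case by (metis gword_simps(1) rangeI SL3_simps(2))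
      next
        case (incl h)
        then obtain i where "h = \<sigma> i" by blast
        then have "h = gword \<sigma> [i]" by simp
        then show ?case by blast
      next
        case (inv h)
        then obtain i where "h = \<sigma> i" by blast
        then have "m_inv SL3 h = gword \<sigma> [i]" using \<open>\<And>i. m_inv SL3 (\<sigma> i) = \<sigma> i\<close> by simp
        then show ?case by blast
      next
        case (eng h1 h2)
        then obtain u v where "h1 = gword \<sigma> u" "h2 = gword \<sigma> v" by blast
        then have "mult SL3 h1 h2 = gword \<sigma> (u @ v)" by (simp add: gword_append SL3_simps)
        then show ?case by blast
      qed
    qed
    show "range (gword \<sigma>) \<subseteq> generate SL3 (range \<sigma>)"
    proof
      fix A assume "A \<in> range (gword \<sigma>)"
      then obtain w where "A = gword \<sigma> w" by blast
      moreover have "gword \<sigma> w \<in> generate SL3 (range \<sigma>)"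
      proof (induction w)
        case Nil
        have "one SL3 \<in> generate SL3 (range \<sigma>)" by (rule generate.one)
        then show ?case by (simp add: SL3_simps)
      next
        case (Cons i w)
        have "mult SL3 (\<sigma> i) (gword \<sigma> w) \<in> generate SL3 (range \<sigma>)"
          by (intro generate.eng Cons) (simp add: generate.incl)
        then show ?case by (simp add: SL3_simps)
      qed
      ultimately show "A \<in> generate SL3 (range \<sigma>)" by simp
    qed
  qed
  finally show ?thesis .
qed

lemma hom_gword:
  assumes \<sigma>: "\<And>i. \<sigma> i \<in> carrier SL3" "\<And>i. \<sigma> i ** \<sigma> i = mat 1"
    and \<rho>: "\<rho> \<in> hom (subgroup_generated SL3 (range \<sigma>)) SL3"
  shows "\<rho> (gword \<sigma> w) = gword (\<lambda>i. \<rho> (\<sigma> i)) w"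
proof -
  let ?G = "subgroup_generated SL3 (range \<sigma>)"
  have G: "group ?G" "group SL3" using group_SL3 group.group_subgroup_generated by blast+
  have car: "carrier ?G = range (gword \<sigma>)" by (rule carrier_reflection_group[OF \<sigma>])
  have mult: "\<rho> (A ** B) = \<rho> A ** \<rho> B" if "A \<in> carrier ?G" "B \<in> carrier ?G" for A B
    using hom_mult[OF \<rho> that] by (simp add: SL3_simps)
  have gen: "\<sigma> i \<in> carrier ?G" for i
  proof -
    have "\<sigma> i = gword \<sigma> [i]" by simp
    then show ?thesis unfolding car by blast
  qed
  show ?thesis
  proof (induction w)
    case Nil
    then show ?case using hom_one[OF \<rho> G] by (simp add: SL3_simps)
  next
    case (Cons i w)
    then show ?case using mult[OF gen[of i], of "gword \<sigma> w"] car by simp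
  qed
qed

lemma det_uminus_3: "det (- A) = - det A" for A :: "real^3^3"
  by (simp add: det_3)

lemma normal_form_gword:
  assumes F: "\<And>i x. F *v (B i *v x) = - refl S i (F *v x)"
  shows "F *v (gword B w *v x) = (- 1) ^ length w *\<^sub>R foldr (refl S) w (F *v x)"
proof (induction w)
  case (Cons i w)
  have lin: "refl S i (c *\<^sub>R y) = c *\<^sub>R refl S i y" for c y by (rule refl_scaleR)
  show ?case using Cons by (simp add: matrix_vector_mul_assoc[symmetric] F lin)
qed simp

text \<open>Two triples with the same angles satisfy the same relations, so one can be substituted for the other.\<close>

lemma gword_well_defined:
  assumes S: "cartan m S" and T: "cartan m T"
    and F: "invertible F" "\<And>i x. F *v (B i *v x) = - refl S i (F *v x)"
    and G: "invertible G" "\<And>i x. G *v (C i *v x) = - refl T i (G *v x)"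
    and B: "\<And>i. B i ** B i = mat 1" and C: "\<And>i. C i ** C i = mat 1"
    and eq: "gword B u = gword B v"
  shows "gword C u = gword C v"
proof -
  define w where "w = rev v @ u"
  have Bw: "gword B w = mat 1" using gword_rev[of B v] B eq by (simp add: w_def gword_append)
  have pm: "(- 1) ^ length w *\<^sub>R foldr (refl S) w y = y" for y
  proof -
    have "F *v (gword B w *v (matrix_inv F *v y)) = (- 1) ^ length w *\<^sub>R foldr (refl S) w (F *v (matrix_inv F *v y))"
      by (rule normal_form_gword[OF F(2)])
    then show ?thesis using F(1) Bw by simp
  qed
  \<comment> \<open>Each generator is minus a linear reflection, so a relation of odd length would
    make the word of reflections equal to minus the identity.\<close>
  have even: "even (length w)"
  proof (rule ccontr)
    assume "odd (length w)"
    then have "foldr (refl S) w y = - y" for y using pm[of y] by (simp add: minus_equation_iff)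
    then have "foldr (refl S) w = uminus" by auto
    then show False using coxeter_same_relations(2)[OF S S] by blast
  qed
  then have "foldr (refl S) w = id" using pm by auto
  then have "foldr (refl T) w = id" by (rule coxeter_same_relations(1)[OF S T])
  then have "G *v (gword C w *v x) = G *v x" for x
    using even unfolding normal_form_gword[OF G(2)] by simp
  then have "gword C w *v x = x" for x by (metis matrix_inv_mult(2)[OF G(1)])
  then have Cw: "gword C (rev v) ** gword C u = mat 1" by (simp add: matrix_eq w_def gword_append)
  have "gword C v ** gword C (rev v) = mat 1" using gword_rev[of C "rev v"] C by simp
  then have "gword C u = gword C v ** gword C (rev v) ** gword C u" by simp
  also have "\<dots> = gword C v" using Cw by (simp add: matrix_mul_assoc[symmetric])
  finally show ?thesis .
qed

section \<open>Deformations of a reflection group\<close>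

lemma continuous_matrix_mult:
  fixes f g :: "'a::topological_space \<Rightarrow> real^3^3"
  assumes "continuous_on S f" "continuous_on S g"
  shows "continuous_on S (\<lambda>x. f x ** g x)"
proof -
  have "continuous_on S (\<lambda>x. (\<chi> i j. \<Sum>k\<in>UNIV. f x $ i $ k * g x $ k $ j))"
    by (intro continuous_on_vec_lambda continuous_intros continuous_on_component assms)
  then show ?thesis by (simp add: matrix_matrix_mult_def)
qed

lemma continuous_map_matrix_mult:
  fixes f g :: "'a \<Rightarrow> real^3^3"
  assumes "continuous_map X euclidean f" "continuous_map X euclidean g"
  shows "continuous_map X euclidean (\<lambda>x. f x ** g x)"
proof -
  have "continuous_on UNIV (\<lambda>p :: (real^3^3) \<times> (real^3^3). fst p ** snd p)"
    by (intro continuous_matrix_mult continuous_intros)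
  then have "continuous_map euclidean euclidean (\<lambda>p :: (real^3^3) \<times> (real^3^3). fst p ** snd p)" by simp
  moreover have "continuous_map X euclidean (\<lambda>x. (f x, g x))"
    using continuous_map_pairedI[OF assms] by (simp add: euclidean_product_topology)
  ultimately have "continuous_map X euclidean ((\<lambda>p. fst p ** snd p) \<circ> (\<lambda>x. (f x, g x)))"
    by (rule continuous_map_compose[rotated])
  then show ?thesis by (simp add: o_def)
qed

lemma continuous_map_trace:
  fixes f :: "'a \<Rightarrow> real^3^3"
  assumes "continuous_map X euclidean f"
  shows "continuous_map X euclideanreal (\<lambda>x. trace (f x))"
proof -
  have "continuous_on UNIV (\<lambda>A :: real^3^3. trace A)"
    unfolding trace_3 by (intro continuous_intros continuous_on_component)
  then have "continuous_map euclidean euclideanreal (\<lambda>A :: real^3^3. trace A)" by simp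
  from continuous_map_compose[OF assms this] show ?thesis by (simp add: o_def)
qed

lemma connected_space_finite_values:
  fixes f :: "'a \<Rightarrow> real"
  assumes "connected_space X" "continuous_map X euclideanreal f" "finite Z"
    "\<And>x. x \<in> topspace X \<Longrightarrow> f x \<in> Z" "x \<in> topspace X" "y \<in> topspace X"
  shows "f x = f y"
proof -
  have "connectedin euclideanreal (f ` topspace X)"
    using assms(1,2) by (intro connectedin_continuous_map_image) (auto simp: connectedin_topspace)
  moreover have "finite (f ` topspace X)" using assms(3,4) by (meson finite_subset image_subsetI)
  ultimately show ?thesis using connected_finite_iff_sing assms(5,6)
    by (metis connectedin_iff_connected empty_iff imageI singletonD)
qed

lemma connected_space_positive:
  fixes f :: "'a \<Rightarrow> real"
  assumes "connected_space X" "continuous_map X euclideanreal f" "\<And>x. x \<in> topspace X \<Longrightarrow> f x \<noteq> 0"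
    "x \<in> topspace X" "y \<in> topspace X" "0 < f x"
  shows "0 < f y"
proof -
  have "continuous_map X euclideanreal (\<lambda>x. sgn (f x))"
  proof -
    have "continuous_map X (subtopology euclideanreal (- {0})) f"
      using assms(2,3) by (auto simp: continuous_map_in_subtopology)
    moreover have "continuous_on (- {0}) (sgn :: real \<Rightarrow> real)" by (intro continuous_intros) auto
    ultimately show ?thesis using continuous_map_compose[of X "subtopology euclideanreal (- {0})" f euclideanreal sgn]
      by (simp add: o_def)
  qed
  from connected_space_finite_values[OF assms(1) this, of "{-1, 0, 1}" x y] have "sgn (f y) = sgn (f x)"
    using assms(4,5) by (auto simp: sgn_if)
  then show ?thesis using assms(6) by (simp add: sgn_if split: if_splits)
qed

lemma wall_axis:
  assumes "reflection_triple m B"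
  obtains u where "u v* wall B 1 \<noteq> 0"
proof -
  have B: "B i ** B i = mat 1" "trace (B i) = - 1" for i
    using assms unfolding reflection_triple_def by blast+
  obtain v f :: "3 \<Rightarrow> real^3" where vf: "wall B 1 *v v 1 = (f 1 \<bullet> v 1) *\<^sub>R v 1" "f 1 \<bullet> v 1 = 2"
  proof (rule wall_vectors[OF B])
    fix v f :: "3 \<Rightarrow> real^3"
    assume "\<And>i x. wall B i *v x = (f i \<bullet> x) *\<^sub>R v i" "\<And>i. f i \<bullet> v i = 2"
    then show thesis using that by blast
  qed
  then have "wall B 1 *v v 1 \<noteq> 0" by auto
  then have "(wall B 1 *v v 1) \<bullet> (wall B 1 *v v 1) \<noteq> 0" by simp
  then have "((wall B 1 *v v 1) v* wall B 1) \<bullet> v 1 \<noteq> 0" by (simp only: dot_lmul_matrix not_False_eq_True)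
  then show ?thesis using that by (metis inner_zero_left)
qed

text \<open>Deformations are studied from the traces of a triple alone; hyperbolic geometry enters
  when the side reflections are shown to form such a triple.\<close>

locale reflection_group =
  fixes m :: "3 \<Rightarrow> nat" and \<sigma> :: "3 \<Rightarrow> real^3^3"
  assumes hyp: "hyperbolic_orders m" and triple: "reflection_triple m \<sigma>"
begin

definition G :: "(real^3^3) monoid" where "G = subgroup_generated SL3 (range \<sigma>)"

definition incl :: "real^3^3 \<Rightarrow> real^3^3" where "incl = (\<lambda>\<gamma>\<in>carrier G. \<gamma>)"

definition X :: "(real^3^3 \<Rightarrow> real^3^3) topology" where
  "X = subtopology (rep_space G) (connected_component_of_set (rep_space G) incl)"

abbreviation gens :: "(real^3^3 \<Rightarrow> real^3^3) \<Rightarrow> 3 \<Rightarrow> real^3^3" where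
  "gens \<rho> \<equiv> \<lambda>i. \<rho> (\<sigma> i)"

lemma orders: "3 \<le> m k" "0 < m k"
  using hyp by (auto simp: hyperbolic_orders_def) (metis less_le_trans zero_less_numeral)

lemma \<sigma>_invol: "\<sigma> i ** \<sigma> i = mat 1" and \<sigma>_SL3: "\<sigma> i \<in> carrier SL3"
  using triple by (auto simp: reflection_triple_def SL3_simps)

lemma carrier_G: "carrier G = range (gword \<sigma>)"
  unfolding G_def by (rule carrier_reflection_group[OF \<sigma>_SL3 \<sigma>_invol])

lemma \<sigma>_G: "\<sigma> i \<in> carrier G"
proof -
  have "\<sigma> i = gword \<sigma> [i]" by simp
  then show ?thesis unfolding carrier_G by blast
qed

lemma carrier_G_SL3: "\<gamma> \<in> carrier G \<Longrightarrow> \<gamma> \<in> carrier SL3"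
  unfolding carrier_G using gword_SL3[of \<sigma>] \<sigma>_SL3 by auto

lemma group_G: "group G"
  unfolding G_def using group_SL3 by (rule group.group_subgroup_generated)

lemma mult_G: "mult G A B = A ** B" and one_G: "one G = mat 1"
  by (simp_all add: G_def subgroup_generated_def SL3_simps)

lemma topspace_rep: "topspace (rep_space G) = hom G SL3 \<inter> extensional (carrier G)"
  by (auto simp: rep_space_def PiE_def)

lemma incl_rep: "incl \<in> topspace (rep_space G)"
proof -
  have "incl \<in> hom G SL3"
  proof (rule homI)
    show "incl \<gamma> \<in> carrier SL3" if "\<gamma> \<in> carrier G" for \<gamma>
      using carrier_G_SL3[OF that] that by (simp add: incl_def)
    show "incl (mult G \<gamma> \<delta>) = mult SL3 (incl \<gamma>) (incl \<delta>)" if "\<gamma> \<in> carrier G" "\<delta> \<in> carrier G" for \<gamma> \<delta>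
      using that monoid.m_closed[OF group.is_monoid[OF group_G] that]
      by (simp add: incl_def mult_G SL3_simps(1))
  qed
  then show ?thesis unfolding topspace_rep by (simp add: incl_def)
qed

lemma component_rep: "connectedin (rep_space G) (connected_component_of_set (rep_space G) incl)"
  by (rule connectedin_connected_component_of)

lemma topspace_X: "topspace X = connected_component_of_set (rep_space G) incl"
  unfolding X_def topspace_subtopology
  using connectedin_subset_topspace[OF component_rep] by (rule Int_absorb1)

lemma connected_X: "connected_space X"
  unfolding X_def using component_rep unfolding connectedin_def by (rule conjunct2)

lemma incl_X: "incl \<in> topspace X"
  unfolding topspace_X using incl_rep by (simp add: connected_component_of_refl)

lemma X_rep:
  assumes "\<rho> \<in> topspace X" shows "\<rho> \<in> hom G SL3" "\<rho> \<in> extensional (carrier G)"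
proof -
  have "\<rho> \<in> topspace (rep_space G)"
    using assms connectedin_subset_topspace[OF component_rep] unfolding topspace_X by (rule subsetD[rotated])
  then show "\<rho> \<in> hom G SL3" "\<rho> \<in> extensional (carrier G)" unfolding topspace_rep by auto
qed

lemma X_gword: "\<rho> \<in> topspace X \<Longrightarrow> \<rho> (gword \<sigma> w) = gword (gens \<rho>) w"
  using X_rep(1) unfolding G_def by (intro hom_gword[where \<sigma> = \<sigma>, OF \<sigma>_SL3 \<sigma>_invol])

lemma incl_gens: "gens incl = \<sigma>"
  by (simp add: incl_def \<sigma>_G)

lemma continuous_eval: "\<gamma> \<in> carrier G \<Longrightarrow> continuous_map X euclidean (\<lambda>\<rho>. \<rho> \<gamma>)"
  unfolding X_def rep_space_def
  by (intro continuous_map_from_subtopology continuous_map_product_projection)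

lemma continuous_wall: "continuous_map X euclidean (\<lambda>\<rho>. wall (gens \<rho>) i)"
proof -
  have "continuous_on UNIV (\<lambda>A :: real^3^3. mat 1 + A)" by (intro continuous_intros)
  then have "continuous_map euclidean euclidean (\<lambda>A :: real^3^3. mat 1 + A)" by simp
  from continuous_map_compose[OF continuous_eval[OF \<sigma>_G] this] show ?thesis
    by (simp add: o_def wall_def)
qed

lemma continuous_rep_param: "continuous_map X euclideanreal (\<lambda>\<rho>. rep_param (gens \<rho>))"
  unfolding rep_param_def
  by (intro continuous_map_minus continuous_map_trace continuous_map_matrix_mult continuous_wall)

lemma gens_invol:
  assumes "\<rho> \<in> topspace X"
  shows "gens \<rho> i ** gens \<rho> i = mat 1" "det (gens \<rho> i) = 1"
proof -
  have "\<rho> (gword \<sigma> [i, i]) = gword (gens \<rho>) [i, i]" by (rule X_gword[OF assms])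
  moreover have "\<rho> (mat 1) = mat 1" using X_gword[OF assms, of "[]"] by simp
  ultimately show "gens \<rho> i ** gens \<rho> i = mat 1" by (simp add: \<sigma>_invol)
  have "gens \<rho> i \<in> carrier SL3" using hom_in_carrier[OF X_rep(1)[OF assms] \<sigma>_G] .
  then show "det (gens \<rho> i) = 1" by (simp add: SL3_simps)
qed

text \<open>An involution of determinant 1 has trace 3 or -1, so the trace cannot vary along the
  connected space X.\<close>

lemma gens_trace:
  assumes "\<rho> \<in> topspace X" shows "trace (gens \<rho> i) = - 1"
proof -
  have "continuous_map X euclideanreal (\<lambda>\<rho>. trace (gens \<rho> i))"
    by (intro continuous_map_trace continuous_eval \<sigma>_G)
  moreover have "trace (gens \<rho> i) \<in> {3, - 1}" if "\<rho> \<in> topspace X" for \<rho>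
    using involution_trace[OF gens_invol[OF that, of i]] by simp
  ultimately have "trace (gens \<rho> i) = trace (gens incl i)"
    using connected_space_finite_values[of X "\<lambda>\<rho>. trace (gens \<rho> i)" "{3, - 1}" \<rho> incl]
      connected_X assms incl_X by simp
  moreover have "incl (\<sigma> i) = \<sigma> i" by (simp add: incl_def \<sigma>_G)
  moreover have "trace (\<sigma> i) = - 1" using triple unfolding reflection_triple_def by blast
  ultimately show ?thesis by simp
qed

definition base_frame :: "real^3^3" where
  "base_frame = rep_frame \<sigma> (SOME u. u v* wall \<sigma> 1 \<noteq> 0)"

definition base_param :: real where "base_param = rep_param \<sigma>"

lemma base_frame:
  "invertible base_frame" "base_frame *v (\<sigma> i *v x) = - refl (tri m (std_param base_param)) i (base_frame *v x)"
proof -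
  have u: "(SOME u. u v* wall \<sigma> 1 \<noteq> 0) v* wall \<sigma> 1 \<noteq> 0" using wall_axis[OF triple] someI_ex by (metis (mono_tags, lifting))
  show "invertible base_frame" "base_frame *v (\<sigma> i *v x) = - refl (tri m (std_param base_param)) i (base_frame *v x)"
    unfolding base_frame_def base_param_def
    using reflection_triple_normal_form[OF hyp triple u] by auto
qed

lemma base_param_pos: "0 < base_param"
  using triple by (simp add: base_param_def reflection_triple_def)

lemma cartan_std: "0 < c \<Longrightarrow> cartan m (tri m (std_param c))"
  by (intro cartan_tri[OF hyp]) (auto simp: std_param_def)

lemma foldr_funpow: "foldr s (alt i j (n + n)) = (s i \<circ> s j) ^^ n"
  by (induction n) (auto simp: fun_eq_iff)

lemma gword_mult: "gword B w *v x = foldr (\<lambda>i y. B i *v y) w x"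
  by (induction w) (auto simp: matrix_vector_mul_assoc[symmetric])

text \<open>The relation is transferred from the reflections of the Tits cone; the signs of the
  generators cancel because the word has even length.\<close>

lemma \<sigma>_order:
  assumes "i \<noteq> j"
  shows "gword \<sigma> (alt i j (m (- (i + j)) + m (- (i + j)))) = mat 1" (is "gword \<sigma> ?w = _")
proof -
  let ?S = "tri m (std_param base_param)"
  interpret coxeter "refl_pair ?S ?S" "\<lambda>i. {x. 0 \<le> fst x $ i \<and> 0 \<le> snd x $ i}" "\<lambda>i j. m (- (i + j))"
    using cartan_std[OF base_param_pos] by (intro coxeter_refl_pair)
  have "foldr (refl ?S) ?w y = y" for y
    using rotation_order[OF assms, of "(y, y)"] by (simp only: foldr_refl_pair prod.inject)
  then have "base_frame *v (gword \<sigma> ?w *v x) = base_frame *v x" for x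
    unfolding normal_form_gword[OF base_frame(2)] by simp
  then have "gword \<sigma> ?w *v x = x" for x by (metis matrix_inv_mult(2)[OF base_frame(1)])
  then show ?thesis by (simp add: matrix_eq)
qed

text \<open>The relation between two generators confines this trace to the finite set
  \<open>dihedral_values\<close>, so along X it keeps the value it has at the inclusion.\<close>

lemma gens_angle:
  assumes \<rho>: "\<rho> \<in> topspace X" and ij: "i \<noteq> j"
  shows "trace (wall (gens \<rho>) i ** wall (gens \<rho>) j) = weight m (- (i + j))"
proof -
  let ?Z = "dihedral_values (m (- (i + j)))"
  have "trace (wall (gens \<rho>) i ** wall (gens \<rho>) j) \<in> ?Z" if \<rho>: "\<rho> \<in> topspace X" for \<rho>
  proof -
    obtain v f where vf: "\<And>i x. wall (gens \<rho>) i *v x = (f i \<bullet> x) *\<^sub>R v i" "\<And>i. f i \<bullet> v i = 2"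
      "\<And>i j. trace (wall (gens \<rho>) i ** wall (gens \<rho>) j) = (f i \<bullet> v j) * (f j \<bullet> v i)"
      using wall_vectors[of "gens \<rho>"] gens_invol(1)[OF \<rho>] gens_trace[OF \<rho>] by metis
    have act: "gens \<rho> i *v y = (f i \<bullet> y) *\<^sub>R v i - y" for i y
      using vf(1)[of i y] by (simp add: wall_def matrix_vector_mult_add_rdistrib algebra_simps)
    have "gword (gens \<rho>) (alt i j (m (- (i + j)) + m (- (i + j)))) = mat 1"
      using X_gword[OF \<rho>] \<sigma>_order[OF ij] X_gword[OF \<rho>, of "[]"] by (metis gword_simps(1))
    then have "foldr (\<lambda>i y. gens \<rho> i *v y) (alt i j (m (- (i + j)) + m (- (i + j)))) (v j) = v j"
      using gword_mult[of "gens \<rho>"] by (metis matrix_vector_mul_lid)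
    then have "(((\<lambda>y. gens \<rho> i *v y) \<circ> (\<lambda>y. gens \<rho> j *v y)) ^^ m (- (i + j))) (v j) = v j"
      unfolding foldr_funpow .
    then have "(f i \<bullet> v j) * (f j \<bullet> v i) \<in> ?Z"
      unfolding act by (intro dihedral_trace_values vf(2) orders(2))
    then show ?thesis by (simp add: vf(3))
  qed
  moreover have "continuous_map X euclideanreal (\<lambda>\<rho>. trace (wall (gens \<rho>) i ** wall (gens \<rho>) j))"
    by (intro continuous_map_trace continuous_map_matrix_mult continuous_wall)
  ultimately have "trace (wall (gens \<rho>) i ** wall (gens \<rho>) j) = trace (wall (gens incl) i ** wall (gens incl) j)"
    using connected_space_finite_values[of X "\<lambda>\<rho>. trace (wall (gens \<rho>) i ** wall (gens \<rho>) j)" ?Z \<rho> incl]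
      connected_X \<rho> incl_X finite_dihedral_values[OF orders(2)] by blast
  then show ?thesis using triple ij by (simp add: incl_gens reflection_triple_def)
qed

text \<open>The factors of the cyclic product are nonzero because the weights are, and a continuous
  function without zeros keeps its sign on X.\<close>

lemma gens_triple:
  assumes "\<rho> \<in> topspace X" shows "reflection_triple m (gens \<rho>)"
proof -
  have "rep_param (gens \<rho>) \<noteq> 0" if \<rho>: "\<rho> \<in> topspace X" for \<rho>
  proof -
    obtain v f where vf: "\<And>i j. trace (wall (gens \<rho>) i ** wall (gens \<rho>) j) = (f i \<bullet> v j) * (f j \<bullet> (v i :: real^3))"
      "rep_param (gens \<rho>) = - ((f 1 \<bullet> v 2) * (f 2 \<bullet> v 3) * (f 3 \<bullet> v 1))"
      using wall_vectors[of "gens \<rho>"] gens_invol(1)[OF \<rho>] gens_trace[OF \<rho>] by metis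
    have "(f i \<bullet> v j) * (f j \<bullet> v i) \<noteq> 0" if "i \<noteq> j" for i j
      using gens_angle[OF \<rho> that] vf(1)[of i j] weight_bounds(2)[of m "- (i + j)"] orders(1) by simp
    from this[of 1 2] this[of 2 3] this[of 3 1] show ?thesis unfolding vf(2) by simp
  qed
  then have "0 < rep_param (gens \<rho>)"
    using connected_space_positive[of X "\<lambda>\<rho>. rep_param (gens \<rho>)" incl \<rho>]
      connected_X continuous_rep_param assms incl_X base_param_pos
    by (simp add: incl_gens base_param_def)
  then show ?thesis
    using gens_invol[OF assms] gens_trace[OF assms] gens_angle[OF assms]
    unfolding reflection_triple_def by blast
qed

end

section \<open>The parameter as a homeomorphism of the moduli space\<close>

lemma matrix_inv_unique':
  fixes A B :: "real^3^3"
  assumes "A ** B = mat 1" shows "matrix_inv A = B"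
proof -
  have "B ** A = mat 1" using assms matrix_left_right_inverse by blast
  then have inv: "invertible A" using assms unfolding invertible_def by blast
  have "matrix_inv A = matrix_inv A ** (A ** B)" using assms by simp
  also have "\<dots> = B" using matrix_inv_inverse(2)[OF inv] by (simp add: matrix_mul_assoc)
  finally show ?thesis .
qed

lemma matrix_inv_1: "matrix_inv (mat 1 :: real^3^3) = mat 1"
  by (rule matrix_inv_unique') simp

lemma matrix_inv_product:
  fixes A B :: "real^3^3"
  assumes "invertible A" "invertible B"
  shows "matrix_inv (A ** B) = matrix_inv B ** matrix_inv A"
proof (rule matrix_inv_unique')
  have "A ** B ** (matrix_inv B ** matrix_inv A) = A ** (B ** matrix_inv B) ** matrix_inv A"
    by (simp add: matrix_mul_assoc)
  then show "A ** B ** (matrix_inv B ** matrix_inv A) = mat 1" using assms by (simp add: matrix_inv_inverse)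
qed

lemma SL3_mult: "A \<in> carrier SL3 \<Longrightarrow> B \<in> carrier SL3 \<Longrightarrow> A ** B \<in> carrier SL3"
  by (simp add: SL3_simps det_mul)

lemma SL3_inv:
  assumes "A \<in> carrier SL3" shows "matrix_inv A \<in> carrier SL3"
proof -
  have "det (matrix_inv A) * det A = 1"
    using matrix_inv_inverse(2)[OF SL3_invertible[OF assms]] by (metis det_I det_mul)
  then show ?thesis using assms by (simp add: SL3_simps)
qed

lemma matrix_minus_mult: "(- A) *v x = - (A *v x)" for A :: "real^3^3"
  by (simp add: vec_eq_iff matrix_vector_mult_def sum_negf)

lemma vector_minus_mult: "A *v (- x) = - (A *v x)" for A :: "real^3^3"
  by (simp add: vec_eq_iff matrix_vector_mult_def sum_negf)

context reflection_group
begin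

abbreviation param :: "(real^3^3 \<Rightarrow> real^3^3) \<Rightarrow> real" where
  "param \<rho> \<equiv> rep_param (gens \<rho>)"

lemma param_pos: "\<rho> \<in> topspace X \<Longrightarrow> 0 < param \<rho>"
  using gens_triple by (simp add: reflection_triple_def)

lemma gword_conj:
  assumes "\<And>i. g ** B i = C i ** g" shows "g ** gword B w = gword C w ** g"
proof (induction w)
  case (Cons i w)
  have "g ** gword B (i # w) = (g ** B i) ** gword B w" by (simp add: matrix_mul_assoc)
  also have "\<dots> = C i ** (g ** gword B w)" by (simp add: assms matrix_mul_assoc)
  finally show ?case by (simp add: Cons matrix_mul_assoc)
qed simp

text \<open>Equal parameters give the same normal form, so one frame followed by the inverse of the
  other conjugates the generators, and with them all words.\<close>

lemma param_eq_conj: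
  assumes \<rho>: "\<rho> \<in> topspace X" "\<rho>' \<in> topspace X" "param \<rho> = param \<rho>'"
  obtains g where "g \<in> carrier SL3" "\<And>\<gamma>. \<gamma> \<in> carrier G \<Longrightarrow> \<rho>' \<gamma> = g ** \<rho> \<gamma> ** matrix_inv g"
proof -
  obtain u u' where u: "u v* wall (gens \<rho>) 1 \<noteq> 0" "u' v* wall (gens \<rho>') 1 \<noteq> 0"
    using wall_axis[OF gens_triple] \<rho> by metis
  let ?F = "rep_frame (gens \<rho>) u" and ?F' = "rep_frame (gens \<rho>') u'"
  note F = reflection_triple_normal_form[OF hyp gens_triple[OF \<rho>(1)] u(1)]
  note F' = reflection_triple_normal_form[OF hyp gens_triple[OF \<rho>(2)] u(2)]
  have "invertible (matrix_inv ?F')" using matrix_inv_inverse[OF F'(1)] unfolding invertible_def by blast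
  then have "invertible (matrix_inv ?F' ** ?F)" using F(1) by (rule invertible_mult)
  then obtain c where c: "c \<noteq> 0" "c *\<^sub>R (matrix_inv ?F' ** ?F) \<in> carrier SL3" by (rule SL3_rescale)
  define g where "g = c *\<^sub>R (matrix_inv ?F' ** ?F)"
  have gx: "?F' *v (g *v x) = c *\<^sub>R (?F *v x)" for x
    using F'(1) by (simp add: g_def scaleR_matrix_vector_assoc[symmetric] matrix_vector_mul_assoc[symmetric] matrix_vector_mult_scaleR)
  have comm: "g ** gens \<rho> i = gens \<rho>' i ** g" for i
  proof -
    have "?F' *v (g *v (gens \<rho> i *v x)) = ?F' *v (gens \<rho>' i *v (g *v x))" for x
      unfolding gx F(2) F'(2) refl_scaleR \<rho>(3) by simp
    then have "g *v (gens \<rho> i *v x) = gens \<rho>' i *v (g *v x)" for x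
      by (metis matrix_inv_mult(2)[OF F'(1)])
    then show ?thesis by (simp add: matrix_eq matrix_vector_mul_assoc[symmetric])
  qed
  have g: "g \<in> carrier SL3" using c(2) by (simp add: g_def)
  have "\<rho>' \<gamma> = g ** \<rho> \<gamma> ** matrix_inv g" if \<gamma>: "\<gamma> \<in> carrier G" for \<gamma>
  proof -
    obtain w where w: "\<gamma> = gword \<sigma> w" using \<gamma> unfolding carrier_G by blast
    have "g ** \<rho> \<gamma> = \<rho>' \<gamma> ** g"
      unfolding w X_gword[OF \<rho>(1)] X_gword[OF \<rho>(2)] by (rule gword_conj) (rule comm)
    then have "g ** \<rho> \<gamma> ** matrix_inv g = \<rho>' \<gamma> ** (g ** matrix_inv g)" by (simp add: matrix_mul_assoc)
    then show ?thesis using matrix_inv_inverse(1)[OF SL3_invertible[OF g]] by simp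
  qed
  then show ?thesis using that g by blast
qed

lemma rep_param_conj:
  assumes "invertible g" "\<And>i. C i = g ** B i ** matrix_inv g"
  shows "rep_param C = rep_param B"
proof -
  have w: "wall C i = g ** wall B i ** matrix_inv g" for i
    using assms by (simp add: wall_def matrix_add_ldistrib matrix_inv_inverse matrix_eq
      matrix_vector_mul_assoc[symmetric] matrix_vector_mult_add_rdistrib matrix_vector_right_distrib)
  have "wall C 1 ** wall C 2 ** wall C 3 = g ** (wall B 1 ** (matrix_inv g ** g) ** wall B 2 ** (matrix_inv g ** g) ** wall B 3) ** matrix_inv g"
    by (simp add: w matrix_mul_assoc)
  also have "\<dots> = g ** (wall B 1 ** wall B 2 ** wall B 3) ** matrix_inv g"
    by (simp add: matrix_inv_inverse(2)[OF assms(1)])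
  finally show ?thesis using trace_conj[OF assms(1)] by (simp add: rep_param_def)
qed

lemma conj_class_eq_iff:
  assumes \<rho>: "\<rho> \<in> topspace X" "\<rho>' \<in> topspace X"
  shows "conj_class G \<rho> = conj_class G \<rho>' \<longleftrightarrow> param \<rho> = param \<rho>'"
proof
  assume eq: "conj_class G \<rho> = conj_class G \<rho>'"
  have "\<rho> = (\<lambda>\<gamma>\<in>carrier G. mat 1 ** \<rho> \<gamma> ** matrix_inv (mat 1))"
    using X_rep(2)[OF \<rho>(1)] by (simp add: matrix_inv_1 extensional_restrict)
  moreover have "mat 1 \<in> carrier SL3" by (simp add: SL3_simps)
  ultimately have "\<rho> \<in> conj_class G \<rho>" unfolding conj_class_def by blast
  then have "\<rho> \<in> conj_class G \<rho>'" by (simp only: eq)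
  then have "\<exists>g. \<rho> = (\<lambda>\<gamma>\<in>carrier G. g ** \<rho>' \<gamma> ** matrix_inv g) \<and> g \<in> carrier SL3"
    unfolding conj_class_def by (rule CollectD)
  then obtain g where g: "g \<in> carrier SL3" "\<rho> = (\<lambda>\<gamma>\<in>carrier G. g ** \<rho>' \<gamma> ** matrix_inv g)"
    by (elim exE conjE) (rule that)
  have "gens \<rho> i = g ** gens \<rho>' i ** matrix_inv g" for i
    using fun_cong[OF g(2), of "\<sigma> i"] \<sigma>_G by simp
  then show "param \<rho> = param \<rho>'" using SL3_invertible[OF g(1)] by (intro rep_param_conj)
next
  have sub: "conj_class G \<rho>' \<subseteq> conj_class G \<rho>" if \<rho>: "\<rho> \<in> topspace X" "\<rho>' \<in> topspace X" "param \<rho> = param \<rho>'" for \<rho> \<rho>'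
  proof
    fix \<tau> assume "\<tau> \<in> conj_class G \<rho>'"
    then obtain h where h: "h \<in> carrier SL3" "\<tau> = (\<lambda>\<gamma>\<in>carrier G. h ** \<rho>' \<gamma> ** matrix_inv h)"
      unfolding conj_class_def by blast
    obtain g where g: "g \<in> carrier SL3" "\<And>\<gamma>. \<gamma> \<in> carrier G \<Longrightarrow> \<rho>' \<gamma> = g ** \<rho> \<gamma> ** matrix_inv g"
      using param_eq_conj[OF \<rho>] by blast
    have "\<tau> = (\<lambda>\<gamma>\<in>carrier G. (h ** g) ** \<rho> \<gamma> ** matrix_inv (h ** g))"
      unfolding h(2) matrix_inv_product[OF SL3_invertible[OF h(1)] SL3_invertible[OF g(1)]]
      using g(2) by (intro restrict_ext) (simp add: matrix_mul_assoc)
    then show "\<tau> \<in> conj_class G \<rho>" using SL3_mult[OF h(1) g(1)] unfolding conj_class_def by blast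
  qed
  assume "param \<rho> = param \<rho>'"
  then show "conj_class G \<rho> = conj_class G \<rho>'" using sub[OF \<rho>] sub[OF \<rho>(2,1)] by auto
qed

definition sec_gen :: "real \<Rightarrow> 3 \<Rightarrow> real^3^3" where
  "sec_gen c i = matrix_inv base_frame ** (- refl_matrix (tri m (std_param c)) i) ** base_frame"

text \<open>A section of the parameter: the representation with parameter c in the coordinates of
  the inclusion. For c > 0 the word chosen for an element does not matter, by
  \<open>gword_well_defined\<close>.\<close>

definition sec :: "real \<Rightarrow> real^3^3 \<Rightarrow> real^3^3" where
  "sec c = (\<lambda>\<gamma>\<in>carrier G. gword (sec_gen c) (SOME w. \<gamma> = gword \<sigma> w))"

lemma sec_gen_frame: "base_frame *v (sec_gen c i *v x) = - refl (tri m (std_param c)) i (base_frame *v x)"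
  using base_frame(1)
  by (simp add: sec_gen_def matrix_vector_mul_assoc[symmetric] matrix_minus_mult refl_matrix_mult vector_minus_mult)

lemma frame_cancel: "(\<And>x. base_frame *v (A *v x) = base_frame *v (B *v x)) \<Longrightarrow> A = B"
  by (simp add: matrix_eq) (metis matrix_inv_mult(2)[OF base_frame(1)])

lemma sec_gen_invol: "sec_gen c i ** sec_gen c i = mat 1"
proof (rule frame_cancel)
  have "refl S i (- y) = - refl S i y" for S y using refl_scaleR[of S i "- 1" y] by simp
  then show "base_frame *v (sec_gen c i ** sec_gen c i *v x) = base_frame *v (mat 1 *v x)" for x
    by (simp add: matrix_vector_mul_assoc[symmetric] sec_gen_frame refl_invol tri_nth)
qed

lemma sec_gen_SL3: "sec_gen c i \<in> carrier SL3"
proof -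
  have "det (refl_matrix (tri m (std_param c)) i) = - 1" by (simp add: det_refl_matrix tri_nth)
  moreover have "det (matrix_inv base_frame) * det base_frame = 1"
    using matrix_inv_inverse(2)[OF base_frame(1)] by (metis det_I det_mul)
  ultimately show ?thesis by (simp add: SL3_simps sec_gen_def det_mul det_uminus_3)
qed

lemma sec_gword:
  assumes "0 < c" shows "sec c (gword \<sigma> w) = gword (sec_gen c) w"
proof -
  have "gword \<sigma> w = gword \<sigma> (SOME v. gword \<sigma> w = gword \<sigma> v)"
    by (rule someI[of "\<lambda>v. gword \<sigma> w = gword \<sigma> v" w]) (rule refl)
  then have "gword (sec_gen c) (SOME v. gword \<sigma> w = gword \<sigma> v) = gword (sec_gen c) w"
    using gword_well_defined[OF cartan_std[OF base_param_pos] cartan_std[OF assms] base_frame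
        base_frame(1) sec_gen_frame \<sigma>_invol sec_gen_invol] by metis
  moreover have "gword \<sigma> w \<in> carrier G" unfolding carrier_G by blast
  ultimately show ?thesis by (simp add: sec_def)
qed

lemma sec_rep: "0 < c \<Longrightarrow> sec c \<in> topspace (rep_space G)"
proof -
  assume c: "0 < c"
  have "sec c \<in> hom G SL3"
  proof (rule homI)
    fix \<gamma> assume "\<gamma> \<in> carrier G"
    then obtain u where u: "\<gamma> = gword \<sigma> u" unfolding carrier_G by blast
    show "sec c \<gamma> \<in> carrier SL3" unfolding u sec_gword[OF c] by (intro gword_SL3 sec_gen_SL3)
    fix \<delta> assume "\<delta> \<in> carrier G"
    then obtain v where v: "\<delta> = gword \<sigma> v" unfolding carrier_G by blast
    show "sec c (mult G \<gamma> \<delta>) = mult SL3 (sec c \<gamma>) (sec c \<delta>)"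
      unfolding u v mult_G gword_append[symmetric] sec_gword[OF c] SL3_simps(1) ..
  qed
  then show ?thesis unfolding topspace_rep by (simp add: sec_def)
qed

lemma sec_base: "sec base_param = incl"
proof -
  have "sec_gen base_param = \<sigma>"
    by (rule ext, rule frame_cancel) (simp add: sec_gen_frame base_frame(2))
  then have "sec base_param \<gamma> = incl \<gamma>" for \<gamma>
  proof (cases "\<gamma> \<in> carrier G")
    case True
    then obtain w where "\<gamma> = gword \<sigma> w" unfolding carrier_G by blast
    then show ?thesis using True sec_gword[OF base_param_pos, of w] \<open>sec_gen base_param = \<sigma>\<close> by (simp add: incl_def)
  qed (simp add: sec_def incl_def)
  then show ?thesis by blast
qed

lemma continuous_sec_gen: "continuous_on UNIV (\<lambda>t. sec_gen (exp t) i)"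
proof -
  have s: "continuous_on UNIV (\<lambda>t. std_param (exp t) j)" "std_param (exp t) j \<noteq> 0" for j t
    by (cases "j = 1") (auto simp: std_param_def intro!: continuous_intros)
  have t: "continuous_on UNIV (\<lambda>t. tri m (std_param (exp t)) $ r $ k)" for r k
  proof (cases "r = k")
    case False
    then show ?thesis
      by (cases "r = k + 2") (auto simp: tri_def intro!: continuous_intros s)
  qed (simp add: tri_nth)
  have "continuous_on UNIV (\<lambda>t. - refl_matrix (tri m (std_param (exp t))) i)"
  proof (intro continuous_on_minus)
    have "continuous_on UNIV (\<lambda>t. (if r = k then 1 else 0) - (if k = i then tri m (std_param (exp t)) $ r $ i else 0))" for r k
      by (cases "k = i") (auto intro!: continuous_intros t)
    then show "continuous_on UNIV (\<lambda>t. refl_matrix (tri m (std_param (exp t))) i)"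
      unfolding refl_matrix_def by (intro continuous_on_vec_lambda)
  qed
  then show ?thesis unfolding sec_gen_def by (intro continuous_matrix_mult continuous_on_const)
qed

lemma continuous_sec: "continuous_map euclideanreal (rep_space G) (\<lambda>t. sec (exp t))"
proof -
  have "continuous_map euclideanreal euclidean (\<lambda>t. sec (exp t) \<gamma>)" if \<gamma>: "\<gamma> \<in> carrier G" for \<gamma>
  proof -
    obtain w where w: "\<gamma> = gword \<sigma> w" using \<gamma> unfolding carrier_G by blast
    have "continuous_on UNIV (\<lambda>t. gword (sec_gen (exp t)) w)"
      by (induction w) (auto intro!: continuous_matrix_mult continuous_sec_gen)
    then show ?thesis by (simp add: w sec_gword)
  qed
  moreover have "(\<lambda>t. sec (exp t)) ` UNIV \<subseteq> extensional (carrier G)" by (auto simp: sec_def)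
  ultimately have "continuous_map euclideanreal (product_topology (\<lambda>_. euclidean) (carrier G)) (\<lambda>t. sec (exp t))"
    by (simp add: continuous_map_componentwise)
  moreover have "sec (exp t) \<in> hom G SL3" for t using sec_rep[of "exp t"] unfolding topspace_rep by simp
  ultimately show ?thesis unfolding rep_space_def by (simp add: continuous_map_in_subtopology)
qed

text \<open>The section is a path that meets the inclusion at the parameter of the undeformed group,
  so it stays in the component of the inclusion.\<close>

lemma sec_X: "sec (exp t) \<in> topspace X"
proof -
  have "connectedin (rep_space G) ((\<lambda>t. sec (exp t)) ` UNIV)"
    using continuous_sec by (rule connectedin_continuous_map_image) simp
  moreover have "incl = sec (exp (ln base_param))" using sec_base base_param_pos by simp
  then have "incl \<in> (\<lambda>t. sec (exp t)) ` UNIV" by blast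
  ultimately have "(\<lambda>t. sec (exp t)) ` UNIV \<subseteq> connected_component_of_set (rep_space G) incl"
    by (rule connected_component_of_maximal)
  then show ?thesis unfolding topspace_X by blast
qed

lemma param_sec: "param (sec (exp t)) = exp t"
proof -
  define S where "S = tri m (std_param (exp t))"
  have gen: "gens (sec (exp t)) = sec_gen (exp t)"
    using sec_gword[of "exp t" "[i]" for i] by auto
  define v where "v i = matrix_inv base_frame *v column i S" for i
  have v: "base_frame *v v i = column i S" for i using base_frame(1) by (simp add: v_def)
  have wall: "wall (sec_gen (exp t)) i *v x = (row i base_frame \<bullet> x) *\<^sub>R v i" for i x
  proof -
    have r: "(base_frame *v x) $ i = row i base_frame \<bullet> x"
      by (simp add: matrix_vector_mult_def row_def inner_vec_def)
    have "base_frame *v (wall (sec_gen (exp t)) i *v x) = base_frame *v ((row i base_frame \<bullet> x) *\<^sub>R v i)"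
      by (simp add: wall_def matrix_vector_mult_add_rdistrib matrix_vector_right_distrib sec_gen_frame
          matrix_vector_mult_scaleR v refl_def S_def r)
    then show ?thesis by (metis matrix_inv_mult(2)[OF base_frame(1)])
  qed
  have fv: "row i base_frame \<bullet> v j = S $ i $ j" for i j
  proof -
    have "row i base_frame \<bullet> v j = (base_frame *v v j) $ i"
      by (simp add: matrix_vector_mult_def row_def inner_vec_def)
    then show ?thesis by (simp add: v column_def)
  qed
  have "(wall (sec_gen (exp t)) 1 ** wall (sec_gen (exp t)) 2 ** wall (sec_gen (exp t)) 3) *v x =
      (row 3 base_frame \<bullet> x) *\<^sub>R ((S $ 1 $ 2 * S $ 2 $ 3) *\<^sub>R v 1)" for x
    by (simp add: matrix_vector_mul_assoc[symmetric] wall matrix_vector_mult_scaleR fv)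
  from trace_rank_one[OF this] have "rep_param (sec_gen (exp t)) = - (S $ 1 $ 2 * S $ 2 $ 3 * S $ 3 $ 1)"
    by (simp add: rep_param_def fv)
  also have "\<dots> = exp t" by (simp add: S_def tri_def std_param_def cyc3)
  finally show ?thesis unfolding gen .
qed

text \<open>The logarithm of the parameter descends to classes by \<open>conj_class_eq_iff\<close>,
  and its continuity descends because the classes carry the quotient topology. The section followed
  by the quotient map is the inverse.\<close>

theorem moduli_homeomorphic:
  obtains \<psi> where "homeomorphic_map (quotient_topology X (conj_class G)) euclideanreal \<psi>"
    "\<And>\<rho>. \<rho> \<in> topspace X \<Longrightarrow> \<psi> (conj_class G \<rho>) = ln (param \<rho>)"
proof -
  let ?M = "quotient_topology X (conj_class G)"
  have q: "quotient_map X ?M (conj_class G)" by (rule quotient_map_quotient_topology)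
  define \<psi> where "\<psi> K = ln (param (SOME \<rho>. \<rho> \<in> topspace X \<and> conj_class G \<rho> = K))" for K
  have \<psi>: "\<psi> (conj_class G \<rho>) = ln (param \<rho>)" if \<rho>: "\<rho> \<in> topspace X" for \<rho>
  proof -
    define \<tau> where "\<tau> = (SOME \<tau>. \<tau> \<in> topspace X \<and> conj_class G \<tau> = conj_class G \<rho>)"
    have "\<tau> \<in> topspace X \<and> conj_class G \<tau> = conj_class G \<rho>"
      unfolding \<tau>_def
      by (rule someI[of "\<lambda>\<tau>. \<tau> \<in> topspace X \<and> conj_class G \<tau> = conj_class G \<rho>" \<rho>]) (use \<rho> in simp)
    then show ?thesis using conj_class_eq_iff[of \<tau> \<rho>] \<rho> by (simp add: \<psi>_def \<tau>_def)
  qed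
  define s where "s t = conj_class G (sec (exp t))" for t :: real
  have "continuous_map X (subtopology euclideanreal {0<..}) (\<lambda>\<rho>. param \<rho>)"
    using continuous_rep_param param_pos by (auto simp: continuous_map_in_subtopology)
  moreover have "continuous_map (subtopology euclideanreal {0<..}) euclideanreal ln"
    by (auto intro!: continuous_intros)
  ultimately have "continuous_map X euclideanreal (ln \<circ> (\<lambda>\<rho>. param \<rho>))"
    by (rule continuous_map_compose)
  then have "continuous_map X euclideanreal (\<psi> \<circ> conj_class G)"
    by (rule continuous_map_eq) (simp add: \<psi>)
  then have c1: "continuous_map ?M euclideanreal \<psi>" by (rule continuous_compose_quotient_map[OF q])
  have "continuous_map euclideanreal X (\<lambda>t. sec (exp t))"
    unfolding X_def using continuous_sec sec_X
    by (simp add: continuous_map_in_subtopology topspace_X[symmetric])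
  from continuous_map_compose[OF this quotient_imp_continuous_map[OF q]]
  have c2: "continuous_map euclideanreal ?M s" by (simp add: o_def s_def[abs_def])
  have "homeomorphic_maps ?M euclideanreal \<psi> s"
    unfolding homeomorphic_maps_def
  proof (intro conjI ballI c1 c2)
    fix K assume "K \<in> topspace ?M"
    then obtain \<rho> where \<rho>: "\<rho> \<in> topspace X" "K = conj_class G \<rho>"
      using quotient_imp_surjective_map[OF q] by blast
    have "conj_class G (sec (exp (ln (param \<rho>)))) = conj_class G \<rho>"
    proof -
      have "sec (param \<rho>) \<in> topspace X" "param (sec (param \<rho>)) = param \<rho>"
        using sec_X[of "ln (param \<rho>)"] param_sec[of "ln (param \<rho>)"] param_pos[OF \<rho>(1)] by simp_all
      then show ?thesis using conj_class_eq_iff \<rho>(1) param_pos[OF \<rho>(1)] by simp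
    qed
    then show "s (\<psi> K) = K" by (simp add: \<rho> \<psi> s_def)
  next
    fix t :: real
    show "\<psi> (s t) = t" by (simp add: s_def \<psi> sec_X param_sec)
  qed
  then show ?thesis using that \<psi> homeomorphic_maps_map by blast
qed

end

section \<open>Projective triangles and reflections\<close>

text \<open>By Cramer's rule the solution is a quotient of determinants, continuous where the
  denominator does not vanish.\<close>

lemma matrix_inv_tendsto:
  fixes N :: "'a \<Rightarrow> real^3^3"
  assumes N: "(N \<longlongrightarrow> M) F" and M: "invertible M"
  shows "((\<lambda>n. matrix_inv (N n) *v b) \<longlongrightarrow> matrix_inv M *v b) F"
proof -
  define s where "s A = (\<chi> k. det (\<chi> i j. if j = k then b $ i else A $ i $ j) / det A)" for A :: "real^3^3"
  have s: "matrix_inv A *v b = s A" if "det A \<noteq> 0" for A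
  proof -
    have "invertible A" using that by (simp add: invertible_det_nz)
    then have "A *v (matrix_inv A *v b) = b" by simp
    then show ?thesis unfolding s_def using cramer[OF that] by blast
  qed
  have d: "det M \<noteq> 0" using M by (simp add: invertible_det_nz)
  have dN: "((\<lambda>n. det (N n)) \<longlongrightarrow> det M) F" unfolding det_3 by (intro tendsto_intros N)
  have num: "((\<lambda>n. det (\<chi> i j. if j = k then b $ i else N n $ i $ j)) \<longlongrightarrow>
      det (\<chi> i j. if j = k then b $ i else M $ i $ j)) F" for k
  proof -
    have "((\<lambda>n. if j = k then b $ i else N n $ i $ j) \<longlongrightarrow> (if j = k then b $ i else M $ i $ j)) F" for i j
      by (cases "j = k") (auto intro!: tendsto_intros N)
    then show ?thesis unfolding det_3 vec_lambda_beta by (intro tendsto_intros)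
  qed
  have "((\<lambda>n. s (N n)) \<longlongrightarrow> s M) F"
    unfolding s_def by (intro vec_tendstoI) (auto intro!: tendsto_divide num dN d)
  moreover have "\<forall>\<^sub>F n in F. s (N n) = matrix_inv (N n) *v b"
    using tendsto_imp_eventually_ne[OF dN d] by eventually_elim (simp add: s)
  ultimately show ?thesis unfolding s[OF d] by (rule Lim_transform_eventually)
qed

lemma pcone_scaled_iff:
  assumes "v \<noteq> 0" shows "proj v \<in> pcone K \<longleftrightarrow> (\<exists>c. c \<noteq> 0 \<and> c *\<^sub>R v \<in> K)"
proof
  assume "proj v \<in> pcone K"
  then obtain y where y: "y \<in> K" "y \<noteq> 0" "proj y = proj v" by (auto simp: pcone_def dest: sym[of "proj v"])
  then obtain c where "c \<noteq> 0" "y = c *\<^sub>R v" using proj_eq_iff assms by metis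
  then show "\<exists>c. c \<noteq> 0 \<and> c *\<^sub>R v \<in> K" using y(1) by blast
next
  assume "\<exists>c. c \<noteq> 0 \<and> c *\<^sub>R v \<in> K"
  then obtain c where c: "c \<noteq> 0" "c *\<^sub>R v \<in> K" by blast
  then have "proj (c *\<^sub>R v) \<in> pcone K" using assms unfolding pcone_def by (intro imageI) simp
  then show "proj v \<in> pcone K" using c(1) by (simp add: proj_scaleR)
qed

text \<open>The rows of M are functionals of the three sides, so a triangle is given by its sides
  rather than by its vertices: \<open>ptri (matrix_inv g)\<close> is the image of the coordinate
  triangle under g.\<close>

definition ptri :: "real^3^3 \<Rightarrow> rp2 set" where
  "ptri M = pcone {y. M *v y \<in> orthant}"

lemma orthant_scaleR_iff: "0 < c \<Longrightarrow> c *\<^sub>R x \<in> orthant \<longleftrightarrow> x \<in> orthant"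
  by (simp add: orthant_def zero_le_mult_iff)

lemma proj_ptri_iff:
  assumes "v \<noteq> 0" shows "proj v \<in> ptri M \<longleftrightarrow> M *v v \<in> orthant \<or> - (M *v v) \<in> orthant"
proof -
  have "proj v \<in> ptri M \<longleftrightarrow> (\<exists>c. c \<noteq> 0 \<and> c *\<^sub>R (M *v v) \<in> orthant)"
    unfolding ptri_def pcone_scaled_iff[OF assms] by (simp add: matrix_vector_mult_scaleR)
  also have "\<dots> \<longleftrightarrow> M *v v \<in> orthant \<or> - (M *v v) \<in> orthant"
  proof
    assume "\<exists>c. c \<noteq> 0 \<and> c *\<^sub>R (M *v v) \<in> orthant"
    then obtain c where c: "c \<noteq> 0" "c *\<^sub>R (M *v v) \<in> orthant" by blast
    show "M *v v \<in> orthant \<or> - (M *v v) \<in> orthant"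
    proof (cases "0 < c")
      case False
      then have "(- c) *\<^sub>R (- (M *v v)) \<in> orthant" "0 < - c" using c by auto
      then show ?thesis using orthant_scaleR_iff by blast
    qed (use c orthant_scaleR_iff in blast)
  next
    assume *: "M *v v \<in> orthant \<or> - (M *v v) \<in> orthant"
    then have "1 *\<^sub>R (M *v v) \<in> orthant \<or> (- 1) *\<^sub>R (M *v v) \<in> orthant" by simp
    then show "\<exists>c. c \<noteq> 0 \<and> c *\<^sub>R (M *v v) \<in> orthant" using one_neq_zero[where 'a = real] neg_equal_0_iff_equal[of "1 :: real"] by blast
  qed
  finally show ?thesis .
qed

lemma ptri_nonempty: "invertible M \<Longrightarrow> ptri M \<noteq> {}"
proof -
  assume M: "invertible M"
  define v where "v = matrix_inv M *v axis 1 1"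
  have v: "M *v v = axis 1 1" using M by (simp add: v_def)
  then have "v \<noteq> 0" by (metis axis_eq_0_iff matrix_vector_mult_0_right zero_neq_one)
  moreover have "M *v v \<in> orthant" by (simp add: v orthant_def axis_def)
  ultimately show ?thesis using proj_ptri_iff by blast
qed

lemma ptri_limit:
  assumes N: "N \<longlonglongrightarrow> M" and z: "\<And>n. z n \<in> ptri (N n)" "z \<longlonglongrightarrow> l"
  shows "l \<in> ptri M"
proof -
  obtain u where u: "norm u = 1" "l = proj u" using rp2_unit_rep by blast
  then have "u \<noteq> 0" by auto
  then obtain v where v: "v \<longlonglongrightarrow> u" "\<And>n. v n \<noteq> 0" "\<And>n. z n = proj (v n)"
    using lift_convergent[of z u] z(2) u(2) by metis
  have "closed (orthant \<union> uminus ` orthant)"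
  proof -
    have "closed orthant" unfolding orthant_def
      by (intro closed_Collect_all closed_Collect_le continuous_intros)
    then show ?thesis by (intro closed_Un closed_negations)
  qed
  moreover have "N n *v v n \<in> orthant \<union> uminus ` orthant" for n
    using z(1)[of n] proj_ptri_iff[OF v(2)[of n], of "N n"] unfolding v(3)
    by (metis UnCI image_eqI minus_minus)
  moreover have "(\<lambda>n. N n *v v n) \<longlonglongrightarrow> M *v u" by (intro tendsto_matrix_vector_mult N v(1))
  ultimately have "M *v u \<in> orthant \<union> uminus ` orthant" by (rule closed_sequentially)
  then show ?thesis unfolding u(2) proj_ptri_iff[OF \<open>u \<noteq> 0\<close>] by auto
qed

lemma closed_ptri: "closed (ptri M)"
  unfolding closed_sequential_limits using ptri_limit[of "\<lambda>_. M" M] by auto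

text \<open>A point of the limit triangle is followed by solving for the same side values with N n
  in place of M. The finitely many terms with singular N n are replaced by M.\<close>

lemma hausdist_ptri_seq:
  assumes N: "N \<longlonglongrightarrow> M" and M: "invertible M"
  shows "(\<lambda>n. hausdist (ptri (N n)) (ptri M)) \<longlonglongrightarrow> 0"
proof -
  have d: "det M \<noteq> 0" using M by (simp add: invertible_det_nz)
  define N' where "N' n = (if det (N n) = 0 then M else N n)" for n
  have inv: "invertible (N' n)" for n using d by (simp add: N'_def invertible_det_nz)
  have "(\<lambda>n. det (N n)) \<longlonglongrightarrow> det M" unfolding det_3 by (intro tendsto_intros N)
  then have "\<forall>\<^sub>F n in sequentially. det (N n) \<noteq> 0" using d by (rule tendsto_imp_eventually_ne)
  then have ev: "\<forall>\<^sub>F n in sequentially. N n = N' n" by eventually_elim (simp add: N'_def)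
  have N': "N' \<longlonglongrightarrow> M" using N ev by (rule Lim_transform_eventually)
  have "(\<lambda>n. hausdist (ptri (N' n)) (ptri M)) \<longlonglongrightarrow> 0"
  proof (rule hausdist_tendsto_0I)
    show "ptri (N' n) \<noteq> {}" "ptri M \<noteq> {}" for n using inv M ptri_nonempty by blast+
  next
    fix p assume p: "p \<in> ptri M"
    obtain u where u: "norm u = 1" "p = proj u" using rp2_unit_rep by blast
    have u0: "u \<noteq> 0" using u(1) by auto
    define v where "v n = matrix_inv (N' n) *v (M *v u)" for n
    have Nv: "N' n *v v n = M *v u" for n using inv by (simp add: v_def)
    have v0: "v n \<noteq> 0" for n using Nv u0 M by (metis matrix_inv_mult(2) matrix_vector_mult_0_right)
    have "v \<longlonglongrightarrow> matrix_inv M *v (M *v u)" unfolding v_def by (rule matrix_inv_tendsto[OF N' M])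
    then have "(\<lambda>n. proj (v n)) \<longlonglongrightarrow> p" using M u0 proj_convergent by (simp add: u(2))
    moreover have "proj (v n) \<in> ptri (N' n)" for n
      using p unfolding u(2) proj_ptri_iff[OF u0] proj_ptri_iff[OF v0] Nv .
    ultimately show "\<exists>z. (\<forall>n. z n \<in> ptri (N' n)) \<and> z \<longlonglongrightarrow> p" by (intro exI[of _ "\<lambda>n. proj (v n)"]) simp
  next
    fix r z l assume r: "strict_mono (r :: nat \<Rightarrow> nat)" "\<And>n. z n \<in> ptri (N' (r n))" "z \<longlonglongrightarrow> l"
    have "(\<lambda>n. N' (r n)) \<longlonglongrightarrow> M" using LIMSEQ_subseq_LIMSEQ[OF N' r(1)] by (simp add: o_def)
    then have "l \<in> ptri M" using r(2,3) by (rule ptri_limit)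
    then show "l \<in> closure (ptri M)" using closure_subset by blast
  qed
  moreover have "\<forall>\<^sub>F n in sequentially. hausdist (ptri (N' n)) (ptri M) = hausdist (ptri (N n)) (ptri M)"
    using ev by eventually_elim simp
  ultimately show ?thesis by (rule Lim_transform_eventually)
qed

lemma hausdist_refl: "A \<noteq> {} \<Longrightarrow> hausdist A A = 0"
  by (auto simp: hausdist_def)

lemma hausdist_ptri:
  assumes N: "(N \<longlongrightarrow> M) F" and M: "invertible M"
  shows "((\<lambda>x. hausdist (ptri (N x)) (ptri M)) \<longlongrightarrow> 0) F"
proof -
  have "isCont (\<lambda>A. hausdist (ptri A) (ptri M)) M"
    unfolding continuous_at_sequentially
    using hausdist_ptri_seq[OF _ M] by (auto simp: o_def hausdist_refl[OF ptri_nonempty[OF M]])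
  from isCont_tendsto_compose[OF this N] show ?thesis by (simp add: hausdist_refl[OF ptri_nonempty[OF M]])
qed

lemma ptri_scaleR:
  assumes "c \<noteq> 0" shows "ptri (c *\<^sub>R M) = ptri M"
proof -
  have "proj v \<in> ptri (c *\<^sub>R M) \<longleftrightarrow> proj v \<in> ptri M" if "v \<noteq> 0" for v
  proof -
    have c: "(c *\<^sub>R M) *v v = c *\<^sub>R (M *v v)" by (simp add: scaleR_matrix_vector_assoc)
    show ?thesis unfolding proj_ptri_iff[OF that] c
      using orthant_scaleR_iff[of c "M *v v"] orthant_scaleR_iff[of c "- (M *v v)"]
        orthant_scaleR_iff[of "- c" "M *v v"] orthant_scaleR_iff[of "- c" "- (M *v v)"] assms
      by (cases "0 < c") auto
  qed
  note * = this
  show ?thesis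
    unfolding set_eq_iff
  proof
    fix p
    obtain v where "norm v = 1" "p = proj v" using rp2_unit_rep by blast
    then show "p \<in> ptri (c *\<^sub>R M) \<longleftrightarrow> p \<in> ptri M" using *[of v] by (metis norm_zero zero_neq_one)
  qed
qed

lemma coord_triangle_pcone: "coord_triangle = pcone orthant"
  by (auto simp: coord_triangle_def pcone_def orthant_def)

lemma coord_line_pcone: "coord_line i = pcone {s. s $ i = 0}"
  by (auto simp: coord_line_def pcone_def)

lemma matrix_image_Collect:
  fixes g M :: "real^3^3"
  assumes "\<And>x. M *v (g *v x) = x" "\<And>x. g *v (M *v x) = x"
  shows "(*v) g ` {x. P x} = {y. P (M *v y)}"
  using assms by (auto simp: image_iff) metis

lemma pact_coord_triangle:
  assumes "invertible g" shows "pact g ` coord_triangle = ptri (matrix_inv g)"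
proof -
  have "(*v) g ` orthant = {y. matrix_inv g *v y \<in> orthant}"
    using matrix_image_Collect[of "matrix_inv g" g "\<lambda>x. x \<in> orthant"] assms by simp
  then show ?thesis unfolding coord_triangle_pcone ptri_def pact_pcone[OF assms] by simp
qed

lemma pact_coord_line:
  assumes "invertible g" shows "pact g ` coord_line i = pcone {y. (matrix_inv g *v y) $ i = 0}"
  unfolding coord_line_pcone pact_pcone[OF assms]
  using matrix_image_Collect[of "matrix_inv g" g "\<lambda>x. x $ i = 0"] assms by simp

lemma pspan_two:
  assumes "u \<noteq> 0" "v \<noteq> 0" shows "pspan {proj u, proj v} = pcone (span {u, v})"
proof -
  have *: "span (span {u} \<union> span {v}) = span {u, v}"
  proof (rule antisym)
    have "span {u} \<subseteq> span {u, v}" "span {v} \<subseteq> span {u, v}" by (intro span_mono; simp)+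
    then show "span (span {u} \<union> span {v}) \<subseteq> span {u, v}" by (intro span_minimal) auto
    show "span {u, v} \<subseteq> span (span {u} \<union> span {v})"
      by (intro span_mono) (auto intro: span_base)
  qed
  have "p \<in> pspan {proj u, proj v} \<longleftrightarrow> p \<in> pcone (span {u, v})" for p
  proof -
    obtain w where w: "norm w = 1" "p = proj w" using rp2_unit_rep by blast
    then have w0: "w \<noteq> 0" by auto
    have "p \<in> pspan {proj u, proj v} \<longleftrightarrow> span {w} \<subseteq> span {u, v}"
      using * assms w0 by (simp add: pspan_def w(2) line_of_proj)
    also have "\<dots> \<longleftrightarrow> w \<in> span {u, v}"
    proof
      show "w \<in> span {u, v}" if "span {w} \<subseteq> span {u, v}" using that span_base[of w "{w}"] by auto
      show "span {w} \<subseteq> span {u, v}" if "w \<in> span {u, v}" using that by (intro span_minimal) auto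
    qed
    also have "\<dots> \<longleftrightarrow> p \<in> pcone (span {u, v})"
      unfolding w(2) pcone_scaled_iff[OF w0]
    proof
      show "\<exists>c. c \<noteq> 0 \<and> c *\<^sub>R w \<in> span {u, v}" if "w \<in> span {u, v}" using that by (intro exI[of _ 1]) simp
      show "w \<in> span {u, v}" if "\<exists>c. c \<noteq> 0 \<and> c *\<^sub>R w \<in> span {u, v}"
        using that span_scale[of "c *\<^sub>R w" "{u, v}" "inverse c" for c] by force
    qed
    finally show ?thesis .
  qed
  then show ?thesis by blast
qed

section \<open>Reflections across a projective line\<close>

lemma orthogonal_basis:
  fixes f :: "real^3"
  assumes "f \<noteq> 0"
  obtains a b where "a \<noteq> 0" "f \<bullet> a = 0" "f \<bullet> b = 0" "cross3 a b = (a \<bullet> a) *\<^sub>R f"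
proof -
  obtain a where a: "a \<noteq> 0" "f \<bullet> a = 0"
    using orthogonal_to_vector_exists[of f] by (auto simp: orthogonal_def inner_commute)
  have "cross3 a (cross3 f a) = (a \<bullet> a) *\<^sub>R f - (f \<bullet> a) *\<^sub>R a"
    by (simp add: vec_eq_iff forall_3 cross3_simps)
  then have "cross3 a (cross3 f a) = (a \<bullet> a) *\<^sub>R f" using a(2) by simp
  moreover have "f \<bullet> cross3 f a = 0" by (simp add: dot_cross_self)
  ultimately show ?thesis using that a by blast
qed

abbreviation half_turn :: "real^3^3" where
  "half_turn \<equiv> \<chi> i j. if i = j then if i = 1 then 1 else - 1 else 0"

lemma half_turn_mult: "half_turn *v x = (2 * x $ 1) *\<^sub>R axis 1 1 - x"
  by (simp add: vec_eq_iff forall_3 matrix_vector_mult_def sum_3 axis_def)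

text \<open>The columns of h are the centre v and a basis of the kernel of f, so h conjugates
  \<open>half_turn\<close> to R; rescaling puts h into SL(3,R).\<close>

lemma reflection_acrossI:
  assumes R: "\<And>x. R *v x = (f \<bullet> x) *\<^sub>R v - x" and fv: "f \<bullet> v = 2"
  shows "reflection_across R (pcone {x. f \<bullet> x = 0})"
proof -
  have "f \<noteq> 0" using fv by auto
  then obtain a b where ab: "a \<noteq> 0" "f \<bullet> a = 0" "f \<bullet> b = 0" "cross3 a b = (a \<bullet> a) *\<^sub>R f"
    by (rule orthogonal_basis)
  define h :: "real^3^3" where "h = (\<chi> i j. if j = 1 then v $ i else if j = 2 then a $ i else b $ i)"
  have hx: "h *v s = s $ 1 *\<^sub>R v + s $ 2 *\<^sub>R a + s $ 3 *\<^sub>R b" for s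
    by (simp add: vec_eq_iff forall_3 matrix_vector_mult_def sum_3 h_def)
  have "det h = v \<bullet> cross3 a b"
    by (simp add: h_def det_3 cross3_def inner_vec_def sum_3 algebra_simps)
  then have "det h \<noteq> 0" using ab(1,4) fv by (simp add: inner_commute)
  then have inv: "invertible h" by (simp add: invertible_det_nz)
  then obtain c where c: "c \<noteq> 0" "c *\<^sub>R h \<in> carrier SL3" by (rule SL3_rescale)
  have fh: "f \<bullet> (h *v s) = 2 * s $ 1" for s
    unfolding hx using ab(2,3) fv by (simp add: inner_add_right)
  have Rh: "R *v (h *v s) = h *v (half_turn *v s)" for s
  proof -
    have "h *v (half_turn *v s) = (2 * s $ 1) *\<^sub>R (h *v axis 1 1) - h *v s"
      by (simp add: half_turn_mult matrix_vector_mult_diff_distrib matrix_vector_mult_scaleR)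
    also have "h *v axis 1 1 = v" unfolding hx by (simp add: axis_def)
    finally show ?thesis unfolding R fh by simp
  qed
  let ?h = "c *\<^sub>R h"
  have "R ** ?h = ?h ** half_turn"
    using Rh by (simp add: matrix_eq matrix_vector_mul_assoc[symmetric] scaleR_matrix_vector_assoc[symmetric]
      matrix_vector_mult_scaleR)
  then have "R ** (?h ** matrix_inv ?h) = ?h ** half_turn ** matrix_inv ?h" by (simp add: matrix_mul_assoc)
  then have "R = ?h ** half_turn ** matrix_inv ?h"
    using matrix_inv_inverse(1)[OF SL3_invertible[OF c(2)]] by simp
  moreover have "{x. f \<bullet> x = 0} = span {a, b}"
  proof
    show "{x. f \<bullet> x = 0} \<subseteq> span {a, b}"
    proof
      fix x assume "x \<in> {x. f \<bullet> x = 0}"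
      then have fx: "f \<bullet> x = 0" by simp
      obtain s where s: "x = h *v s" using matrix_inv_mult(1)[OF inv] by metis
      have "s $ 1 = 0" using fh[of s] fx unfolding s by simp
      then have "x = s $ 2 *\<^sub>R a + s $ 3 *\<^sub>R b" unfolding s hx by simp
      then show "x \<in> span {a, b}" by (simp add: span_add span_base span_scale)
    qed
    show "span {a, b} \<subseteq> {x. f \<bullet> x = 0}"
      using ab(2,3) by (intro span_minimal) (auto simp: subspace_def inner_add_right)
  qed
  moreover have "b \<noteq> 0" "proj a \<noteq> proj b"
  proof -
    have c0: "cross3 a b \<noteq> 0" using ab(1,4) \<open>f \<noteq> 0\<close> by simp
    show b: "b \<noteq> 0" using c0 by auto
    show "proj a \<noteq> proj b"
    proof
      assume "proj a = proj b"
      then obtain c where "a = c *\<^sub>R b" using proj_eq_iff ab(1) b by blast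
      then show False using c0 by (simp add: cross_mult_left)
    qed
  qed
  ultimately have "proj_line (pcone {x. f \<bullet> x = 0})" "\<exists>h\<in>carrier SL3. R = h ** half_turn ** matrix_inv h"
  proof -
    assume *: "R = ?h ** half_turn ** matrix_inv ?h" "{x. f \<bullet> x = 0} = span {a, b}" "b \<noteq> 0" "proj a \<noteq> proj b"
    show "\<exists>h\<in>carrier SL3. R = h ** half_turn ** matrix_inv h" using c(2) *(1) by (rule bexI[rotated])
    show "proj_line (pcone {x. f \<bullet> x = 0})"
      unfolding proj_line_def *(2) pspan_two[OF ab(1) *(3), symmetric] using *(4) by blast
  qed
  moreover have "pact R p = p" if p: "p \<in> pcone {x. f \<bullet> x = 0}" for p
  proof -
    obtain x where x: "p = proj x" "x \<noteq> 0" "f \<bullet> x = 0" using p by (auto simp: pcone_def)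
    have "R *v x = (- 1) *\<^sub>R x" unfolding R x(3) by simp
    then show ?thesis using x proj_scaleR[of "- 1" x] by (simp add: pact_proj)
  qed
  ultimately show ?thesis unfolding reflection_across_def by blast
qed

text \<open>Conjugation gives R x = f(x) v - x for some f, and the point is that f is proportional
  to n. Every nonzero vector of the line is an eigenvector, so if f did not vanish on the line, v
  itself would lie on it.\<close>

lemma reflection_acrossD:
  assumes R: "reflection_across R (pcone {x. n \<bullet> x = 0})" and n: "n \<noteq> 0"
  obtains v where "\<And>x. R *v x = (n \<bullet> x) *\<^sub>R v - x" "n \<bullet> v = 2"
proof -
  obtain h where h: "h \<in> carrier SL3" "R = h ** half_turn ** matrix_inv h"
    using R unfolding reflection_across_def by blast
  have inv: "invertible h" using h(1) by (rule SL3_invertible)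
  define v f where "v = h *v axis 1 1" and "f = 2 *\<^sub>R row 1 (matrix_inv h)"
  have f: "f \<bullet> x = 2 * (matrix_inv h *v x) $ 1" for x
    by (simp add: f_def matrix_vector_mult_def row_def inner_vec_def sum_distrib_left mult.assoc)
  have Rx: "R *v x = (f \<bullet> x) *\<^sub>R v - x" for x
  proof -
    have "R *v x = h *v (half_turn *v (matrix_inv h *v x))" by (simp add: h(2) matrix_vector_mul_assoc matrix_mul_assoc)
    also have "\<dots> = (f \<bullet> x) *\<^sub>R v - x"
      using inv by (simp add: half_turn_mult matrix_vector_mult_diff_distrib matrix_vector_mult_scaleR f v_def)
    finally show ?thesis .
  qed
  have fv: "f \<bullet> v = 2" using inv by (simp add: f v_def axis_def)
  have eig: "\<exists>c. (f \<bullet> x) *\<^sub>R v = c *\<^sub>R x" if x: "n \<bullet> x = 0" for x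
  proof (cases "x = 0")
    case False
    then have "proj x \<in> pcone {x. n \<bullet> x = 0}" using x by (auto simp: pcone_def)
    then have p: "proj (R *v x) = proj x" using R pact_proj[OF False, of R] unfolding reflection_across_def by metis
    have "R *v (R *v x) = x" unfolding Rx using fv by (simp add: inner_diff_right scaleR_diff_left scaleR_2 algebra_simps)
    then have "R *v x \<noteq> 0" using False by auto
    then obtain c where "R *v x = c *\<^sub>R x" using p proj_eq_iff False by blast
    then have "(f \<bullet> x) *\<^sub>R v = (c + 1) *\<^sub>R x" unfolding Rx by (simp add: algebra_simps)
    then show ?thesis by blast
  qed auto
  have ker: "f \<bullet> x = 0" if x: "n \<bullet> x = 0" for x
  proof (rule ccontr)
    assume fx: "f \<bullet> x \<noteq> 0"
    obtain c where c: "(f \<bullet> x) *\<^sub>R v = c *\<^sub>R x" using eig[OF x] by blast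
    have "(f \<bullet> x) * (n \<bullet> v) = n \<bullet> ((f \<bullet> x) *\<^sub>R v)" by simp
    also have "\<dots> = 0" unfolding c using x by simp
    finally have nv: "n \<bullet> v = 0" using fx by simp
    \<comment> \<open>A second vector of the line, corrected along v so that f vanishes at it. As v
      + z is an eigenvector, z is 0, which would make the nonzero vector \<open>cross3 n v\<close>
      both parallel and orthogonal to v.\<close>
    define z where "z = cross3 n v - ((f \<bullet> cross3 n v) / 2) *\<^sub>R v"
    have z: "n \<bullet> z = 0" "f \<bullet> z = 0" using nv fv by (simp_all add: z_def inner_diff_right dot_cross_self)
    obtain c where "(f \<bullet> (v + z)) *\<^sub>R v = c *\<^sub>R (v + z)" using eig[of "v + z"] nv z by (auto simp: inner_add_right)
    then have c: "2 *\<^sub>R v = c *\<^sub>R (v + z)" using fv z by (simp add: inner_add_right)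
    have "f \<bullet> (2 *\<^sub>R v) = f \<bullet> (c *\<^sub>R (v + z))" by (simp only: c)
    then have "c = 2" using fv z by (simp add: inner_add_right)
    then have "z = 0" using c by simp
    then have k: "cross3 n v = ((f \<bullet> cross3 n v) / 2) *\<^sub>R v" by (simp add: z_def)
    have "cross3 n v \<bullet> cross3 n v = ((f \<bullet> cross3 n v) / 2) * (v \<bullet> cross3 n v)" by (subst k) simp
    then have "cross3 n v = 0" by (simp add: dot_cross_self)
    moreover have "(norm (cross3 n v))\<^sup>2 = (norm n)\<^sup>2 * (norm v)\<^sup>2" using norm_cross_dot[of n v] nv by (simp add: power_mult_distrib)
    moreover have "v \<noteq> 0" using fv by auto
    ultimately show False using n by simp
  qed
  have nn: "n \<bullet> n \<noteq> 0" using n by simp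
  define t where "t = (f \<bullet> n) / (n \<bullet> n)"
  have fx: "f \<bullet> x = t * (n \<bullet> x)" for x
  proof -
    have "n \<bullet> (x - ((n \<bullet> x) / (n \<bullet> n)) *\<^sub>R n) = 0" using nn by (simp add: inner_diff_right)
    from ker[OF this] show ?thesis by (simp add: inner_diff_right t_def field_simps)
  qed
  show ?thesis
  proof (rule that[of "t *\<^sub>R v"])
    show "R *v x = (n \<bullet> x) *\<^sub>R t *\<^sub>R v - x" for x unfolding Rx fx by (simp add: mult.commute)
    show "n \<bullet> (t *\<^sub>R v) = 2" using fv fx[of v] by simp
  qed
qed

section \<open>Fundamental triangles\<close>

lemma transpose_mult_tendsto:
  fixes A :: "'a \<Rightarrow> real^3^3"
  assumes "(A \<longlongrightarrow> M) F" shows "((\<lambda>x. u v* A x) \<longlongrightarrow> u v* M) F"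
  using assms by (auto simp: vector_matrix_mult_def intro!: vec_tendstoI tendsto_intros)

text \<open>The wall of index 1 has rank one, so a change of u only rescales the frame and leaves
  the projective triangle as it is.\<close>

lemma rep_frame_scaleR:
  assumes B: "reflection_triple m B" and u: "u v* wall B 1 \<noteq> 0" "u' v* wall B 1 \<noteq> 0"
  obtains c where "c \<noteq> 0" "rep_frame B u' = c *\<^sub>R rep_frame B u"
proof -
  have B: "B i ** B i = mat 1" "trace (B i) = - 1" for i
    using B unfolding reflection_triple_def by blast+
  obtain v f where vf: "\<And>x. wall B 1 *v x = (f \<bullet> x) *\<^sub>R v"
    using involution_rank_one[OF B] unfolding wall_def by metis
  have w: "u v* wall B 1 = (u \<bullet> v) *\<^sub>R f" for u
  proof -
    have "(u v* wall B 1) \<bullet> x = ((u \<bullet> v) *\<^sub>R f) \<bullet> x" for x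
      by (simp add: dot_lmul_matrix vf)
    then show ?thesis using vector_eq_rdot by blast
  qed
  define c where "c = (u' \<bullet> v) / (u \<bullet> v)"
  have uv: "u \<bullet> v \<noteq> 0" "u' \<bullet> v \<noteq> 0" using u unfolding w by auto
  have uc: "u' \<bullet> (wall B 1 *v x) = c * (u \<bullet> (wall B 1 *v x))" for x
    using uv by (simp add: vf c_def)
  have "rep_frame B u' *v x = (c *\<^sub>R rep_frame B u) *v x" for x
    by (simp add: vec_eq_iff forall_3 rep_frame_nth uc scaleR_matrix_vector_assoc[symmetric])
  then show ?thesis using that[of c] uv by (auto simp: c_def matrix_eq)
qed

text \<open>The zero sets belonging to J and to the remaining indices are closed, disjoint and cover
  X, so one of them is empty.\<close>

lemma connected_space_constant:
  fixes f :: "'i \<Rightarrow> 'a \<Rightarrow> real"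
  assumes X: "connected_space X" and f: "\<And>i. i \<in> I \<Longrightarrow> continuous_map X euclideanreal (f i)"
    and I: "finite I" "J \<subseteq> I"
    and cover: "\<And>x. x \<in> topspace X \<Longrightarrow> \<exists>i\<in>I. f i x = 0"
    and disj: "\<And>x i j. x \<in> topspace X \<Longrightarrow> i \<in> J \<Longrightarrow> j \<in> I - J \<Longrightarrow> f i x = 0 \<Longrightarrow> f j x \<noteq> 0"
    and x: "x \<in> topspace X" "\<exists>i\<in>J. f i x = 0" and y: "y \<in> topspace X"
  shows "\<exists>i\<in>J. f i y = 0"
proof -
  define Z where "Z K = (\<Union>i\<in>K. {x \<in> topspace X. f i x = 0})" for K
  have Z: "closedin X (Z K)" if "K \<subseteq> I" for K
  proof -
    have "closedin X {x \<in> topspace X. f i x \<in> {0}}" if "i \<in> I" for i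
      using f[OF that] by (rule closedin_continuous_map_preimage) simp
    then show ?thesis unfolding Z_def using that I(1) finite_subset[OF that I(1)]
      by (intro closedin_Union) auto
  qed
  have "closedin X (Z J)" "closedin X (Z (I - J))" using Z I(2) by auto
  moreover have "topspace X \<subseteq> Z J \<union> Z (I - J)" using cover unfolding Z_def by blast
  moreover have "Z J \<inter> Z (I - J) = {}" using disj unfolding Z_def by blast
  moreover have "Z J \<noteq> {}" using x unfolding Z_def by blast
  ultimately have "Z (I - J) = {}" using X unfolding connected_space_closedin by blast
  then show ?thesis using cover[OF y] y unfolding Z_def by blast
qed

definition signs :: "(real^3) set" where
  "signs = {e. \<forall>i. \<bar>e $ i\<bar> = 1}"

lemma finite_signs: "finite signs"
proof -
  have "signs \<subseteq> (\<lambda>(a, b, c). vector [a, b, c]) ` ({- 1, 1} \<times> {- 1, 1} \<times> {- 1, 1})"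
  proof
    fix e :: "real^3" assume "e \<in> signs"
    then have *: "e $ i = - 1 \<or> e $ i = 1" for i by (auto simp: signs_def abs_if split: if_splits)
    have "e = vector [e $ 1, e $ 2, e $ 3]" by (simp add: vec_eq_iff forall_3)
    then show "e \<in> (\<lambda>(a, b, c). vector [a, b, c]) ` ({- 1, 1} \<times> {- 1, 1} \<times> {- 1, 1})"
      using *[of 1] *[of 2] *[of 3] by (intro image_eqI[of _ _ "(e $ 1, e $ 2, e $ 3)"]) auto
  qed
  then show ?thesis by (rule finite_subset) simp
qed

lemma invertible_sign: "e \<in> signs \<Longrightarrow> invertible M \<Longrightarrow> invertible (diag (\<lambda>i. e $ i) ** M)"
  by (intro invertible_mult invertible_diag) (metis (mono_tags) signs_def mem_Collect_eq abs_zero zero_neq_one)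

lemma mult_sign_nth: "((diag (\<lambda>i. e $ i) ** M) *v x) $ k = e $ k * (M *v x) $ k"
  by (simp add: matrix_vector_mul_assoc[symmetric] diag_mult_nth)

text \<open>The lines spanned by the sides of a triangle cut the projective plane into four triangles, one
  for each pair \<open>\<plusminus> e\<close> of sign vectors.\<close>

lemma ptri_sign_eq:
  assumes M: "invertible M" and e: "e \<in> signs" and eq: "ptri (diag (\<lambda>i. e $ i) ** M) = ptri M"
  shows "e = 1 \<or> e = - 1"
proof -
  define y where "y = matrix_inv M *v 1"
  have y: "M *v y = 1" using M by (simp add: y_def)
  then have "y \<noteq> 0" by (metis matrix_vector_mult_0_right zero_neq_one)
  have "M *v y \<in> orthant" by (simp add: y orthant_def)
  then have "proj y \<in> ptri (diag (\<lambda>i. e $ i) ** M)" unfolding eq using proj_ptri_iff[OF \<open>y \<noteq> 0\<close>] by blast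
  then have "(\<forall>k. 0 \<le> e $ k) \<or> (\<forall>k. e $ k \<le> 0)"
    unfolding proj_ptri_iff[OF \<open>y \<noteq> 0\<close>] by (simp add: orthant_def mult_sign_nth y)
  moreover have "\<bar>e $ k\<bar> = 1" for k using e by (simp add: signs_def)
  ultimately show ?thesis
    by (simp add: vec_eq_iff) (metis abs_of_nonneg abs_of_nonpos minus_equation_iff)
qed

lemma ptri_minus: "ptri (- M) = ptri M"
  using ptri_scaleR[of "- 1" M] by simp

lemma minus_diag_mult:
  fixes M :: "real^3^3"
  shows "diag (\<lambda>i. (- 1 :: real^3) $ i) ** M = - M" "diag (\<lambda>i. (1 :: real^3) $ i) ** M = M"
  by (simp_all add: matrix_eq vec_eq_iff matrix_vector_mul_assoc[symmetric] diag_mult_nth matrix_minus_mult)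

context reflection_group
begin

section \<open>Existence and uniqueness of the fundamental triangles\<close>

definition frame :: "(real^3^3 \<Rightarrow> real^3^3) \<Rightarrow> real^3^3" where
  "frame \<rho> = rep_frame (gens \<rho>) (SOME u. u v* wall (gens \<rho>) 1 \<noteq> 0)"

lemma frame_axis:
  assumes "\<rho> \<in> topspace X" shows "(SOME u. u v* wall (gens \<rho>) 1 \<noteq> 0) v* wall (gens \<rho>) 1 \<noteq> 0"
proof -
  obtain u where "u v* wall (gens \<rho>) 1 \<noteq> 0" using wall_axis[OF gens_triple[OF assms]] by blast
  then show ?thesis by (rule someI[of "\<lambda>u. u v* wall (gens \<rho>) 1 \<noteq> 0"])
qed

lemma frame:
  assumes "\<rho> \<in> topspace X"
  shows "invertible (frame \<rho>)"
    "frame \<rho> *v (\<rho> (\<sigma> i) *v x) = - refl (tri m (std_param (param \<rho>))) i (frame \<rho> *v x)"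
  using reflection_triple_normal_form[OF hyp gens_triple[OF assms] frame_axis[OF assms]] unfolding frame_def by auto

lemma tendsto_wall:
  assumes "\<rho> \<in> topspace X" shows "((\<lambda>\<rho>. wall (gens \<rho>) i) \<longlongrightarrow> wall (gens \<rho>) i) (atin X \<rho>)"
  using continuous_wall[of i] assms by (auto simp: continuous_map_atin)

lemma tendsto_matrix_mult:
  fixes A B :: "'b \<Rightarrow> real^3^3"
  assumes "(A \<longlongrightarrow> M) F" "(B \<longlongrightarrow> N) F" shows "((\<lambda>x. A x ** B x) \<longlongrightarrow> M ** N) F"
  using assms by (auto simp: matrix_matrix_mult_def intro!: vec_tendstoI tendsto_intros)

lemma tendsto_rep_frame:
  assumes "\<rho> \<in> topspace X"
  shows "((\<lambda>\<rho>. rep_frame (gens \<rho>) u) \<longlongrightarrow> rep_frame (gens \<rho>) u) (atin X \<rho>)"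
proof (rule vec_tendstoI)
  note w = tendsto_wall[OF assms]
  fix i :: 3
  have *: "((\<lambda>\<rho>. u v* wall (gens \<rho>) 1) \<longlongrightarrow> u v* wall (gens \<rho>) 1) (atin X \<rho>)"
    "((\<lambda>\<rho>. - (u v* (wall (gens \<rho>) 1 ** wall (gens \<rho>) 2))) \<longlongrightarrow> - (u v* (wall (gens \<rho>) 1 ** wall (gens \<rho>) 2))) (atin X \<rho>)"
    "((\<lambda>\<rho>. u v* (wall (gens \<rho>) 1 ** wall (gens \<rho>) 2 ** wall (gens \<rho>) 3)) \<longlongrightarrow>
       u v* (wall (gens \<rho>) 1 ** wall (gens \<rho>) 2 ** wall (gens \<rho>) 3)) (atin X \<rho>)"
    by (intro tendsto_minus transpose_mult_tendsto tendsto_matrix_mult w)+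
  show "((\<lambda>\<rho>. rep_frame (gens \<rho>) u $ i) \<longlongrightarrow> rep_frame (gens \<rho>) u $ i) (atin X \<rho>)"
    using exhaust_3[of i] * by (auto simp: rep_frame_def)
qed

text \<open>The vector chosen in \<open>frame\<close> need not depend continuously on the
  representation. Near \<rho> the vector chosen at \<rho> still works, and it gives the same
  triangle because the frames differ by a scalar.\<close>

lemma tendsto_ptri_frame:
  assumes \<rho>: "\<rho> \<in> topspace X" and e: "e \<in> signs"
  defines "T \<equiv> \<lambda>\<rho>. ptri (diag (\<lambda>i. e $ i) ** frame \<rho>)"
  shows "((\<lambda>\<rho>'. hausdist (T \<rho>') (T \<rho>)) \<longlongrightarrow> 0) (atin X \<rho>)"
proof -
  define u where "u = (SOME u. u v* wall (gens \<rho>) 1 \<noteq> 0)"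
  have fr: "frame \<rho> = rep_frame (gens \<rho>) u" by (simp add: frame_def u_def)
  let ?E = "diag (\<lambda>i. e $ i)"
  have "((\<lambda>\<rho>'. ?E ** rep_frame (gens \<rho>') u) \<longlongrightarrow> ?E ** frame \<rho>) (atin X \<rho>)"
    unfolding fr by (intro tendsto_matrix_mult tendsto_const tendsto_rep_frame \<rho>)
  then have "((\<lambda>\<rho>'. hausdist (ptri (?E ** rep_frame (gens \<rho>') u)) (T \<rho>)) \<longlongrightarrow> 0) (atin X \<rho>)"
    unfolding T_def by (rule hausdist_ptri[OF _ invertible_sign[OF e frame(1)[OF \<rho>]]])
  moreover have "\<forall>\<^sub>F \<rho>' in atin X \<rho>. hausdist (ptri (?E ** rep_frame (gens \<rho>') u)) (T \<rho>) = hausdist (T \<rho>') (T \<rho>)"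
  proof -
    have "((\<lambda>\<rho>'. u v* wall (gens \<rho>') 1) \<longlongrightarrow> u v* wall (gens \<rho>) 1) (atin X \<rho>)"
      by (intro transpose_mult_tendsto tendsto_wall \<rho>)
    then have "\<forall>\<^sub>F \<rho>' in atin X \<rho>. u v* wall (gens \<rho>') 1 \<noteq> 0"
      using frame_axis[OF \<rho>, folded u_def] by (rule tendsto_imp_eventually_ne)
    moreover have "\<forall>\<^sub>F \<rho>' in atin X \<rho>. \<rho>' \<in> topspace X"
      using openin_topspace[of X] \<rho> by (auto simp: eventually_atin)
    ultimately show ?thesis
    proof eventually_elim
      fix \<rho>' assume u: "u v* wall (gens \<rho>') 1 \<noteq> 0" and \<rho>': "\<rho>' \<in> topspace X"
      obtain c where c: "c \<noteq> 0" "frame \<rho>' = c *\<^sub>R rep_frame (gens \<rho>') u"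
        using rep_frame_scaleR[OF gens_triple[OF \<rho>'] u frame_axis[OF \<rho>']] unfolding frame_def by blast
      have "?E ** frame \<rho>' = c *\<^sub>R (?E ** rep_frame (gens \<rho>') u)"
        unfolding c(2) by (simp add: matrix_eq matrix_vector_mul_assoc[symmetric] scaleR_matrix_vector_assoc[symmetric]
          matrix_vector_mult_scaleR)
      then show "hausdist (ptri (?E ** rep_frame (gens \<rho>') u)) (T \<rho>) = hausdist (T \<rho>') (T \<rho>)"
        using ptri_scaleR[OF c(1)] by (simp add: T_def)
    qed
  qed
  ultimately show ?thesis by (rule Lim_transform_eventually)
qed

definition fundamental :: "((real^3^3 \<Rightarrow> real^3^3) \<Rightarrow> rp2 set) \<Rightarrow> bool" where
  "fundamental D \<longleftrightarrow>
     (\<forall>\<rho>\<in>topspace X.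
        (\<exists>g\<in>carrier SL3. D \<rho> = pact g ` coord_triangle \<and>
           (\<forall>i. reflection_across (\<rho> (\<sigma> i)) (pact g ` coord_line i))) \<and>
        ((\<lambda>\<rho>'. hausdist (D \<rho>') (D \<rho>)) \<longlongrightarrow> 0) (atin X \<rho>))"

lemma frame_wall:
  assumes "\<rho> \<in> topspace X"
  shows "frame \<rho> *v (wall (gens \<rho>) i *v x) = (frame \<rho> *v x) $ i *\<^sub>R column i (tri m (std_param (param \<rho>)))"
  using frame(2)[OF assms, of i x]
  by (simp add: wall_def matrix_vector_mult_add_rdistrib matrix_vector_right_distrib refl_def)

lemma fundamental_frame: "fundamental (\<lambda>\<rho>. ptri (frame \<rho>))"
  unfolding fundamental_def
proof (intro ballI conjI)
  fix \<rho> assume \<rho>: "\<rho> \<in> topspace X"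
  let ?F = "frame \<rho>" and ?S = "tri m (std_param (param \<rho>))"
  have F: "invertible ?F" using frame(1)[OF \<rho>] .
  obtain c where c: "c \<noteq> 0" "c *\<^sub>R matrix_inv ?F \<in> carrier SL3"
    using SL3_rescale[of "matrix_inv ?F"] matrix_inv_inverse[OF F] unfolding invertible_def by blast
  define g where "g = c *\<^sub>R matrix_inv ?F"
  have g: "g \<in> carrier SL3" "invertible g" using c(2) SL3_invertible by (auto simp: g_def)
  have "matrix_inv g = inverse c *\<^sub>R ?F"
  proof (rule matrix_inv_unique')
    have "g ** (inverse c *\<^sub>R ?F) = (c * inverse c) *\<^sub>R (matrix_inv ?F ** ?F)"
      by (simp add: g_def matrix_eq matrix_vector_mul_assoc[symmetric] scaleR_matrix_vector_assoc[symmetric] matrix_vector_mult_scaleR)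
    then show "g ** (inverse c *\<^sub>R ?F) = mat 1" using c(1) matrix_inv_inverse(2)[OF F] by simp
  qed
  then have gi: "matrix_inv g = inverse c *\<^sub>R ?F" .
  have "ptri ?F = pact g ` coord_triangle"
    unfolding pact_coord_triangle[OF g(2)] gi using ptri_scaleR c(1) by simp
  moreover have "reflection_across (\<rho> (\<sigma> i)) (pact g ` coord_line i)" for i
  proof -
    define f where "f = row i ?F"
    have f: "f \<bullet> x = (?F *v x) $ i" for x by (simp add: f_def matrix_vector_mult_def row_def inner_vec_def)
    define v where "v = matrix_inv ?F *v column i ?S"
    have "?F *v (\<rho> (\<sigma> i) *v x) = ?F *v ((f \<bullet> x) *\<^sub>R v - x)" for x
      using frame(2)[OF \<rho>, of i x] F
      by (simp add: matrix_vector_mult_diff_distrib matrix_vector_mult_scaleR v_def f refl_def)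
    then have "\<rho> (\<sigma> i) *v x = (f \<bullet> x) *\<^sub>R v - x" for x by (metis matrix_inv_mult(2)[OF F])
    moreover have "f \<bullet> v = 2" unfolding f v_def using F by (simp add: column_def tri_nth)
    ultimately have "reflection_across (\<rho> (\<sigma> i)) (pcone {x. f \<bullet> x = 0})" by (rule reflection_acrossI)
    moreover have "pact g ` coord_line i = pcone {x. f \<bullet> x = 0}"
      unfolding pact_coord_line[OF g(2)] gi f using c(1) by (simp add: scaleR_matrix_vector_assoc[symmetric])
    ultimately show ?thesis by simp
  qed
  ultimately show "\<exists>g\<in>carrier SL3. ptri ?F = pact g ` coord_triangle \<and>
      (\<forall>i. reflection_across (\<rho> (\<sigma> i)) (pact g ` coord_line i))" using g(1) by blast
  have "1 \<in> signs" by (simp add: signs_def)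
  from tendsto_ptri_frame[OF \<rho> this]
  show "((\<lambda>\<rho>'. hausdist (ptri (frame \<rho>')) (ptri (frame \<rho>))) \<longlongrightarrow> 0) (atin X \<rho>)"
    by (simp only: minus_diag_mult)
qed

text \<open>The sides determine the three functionals up to nonzero factors d_i, and only the signs
  of these factors matter for the triangle.\<close>

lemma triangle_sign:
  assumes \<rho>: "\<rho> \<in> topspace X" and g: "g \<in> carrier SL3"
    "\<And>i. reflection_across (\<rho> (\<sigma> i)) (pact g ` coord_line i)"
  obtains e where "e \<in> signs" "pact g ` coord_triangle = ptri (diag (\<lambda>i. e $ i) ** frame \<rho>)"
proof -
  let ?F = "frame \<rho>"
  have F: "invertible ?F" using frame(1)[OF \<rho>] .
  have gi: "invertible g" using SL3_invertible[OF g(1)] .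
  have "\<exists>d. \<forall>x. (?F *v x) $ i = d * (matrix_inv g *v x) $ i" for i
  proof -
    define n where "n = row i (matrix_inv g)"
    have n: "n \<bullet> x = (matrix_inv g *v x) $ i" for x by (simp add: n_def matrix_vector_mult_def row_def inner_vec_def)
    have "n \<bullet> (g *v axis i 1) = 1" unfolding n using gi by simp
    then have "n \<noteq> 0" by auto
    moreover have "reflection_across (\<rho> (\<sigma> i)) (pcone {x. n \<bullet> x = 0})"
      using g(2)[of i] unfolding pact_coord_line[OF gi] n .
    ultimately obtain v where v: "\<And>x. \<rho> (\<sigma> i) *v x = (n \<bullet> x) *\<^sub>R v - x"
      using reflection_acrossD by blast
    have "2 * (?F *v x) $ i = (?F *v v) $ i * (n \<bullet> x)" for x
    proof -
      have "wall (gens \<rho>) i *v x = (n \<bullet> x) *\<^sub>R v" by (simp add: wall_def matrix_vector_mult_add_rdistrib v)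
      from frame_wall[OF \<rho>, of i x, unfolded this] have "(n \<bullet> x) * (?F *v v) $ i = (?F *v x) $ i * 2"
        by (simp add: matrix_vector_mult_scaleR vec_eq_iff column_def) (metis tri_nth(1))
      then show ?thesis by (simp only: mult.commute)
    qed
    then show ?thesis unfolding n by (intro exI[of _ "(?F *v v) $ i / 2"]) (simp add: field_simps)
  qed
  then obtain d where d: "\<And>i x. (?F *v x) $ i = d i * (matrix_inv g *v x) $ i" by metis
  have d0: "d i \<noteq> 0" for i
  proof -
    have "(?F *v (matrix_inv ?F *v axis i 1)) $ i = 1" using F by simp
    then show ?thesis unfolding d by auto
  qed
  define e :: "real^3" where "e = (\<chi> i. sgn (d i))"
  have "e \<in> signs" using d0 by (simp add: e_def signs_def abs_sgn_eq)
  moreover have "(matrix_inv g *v x) \<in> orthant \<longleftrightarrow> (diag (\<lambda>i. e $ i) ** ?F) *v x \<in> orthant" for x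
    unfolding orthant_def mem_Collect_eq mult_sign_nth e_def d
    using d0 by (auto simp: mult.assoc[symmetric] sgn_mult_self_eq abs_sgn[symmetric] zero_le_mult_iff sgn_if)
  ultimately show ?thesis using that unfolding pact_coord_triangle[OF gi] ptri_def by simp
qed

text \<open>At each \<rho> the triangle D \<rho> is one of the four candidates T e, and which one is
  decided by the vanishing of a continuous function f e. Connectedness carries the choice of e in
  {1, -1} from the inclusion to all of X; both signs name the same triangle.\<close>

theorem fundamental_unique:
  assumes D: "fundamental D" "D incl = ptri (frame incl)" and \<rho>: "\<rho> \<in> topspace X"
  shows "D \<rho> = ptri (frame \<rho>)"
proof -
  define T where "T e \<rho> = ptri (diag (\<lambda>i. e $ i) ** frame \<rho>)" for e \<rho>
  have T1: "T 1 \<rho> = ptri (frame \<rho>)" "T (- 1) \<rho> = ptri (frame \<rho>)" for \<rho>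
    by (simp_all only: T_def minus_diag_mult ptri_minus)
  have DT: "\<exists>e\<in>signs. D \<rho> = T e \<rho>" if \<rho>: "\<rho> \<in> topspace X" for \<rho>
    using D(1)[unfolded fundamental_def, rule_format, OF \<rho>] triangle_sign[OF \<rho>] unfolding T_def by metis
  have T: "T e \<rho> \<noteq> {}" "closed (T e \<rho>)" if "\<rho> \<in> topspace X" "e \<in> signs" for e \<rho>
    using ptri_nonempty[OF invertible_sign[OF that(2) frame(1)[OF that(1)]]] closed_ptri unfolding T_def by auto
  have Dn: "D \<rho> \<noteq> {}" "closed (D \<rho>)" if "\<rho> \<in> topspace X" for \<rho> using DT[OF that] T[OF that] by auto
  define f where "f e \<rho> = hausdist (D \<rho>) (T e \<rho>)" for e \<rho>
  have eq: "f e \<rho> = 0 \<longleftrightarrow> D \<rho> = T e \<rho>" if *: "\<rho> \<in> topspace X" "e \<in> signs" for e \<rho>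
  proof
    assume "f e \<rho> = 0"
    then have "hausdist (D \<rho>) (T e \<rho>) = 0" "hausdist (T e \<rho>) (D \<rho>) = 0"
      unfolding f_def using hausdist_commute by metis+
    then have "D \<rho> \<subseteq> T e \<rho>" "T e \<rho> \<subseteq> D \<rho>"
      using hausdist_eq_0D[of "D \<rho>" "T e \<rho>"] hausdist_eq_0D[of "T e \<rho>" "D \<rho>"] T[OF *] Dn[OF *(1)]
      by (simp_all add: closure_closed)
    then show "D \<rho> = T e \<rho>" by (rule antisym)
  next
    assume "D \<rho> = T e \<rho>"
    then show "f e \<rho> = 0" unfolding f_def using hausdist_refl[OF T(1)[OF *]] by simp
  qed
  have cont: "continuous_map X euclideanreal (f e)" if e: "e \<in> signs" for e
    unfolding continuous_map_atin
  proof
    fix \<rho> assume \<rho>: "\<rho> \<in> topspace X"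
    have "((\<lambda>\<rho>'. hausdist (D \<rho>') (D \<rho>) + hausdist (T e \<rho>') (T e \<rho>)) \<longlongrightarrow> 0 + 0) (atin X \<rho>)"
      using D(1) \<rho> tendsto_ptri_frame[OF \<rho> e] unfolding fundamental_def T_def by (intro tendsto_add) auto
    moreover have "\<forall>\<^sub>F \<rho>' in atin X \<rho>. \<rho>' \<in> topspace X"
      using openin_topspace[of X] \<rho> by (auto simp: eventually_atin)
    then have "\<forall>\<^sub>F \<rho>' in atin X \<rho>. dist (f e \<rho>') (f e \<rho>) \<le> hausdist (D \<rho>') (D \<rho>) + hausdist (T e \<rho>') (T e \<rho>)"
    proof eventually_elim
      fix \<rho>' assume \<rho>': "\<rho>' \<in> topspace X"
      note ne = Dn(1)[OF \<rho>] Dn(1)[OF \<rho>'] T(1)[OF \<rho> e] T(1)[OF \<rho>' e]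
      have "f e \<rho>' \<le> hausdist (D \<rho>') (D \<rho>) + (f e \<rho> + hausdist (T e \<rho>) (T e \<rho>'))"
        unfolding f_def using hausdist_triangle[of "D \<rho>'" "D \<rho>" "T e \<rho>'"] hausdist_triangle[of "D \<rho>" "T e \<rho>" "T e \<rho>'"] ne
        by linarith
      moreover have "f e \<rho> \<le> hausdist (D \<rho>) (D \<rho>') + (f e \<rho>' + hausdist (T e \<rho>') (T e \<rho>))"
        unfolding f_def using hausdist_triangle[of "D \<rho>" "D \<rho>'" "T e \<rho>"] hausdist_triangle[of "D \<rho>'" "T e \<rho>'" "T e \<rho>"] ne
        by linarith
      ultimately show "dist (f e \<rho>') (f e \<rho>) \<le> hausdist (D \<rho>') (D \<rho>) + hausdist (T e \<rho>') (T e \<rho>)"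
        using hausdist_commute[of "D \<rho>" "D \<rho>'"] hausdist_commute[of "T e \<rho>" "T e \<rho>'"] by (simp add: dist_real_def)
    qed
    ultimately have "((\<lambda>\<rho>'. dist (f e \<rho>') (f e \<rho>)) \<longlongrightarrow> 0) (atin X \<rho>)"
      by (intro Lim_null_comparison[where f = "\<lambda>\<rho>'. dist (f e \<rho>') (f e \<rho>)"]) simp_all
    then show "limitin euclideanreal (f e) (f e \<rho>) (atin X \<rho>)" unfolding limitin_canonical_iff by (subst tendsto_dist_iff)
  qed
  have one: "1 \<in> signs" "- 1 \<in> signs" by (simp_all add: signs_def)
  have "\<exists>e\<in>{1, - 1}. f e \<rho> = 0"
  proof (rule connected_space_constant[OF connected_X, where I = signs and x = incl and f = f])
    show "{1, - 1} \<subseteq> signs" using one by simp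
    show "\<exists>e\<in>signs. f e \<rho> = 0" if "\<rho> \<in> topspace X" for \<rho> using DT[OF that] eq[OF that] by blast
    show "f j \<rho> \<noteq> 0" if *: "\<rho> \<in> topspace X" "i \<in> {1, - 1}" "j \<in> signs - {1, - 1}" "f i \<rho> = 0" for \<rho> i j
    proof
      assume "f j \<rho> = 0"
      then have "D \<rho> = T j \<rho>" "D \<rho> = T i \<rho>" using eq[OF *(1)] * one by auto
      then have "T j \<rho> = ptri (frame \<rho>)" using *(2) T1 by auto
      then show False using ptri_sign_eq[OF frame(1)[OF *(1)], of j] *(3) unfolding T_def by auto
    qed
    show "\<exists>e\<in>{1, - 1}. f e incl = 0" using eq[OF incl_X one(1)] D(2) T1 by simp
  qed (use cont finite_signs incl_X \<rho> in auto)
  then show ?thesis using eq[OF \<rho>] one T1 by auto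
qed

text \<open>In the frame a group word acts as the word of reflections up to the sign -1 to its
  length, which the projection removes.\<close>

theorem orbit_frame:
  assumes \<rho>: "\<rho> \<in> topspace X"
  shows "(\<Union>\<gamma>\<in>carrier G. pact (\<rho> \<gamma>) ` ptri (frame \<rho>)) =
    pcone ((*v) (matrix_inv (frame \<rho>)) ` tits (tri m (std_param (param \<rho>))))"
proof -
  let ?F = "frame \<rho>" and ?S = "tri m (std_param (param \<rho>))"
  have F: "invertible ?F" using frame(1)[OF \<rho>] .
  note word = normal_form_gword[OF frame(2)[OF \<rho>]]
  have g: "gword (gens \<rho>) w \<in> carrier SL3" for w
    using gens_invol(2)[OF \<rho>] by (intro gword_SL3) (simp add: SL3_simps)
  have W: "gword (gens \<rho>) w *v x = (- 1) ^ length w *\<^sub>R (matrix_inv ?F *v foldr (refl ?S) w (?F *v x))" for w x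
  proof -
    have "?F *v (gword (gens \<rho>) w *v x) = ?F *v ((- 1) ^ length w *\<^sub>R (matrix_inv ?F *v foldr (refl ?S) w (?F *v x)))"
      using F by (simp add: word matrix_vector_mult_scaleR)
    then show ?thesis by (metis matrix_inv_mult(2)[OF F])
  qed
  have "(\<Union>\<gamma>\<in>carrier G. pact (\<rho> \<gamma>) ` ptri ?F) = (\<Union>w. pact (gword (gens \<rho>) w) ` ptri ?F)"
    unfolding carrier_G by (simp add: X_gword[OF \<rho>])
  also have "\<dots> = (\<Union>w. pcone ((*v) (gword (gens \<rho>) w) ` {y. ?F *v y \<in> orthant}))"
    unfolding ptri_def using pact_pcone[OF SL3_invertible[OF g]] by simp
  also have "\<dots> = (\<Union>w. pcone ((\<lambda>x. matrix_inv ?F *v foldr (refl ?S) w x) ` orthant))"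
  proof (intro arg_cong[where f = Union] image_cong refl)
    fix w
    have "{y. ?F *v y \<in> orthant} = (*v) (matrix_inv ?F) ` orthant"
      using matrix_image_Collect[of ?F "matrix_inv ?F" "\<lambda>x. x \<in> orthant"] F by simp
    then have "(*v) (gword (gens \<rho>) w) ` {y. ?F *v y \<in> orthant} =
        (*\<^sub>R) ((- 1) ^ length w) ` (\<lambda>x. matrix_inv ?F *v foldr (refl ?S) w x) ` orthant"
      using F by (simp add: image_image W)
    then show "pcone ((*v) (gword (gens \<rho>) w) ` {y. ?F *v y \<in> orthant}) =
        pcone ((\<lambda>x. matrix_inv ?F *v foldr (refl ?S) w x) ` orthant)"
      by (simp only: pcone_scaleR[of "(- 1) ^ length w"] power_eq_0_iff neg_equal_0_iff_equal one_neq_zero simp_thms)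
  qed
  also have "\<dots> = pcone (\<Union>w. (\<lambda>x. matrix_inv ?F *v foldr (refl ?S) w x) ` orthant)"
    unfolding pcone_def by blast
  also have "(\<Union>w. (\<lambda>x. matrix_inv ?F *v foldr (refl ?S) w x) ` orthant) = (*v) (matrix_inv ?F) ` tits ?S"
    unfolding tits_def by blast
  finally show ?thesis .
qed

end

section \<open>Hyperbolic triangles\<close>

lemma mink_bilinear:
  "mink (u + v) w = mink u w + mink v w" "mink w (u + v) = mink w u + mink w v"
  "mink (u - v) w = mink u w - mink v w" "mink w (u - v) = mink w u - mink w v"
  "mink (c *\<^sub>R u) w = c * mink u w" "mink w (c *\<^sub>R u) = c * mink w u"
  by (simp_all add: mink_def algebra_simps)

lemma mink_commute: "mink u v = mink v u"
  by (simp add: mink_def mult.commute)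

lemma mink_cross:
  "mink (cross3 a b) (cross3 c d) = mink a d * mink b c - mink a c * mink b d"
  by (simp add: mink_def cross3_def algebra_simps)

text \<open>The Gram determinant of the rows of A is (det A)^2 det J, and J has determinant
  -1.\<close>

lemma mink_gram:
  "mink a a * mink b b * mink c c + 2 * (mink a b * mink a c * mink b c) - mink a a * (mink b c)\<^sup>2
    - mink b b * (mink a c)\<^sup>2 - mink c c * (mink a b)\<^sup>2 = - (a \<bullet> cross3 b c)\<^sup>2"
proof -
  define A :: "real^3^3" where "A = vector [a, b, c]"
  define J :: "real^3^3" where "J = diag (\<lambda>i. if i = 3 then - 1 else 1)"
  have "(A ** J ** transpose A) $ i $ j = mink (A $ i) (A $ j)" for i j
    by (simp add: matrix_matrix_mult_def J_def diag_def transpose_def mink_def sum_3)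
  moreover have "det (A ** J ** transpose A) = - (det A)\<^sup>2"
  proof -
    have "det J = - 1" by (simp add: J_def diag_def det_3)
    then show ?thesis by (simp add: det_mul det_transpose power2_eq_square)
  qed
  moreover have "det A = a \<bullet> cross3 b c"
    by (simp add: A_def det_3 cross3_def inner_vec_def sum_3 algebra_simps)
  ultimately have "- (a \<bullet> cross3 b c)\<^sup>2 = det (\<chi> i j. mink (A $ i) (A $ j))"
    by (metis (no_types, lifting) vec_lambda_unique vec_nth_inverse)
  also have "\<dots> = mink a a * mink b b * mink c c + 2 * (mink a b * mink a c * mink b c) - mink a a * (mink b c)\<^sup>2
    - mink b b * (mink a c)\<^sup>2 - mink c c * (mink a b)\<^sup>2"
    by (simp add: det_3 A_def mink_commute[of b a] mink_commute[of c a] mink_commute[of c b] power2_eq_square algebra_simps)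
  finally show ?thesis by simp
qed

lemma mink_affine_lift: "mink (affine_lift x) (affine_lift y) = x \<bullet> y - 1"
  by (simp add: mink_def inner_vec_def sum_2)

text \<open>The factors sqrt(1 - |x|^2) that bring the lifts to the hyperboloid cancel between
  numerator and denominator.\<close>

lemma hyp_angle_mink:
  assumes "norm x < 1" "norm y < 1" "norm z < 1"
  defines "A \<equiv> affine_lift x" and "B \<equiv> affine_lift y" and "C \<equiv> affine_lift z"
  shows "hyp_angle x y z = arccos ((mink A B * mink A C - mink A A * mink B C) /
    sqrt (((mink A B)\<^sup>2 - mink A A * mink B B) * ((mink A C)\<^sup>2 - mink A A * mink C C)))"
proof -
  define s where "s x = sqrt (1 - (norm x)\<^sup>2)" for x :: "real^2"
  have s: "0 < s x" "mink (affine_lift x) (affine_lift x) = - (s x)\<^sup>2" if "norm x < 1" for x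
  proof -
    have "(norm x)\<^sup>2 < 1" using that by (simp add: power_less_one_iff)
    then show "0 < s x" "mink (affine_lift x) (affine_lift x) = - (s x)\<^sup>2"
      by (simp_all add: s_def mink_affine_lift power2_norm_eq_inner)
  qed
  have hl: "hyperboloid_lift w = inverse (s w) *\<^sub>R affine_lift w" for w by (simp add: hyperboloid_lift_def s_def)
  have d: "mink (hyp_direction x y) (hyp_direction x z) =
      (mink A (affine_lift y) * mink A (affine_lift z) - mink A A * mink (affine_lift y) (affine_lift z)) / ((s x)\<^sup>2 * (s y * s z))"
    if "norm y < 1" "norm z < 1" for y z
  proof -
    have "mink (hyp_direction x y) (hyp_direction x z) =
       mink (affine_lift y) (affine_lift z) / (s y * s z) + 2 * (mink A (affine_lift y) * mink A (affine_lift z)) / ((s x)\<^sup>2 * (s y * s z))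
       + mink A (affine_lift y) * mink A (affine_lift z) * mink A A / ((s x)\<^sup>2 * (s x)\<^sup>2 * (s y * s z))"
      using s(1)[OF assms(1)] s(1)[OF that(1)] s(1)[OF that(2)]
      unfolding hyp_direction_def Let_def hl mink_bilinear A_def mink_commute[of "affine_lift y" "affine_lift x"]
      by (simp add: field_simps power2_eq_square)
    also have "\<dots> = (mink A (affine_lift y) * mink A (affine_lift z) - mink A A * mink (affine_lift y) (affine_lift z)) / ((s x)\<^sup>2 * (s y * s z))"
      using s(1)[OF assms(1)] s(1)[OF that(1)] s(1)[OF that(2)]
      unfolding A_def s(2)[OF assms(1)] by (simp add: field_simps power2_eq_square)
    finally show ?thesis .
  qed
  define P Q R where "P = mink A B * mink A C - mink A A * mink B C" and "Q = (mink A B)\<^sup>2 - mink A A * mink B B"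
    and "R = (mink A C)\<^sup>2 - mink A A * mink C C"
  define k where "k = (s x)\<^sup>2 * (s y * s z)"
  have k: "0 < k" using s(1)[OF assms(1)] s(1)[OF assms(2)] s(1)[OF assms(3)] by (simp add: k_def)
  have "mink (hyp_direction x y) (hyp_direction x z) = P / k"
    using d[OF assms(2,3)] by (simp add: P_def k_def B_def C_def)
  moreover have "mink (hyp_direction x y) (hyp_direction x y) * mink (hyp_direction x z) (hyp_direction x z) = Q * R / k\<^sup>2"
    unfolding d[OF assms(2,2)] d[OF assms(3,3)]
    by (simp add: Q_def R_def k_def B_def C_def power2_eq_square mult_ac)
  then have "sqrt (mink (hyp_direction x y) (hyp_direction x y) * mink (hyp_direction x z) (hyp_direction x z)) = sqrt (Q * R) / k"
    using k by (simp add: real_sqrt_divide)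
  ultimately have "hyp_angle x y z = arccos ((P / k) / (sqrt (Q * R) / k))" by (simp add: hyp_angle_def Let_def)
  also have "(P / k) / (sqrt (Q * R) / k) = P / sqrt (Q * R)" using k by simp
  finally show ?thesis by (simp add: P_def Q_def R_def)
qed

locale hyperbolic_triangle =
  fixes x :: "3 \<Rightarrow> real^2" assumes tri: "hyp_triangle x"
begin

definition V :: "3 \<Rightarrow> real^3" where "V i = affine_lift (x i)"

definition vol :: real where "vol = V 1 \<bullet> cross3 (V 2) (V 3)"

text \<open>The basis dual to the lifted vertices: \<open>dual i\<close> is the functional of the
  side opposite vertex i, normalised to 1 at that vertex.\<close>

definition dual :: "3 \<Rightarrow> real^3" where
  "dual i = cross3 (V (i + 1)) (V (i + 2)) /\<^sub>R vol"

lemma norm_vertex: "norm (x i) < 1"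
  using tri by (simp add: hyp_triangle_def)

lemma mink_vertex: "mink (V i) (V i) < 0"
  using norm_vertex[of i] by (simp add: V_def mink_affine_lift power2_norm_eq_inner[symmetric] power_less_one_iff)

text \<open>Up to sign vol is twice the Euclidean area; if it vanished, two edge vectors would
  attain equality in the Cauchy-Schwarz inequality.\<close>

lemma vol_nonzero: "vol \<noteq> 0"
proof
  assume v: "vol = 0"
  define u w where "u = x 1 - x 2" and "w = x 3 - x 2"
  have "u $ 1 * w $ 2 - u $ 2 * w $ 1 = - vol"
    by (simp add: vol_def V_def u_def w_def cross3_def inner_vec_def sum_3 algebra_simps)
  then have d: "u $ 1 * w $ 2 = u $ 2 * w $ 1" using v by simp
  have "(u \<bullet> w)\<^sup>2 + (u $ 1 * w $ 2 - u $ 2 * w $ 1)\<^sup>2 = (u \<bullet> u) * (w \<bullet> w)"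
    by (simp add: inner_vec_def sum_2 power2_eq_square algebra_simps)
  then have "\<bar>u \<bullet> w\<bar>\<^sup>2 = (norm u * norm w)\<^sup>2" using d by (simp add: power_mult_distrib power2_norm_eq_inner)
  then have "\<bar>u \<bullet> w\<bar> = norm u * norm w" by (rule power2_eq_imp_eq) simp_all
  then have "collinear {0, u, w}" using norm_cauchy_schwarz_equal by blast
  then have "collinear {x 1, x 2, x 3}" unfolding u_def w_def by (subst collinear_3) simp_all
  moreover have "range x = {x 1, x 2, x 3}" unfolding UNIV_3 by auto
  ultimately show False using tri by (simp add: hyp_triangle_def)
qed

lemma triple_cyclic: "V i \<bullet> cross3 (V (i + 1)) (V (i + 2)) = vol"
  using exhaust_3[of i]
  by (auto simp: vol_def cyc3 cross3_def inner_vec_def sum_3 algebra_simps)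

lemma dual_V: "dual i \<bullet> V j = (if i = j then 1 else 0)"
proof -
  have "j = i \<or> j = i + 1 \<or> j = i + 2" using exhaust_3[of i] exhaust_3[of j] by (auto simp: cyc3)
  then show ?thesis
    using triple_cyclic[of i] vol_nonzero
    by (auto simp: dual_def inner_commute[of "cross3 _ _" "V i"] dot_cross_self)
qed

lemma expansion: "y = (\<Sum>i\<in>UNIV. (dual i \<bullet> y) *\<^sub>R V i)"
proof -
  define A :: "real^3^3" where "A = (\<chi> i. dual i)"
  define B :: "real^3^3" where "B = transpose (\<chi> i. V i)"
  have "A ** B = mat 1"
    using dual_V by (simp add: vec_eq_iff A_def B_def matrix_matrix_mult_def transpose_def mat_def inner_vec_def)
  then have "B ** A = mat 1" using matrix_left_right_inverse by blast
  then have "B *v (A *v y) = y" by (simp add: matrix_vector_mul_assoc)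
  moreover have "(A *v y) $ i = dual i \<bullet> y" for i by (simp add: A_def matrix_vector_mult_def inner_vec_def)
  moreover have "B *v z = (\<Sum>i\<in>UNIV. z $ i *\<^sub>R V i)" for z
    by (simp add: B_def vec_eq_iff matrix_vector_mult_def transpose_def mult.commute)
  ultimately show ?thesis by simp
qed

definition g :: "3 \<Rightarrow> 3 \<Rightarrow> real" where "g i j = mink (dual i) (dual j)"

lemma g_formulas:
  "g (i + 1) (i + 2) = - (mink (V i) (V (i + 1)) * mink (V i) (V (i + 2)) - mink (V i) (V i) * mink (V (i + 1)) (V (i + 2))) / vol\<^sup>2"
  "g (i + 2) (i + 2) = ((mink (V i) (V (i + 1)))\<^sup>2 - mink (V i) (V i) * mink (V (i + 1)) (V (i + 1))) / vol\<^sup>2"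
  "g (i + 1) (i + 1) = ((mink (V i) (V (i + 2)))\<^sup>2 - mink (V i) (V i) * mink (V (i + 2)) (V (i + 2))) / vol\<^sup>2"
proof -
  have d: "dual (i + 1) = cross3 (V (i + 2)) (V i) /\<^sub>R vol" "dual (i + 2) = cross3 (V i) (V (i + 1)) /\<^sub>R vol"
    using exhaust_3[of i] by (auto simp: dual_def cyc3)
  show "g (i + 1) (i + 2) = - (mink (V i) (V (i + 1)) * mink (V i) (V (i + 2)) - mink (V i) (V i) * mink (V (i + 1)) (V (i + 2))) / vol\<^sup>2"
    "g (i + 2) (i + 2) = ((mink (V i) (V (i + 1)))\<^sup>2 - mink (V i) (V i) * mink (V (i + 1)) (V (i + 1))) / vol\<^sup>2"
    "g (i + 1) (i + 1) = ((mink (V i) (V (i + 2)))\<^sup>2 - mink (V i) (V i) * mink (V (i + 2)) (V (i + 2))) / vol\<^sup>2"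
    unfolding g_def d mink_bilinear mink_cross mink_commute[of "V (i + 1)" "V i"] mink_commute[of "V (i + 2)" "V i"]
      mink_commute[of "V (i + 2)" "V (i + 1)"]
    using vol_nonzero by (simp_all add: field_simps power2_eq_square)
qed

lemma g_commute: "g i j = g j i"
  by (simp add: g_def mink_commute)

text \<open>Jacobi's identity for complementary minors: g is the inverse of the Gram matrix of the
  vertices, whose determinant is - vol^2.\<close>

lemma g_minor: "g (i + 1) (i + 1) * g (i + 2) (i + 2) - (g (i + 1) (i + 2))\<^sup>2 = - mink (V i) (V i) / vol\<^sup>2"
proof -
  let ?a = "mink (V i) (V i)" and ?b = "mink (V (i + 1)) (V (i + 1))" and ?c = "mink (V (i + 2)) (V (i + 2))"
  let ?p = "mink (V i) (V (i + 1))" and ?q = "mink (V i) (V (i + 2))" and ?r = "mink (V (i + 1)) (V (i + 2))"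
  have "g (i + 1) (i + 1) * g (i + 2) (i + 2) - (g (i + 1) (i + 2))\<^sup>2 =
      ((?q\<^sup>2 - ?a * ?c) * (?p\<^sup>2 - ?a * ?b) - (?p * ?q - ?a * ?r)\<^sup>2) / (vol\<^sup>2 * vol\<^sup>2)"
  proof -
    have "(A / v) * (B / v) - (- C / v)\<^sup>2 = (A * B - C\<^sup>2) / (v * v)" for A B C v :: real
      by (simp add: power2_eq_square diff_divide_distrib)
    then show ?thesis unfolding g_formulas .
  qed
  also have "(?q\<^sup>2 - ?a * ?c) * (?p\<^sup>2 - ?a * ?b) - (?p * ?q - ?a * ?r)\<^sup>2 =
      ?a * (?a * ?b * ?c + 2 * (?p * ?q * ?r) - ?a * ?r\<^sup>2 - ?b * ?q\<^sup>2 - ?c * ?p\<^sup>2)"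
    by (simp add: power2_eq_square algebra_simps)
  also have "\<dots> = - ?a * vol\<^sup>2" unfolding mink_gram triple_cyclic by simp
  moreover have "- a * v / (v * v) = - a / v" if "v \<noteq> 0" for a v :: real using that by simp
  ultimately show ?thesis using vol_nonzero by (metis power_not_zero)
qed

text \<open>Sides are spacelike: for the endpoints a and b of the side the numerator splits as (1 -
  |a|^2) |b - a|^2 + (a \<bullet> (b - a))^2, and a lies in the open disc.\<close>

lemma g_pos: "0 < g i i"
proof -
  define j where "j = i + 1"
  have i: "i = j + 2" using exhaust_3[of i] by (auto simp: cyc3 j_def)
  define a b where "a = x j" and "b = x (j + 1)"
  have "a \<noteq> b"
    using dual_V[of j j] dual_V[of j "j + 1"] by (auto simp: V_def a_def b_def)
  have "(a \<bullet> b - 1)\<^sup>2 - (a \<bullet> a - 1) * (b \<bullet> b - 1) = (1 - a \<bullet> a) * ((b - a) \<bullet> (b - a)) + (a \<bullet> (b - a))\<^sup>2"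
    by (simp add: inner_diff_left inner_diff_right inner_commute power2_eq_square algebra_simps)
  moreover have "0 < 1 - a \<bullet> a" using norm_vertex[of j] by (simp add: a_def power2_norm_eq_inner[symmetric] power_less_one_iff)
  moreover have "0 < (b - a) \<bullet> (b - a)" using \<open>a \<noteq> b\<close> by simp
  ultimately have "0 < (a \<bullet> b - 1)\<^sup>2 - (a \<bullet> a - 1) * (b \<bullet> b - 1)" by (smt (verit) mult_pos_pos zero_le_power2)
  then show ?thesis
    unfolding i g_formulas V_def mink_affine_lift a_def b_def using vol_nonzero by simp
qed

text \<open>The angle at a vertex is read off from the duals of the two sides meeting there. The
  minor identity bounds the quotient by 1 in absolute value, so that the cosine undoes the
  arccosine.\<close>

lemma hyp_angle_g:
  "cos (hyp_angle (x i) (x (i + 1)) (x (i + 2))) * sqrt (g (i + 1) (i + 1) * g (i + 2) (i + 2)) = - g (i + 1) (i + 2)"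
proof -
  define P Q R where "P = - g (i + 1) (i + 2)" and "Q = g (i + 2) (i + 2)" and "R = g (i + 1) (i + 1)"
  have v: "0 < vol\<^sup>2" using vol_nonzero by simp
  have PQR: "mink (V i) (V (i + 1)) * mink (V i) (V (i + 2)) - mink (V i) (V i) * mink (V (i + 1)) (V (i + 2)) = vol\<^sup>2 * P"
    "(mink (V i) (V (i + 1)))\<^sup>2 - mink (V i) (V i) * mink (V (i + 1)) (V (i + 1)) = vol\<^sup>2 * Q"
    "(mink (V i) (V (i + 2)))\<^sup>2 - mink (V i) (V i) * mink (V (i + 2)) (V (i + 2)) = vol\<^sup>2 * R"
    using v unfolding P_def Q_def R_def g_formulas by (simp_all add: field_simps)
  have QR: "0 < Q * R" using g_pos by (simp add: Q_def R_def)
  have "hyp_angle (x i) (x (i + 1)) (x (i + 2)) = arccos (vol\<^sup>2 * P / sqrt (vol\<^sup>2 * Q * (vol\<^sup>2 * R)))"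
    using hyp_angle_mink[OF norm_vertex[of i] norm_vertex[of "i + 1"] norm_vertex[of "i + 2"]]
    unfolding V_def[symmetric] PQR .
  also have "sqrt (vol\<^sup>2 * Q * (vol\<^sup>2 * R)) = vol\<^sup>2 * sqrt (Q * R)"
  proof -
    have "vol\<^sup>2 * Q * (vol\<^sup>2 * R) = (vol\<^sup>2)\<^sup>2 * (Q * R)" by (simp add: power2_eq_square)
    moreover have "sqrt ((vol\<^sup>2)\<^sup>2) = vol\<^sup>2" by (rule real_sqrt_unique) simp_all
    ultimately show ?thesis by (simp only: real_sqrt_mult)
  qed
  finally have "hyp_angle (x i) (x (i + 1)) (x (i + 2)) = arccos (P / sqrt (Q * R))" using v by simp
  moreover have "\<bar>P / sqrt (Q * R)\<bar> \<le> 1"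
  proof -
    have "0 < - mink (V i) (V i) / vol\<^sup>2" using v mink_vertex[of i] by (intro divide_pos_pos) auto
    then have "P\<^sup>2 \<le> Q * R" using g_minor[of i] unfolding P_def Q_def R_def by (simp add: mult.commute)
    then have "\<bar>P\<bar> \<le> sqrt (Q * R)" using real_le_rsqrt[of "\<bar>P\<bar>" "Q * R"] by simp
    then show ?thesis using QR by (simp add: divide_le_eq)
  qed
  ultimately have "cos (hyp_angle (x i) (x (i + 1)) (x (i + 2))) = P / sqrt (Q * R)" by (simp add: cos_arccos_abs)
  moreover have "sqrt (Q * R) \<noteq> 0" using real_sqrt_gt_zero[OF QR] by linarith
  ultimately have "cos (hyp_angle (x i) (x (i + 1)) (x (i + 2))) * sqrt (Q * R) = P" by simp
  then show ?thesis by (simp only: P_def Q_def R_def mult.commute[of "g (i + 2) (i + 2)"])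
qed

end

section \<open>The side reflections of a hyperbolic triangle\<close>

lemma neg3: "- (1::3) = 2" "- (2::3) = 1" "- (3::3) = 3"
  by simp_all

context hyperbolic_triangle
begin

definition J :: "real^3 \<Rightarrow> real^3" where "J v = vector [v $ 1, v $ 2, - v $ 3]"

lemma inner_J: "u \<bullet> J v = mink u v" "mink u (J v) = u \<bullet> v"
  by (simp_all add: J_def mink_def inner_vec_def sum_3)

text \<open>The pole of side i for the Minkowski form, scaled so that \<open>dual i\<close> takes
  the value 2 on it. Within this context the name hides that of the coordinate vectors.\<close>

definition axis :: "3 \<Rightarrow> real^3" where "axis i = (2 / g i i) *\<^sub>R J (dual i)"

lemma dual_axis: "dual i \<bullet> axis j = 2 * g i j / g j j"
  by (simp add: axis_def inner_J g_def)

lemma dual_axis_self [simp]: "dual i \<bullet> axis i = 2"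
  using g_pos[of i] by (simp add: dual_axis)

definition side_refl :: "3 \<Rightarrow> real^3^3" where
  "side_refl i = (\<chi> r c. axis i $ r * dual i $ c) - mat 1"

lemma side_refl_mult: "side_refl i *v y = (dual i \<bullet> y) *\<^sub>R axis i - y"
  by (simp add: side_refl_def matrix_vector_mult_diff_rdistrib)
    (simp add: vec_eq_iff matrix_vector_mult_def inner_vec_def sum_distrib_left sum_distrib_right mult_ac)

lemma side_line_pcone: "side_line x i = pcone {y. dual i \<bullet> y = 0}"
proof -
  have "- {i} = {i + 1, i + 2}" using exhaust_3 by (auto simp: cyc3) (metis exhaust_3 cyc3)+
  then have "side_line x i = pspan {proj (V (i + 1)), proj (V (i + 2))}"
    by (simp add: side_line_def affine_pt_def V_def)
  also have "\<dots> = pcone (span {V (i + 1), V (i + 2)})" by (intro pspan_two) (simp_all add: V_def)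
  also have "span {V (i + 1), V (i + 2)} = {y. dual i \<bullet> y = 0}"
  proof
    show "span {V (i + 1), V (i + 2)} \<subseteq> {y. dual i \<bullet> y = 0}"
      by (intro span_minimal) (auto simp: subspace_def inner_add_right dual_V)
    show "{y. dual i \<bullet> y = 0} \<subseteq> span {V (i + 1), V (i + 2)}"
    proof
      fix y assume "y \<in> {y. dual i \<bullet> y = 0}"
      moreover have "(\<Sum>j\<in>UNIV. f j) = f i + f (i + 1) + f (i + 2)" for f :: "3 \<Rightarrow> real^3"
        using exhaust_3[of i] by (auto simp: sum_3 cyc3 add_ac)
      ultimately have "y = (dual (i + 1) \<bullet> y) *\<^sub>R V (i + 1) + (dual (i + 2) \<bullet> y) *\<^sub>R V (i + 2)"
        using expansion[of y] by simp
      then show "y \<in> span {V (i + 1), V (i + 2)}" by (metis span_add span_base span_scale insertI1 insertI2)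
    qed
  qed
  finally show ?thesis .
qed

lemma mink_side_refl: "mink (side_refl i *v u) (side_refl i *v v) = mink u v"
proof -
  have a: "mink y (axis i) = 2 * (dual i \<bullet> y) / g i i" for y
    by (simp add: axis_def mink_bilinear inner_J inner_commute)
  have "mink (side_refl i *v u) (side_refl i *v v) = (dual i \<bullet> u) * (dual i \<bullet> v) * mink (axis i) (axis i)
      - (dual i \<bullet> u) * mink v (axis i) - (dual i \<bullet> v) * mink u (axis i) + mink u v"
    unfolding side_refl_mult mink_bilinear mink_commute[of "axis i" v] by (simp add: algebra_simps)
  also have "\<dots> = mink u v" unfolding a dual_axis_self using g_pos[of i] by (simp add: field_simps)
  finally show ?thesis .
qed

lemma reflection_across_det:
  assumes "reflection_across A L" shows "det A = 1"
proof -
  obtain h where h: "h \<in> carrier SL3" "A = h ** half_turn ** matrix_inv h"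
    using assms unfolding reflection_across_def by blast
  have "det half_turn = 1" by (simp add: det_3)
  then show ?thesis using h SL3_inv[OF h(1)] by (simp add: SL3_simps det_mul)
qed

text \<open>For uniqueness, a reflection across the side has the form \<open>dual i\<close>(y) v -
  y. Preserving the Minkowski form makes v orthogonal to the side, hence a multiple of
  \<open>J (dual i)\<close>, and the factor is fixed by the value 2 of \<open>dual i\<close> at
  v.\<close>

lemma side_reflection_eq: "side_reflection x i = side_refl i"
  unfolding side_reflection_def
proof (rule the_equality)
  have "reflection_across (side_refl i) (side_line x i)"
    unfolding side_line_pcone by (rule reflection_acrossI[OF side_refl_mult]) simp
  then show "side_refl i \<in> SO21 \<and> reflection_across (side_refl i) (side_line x i)"
    using reflection_across_det mink_side_refl by (simp add: SO21_def)
next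
  fix A assume A: "A \<in> SO21 \<and> reflection_across A (side_line x i)"
  have "dual i \<noteq> 0" using dual_axis_self[of i] by (metis inner_zero_left zero_neq_numeral)
  moreover have "reflection_across A (pcone {y. dual i \<bullet> y = 0})" using A unfolding side_line_pcone by blast
  ultimately obtain v where v: "\<And>y. A *v y = (dual i \<bullet> y) *\<^sub>R v - y" "dual i \<bullet> v = 2"
    using reflection_acrossD by blast
  have A: "mink (A *v y) (A *v y) = mink y y" for y using A by (simp add: SO21_def)
  have iso: "(dual i \<bullet> y) * ((dual i \<bullet> y) * mink v v - 2 * mink v y) = 0" for y
    using A[of y] unfolding v(1) mink_bilinear mink_commute[of y v] by (simp add: algebra_simps)
  have perp: "mink v z = 0" if "dual i \<bullet> z = 0" for z
    using iso[of "v + z"] that v(2) by (simp add: inner_add_right mink_bilinear)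
  define k where "k = mink v v / 2"
  have vk: "mink v y = k * (dual i \<bullet> y)" for y
  proof -
    have "dual i \<bullet> (y - ((dual i \<bullet> y) / 2) *\<^sub>R v) = 0" using v(2) by (simp add: inner_diff_right)
    from perp[OF this] show ?thesis by (simp add: mink_bilinear k_def)
  qed
  have "v = k *\<^sub>R J (dual i)"
  proof -
    have "v \<bullet> y = (k *\<^sub>R J (dual i)) \<bullet> y" for y
    proof -
      have "v \<bullet> y = mink v (J y)" by (simp add: inner_J)
      also have "\<dots> = k * (dual i \<bullet> J y)" by (rule vk)
      also have "dual i \<bullet> J y = J (dual i) \<bullet> y" by (simp add: inner_J mink_commute inner_commute[of "J (dual i)"])
      finally show ?thesis by simp
    qed
    then show ?thesis using vector_eq_rdot by blast
  qed
  moreover have "k * g i i = 2" using v(2) unfolding \<open>v = k *\<^sub>R J (dual i)\<close> by (simp add: inner_J g_def)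
  then have "k = 2 / g i i" using g_pos[of i] by (simp add: field_simps)
  ultimately have "v = axis i" by (simp add: axis_def)
  then show "A = side_refl i" using v(1) side_refl_mult by (simp add: matrix_eq)
qed

lemma closed_triangle_pcone: "closed_triangle x = pcone {y. \<forall>i. 0 \<le> dual i \<bullet> y}"
proof
  have r: "range x = {x 1, x 2, x 3}" unfolding UNIV_3 by auto
  show "closed_triangle x \<subseteq> pcone {y. \<forall>i. 0 \<le> dual i \<bullet> y}"
  proof
    fix p assume "p \<in> closed_triangle x"
    then obtain t u w where t: "0 \<le> t" "0 \<le> u" "0 \<le> w" "t + u + w = 1"
      and p: "p = affine_pt (t *\<^sub>R x 1 + u *\<^sub>R x 2 + w *\<^sub>R x 3)"
      unfolding closed_triangle_def r convex_hull_3 by blast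
    have "affine_lift (t *\<^sub>R x 1 + u *\<^sub>R x 2 + w *\<^sub>R x 3) = t *\<^sub>R V 1 + u *\<^sub>R V 2 + w *\<^sub>R V 3"
      using t(4) by (simp add: V_def vec_eq_iff forall_3)
    moreover have "0 \<le> dual i \<bullet> (t *\<^sub>R V 1 + u *\<^sub>R V 2 + w *\<^sub>R V 3)" for i
      using t by (simp add: inner_add_right dual_V)
    ultimately have "affine_lift (t *\<^sub>R x 1 + u *\<^sub>R x 2 + w *\<^sub>R x 3) \<in> {y. \<forall>i. 0 \<le> dual i \<bullet> y}" by simp
    then show "p \<in> pcone {y. \<forall>i. 0 \<le> dual i \<bullet> y}"
      unfolding p affine_pt_def pcone_def using affine_lift_nonzero by blast
  qed
  show "pcone {y. \<forall>i. 0 \<le> dual i \<bullet> y} \<subseteq> closed_triangle x"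
  proof
    fix p assume "p \<in> pcone {y. \<forall>i. 0 \<le> dual i \<bullet> y}"
    then obtain y where y: "y \<noteq> 0" "p = proj y" "\<And>i. 0 \<le> dual i \<bullet> y" by (auto simp: pcone_def)
    define t where "t i = dual i \<bullet> y" for i
    have t: "0 \<le> t i" for i using y(3) by (simp add: t_def)
    have ye: "y = t 1 *\<^sub>R V 1 + t 2 *\<^sub>R V 2 + t 3 *\<^sub>R V 3" using expansion[of y] by (simp add: sum_3 t_def)
    define s where "s = t 1 + t 2 + t 3"
    have s: "s \<noteq> 0"
    proof
      assume "s = 0"
      then have "t 1 = 0" "t 2 = 0" "t 3 = 0" using t[of 1] t[of 2] t[of 3] by (auto simp: s_def)
      then show False using ye y(1) by simp
    qed
    let ?z = "(t 1 / s) *\<^sub>R x 1 + (t 2 / s) *\<^sub>R x 2 + (t 3 / s) *\<^sub>R x 3"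
    have "y = s *\<^sub>R affine_lift ?z"
      using s by (subst ye) (simp add: V_def vec_eq_iff forall_3 s_def[symmetric] field_simps, simp add: s_def)
    then have "p = affine_pt ?z" using s by (simp add: y(2) affine_pt_def proj_scaleR)
    moreover have "0 < s" using t[of 1] t[of 2] t[of 3] s unfolding s_def by linarith
    then have "0 \<le> t 1 / s" "0 \<le> t 2 / s" "0 \<le> t 3 / s" "t 1 / s + t 2 / s + t 3 / s = 1"
      using t s by (simp_all add: add_divide_distrib[symmetric] s_def[symmetric])
    then have "?z \<in> convex hull (range x)" unfolding r convex_hull_3 by blast
    ultimately show "p \<in> closed_triangle x" unfolding closed_triangle_def by blast
  qed
qed

text \<open>The duals form a basis, so by \<open>mink_gram\<close> their Gram determinant is minus a
  nonzero square. After normalising the duals to length one it becomes the inequality of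
  \<open>hyperbolic_orders\<close>.\<close>

lemma gram_dual:
  "g 1 1 * g 2 2 * g 3 3 + 2 * (g 1 2 * g 1 3 * g 2 3) - g 1 1 * (g 2 3)\<^sup>2 - g 2 2 * (g 1 3)\<^sup>2 - g 3 3 * (g 1 2)\<^sup>2 < 0"
proof -
  have "dual 1 \<bullet> cross3 (dual 2) (dual 3) \<noteq> 0"
  proof
    assume z: "dual 1 \<bullet> cross3 (dual 2) (dual 3) = 0"
    define w where "w = cross3 (dual 2) (dual 3)"
    have "dual i \<bullet> w = 0" for i using z exhaust_3[of i] by (auto simp: w_def dot_cross_self)
    then have "w = 0" using expansion[of w] by simp
    then have "cross3 (dual 2) (dual 3) = 0" by (simp add: w_def)
    then obtain k where "dual 2 = k *\<^sub>R dual 3 \<or> dual 3 = k *\<^sub>R dual 2"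
      unfolding cross_eq_0 collinear_lemma by (metis scaleR_zero_left)
    then show False using dual_V[of 2 2] dual_V[of 3 3] dual_V[of 2 3] dual_V[of 3 2] by auto
  qed
  then have "0 < (dual 1 \<bullet> cross3 (dual 2) (dual 3))\<^sup>2" by simp
  then show ?thesis using mink_gram[of "dual 1" "dual 2" "dual 3"] by (simp add: g_def)
qed

text \<open>Dividing the duals by their lengths s_i turns the off-diagonal Gram entries into
  -cos(\<pi> / m k), so hyperbolicity of the orders follows from the existence of the triangle. The
  parameter is positive because all three factors of the cyclic product are negative.\<close>

lemma side_refl_triple:
  fixes m :: "3 \<Rightarrow> nat"
  assumes m: "\<And>i. 3 \<le> m i" "\<And>i. hyp_angle (x i) (x (i + 1)) (x (i + 2)) = pi / m i"
  shows "reflection_triple m side_refl" "hyperbolic_orders m" "\<And>i j. i \<noteq> j \<Longrightarrow> g i j < 0"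
proof -
  define c where "c i = cos (pi / m i)" for i
  define s where "s i = sqrt (g i i)" for i
  have s: "0 < s i" "g i i = s i * s i" for i using g_pos[of i] by (simp_all add: s_def)
  have gc: "g (i + 1) (i + 2) = - (c i * (s (i + 1) * s (i + 2)))" for i
    using hyp_angle_g[of i] unfolding m(2) by (simp add: c_def s_def real_sqrt_mult)
  have c: "0 < c i" for i
  proof -
    have "pi / real (m i) \<le> pi / 3" "0 \<le> pi / real (m i)" using m(1)[of i] by (simp_all add: field_simps)
    then have "- (pi / 2) < pi / real (m i)" "pi / real (m i) < pi / 2" using pi_gt_zero by linarith+
    then show ?thesis unfolding c_def by (rule cos_gt_zero_pi)
  qed
  have g3: "g 1 2 = - (c 3 * (s 1 * s 2))" "g 1 3 = - (c 2 * (s 1 * s 3))" "g 2 3 = - (c 1 * (s 2 * s 3))"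
    using gc[of 1] gc[of 2] gc[of 3] by (simp_all add: cyc3 mult_ac g_commute[of 3 1])
  have third: "- ((1::3) + 2) = 3" "- ((2::3) + 1) = 3" "- ((1::3) + 3) = 2" "- ((3::3) + 1) = 2"
    "- ((2::3) + 3) = 1" "- ((3::3) + 2) = 1"
    by simp_all
  have gij: "g i j = - (c (- (i + j)) * (s i * s j))" if "i \<noteq> j" for i j
    using that exhaust_3[of i] exhaust_3[of j]
    by (elim disjE; simp only: third g3 g_commute[of 2 1] g_commute[of 3 1] g_commute[of 3 2] mult.commute)
  show neg: "g i j < 0" if "i \<noteq> j" for i j using gij[OF that] s c by simp
  have "(s 1 * s 2 * s 3)\<^sup>2 * (1 - (c 1)\<^sup>2 - (c 2)\<^sup>2 - (c 3)\<^sup>2 - 2 * (c 1 * c 2 * c 3)) < 0"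
    using gram_dual unfolding s(2) g3 by (simp add: power2_eq_square algebra_simps)
  moreover have "0 < (s 1 * s 2 * s 3)\<^sup>2" using s(1)[of 1] s(1)[of 2] s(1)[of 3] by simp
  ultimately have "1 - (c 1)\<^sup>2 - (c 2)\<^sup>2 - (c 3)\<^sup>2 - 2 * (c 1 * c 2 * c 3) < 0" by (simp add: mult_less_0_iff)
  then show "hyperbolic_orders m"
    using m(1) by (simp add: hyperbolic_orders_def weight_def sum_3 c_def)
  have wall: "wall side_refl i *v y = (dual i \<bullet> y) *\<^sub>R axis i" for i y
    by (simp add: wall_def matrix_vector_mult_add_rdistrib side_refl_mult)
  have two: "(wall side_refl i ** wall side_refl j) *v y = (dual j \<bullet> y) *\<^sub>R ((dual i \<bullet> axis j) *\<^sub>R axis i)" for i j y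
    by (simp add: matrix_vector_mul_assoc[symmetric] wall)
  have three: "(wall side_refl 1 ** wall side_refl 2 ** wall side_refl 3) *v y =
      (dual 3 \<bullet> y) *\<^sub>R ((dual 1 \<bullet> axis 2) * (dual 2 \<bullet> axis 3)) *\<^sub>R axis 1" for y
    by (simp add: matrix_vector_mul_assoc[symmetric] wall)
  have "rep_param side_refl = - ((dual 1 \<bullet> axis 2) * (dual 2 \<bullet> axis 3) * (dual 3 \<bullet> axis 1))"
    using trace_rank_one[OF three] by (simp add: rep_param_def)
  also have "\<dots> > 0"
  proof -
    have "dual i \<bullet> axis j < 0" if "i \<noteq> j" for i j
      using neg[OF that] g_pos[of j] by (simp add: dual_axis divide_neg_pos mult_pos_neg)
    then have "dual 1 \<bullet> axis 2 < 0" "dual 2 \<bullet> axis 3 < 0" "dual 3 \<bullet> axis 1 < 0" by simp_all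
    then show ?thesis by (simp add: mult_neg_neg mult_pos_neg)
  qed
  finally have pos: "0 < rep_param side_refl" .
  moreover have "trace (wall side_refl i ** wall side_refl j) = weight m (- (i + j))" if "i \<noteq> j" for i j
  proof -
    have "trace (wall side_refl i ** wall side_refl j) = 4 * (g i j * g j i) / (g i i * g j j)"
      using trace_rank_one[OF two] by (simp add: dual_axis mult_ac)
    also have "\<dots> = weight m (- (i + j))"
      unfolding g_commute[of j i] gij[OF that] s(2) weight_def c_def[symmetric]
      using s(1)[of i] s(1)[of j] by (simp add: power2_eq_square)
    finally show ?thesis .
  qed
  moreover have "side_refl i ** side_refl i = mat 1" for i
    by (simp add: matrix_eq matrix_vector_mul_assoc[symmetric] side_refl_mult inner_diff_right scaleR_diff_left scaleR_2)
  moreover have "det (side_refl i) = 1" for i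
    by (rule reflection_across_det, rule reflection_acrossI[OF side_refl_mult]) simp
  moreover have "trace (side_refl i) = - 1" for i
  proof -
    have "trace (wall side_refl i) = 2" using trace_rank_one[OF wall] by simp
    then show ?thesis by (simp add: wall_def trace_3 mat_def)
  qed
  ultimately show "reflection_triple m side_refl" by (simp add: reflection_triple_def)
qed

end

text \<open>The frame coordinates are multiples d_i f_i of the given functionals. As the
  off-diagonal Cartan entries are negative for both, all d_i have the same sign, so both sets of
  functionals single out the same one of the four triangles.\<close>

lemma (in reflection_group) base_triangle:
  assumes \<sigma>: "\<And>i y. \<sigma> i *v y = (f i \<bullet> y) *\<^sub>R v i - y" and fv: "\<And>i j. i \<noteq> j \<Longrightarrow> f i \<bullet> v j < 0"
  shows "ptri (frame incl) = pcone {y. \<forall>i. 0 \<le> f i \<bullet> y}"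
proof -
  let ?F = "frame incl" and ?S = "tri m (std_param (param incl))"
  have F: "invertible ?F" using frame(1)[OF incl_X] .
  have wall: "wall (gens incl) i *v y = (f i \<bullet> y) *\<^sub>R v i" for i y
    unfolding incl_gens by (simp add: wall_def matrix_vector_mult_add_rdistrib \<sigma>)
  have fr: "(f i \<bullet> y) * (?F *v v i) $ k = (?F *v y) $ i * ?S $ k $ i" for i k y
    using arg_cong[OF frame_wall[OF incl_X, of i y], of "\<lambda>z. z $ k"]
    by (simp add: wall matrix_vector_mult_scaleR column_def)
  define d where "d i = (?F *v v i) $ i / 2" for i
  have d: "(?F *v y) $ i = d i * (f i \<bullet> y)" for i y
    using fr[of i y i] by (simp add: d_def tri_nth mult.commute)
  have d0: "d i \<noteq> 0" for i
  proof
    assume "d i = 0"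
    moreover have "(?F *v (matrix_inv ?F *v axis i 1)) $ i = 1" using F by simp
    ultimately show False unfolding d by simp
  qed
  have S: "?S $ k $ i < 0" if "k \<noteq> i" for i k
    using cartan_std[OF param_pos[OF incl_X]] that by (simp add: cartan_def)
  have same: "0 < d i \<longleftrightarrow> 0 < d j" for i j
  proof (cases "i = j")
    case False
    obtain y where y: "f j \<bullet> y \<noteq> 0" using d0[of j] F unfolding d_def
      by (metis d d0 matrix_inv_mult(1) mult_zero_right axis_nth zero_neq_one)
    have "(f j \<bullet> y) * (d i * (f i \<bullet> v j)) = d j * (f j \<bullet> y) * ?S $ i $ j" using fr[of j y i] unfolding d .
    then have "d i * (f i \<bullet> v j) = d j * ?S $ i $ j" using y by simp
    then show ?thesis using fv[OF False] S[OF False] d0 by (smt (verit) mult_neg_neg mult_pos_neg zero_less_mult_iff)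
  qed simp
  have "proj y \<in> ptri ?F \<longleftrightarrow> proj y \<in> pcone {y. \<forall>i. 0 \<le> f i \<bullet> y}" if "y \<noteq> 0" for y
  proof -
    define e where "e = sgn (d 1)"
    have e: "e \<noteq> 0" "0 < e * d i" for i using d0[of 1] d0[of i] same[of 1 i] by (auto simp: e_def sgn_if)
    have iff: "c *\<^sub>R y \<in> {y. ?F *v y \<in> orthant} \<longleftrightarrow> (c * e) *\<^sub>R y \<in> {y. \<forall>i. 0 \<le> f i \<bullet> y}" for c
    proof -
      have ee: "e * e = 1" using e(1) by (simp add: e_def sgn_if split: if_splits)
      have "0 \<le> d i * (c * (f i \<bullet> y)) \<longleftrightarrow> 0 \<le> c * e * (f i \<bullet> y)" for i
      proof -
        have pos: "0 \<le> u * z \<longleftrightarrow> 0 \<le> z" if "0 < u" for u z :: real using that by (simp add: zero_le_mult_iff)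
        have "(e * d i) * (c * e * (f i \<bullet> y)) = (e * e) * (d i * (c * (f i \<bullet> y)))" by (simp only: mult_ac)
        then have "d i * (c * (f i \<bullet> y)) = (e * d i) * (c * e * (f i \<bullet> y))" by (simp add: ee)
        then show ?thesis using pos[OF e(2)] by metis
      qed
      then show ?thesis by (simp add: orthant_def d)
    qed
    show ?thesis unfolding ptri_def pcone_scaled_iff[OF that] iff
    proof
      assume "\<exists>c. c \<noteq> 0 \<and> (c * e) *\<^sub>R y \<in> {y. \<forall>i. 0 \<le> f i \<bullet> y}"
      then show "\<exists>c. c \<noteq> 0 \<and> c *\<^sub>R y \<in> {y. \<forall>i. 0 \<le> f i \<bullet> y}" using e(1) by (meson mult_eq_0_iff)
    next
      assume "\<exists>c. c \<noteq> 0 \<and> c *\<^sub>R y \<in> {y. \<forall>i. 0 \<le> f i \<bullet> y}"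
      then obtain c where "c \<noteq> 0" "c *\<^sub>R y \<in> {y. \<forall>i. 0 \<le> f i \<bullet> y}" by blast
      then show "\<exists>c. c \<noteq> 0 \<and> (c * e) *\<^sub>R y \<in> {y. \<forall>i. 0 \<le> f i \<bullet> y}"
        using e(1) by (intro exI[of _ "c / e"]) simp
    qed
  qed
  note * = this
  show ?thesis
    unfolding set_eq_iff
  proof
    fix p
    obtain y where "norm y = 1" "p = proj y" using rp2_unit_rep by blast
    then show "p \<in> ptri ?F \<longleftrightarrow> p \<in> pcone {y. \<forall>i. 0 \<le> f i \<bullet> y}" using *[of y] by (metis norm_zero zero_neq_one)
  qed
qed

section \<open>The two ends\<close>

definition reversal :: "real^3^3" where
  "reversal = (\<chi> i j. if j = - i then 1 else 0)"

lemma reversal_mult: "(reversal *v x) $ i = x $ (- i)"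
  by (simp add: reversal_def matrix_vector_mult_def if_distrib[of "\<lambda>z. z * _"] cong: if_cong)

lemma reversal_reversal: "reversal *v (reversal *v x) = x"
  by (simp add: vec_eq_iff reversal_mult)

text \<open>Negating indices exchanges the walls 1 and 2 and so reverses the cyclic order. In each
  pair of opposite entries the one recorded as a parameter is replaced by the other, which is why a
  parameter turns into a weight divided by a parameter.\<close>

lemma reversal_tits:
  assumes p: "\<And>i. p i \<noteq> 0" and m: "\<And>i. 3 \<le> m i"
  shows "(*v) reversal ` tits (tri m p) = tits (tri (\<lambda>k. m (- k)) (\<lambda>i. weight m (- i + 2) / p (- i + 1)))"
    (is "_ = tits ?T")
proof (rule tits_transport[where \<pi> = uminus])
  have w: "weight m k \<noteq> 0" for k using weight_bounds(2)[of m k] m by force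
  have neg: "- (k + 1) = - k + 2" "- (k + 2) = - k + 1" for k :: 3
    using exhaust_3[of k] by (elim disjE; simp)+
  have T: "?T $ k $ (- i) = tri m p $ (- k) $ i" for k i
  proof -
    have w': "weight (\<lambda>k. m (- k)) k = weight m (- k)" for k by (simp add: weight_def)
    define j where "j = - i"
    have i: "i = - j" by (simp add: j_def)
    show ?thesis
      using cyclic_cases[of k j]
    proof (elim disjE)
      assume k: "k = j"
      show ?thesis by (simp add: k i tri_nth(1))
    next
      assume k: "k = j + 1"
      have "?T $ (j + 1) $ j = tri m p $ (- j + 2) $ (- j)"
        unfolding tri_nth(2,3) w' neg ne3 using w[of "- j + 1"] p[of "- j"] by simp
      then show ?thesis unfolding k i minus_minus neg .
    next
      assume k: "k = j + 2"
      have "?T $ (j + 2) $ j = tri m p $ (- j + 1) $ (- j)"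
        unfolding tri_nth(2,3) by simp
      then show ?thesis unfolding k i minus_minus neg .
    qed
  qed
  show "reversal *v refl (tri m p) i x = refl ?T (- i) (reversal *v x)" for i x
    unfolding vec_eq_iff refl_component reversal_mult T minus_minus by (rule allI) (rule HOL.refl)
  show "surj (uminus :: 3 \<Rightarrow> 3)" by (rule surjI[where g = uminus and f = "uminus :: 3 \<Rightarrow> 3"]) simp
  show "(*v) reversal ` orthant = orthant"
  proof
    show "(*v) reversal ` orthant \<subseteq> orthant" by (auto simp: orthant_def reversal_mult)
    then show "orthant \<subseteq> (*v) reversal ` orthant" by (metis reversal_reversal image_subset_iff rev_image_eqI subsetI)
  qed
qed

text \<open>After the reversal the product of the parameters is the product of the weights divided
  by c, so c near 0 is traded for a large parameter.\<close>

lemma small_parameter: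
  assumes m: "hyperbolic_orders m" and c: "0 < c"
  obtains R where "invertible R" "tits (tri m (std_param c)) =
    (*v) R ` tits (tri (\<lambda>k. m (- k)) (std_param (weight m 1 * weight m 2 * weight m 3 / c)))"
proof -
  have m3: "3 \<le> m i" for i using m by (simp add: hyperbolic_orders_def)
  have w: "0 < weight m k" for k using weight_bounds(2)[of m k] m3 by force
  define C where "C = weight m 1 * weight m 2 * weight m 3 / c"
  define p where "p i = weight m (- i + 2) / std_param c (- i + 1)" for i
  have s: "0 < std_param c i" for i using c by (simp add: std_param_def)
  have C: "0 < std_param C i" for i using c w by (simp add: std_param_def C_def)
  have p: "0 < p i" for i using s w by (simp add: p_def)
  have "p 1 * p 2 * p 3 = std_param C 1 * std_param C 2 * std_param C 3"
    unfolding p_def neg3 by (simp add: std_param_def C_def cyc3 mult_ac)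
  then obtain d where d: "\<And>i. 0 < d i" "\<And>i. p i = std_param C i * d (i + 2) / d i"
    using diagonal_change[of p "std_param C"] p C by metis
  let ?m = "\<lambda>k. m (- k)"
  have "(*v) reversal ` tits (tri m (std_param c)) = tits (tri ?m p)"
    unfolding p_def using reversal_tits[of "std_param c" m] s m3 by (simp add: less_imp_neq[THEN not_sym])
  also have "p = (\<lambda>i. std_param C i * d (i + 2) / d i)" using d(2) by auto
  also have "tits (tri ?m \<dots>) = (*v) (diag d) ` tits (tri ?m (std_param C))"
    using diag_tits[of d "std_param C" ?m] d(1) C by (simp add: less_imp_neq[THEN not_sym])
  finally have e: "(*v) reversal ` tits (tri m (std_param c)) = (*v) (diag d) ` tits (tri ?m (std_param C))" .
  have "tits (tri m (std_param c)) = (*v) reversal ` (*v) reversal ` tits (tri m (std_param c))"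
    by (simp add: image_image reversal_reversal)
  also have "\<dots> = (*v) (reversal ** diag d) ` tits (tri ?m (std_param C))"
    unfolding e by (simp add: image_image matrix_vector_mul_assoc)
  finally have "tits (tri m (std_param c)) = (*v) (reversal ** diag d) ` tits (tri ?m (std_param C))" .
  moreover have "invertible reversal" unfolding invertible_def
    by (rule exI[of _ reversal]) (simp add: matrix_eq matrix_vector_mul_assoc[symmetric] reversal_reversal)
  then have "invertible (reversal ** diag d)"
    using d(1) by (intro invertible_mult invertible_diag) (auto simp: less_imp_neq[THEN not_sym])
  ultimately show ?thesis using that unfolding C_def by blast
qed

lemma hyperbolic_orders_flip: "hyperbolic_orders m \<Longrightarrow> hyperbolic_orders (\<lambda>k. m (- k))"
proof -
  assume "hyperbolic_orders m"
  then show ?thesis by (simp add: hyperbolic_orders_def weight_def neg3) (simp add: algebra_simps)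
qed

theorem degeneration_ends_iff:
  fixes B :: "real \<Rightarrow> real^3^3" and c :: "real \<Rightarrow> real"
  assumes m: "hyperbolic_orders m" and c: "\<And>t. 0 < c t"
    and lim: "filterlim c at_top F \<or> filterlim c (at_right 0) F" and F: "F \<in> {at_top, at_bot}"
    and B: "\<And>t. invertible (B t)" and \<Omega>: "\<Omega> \<in> convex_domains"
  shows "(\<exists>A. (\<forall>t. A t \<in> carrier SL3) \<and>
     limitin domain_topology (\<lambda>t. pact (A t) ` pcone ((*v) (B t) ` tits (tri m (std_param (c t))))) \<Omega> F) \<longleftrightarrow>
     (\<exists>k\<in>insert 3 (range m). regular_gon k \<Omega>)"
  using lim
proof
  assume "filterlim c at_top F"
  then show ?thesis by (rule degeneration_iff[OF m c _ F B \<Omega>])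
next
  assume l: "filterlim c (at_right 0) F"
  define W where "W = weight m 1 * weight m 2 * weight m 3"
  have "0 < weight m k" for k
    using weight_bounds(2)[of m k] m by (force simp: hyperbolic_orders_def)
  then have W: "0 < W" by (simp add: W_def)
  have "\<exists>R. invertible R \<and> tits (tri m (std_param (c t))) = (*v) R ` tits (tri (\<lambda>k. m (- k)) (std_param (W / c t)))" for t
    using small_parameter[OF m c] unfolding W_def by metis
  then obtain R where R: "\<And>t. invertible (R t)"
    "\<And>t. tits (tri m (std_param (c t))) = (*v) (R t) ` tits (tri (\<lambda>k. m (- k)) (std_param (W / c t)))" by metis
  have "filterlim (\<lambda>t. inverse (c t)) at_top F"
    using filterlim_compose[OF filterlim_inverse_at_top_right l] .
  then have "filterlim (\<lambda>t. W * inverse (c t)) at_top F"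
    using filterlim_tendsto_pos_mult_at_top[OF tendsto_const W] by blast
  then have "filterlim (\<lambda>t. W / c t) at_top F" by (simp add: divide_inverse)
  moreover have "invertible (B t ** R t)" for t by (intro invertible_mult B R(1))
  moreover have "(*v) (B t) ` (*v) (R t) ` K = (*v) (B t ** R t) ` K" for t K
    by (simp add: image_image matrix_vector_mul_assoc)
  moreover have "range (\<lambda>k. m (- k)) = range m"
  proof -
    have "m k \<in> range (\<lambda>k. m (- k))" for k by (rule image_eqI[of _ _ "- k"]) simp_all
    then show ?thesis by auto
  qed
  ultimately show ?thesis
    unfolding R(2) using degeneration_iff[OF hyperbolic_orders_flip[OF m], of "\<lambda>t. W / c t" F "\<lambda>t. B t ** R t" \<Omega>]
      c W F \<Omega> by simp
qed

text \<open>A continuous injection of the line is monotone, and being onto it carries each end to an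
  end.\<close>

lemma homeomorphism_ends:
  fixes \<theta> :: "real \<Rightarrow> real"
  assumes "continuous_on UNIV \<theta>" "inj \<theta>" "surj \<theta>" and F: "F \<in> {at_top, at_bot}"
  shows "filterlim \<theta> at_top F \<or> filterlim \<theta> at_bot F"
proof -
  have ends: "filterlim f at_top at_top" "filterlim f at_bot at_bot" if f: "strict_mono f" "surj f" for f :: "real \<Rightarrow> real"
  proof -
    have "\<exists>y. f y = Z" for Z using f(2) by (metis surjD)
    then show "filterlim f at_top at_top" "filterlim f at_bot at_bot"
      unfolding filterlim_at_top filterlim_at_bot eventually_at_top_linorder eventually_at_bot_linorder
      using strict_mono_leD[OF f(1)] by metis+
  qed
  have "strict_mono_on UNIV \<theta> \<or> strict_antimono_on UNIV \<theta>"
    using assms injective_eq_monotone_map[of UNIV \<theta>] by (simp add: is_interval_univ)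
  then show ?thesis
  proof
    assume "strict_mono_on UNIV \<theta>"
    then show ?thesis using ends[of \<theta>] assms(3) F by auto
  next
    assume "strict_antimono_on UNIV \<theta>"
    then have "strict_mono (\<lambda>t. - \<theta> t)" by (auto simp: monotone_on_def)
    moreover have "surj (\<lambda>t. - \<theta> t)" using assms(3) by (metis surj_def minus_minus)
    ultimately have "filterlim (\<lambda>t. - \<theta> t) at_top at_top" "filterlim (\<lambda>t. - \<theta> t) at_bot at_bot" using ends by blast+
    then have "filterlim \<theta> at_bot at_top" "filterlim \<theta> at_top at_bot"
      by (simp_all only: filterlim_uminus_at_bot[of \<theta>] filterlim_uminus_at_top[of \<theta>])
    then show ?thesis using F by auto
  qed
qed

theorem theorem3:
  fixes a b c :: nat and x :: "3 \<Rightarrow> real^2"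
  assumes "a \<ge> 3" "b \<ge> 3" "c \<ge> 3"
    and "hyp_triangle x"
    and "hyp_angle (x 1) (x 2) (x 3) = pi / a"
    and "hyp_angle (x 2) (x 3) (x 1) = pi / b"
    and "hyp_angle (x 3) (x 1) (x 2) = pi / c"
  shows "moduli_space x homeomorphic_space euclideanreal \<and>
    (\<forall>h \<rho>. homeomorphic_map (moduli_space x) euclideanreal h \<longrightarrow>
       (\<forall>t::real. \<rho> t \<in> topspace (deformations x) \<and> h (conj_class (triangle_group x) (\<rho> t)) = t) \<longrightarrow>
       (\<forall>\<Omega>\<in>convex_domains. \<forall>F\<in>{at_top, at_bot}.
          (\<exists>A. (\<forall>t. A t \<in> carrier SL3) \<and>
               limitin domain_topology (\<lambda>t. pact (A t) ` invariant_domain x (\<rho> t)) \<Omega> F)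
          \<longleftrightarrow> (\<exists>k\<in>{3, a, b, c}. regular_gon k \<Omega>)))"
proof -
  define m :: "3 \<Rightarrow> nat" where "m i = (if i = 1 then a else if i = 2 then b else c)" for i
  have m: "3 \<le> m i" "hyp_angle (x i) (x (i + 1)) (x (i + 2)) = pi / m i" for i
    using assms(1-3,5-7) exhaust_3[of i] by (auto simp: m_def cyc3)
  have range_m: "insert 3 (range m) = {3, a, b, c}"
    unfolding UNIV_3 by (auto simp: m_def)
  interpret tri: hyperbolic_triangle x by unfold_locales (rule assms(4))
  note refls = tri.side_refl_triple[OF m]
  have \<sigma>: "side_reflection x = tri.side_refl" using tri.side_reflection_eq by auto
  interpret reflection_group m "side_reflection x"
    by unfold_locales (use refls \<sigma> in auto)
  have G: "triangle_group x = G" by (simp add: triangle_group_def G_def)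
  have X: "deformations x = X" by (simp add: deformations_def X_def incl_def Let_def G)
  have M: "moduli_space x = quotient_topology X (conj_class G)" by (simp add: moduli_space_def G X)
  have base: "closed_triangle x = ptri (frame incl)"
    unfolding tri.closed_triangle_pcone
  proof (rule base_triangle[symmetric])
    show "side_reflection x i *v y = (tri.dual i \<bullet> y) *\<^sub>R tri.axis i - y" for i y
      unfolding \<sigma> by (rule tri.side_refl_mult)
    show "tri.dual i \<bullet> tri.axis j < 0" if "i \<noteq> j" for i j
      using refls(3)[OF that] tri.g_pos[of j] by (simp add: tri.dual_axis divide_neg_pos mult_pos_neg)
  qed
  have fund: "fundamental_triangles x D \<longleftrightarrow> fundamental D \<and> D incl = closed_triangle x" for D
    by (simp add: fundamental_triangles_def fundamental_def X G incl_def)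
  have triangle: "fundamental_triangle x \<rho> = ptri (frame \<rho>)" if \<rho>: "\<rho> \<in> topspace X" for \<rho>
    unfolding fundamental_triangle_def
  proof (rule the_equality)
    show "\<exists>D. fundamental_triangles x D \<and> ptri (frame \<rho>) = D \<rho>"
      using fundamental_frame base by (intro exI[of _ "\<lambda>\<rho>. ptri (frame \<rho>)"]) (simp add: fund)
    show "T = ptri (frame \<rho>)" if "\<exists>D. fundamental_triangles x D \<and> T = D \<rho>" for T
      using that fundamental_unique[OF _ _ \<rho>] base by (auto simp: fund)
  qed
  have domain: "invariant_domain x \<rho> = pcone ((*v) (matrix_inv (frame \<rho>)) ` tits (tri m (std_param (param \<rho>))))"
    if \<rho>: "\<rho> \<in> topspace X" for \<rho>
    unfolding invariant_domain_def G triangle[OF \<rho>] by (rule orbit_frame[OF \<rho>])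
  obtain \<psi> where \<psi>: "homeomorphic_map (moduli_space x) euclideanreal \<psi>"
    "\<And>\<rho>. \<rho> \<in> topspace X \<Longrightarrow> \<psi> (conj_class G \<rho>) = ln (param \<rho>)"
    using moduli_homeomorphic unfolding M by metis
  show ?thesis
  proof (intro conjI allI impI ballI)
    show "moduli_space x homeomorphic_space euclideanreal" using homeomorphic_map_imp_homeomorphic_space[OF \<psi>(1)] .
  next
    fix h \<rho> \<Omega> F
    assume h: "homeomorphic_map (moduli_space x) euclideanreal h"
      and \<rho>: "\<forall>t::real. \<rho> t \<in> topspace (deformations x) \<and> h (conj_class (triangle_group x) (\<rho> t)) = t"
      and \<Omega>: "\<Omega> \<in> convex_domains" and F: "F \<in> {at_top, at_bot :: real filter}"
    have \<rho>: "\<rho> t \<in> topspace X" "h (conj_class G (\<rho> t)) = t" for t using \<rho> by (simp_all add: X G)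
    obtain k where k: "homeomorphic_maps (moduli_space x) euclideanreal h k"
      using h homeomorphic_map_maps by blast
    have K: "conj_class G (\<rho> t) \<in> topspace (moduli_space x)" for t
      using \<rho>(1) quotient_imp_surjective_map[OF quotient_map_quotient_topology[of X "conj_class G"]] unfolding M by blast
    then have kt: "k t = conj_class G (\<rho> t)" for t
      using k \<rho>(2) unfolding homeomorphic_maps_def by metis
    \<comment> \<open>The homeomorphism h is arbitrary. Its inverse followed by \<psi> is the
      logarithm of the parameter as a function of t, so \<theta> is a homeomorphism of the line
      although \<rho> itself need not be continuous.\<close>
    define \<theta> where "\<theta> t = ln (param (\<rho> t))" for t
    have "homeomorphic_map euclideanreal euclideanreal (\<psi> \<circ> k)"
      using homeomorphic_maps_map k \<psi>(1) by (intro homeomorphic_map_compose) blast+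
    moreover have "\<psi> \<circ> k = \<theta>" by (simp add: fun_eq_iff kt \<psi>(2) \<rho>(1) \<theta>_def)
    ultimately have \<theta>: "homeomorphic_map euclideanreal euclideanreal \<theta>" by simp
    have ends: "filterlim \<theta> at_top F \<or> filterlim \<theta> at_bot F"
    proof (rule homeomorphism_ends[OF _ _ _ F])
      show "continuous_on UNIV \<theta>" using homeomorphic_imp_continuous_map[OF \<theta>] by simp
      show "inj \<theta>" "surj \<theta>"
        using homeomorphic_imp_injective_map[OF \<theta>] homeomorphic_imp_surjective_map[OF \<theta>] by simp_all
    qed
    have c: "param (\<rho> t) = exp (\<theta> t)" for t using param_pos[OF \<rho>(1)] by (simp add: \<theta>_def)
    have "filterlim (\<lambda>t. param (\<rho> t)) at_top F \<or> filterlim (\<lambda>t. param (\<rho> t)) (at_right 0) F"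
      using ends
    proof
      assume "filterlim \<theta> at_top F"
      then show ?thesis unfolding c using filterlim_compose[OF exp_at_top] by blast
    next
      assume "filterlim \<theta> at_bot F"
      moreover have "filterlim (exp :: real \<Rightarrow> real) (at_right 0) at_bot"
        using exp_at_bot by (simp add: filterlim_at)
      ultimately show ?thesis unfolding c using filterlim_compose by blast
    qed
    moreover have "invertible (matrix_inv (frame (\<rho> t)))" for t
      using matrix_inv_inverse[OF frame(1)[OF \<rho>(1)]] unfolding invertible_def by blast
    ultimately show "(\<exists>A. (\<forall>t. A t \<in> carrier SL3) \<and>
        limitin domain_topology (\<lambda>t. pact (A t) ` invariant_domain x (\<rho> t)) \<Omega> F)
        \<longleftrightarrow> (\<exists>k\<in>{3, a, b, c}. regular_gon k \<Omega>)"
      unfolding domain[OF \<rho>(1)] range_m[symmetric]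
      by (intro degeneration_ends_iff[OF hyp _ _ F _ \<Omega>] param_pos \<rho>(1))
  qed
qed

end
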